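(* Let $\mathcal{T}$ be a triangulated category, let $\mathcal{P}=\operatorname{add}\mathcal{P}$ be a presilting subcategory of $\mathcal{T}$ satisfying conditions (P1) and (P2) (stated in the context), let $\mathcal{U}=\mathcal{T}/\operatorname{thick}\mathcal{P}$ with canonical projection functor $\rho:\mathcal{T}\to\mathcal{U}$, and put $\mathcal{Z}=({}^{\perp}\mathcal{P}[>0])\cap(\mathcal{P}[<0]^{\perp})$. Let $\bar\rho:\frac{\mathcal{Z}}{[\mathcal{P}]}\to\mathcal{U}$ be the functor induced by the composition $\mathcal{Z}\subset\mathcal{T}\xrightarrow{\rho}\mathcal{U}$. Then the category $\frac{\mathcal{Z}}{[\mathcal{P}]}$ has a structure of a triangulated category, given by the shift functor $\langle1\rangle$ and the class of triangles described in the context, such that $\bar\rho$ is a triangle equivalence.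
   Context: All subcategories are full. $[1]$ is the shift of $\mathcal{T}$. $\operatorname{add}\mathcal{S}$ is the smallest full subcategory containing $\mathcal{S}$ and closed under isomorphisms, finite direct sums and direct summands; $\operatorname{thick}\mathcal{S}$ is the smallest triangulated subcategory containing $\mathcal{S}$ and closed under direct summands. $\mathcal{P}$ is presilting if $\operatorname{Hom}_{\mathcal{T}}(\mathcal{P},\mathcal{P}[i])=0$ for all $i>0$. ${}^{\perp}\mathcal{P}[>0]=\{X\in\mathcal{T}\mid\operatorname{Hom}_{\mathcal{T}}(X,\mathcal{P}[i])=0\ \forall i>0\}$ and $\mathcal{P}[<0]^{\perp}=\{X\in\mathcal{T}\mid\operatorname{Hom}_{\mathcal{T}}(\mathcal{P}[i],X)=0\ \forall i<0\}$. A right $\mathcal{S}$-approximation of $X$ is a morphism $f:S\to X$ with $S\in\mathcal{S}$ such that $\operatorname{Hom}(S',f)$ is surjective for all $S'\in\mathcal{S}$; $\mathcal{S}$ is contravariantly finite in a category if every object of it has a right $\mathcal{S}$-approximation. Left approximations and covariant finiteness are defined dually. (P1) $\mathcal{P}$ is covariantly finite in ${}^{\perp}\mathcal{P}[>0]$ and contravariantly finite in $\mathcal{P}[<0]^{\perp}$. (P2) For any $X\in\mathcal{T}$, $\operatorname{Hom}_{\mathcal{T}}(X,\mathcal{P}[\ell])=0=\operatorname{Hom}_{\mathcal{T}}(\mathcal{P},X[\ell])$ for all $\ell\gg0$. $[\mathcal{P}]$ is the ideal of morphisms factoring through an object of $\operatorname{add}\mathcal{P}$, and $\frac{\mathcal{Z}}{[\mathcal{P}]}$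 is the corresponding additive quotient; $\overline{f}$ is the class of $f$. (Since $\rho(\mathcal{P})=0$, the functor $\bar\rho$ is well defined.) Triangulated structure on $\frac{\mathcal{Z}}{[\mathcal{P}]}$: for $X\in\mathcal{Z}$ fix a triangle $X\xrightarrow{\iota_X}P_X\to X\langle1\rangle\to X[1]$ in $\mathcal{T}$ with $\iota_X$ a left $\mathcal{P}$-approximation; $X\mapsto X\langle1\rangle$ induces an auto-equivalence $\langle1\rangle$ of $\frac{\mathcal{Z}}{[\mathcal{P}]}$, which is the shift. For a triangle $X\xrightarrow{f}Y\xrightarrow{g}Z\xrightarrow{h}X[1]$ in $\mathcal{T}$ with $X,Y,Z\in\mathcal{Z}$, take a morphism of triangles from it to $X\xrightarrow{\iota_X}P_X\to X\langle1\rangle\to X[1]$ which is the identity on $X$ and $X[1]$, and let $a:Z\to X\langle1\rangle$ be its third component. The triangles in $\frac{\mathcal{Z}}{[\mathcal{P}]}$ are the complexes isomorphic to complexes $X\xrightarrow{\overline f}Y\xrightarrow{\overline g}Z\xrightarrow{\overline a}X\langle1\rangle$ obtained in this way. *)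

theory Defs
  imports "HOL-Algebra.Group"
begin

section \<open>Categories\<close>

record ('o, 'm) cat_data =
  Obj :: "'o set"
  Arr :: "'m set"
  Dom :: "'m \<Rightarrow> 'o"
  Cod :: "'m \<Rightarrow> 'o"
  Ident :: "'o \<Rightarrow> 'm"
  Comp :: "'m \<Rightarrow> 'm \<Rightarrow> 'm" (infixl "\<cdot>\<index>" 70)

definition Hom :: "('o, 'm, 'x) cat_data_scheme \<Rightarrow> 'o \<Rightarrow> 'o \<Rightarrow> 'm set" where
  "Hom C X Y = {f \<in> Arr C. Dom C f = X \<and> Cod C f = Y}"

locale category =
  fixes C :: "('o, 'm, 'x) cat_data_scheme" (structure)
  assumes dom_obj: "f \<in> Arr C \<Longrightarrow> Dom C f \<in> Obj C"
    and cod_obj: "f \<in> Arr C \<Longrightarrow> Cod C f \<in> Obj C"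
    and ident_hom: "X \<in> Obj C \<Longrightarrow> Ident C X \<in> Hom C X X"
    and comp_hom: "\<lbrakk>f \<in> Hom C X Y; g \<in> Hom C Y Z\<rbrakk> \<Longrightarrow> g \<cdot> f \<in> Hom C X Z"
    and ident_left: "f \<in> Hom C X Y \<Longrightarrow> Ident C Y \<cdot> f = f"
    and ident_right: "f \<in> Hom C X Y \<Longrightarrow> f \<cdot> Ident C X = f"
    and comp_assoc:
      "\<lbrakk>f \<in> Hom C W X; g \<in> Hom C X Y; h \<in> Hom C Y Z\<rbrakk> \<Longrightarrow> (h \<cdot> g) \<cdot> f = h \<cdot> (g \<cdot> f)"

definition iso_arrow :: "('o, 'm, 'x) cat_data_scheme \<Rightarrow> 'm \<Rightarrow> bool" where
  "iso_arrow C f \<longleftrightarrow> f \<in> Arr C \<and>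
     (\<exists>g\<in>Hom C (Cod C f) (Dom C f).
        g \<cdot>\<^bsub>C\<^esub> f = Ident C (Dom C f) \<and> f \<cdot>\<^bsub>C\<^esub> g = Ident C (Cod C f))"

definition isomorphic :: "('o, 'm, 'x) cat_data_scheme \<Rightarrow> 'o \<Rightarrow> 'o \<Rightarrow> bool" where
  "isomorphic C X Y \<longleftrightarrow> (\<exists>f\<in>Hom C X Y. iso_arrow C f)"

text \<open>A functor is a pair consisting of its object map and its arrow map.\<close>

locale cat_functor = dom: category C + cod: category D
  for C :: "('o, 'm, 'x) cat_data_scheme" and D :: "('p, 'n, 'y) cat_data_scheme" +
  fixes Fo :: "'o \<Rightarrow> 'p" and Fa :: "'m \<Rightarrow> 'n"
  assumes map_obj: "X \<in> Obj C \<Longrightarrow> Fo X \<in> Obj D"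
    and map_hom: "f \<in> Hom C X Y \<Longrightarrow> Fa f \<in> Hom D (Fo X) (Fo Y)"
    and map_ident: "X \<in> Obj C \<Longrightarrow> Fa (Ident C X) = Ident D (Fo X)"
    and map_comp: "\<lbrakk>f \<in> Hom C X Y; g \<in> Hom C Y Z\<rbrakk> \<Longrightarrow> Fa (g \<cdot>\<^bsub>C\<^esub> f) = Fa g \<cdot>\<^bsub>D\<^esub> Fa f"

definition natural_iso ::
    "('o, 'm, 'x) cat_data_scheme \<Rightarrow> ('p, 'n, 'y) cat_data_scheme \<Rightarrow>
     ('o \<Rightarrow> 'p) \<Rightarrow> ('m \<Rightarrow> 'n) \<Rightarrow> ('o \<Rightarrow> 'p) \<Rightarrow> ('m \<Rightarrow> 'n) \<Rightarrow> ('o \<Rightarrow> 'n) \<Rightarrow> bool" where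
  "natural_iso C D Fo Fa Go Ga \<eta> \<longleftrightarrow>
     (\<forall>X\<in>Obj C. \<eta> X \<in> Hom D (Fo X) (Go X) \<and> iso_arrow D (\<eta> X)) \<and>
     (\<forall>f\<in>Arr C. \<eta> (Cod C f) \<cdot>\<^bsub>D\<^esub> Fa f = Ga f \<cdot>\<^bsub>D\<^esub> \<eta> (Dom C f))"

definition cat_equivalence ::
    "('o, 'm, 'x) cat_data_scheme \<Rightarrow> ('p, 'n, 'y) cat_data_scheme \<Rightarrow>
     ('o \<Rightarrow> 'p) \<Rightarrow> ('m \<Rightarrow> 'n) \<Rightarrow> bool" where
  "cat_equivalence C D Fo Fa \<longleftrightarrow> cat_functor C D Fo Fa \<and>
     (\<exists>Go Ga \<eta> \<epsilon>. cat_functor D C Go Ga \<and>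
        natural_iso C C (\<lambda>X. X) (\<lambda>f. f) (Go \<circ> Fo) (Ga \<circ> Fa) \<eta> \<and>
        natural_iso D D (Fo \<circ> Go) (Fa \<circ> Ga) (\<lambda>X. X) (\<lambda>f. f) \<epsilon>)"


section \<open>Additive categories\<close>

record ('o, 'm) preadd_data = "('o, 'm) cat_data" +
  Add :: "'m \<Rightarrow> 'm \<Rightarrow> 'm" (infixl "\<boxplus>\<index>" 65)
  Zero :: "'o \<Rightarrow> 'o \<Rightarrow> 'm"

definition hom_group :: "('o, 'm, 'x) preadd_data_scheme \<Rightarrow> 'o \<Rightarrow> 'o \<Rightarrow> 'm monoid" where
  "hom_group C X Y = \<lparr>carrier = Hom C X Y, monoid.mult = Add C, one = Zero C X Y\<rparr>"

definition neg :: "('o, 'm, 'x) preadd_data_scheme \<Rightarrow> 'm \<Rightarrow> 'm" where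
  "neg C f = inv\<^bsub>hom_group C (Dom C f) (Cod C f)\<^esub> f"

definition zero_object :: "('o, 'm, 'x) cat_data_scheme \<Rightarrow> 'o \<Rightarrow> bool" where
  "zero_object C N \<longleftrightarrow> N \<in> Obj C \<and>
     (\<forall>X\<in>Obj C. (\<exists>!f. f \<in> Hom C X N) \<and> (\<exists>!f. f \<in> Hom C N X))"

text \<open>\<open>biproduct C A B S\<close>: the object \<open>S\<close> is a direct sum of \<open>A\<close> and \<open>B\<close>.\<close>

definition biproduct :: "('o, 'm, 'x) preadd_data_scheme \<Rightarrow> 'o \<Rightarrow> 'o \<Rightarrow> 'o \<Rightarrow> bool" where
  "biproduct C A B S \<longleftrightarrow> A \<in> Obj C \<and> B \<in> Obj C \<and> S \<in> Obj C \<and>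
     (\<exists>i\<in>Hom C A S. \<exists>j\<in>Hom C B S. \<exists>p\<in>Hom C S A. \<exists>q\<in>Hom C S B.
        p \<cdot>\<^bsub>C\<^esub> i = Ident C A \<and> q \<cdot>\<^bsub>C\<^esub> j = Ident C B \<and>
        p \<cdot>\<^bsub>C\<^esub> j = Zero C B A \<and> q \<cdot>\<^bsub>C\<^esub> i = Zero C A B \<and>
        (i \<cdot>\<^bsub>C\<^esub> p) \<boxplus>\<^bsub>C\<^esub> (j \<cdot>\<^bsub>C\<^esub> q) = Ident C S)"

locale additive_category = category C
  for C :: "('o, 'm, 'x) preadd_data_scheme" (structure) +
  assumes hom_comm_group: "\<lbrakk>X \<in> Obj C; Y \<in> Obj C\<rbrakk> \<Longrightarrow> comm_group (hom_group C X Y)"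
    and comp_add_left: "\<lbrakk>f \<in> Hom C X Y; g \<in> Hom C Y Z; g' \<in> Hom C Y Z\<rbrakk>
          \<Longrightarrow> (g \<boxplus> g') \<cdot> f = (g \<cdot> f) \<boxplus> (g' \<cdot> f)"
    and comp_add_right: "\<lbrakk>f \<in> Hom C X Y; f' \<in> Hom C X Y; g \<in> Hom C Y Z\<rbrakk>
          \<Longrightarrow> g \<cdot> (f \<boxplus> f') = (g \<cdot> f) \<boxplus> (g \<cdot> f')"
    and zero_object_exists: "\<exists>N. zero_object C N"
    and biproduct_exists: "\<lbrakk>A \<in> Obj C; B \<in> Obj C\<rbrakk> \<Longrightarrow> \<exists>S. biproduct C A B S"

definition additive_maps ::
    "('o, 'm, 'x) preadd_data_scheme \<Rightarrow> ('p, 'n, 'y) preadd_data_scheme \<Rightarrow>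
     ('o \<Rightarrow> 'p) \<Rightarrow> ('m \<Rightarrow> 'n) \<Rightarrow> bool" where
  "additive_maps C D Fo Fa \<longleftrightarrow>
     (\<forall>X\<in>Obj C. \<forall>Y\<in>Obj C. Fa \<in> hom (hom_group C X Y) (hom_group D (Fo X) (Fo Y)))"

definition iso_closed :: "('o, 'm, 'x) cat_data_scheme \<Rightarrow> 'o set \<Rightarrow> bool" where
  "iso_closed C S \<longleftrightarrow> (\<forall>X\<in>S. \<forall>Y\<in>Obj C. isomorphic C X Y \<longrightarrow> Y \<in> S)"

text \<open>The empty direct sum is a zero object.\<close>

definition sum_closed :: "('o, 'm, 'x) preadd_data_scheme \<Rightarrow> 'o set \<Rightarrow> bool" where
  "sum_closed C S \<longleftrightarrow> (\<forall>N. zero_object C N \<longrightarrow> N \<in> S) \<and>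
     (\<forall>A\<in>S. \<forall>B\<in>S. \<forall>X. biproduct C A B X \<longrightarrow> X \<in> S)"

definition summand_closed :: "('o, 'm, 'x) preadd_data_scheme \<Rightarrow> 'o set \<Rightarrow> bool" where
  "summand_closed C S \<longleftrightarrow> (\<forall>X\<in>S. \<forall>A B. biproduct C A B X \<longrightarrow> A \<in> S)"

text \<open>Full subcategories are given by their sets of objects.\<close>

definition add_closure :: "('o, 'm, 'x) preadd_data_scheme \<Rightarrow> 'o set \<Rightarrow> 'o set" where
  "add_closure C S =
     \<Inter>{D. S \<subseteq> D \<and> D \<subseteq> Obj C \<and> iso_closed C D \<and> sum_closed C D \<and> summand_closed C D}"

definition right_approximation :: "('o, 'm, 'x) cat_data_scheme \<Rightarrow> 'o set \<Rightarrow> 'm \<Rightarrow> bool" where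
  "right_approximation C S f \<longleftrightarrow> f \<in> Arr C \<and> Dom C f \<in> S \<and>
     (\<forall>S'\<in>S. \<forall>g\<in>Hom C S' (Cod C f). \<exists>h\<in>Hom C S' (Dom C f). f \<cdot>\<^bsub>C\<^esub> h = g)"

definition left_approximation :: "('o, 'm, 'x) cat_data_scheme \<Rightarrow> 'o set \<Rightarrow> 'm \<Rightarrow> bool" where
  "left_approximation C S f \<longleftrightarrow> f \<in> Arr C \<and> Cod C f \<in> S \<and>
     (\<forall>S'\<in>S. \<forall>g\<in>Hom C (Dom C f) S'. \<exists>h\<in>Hom C (Cod C f) S'. h \<cdot>\<^bsub>C\<^esub> f = g)"

definition contravariantly_finite_in ::
    "('o, 'm, 'x) cat_data_scheme \<Rightarrow> 'o set \<Rightarrow> 'o set \<Rightarrow> bool" where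
  "contravariantly_finite_in C S D \<longleftrightarrow>
     (\<forall>X\<in>D. \<exists>f. Cod C f = X \<and> right_approximation C S f)"

definition covariantly_finite_in ::
    "('o, 'm, 'x) cat_data_scheme \<Rightarrow> 'o set \<Rightarrow> 'o set \<Rightarrow> bool" where
  "covariantly_finite_in C S D \<longleftrightarrow>
     (\<forall>X\<in>D. \<exists>f. Dom C f = X \<and> left_approximation C S f)"


section \<open>Triangulated categories\<close>

text \<open>
  A sequence \<open>X \<rightarrow> Y \<rightarrow> Z \<rightarrow> \<Sigma>X\<close> is the triple of its arrows, where \<open>\<Sigma>\<close> has object map \<open>So\<close>
  and arrow map \<open>Sa\<close>. A morphism of such sequences is a triple \<open>(a, b, c)\<close>, the fourth
  component being \<open>Sa a\<close>.
\<close>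

definition is_seq ::
    "('o, 'm, 'x) cat_data_scheme \<Rightarrow> ('o \<Rightarrow> 'o) \<Rightarrow> 'm \<times> 'm \<times> 'm \<Rightarrow> bool" where
  "is_seq C So = (\<lambda>(f, g, h). f \<in> Arr C \<and> g \<in> Arr C \<and> h \<in> Arr C \<and>
     Cod C f = Dom C g \<and> Cod C g = Dom C h \<and> Cod C h = So (Dom C f))"

definition seq_morphism ::
    "('o, 'm, 'x) cat_data_scheme \<Rightarrow> ('m \<Rightarrow> 'm) \<Rightarrow>
     'm \<times> 'm \<times> 'm \<Rightarrow> 'm \<times> 'm \<times> 'm \<Rightarrow> 'm \<times> 'm \<times> 'm \<Rightarrow> bool" where
  "seq_morphism C Sa = (\<lambda>(f, g, h) (f', g', h') (a, b, c).
     a \<in> Hom C (Dom C f) (Dom C f') \<and> b \<in> Hom C (Dom C g) (Dom C g') \<and>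
     c \<in> Hom C (Dom C h) (Dom C h') \<and>
     b \<cdot>\<^bsub>C\<^esub> f = f' \<cdot>\<^bsub>C\<^esub> a \<and> c \<cdot>\<^bsub>C\<^esub> g = g' \<cdot>\<^bsub>C\<^esub> b \<and> Sa a \<cdot>\<^bsub>C\<^esub> h = h' \<cdot>\<^bsub>C\<^esub> c)"

definition seq_isomorphic ::
    "('o, 'm, 'x) cat_data_scheme \<Rightarrow> ('o \<Rightarrow> 'o) \<Rightarrow> ('m \<Rightarrow> 'm) \<Rightarrow>
     'm \<times> 'm \<times> 'm \<Rightarrow> 'm \<times> 'm \<times> 'm \<Rightarrow> bool" where
  "seq_isomorphic C So Sa t t' \<longleftrightarrow> is_seq C So t \<and> is_seq C So t' \<and>
     (\<exists>a b c. seq_morphism C Sa t t' (a, b, c) \<and>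
        iso_arrow C a \<and> iso_arrow C b \<and> iso_arrow C c)"

record ('o, 'm) triang_data = "('o, 'm) preadd_data" +
  ShO :: "'o \<Rightarrow> 'o"
  ShA :: "'m \<Rightarrow> 'm"
  Tri :: "('m \<times> 'm \<times> 'm) set"

text \<open>The shift is an auto-equivalence, not necessarily an automorphism.\<close>

locale triangulated_category = additive_category T
  for T :: "('o, 'm, 'x) triang_data_scheme" (structure) +
  assumes shift_equivalence: "cat_equivalence T T (ShO T) (ShA T)"
    and shift_additive: "additive_maps T T (ShO T) (ShA T)"
    and tri_seq: "t \<in> Tri T \<Longrightarrow> is_seq T (ShO T) t"
    and tri_iso: "\<lbrakk>t \<in> Tri T; seq_isomorphic T (ShO T) (ShA T) t' t\<rbrakk> \<Longrightarrow> t' \<in> Tri T"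
    and tri_ident: "\<lbrakk>X \<in> Obj T; zero_object T N\<rbrakk>
          \<Longrightarrow> (Ident T X, Zero T X N, Zero T N (ShO T X)) \<in> Tri T"
    and tri_cone: "f \<in> Arr T \<Longrightarrow> \<exists>g h. (f, g, h) \<in> Tri T"
    and tri_rotate: "is_seq T (ShO T) (f, g, h)
          \<Longrightarrow> (f, g, h) \<in> Tri T \<longleftrightarrow> (g, h, neg T (ShA T f)) \<in> Tri T"
    and tri_fill: "\<lbrakk>(f, g, h) \<in> Tri T; (f', g', h') \<in> Tri T;
            a \<in> Hom T (Dom T f) (Dom T f'); b \<in> Hom T (Cod T f) (Cod T f'); b \<cdot> f = f' \<cdot> a\<rbrakk>
          \<Longrightarrow> \<exists>c. seq_morphism T (ShA T) (f, g, h) (f', g', h') (a, b, c)"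
    and tri_octahedral: "\<lbrakk>Cod T f = Dom T g; (f, f', f'') \<in> Tri T; (g, g', g'') \<in> Tri T;
            (g \<cdot> f, k', k'') \<in> Tri T\<rbrakk>
          \<Longrightarrow> \<exists>u v. (u, v, ShA T f' \<cdot> g'') \<in> Tri T \<and>
                u \<cdot> f' = k' \<cdot> g \<and> k'' \<cdot> u = f'' \<and> v \<cdot> k' = g' \<and> g'' \<cdot> v = ShA T f \<cdot> k''"

text \<open>
  A triangle functor comes with a natural isomorphism \<open>\<phi>\<close> from \<open>F \<circ> \<Sigma>\<close> to \<open>\<Sigma> \<circ> F\<close>.
\<close>

locale triangle_functor =
  dom: triangulated_category C + cod: triangulated_category D + cat_functor C D Fo Fa
  for C :: "('o, 'm, 'x) triang_data_scheme" and D :: "('p, 'n, 'y) triang_data_scheme"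
    and Fo :: "'o \<Rightarrow> 'p" and Fa :: "'m \<Rightarrow> 'n" +
  fixes \<phi> :: "'o \<Rightarrow> 'n"
  assumes additive: "additive_maps C D Fo Fa"
    and shift_iso: "natural_iso C D (Fo \<circ> ShO C) (Fa \<circ> ShA C) (ShO D \<circ> Fo) (ShA D \<circ> Fa) \<phi>"
    and map_tri: "(f, g, h) \<in> Tri C \<Longrightarrow> (Fa f, Fa g, \<phi> (Dom C f) \<cdot>\<^bsub>D\<^esub> Fa h) \<in> Tri D"

definition triangle_equivalence ::
    "('o, 'm, 'x) triang_data_scheme \<Rightarrow> ('p, 'n, 'y) triang_data_scheme \<Rightarrow>
     ('o \<Rightarrow> 'p) \<Rightarrow> ('m \<Rightarrow> 'n) \<Rightarrow> bool" where
  "triangle_equivalence C D Fo Fa \<longleftrightarrow>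
     (\<exists>\<phi>. triangle_functor C D Fo Fa \<phi>) \<and> cat_equivalence C D Fo Fa"

text \<open>
  \<open>shift T X i\<close> is \<open>X[i]\<close>. For \<open>i < 0\<close> this is determined only up to isomorphism,
  which is enough for its uses in the vanishing of Hom groups and in iso-closed subcategories.
\<close>

definition unshift :: "('o, 'm, 'x) triang_data_scheme \<Rightarrow> 'o \<Rightarrow> 'o" where
  "unshift T X = (SOME Y. Y \<in> Obj T \<and> isomorphic T (ShO T Y) X)"

definition shift :: "('o, 'm, 'x) triang_data_scheme \<Rightarrow> 'o \<Rightarrow> int \<Rightarrow> 'o" where
  "shift T X i = (if 0 \<le> i then (ShO T ^^ nat i) X else (unshift T ^^ nat (- i)) X)"

definition triangulated_subcategory :: "('o, 'm, 'x) triang_data_scheme \<Rightarrow> 'o set \<Rightarrow> bool" where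
  "triangulated_subcategory T D \<longleftrightarrow> D \<subseteq> Obj T \<and> iso_closed T D \<and>
     (\<forall>N. zero_object T N \<longrightarrow> N \<in> D) \<and>
     (\<forall>X\<in>D. shift T X 1 \<in> D \<and> shift T X (- 1) \<in> D) \<and>
     (\<forall>(f, g, h)\<in>Tri T. Dom T f \<in> D \<and> Cod T f \<in> D \<longrightarrow> Cod T g \<in> D)"

definition thick :: "('o, 'm, 'x) triang_data_scheme \<Rightarrow> 'o set \<Rightarrow> 'o set" where
  "thick T S = \<Inter>{D. S \<subseteq> D \<and> triangulated_subcategory T D \<and> summand_closed T D}"


section \<open>Verdier quotients\<close>

text \<open>
  The Verdier quotient of \<open>T\<close> by a thick subcategory \<open>N\<close> has the objects of \<open>T\<close>. Its arrows
  from \<open>X\<close> to \<open>Y\<close> are equivalence classes of roofs \<open>(s, f)\<close>, that is, of diagrams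
  \<open>X \<leftarrow> W \<rightarrow> Y\<close> with left leg \<open>s\<close> in the class \<open>mult_sys T N\<close> of arrows whose cone lies in
  \<open>N\<close>; the roof \<open>(s, f)\<close> stands for \<open>f \<circ> s\<^sup>-\<^sup>1\<close>. Operations on classes are
  defined by representatives: \<open>the_elem\<close> picks the common value that all representatives give.
\<close>

definition mult_sys :: "('o, 'm, 'x) triang_data_scheme \<Rightarrow> 'o set \<Rightarrow> 'm set" where
  "mult_sys T N = {s \<in> Arr T. \<exists>g h. (s, g, h) \<in> Tri T \<and> Cod T g \<in> N}"

definition roofs :: "('o, 'm, 'x) triang_data_scheme \<Rightarrow> 'o set \<Rightarrow> ('m \<times> 'm) set" where
  "roofs T N = {(s, f). s \<in> mult_sys T N \<and> f \<in> Arr T \<and> Dom T s = Dom T f}"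

definition roof_rel :: "('o, 'm, 'x) triang_data_scheme \<Rightarrow> 'o set \<Rightarrow> ('m \<times> 'm) rel" where
  "roof_rel T N = {((s, f), (s', f')). (s, f) \<in> roofs T N \<and> (s', f') \<in> roofs T N \<and>
     Cod T s = Cod T s' \<and> Cod T f = Cod T f' \<and>
     (\<exists>W. \<exists>u\<in>Hom T W (Dom T s). \<exists>u'\<in>Hom T W (Dom T s').
        s \<cdot>\<^bsub>T\<^esub> u = s' \<cdot>\<^bsub>T\<^esub> u' \<and> f \<cdot>\<^bsub>T\<^esub> u = f' \<cdot>\<^bsub>T\<^esub> u' \<and> s \<cdot>\<^bsub>T\<^esub> u \<in> mult_sys T N)}"

definition roof_class :: "('o, 'm, 'x) triang_data_scheme \<Rightarrow> 'o set \<Rightarrow> 'm \<times> 'm \<Rightarrow> ('m \<times> 'm) set" where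
  "roof_class T N r = roof_rel T N `` {r}"

text \<open>
  Roofs \<open>(s, f)\<close> and \<open>(t, g)\<close> are composed by completing \<open>f\<close>, \<open>t\<close> to a commutative square
  \<open>f \<circ> u = t \<circ> h\<close> with \<open>u\<close> in the multiplicative system, and added after passing to a common
  left leg.
\<close>

definition verdier_preadd ::
    "('o, 'm, 'x) triang_data_scheme \<Rightarrow> 'o set \<Rightarrow> ('o, ('m \<times> 'm) set) preadd_data" where
  "verdier_preadd T N = \<lparr>
     Obj = Obj T,
     Arr = roofs T N // roof_rel T N,
     Dom = (\<lambda>a. the_elem ((\<lambda>(s, f). Cod T s) ` a)),
     Cod = (\<lambda>a. the_elem ((\<lambda>(s, f). Cod T f) ` a)),
     Ident = (\<lambda>X. roof_class T N (Ident T X, Ident T X)),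
     Comp = (\<lambda>b a. the_elem {roof_class T N (s \<cdot>\<^bsub>T\<^esub> u, g \<cdot>\<^bsub>T\<^esub> h) | s f t g u h.
        (s, f) \<in> a \<and> (t, g) \<in> b \<and> u \<in> mult_sys T N \<and> Cod T u = Dom T f \<and>
        h \<in> Hom T (Dom T u) (Dom T t) \<and> f \<cdot>\<^bsub>T\<^esub> u = t \<cdot>\<^bsub>T\<^esub> h}),
     Add = (\<lambda>a b. the_elem {roof_class T N (s, f \<boxplus>\<^bsub>T\<^esub> g) | s f g. (s, f) \<in> a \<and> (s, g) \<in> b}),
     Zero = (\<lambda>X Y. roof_class T N (Ident T X, Zero T X Y))\<rparr>"

definition verdier_shift ::
    "('o, 'm, 'x) triang_data_scheme \<Rightarrow> 'o set \<Rightarrow> ('m \<times> 'm) set \<Rightarrow> ('m \<times> 'm) set" where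
  "verdier_shift T N a = the_elem ((\<lambda>(s, f). roof_class T N (ShA T s, ShA T f)) ` a)"

definition verdier_proj :: "('o, 'm, 'x) triang_data_scheme \<Rightarrow> 'o set \<Rightarrow> 'm \<Rightarrow> ('m \<times> 'm) set" where
  "verdier_proj T N f = roof_class T N (Ident T (Dom T f), f)"

definition verdier_quotient ::
    "('o, 'm, 'x) triang_data_scheme \<Rightarrow> 'o set \<Rightarrow> ('o, ('m \<times> 'm) set) triang_data" where
  "verdier_quotient T N = preadd_data.extend (verdier_preadd T N)
     (triang_data.fields (ShO T) (verdier_shift T N)
       {t. \<exists>(f, g, h)\<in>Tri T.
          seq_isomorphic (verdier_preadd T N) (ShO T) (verdier_shift T N)
            t (verdier_proj T N f, verdier_proj T N g, verdier_proj T N h)})"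


section \<open>Quotients by ideals\<close>

definition ideal_of :: "('o, 'm, 'x) preadd_data_scheme \<Rightarrow> 'o set \<Rightarrow> 'm set" where
  "ideal_of C S = {f \<in> Arr C. \<exists>Q\<in>add_closure C S.
     \<exists>u\<in>Hom C (Dom C f) Q. \<exists>v\<in>Hom C Q (Cod C f). f = v \<cdot>\<^bsub>C\<^esub> u}"

definition ideal_rel :: "('o, 'm, 'x) preadd_data_scheme \<Rightarrow> 'm set \<Rightarrow> 'm rel" where
  "ideal_rel C I = {(f, g). f \<in> Arr C \<and> g \<in> Hom C (Dom C f) (Cod C f) \<and> f \<boxplus>\<^bsub>C\<^esub> neg C g \<in> I}"

definition ideal_class :: "('o, 'm, 'x) preadd_data_scheme \<Rightarrow> 'm set \<Rightarrow> 'm \<Rightarrow> 'm set" where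
  "ideal_class C I f = ideal_rel C I `` {f}"

text \<open>The quotient by \<open>I\<close> of the full subcategory of \<open>C\<close> with object set \<open>Z\<close>.\<close>

definition ideal_quotient ::
    "('o, 'm, 'x) preadd_data_scheme \<Rightarrow> 'o set \<Rightarrow> 'm set \<Rightarrow> ('o, 'm set) preadd_data" where
  "ideal_quotient C Z I = \<lparr>
     Obj = Z,
     Arr = {f \<in> Arr C. Dom C f \<in> Z \<and> Cod C f \<in> Z} // ideal_rel C I,
     Dom = (\<lambda>a. the_elem (Dom C ` a)),
     Cod = (\<lambda>a. the_elem (Cod C ` a)),
     Ident = (\<lambda>X. ideal_class C I (Ident C X)),
     Comp = (\<lambda>b a. the_elem {ideal_class C I (g \<cdot>\<^bsub>C\<^esub> f) | f g. f \<in> a \<and> g \<in> b}),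
     Add = (\<lambda>a b. the_elem {ideal_class C I (f \<boxplus>\<^bsub>C\<^esub> g) | f g. f \<in> a \<and> g \<in> b}),
     Zero = (\<lambda>X Y. ideal_class C I (Zero C X Y))\<rparr>"


section \<open>Silting reduction\<close>

definition hom_vanish :: "('o, 'm, 'x) preadd_data_scheme \<Rightarrow> 'o \<Rightarrow> 'o \<Rightarrow> bool" where
  "hom_vanish C X Y \<longleftrightarrow> Hom C X Y = {Zero C X Y}"

definition presilting :: "('o, 'm, 'x) triang_data_scheme \<Rightarrow> 'o set \<Rightarrow> bool" where
  "presilting T P \<longleftrightarrow> P \<subseteq> Obj T \<and>
     (\<forall>i>0. \<forall>A\<in>P. \<forall>B\<in>P. hom_vanish T A (shift T B i))"

definition left_perp :: "('o, 'm, 'x) triang_data_scheme \<Rightarrow> 'o set \<Rightarrow> 'o set" where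
  "left_perp T P = {X \<in> Obj T. \<forall>i>0. \<forall>A\<in>P. hom_vanish T X (shift T A i)}"

definition right_perp :: "('o, 'm, 'x) triang_data_scheme \<Rightarrow> 'o set \<Rightarrow> 'o set" where
  "right_perp T P = {X \<in> Obj T. \<forall>i<0. \<forall>A\<in>P. hom_vanish T (shift T A i) X}"

definition cond_P1 :: "('o, 'm, 'x) triang_data_scheme \<Rightarrow> 'o set \<Rightarrow> bool" where
  "cond_P1 T P \<longleftrightarrow>
     covariantly_finite_in T P (left_perp T P) \<and> contravariantly_finite_in T P (right_perp T P)"

definition cond_P2 :: "('o, 'm, 'x) triang_data_scheme \<Rightarrow> 'o set \<Rightarrow> bool" where
  "cond_P2 T P \<longleftrightarrow> (\<forall>X\<in>Obj T. \<exists>l0. \<forall>l\<ge>l0. \<forall>A\<in>P.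
     hom_vanish T X (shift T A l) \<and> hom_vanish T A (shift T X l))"

definition silting_Z :: "('o, 'm, 'x) triang_data_scheme \<Rightarrow> 'o set \<Rightarrow> 'o set" where
  "silting_Z T P = left_perp T P \<inter> right_perp T P"

text \<open>
  The data \<open>\<iota>\<close>, \<open>\<pi>\<close>, \<open>\<delta>\<close> provide for each \<open>X\<close> in \<open>\<Z>\<close> the fixed triangle
  \<open>X \<rightarrow> P\<^sub>X \<rightarrow> X\<langle>1\<rangle> \<rightarrow> X[1]\<close>, where \<open>P\<^sub>X = Cod T (\<iota> X)\<close> and
  \<open>X\<langle>1\<rangle> = Cod T (\<pi> X)\<close>.
\<close>

definition approximation_triangles ::
    "('o, 'm, 'x) triang_data_scheme \<Rightarrow> 'o set \<Rightarrow> ('o \<Rightarrow> 'm) \<Rightarrow> ('o \<Rightarrow> 'm) \<Rightarrow> ('o \<Rightarrow> 'm) \<Rightarrow> bool" where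
  "approximation_triangles T P \<iota> \<pi> \<delta> \<longleftrightarrow> (\<forall>X\<in>silting_Z T P.
     Dom T (\<iota> X) = X \<and> left_approximation T P (\<iota> X) \<and> (\<iota> X, \<pi> X, \<delta> X) \<in> Tri T)"

text \<open>
  The shift \<open>\<langle>1\<rangle>\<close> sends the class of \<open>f : X \<rightarrow> Y\<close> to the class of the third component of any
  morphism \<open>(f, p, g)\<close> between the fixed triangles of \<open>X\<close> and \<open>Y\<close>.
\<close>

definition angle_shift ::
    "('o, 'm, 'x) triang_data_scheme \<Rightarrow> 'o set \<Rightarrow> ('o \<Rightarrow> 'm) \<Rightarrow> ('o \<Rightarrow> 'm) \<Rightarrow> ('o \<Rightarrow> 'm) \<Rightarrow>
     'm set \<Rightarrow> 'm set" where
  "angle_shift T P \<iota> \<pi> \<delta> a = the_elem {ideal_class T (ideal_of T P) g | f p g. f \<in> a \<and>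
     seq_morphism T (ShA T)
       (\<iota> (Dom T f), \<pi> (Dom T f), \<delta> (Dom T f)) (\<iota> (Cod T f), \<pi> (Cod T f), \<delta> (Cod T f))
       (f, p, g)}"

definition silting_preadd ::
    "('o, 'm, 'x) triang_data_scheme \<Rightarrow> 'o set \<Rightarrow> ('o, 'm set) preadd_data" where
  "silting_preadd T P = ideal_quotient T (silting_Z T P) (ideal_of T P)"

definition standard_triangles ::
    "('o, 'm, 'x) triang_data_scheme \<Rightarrow> 'o set \<Rightarrow> ('o \<Rightarrow> 'm) \<Rightarrow> ('o \<Rightarrow> 'm) \<Rightarrow> ('o \<Rightarrow> 'm) \<Rightarrow>
     ('m set \<times> 'm set \<times> 'm set) set" where
  "standard_triangles T P \<iota> \<pi> \<delta> =
     {(ideal_class T (ideal_of T P) f, ideal_class T (ideal_of T P) g,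
       ideal_class T (ideal_of T P) a) | f g h p a.
      (f, g, h) \<in> Tri T \<and> Dom T f \<in> silting_Z T P \<and> Cod T f \<in> silting_Z T P \<and>
      Cod T g \<in> silting_Z T P \<and>
      seq_morphism T (ShA T) (f, g, h) (\<iota> (Dom T f), \<pi> (Dom T f), \<delta> (Dom T f))
        (Ident T (Dom T f), p, a)}"

definition silting_reduction ::
    "('o, 'm, 'x) triang_data_scheme \<Rightarrow> 'o set \<Rightarrow> ('o \<Rightarrow> 'm) \<Rightarrow> ('o \<Rightarrow> 'm) \<Rightarrow> ('o \<Rightarrow> 'm) \<Rightarrow>
     ('o, 'm set) triang_data" where
  "silting_reduction T P \<iota> \<pi> \<delta> = preadd_data.extend (silting_preadd T P)
     (triang_data.fields (\<lambda>X. Cod T (\<pi> X)) (angle_shift T P \<iota> \<pi> \<delta>)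
       {t. \<exists>t'\<in>standard_triangles T P \<iota> \<pi> \<delta>.
          seq_isomorphic (silting_preadd T P) (\<lambda>X. Cod T (\<pi> X)) (angle_shift T P \<iota> \<pi> \<delta>) t t'})"

text \<open>The arrow map of \<open>\<rho>\<close> induced on \<open>\<Z>/[\<P>]\<close>; on objects it is the identity.\<close>

definition rho_bar :: "('o, 'm, 'x) triang_data_scheme \<Rightarrow> 'o set \<Rightarrow> 'm set \<Rightarrow> ('m \<times> 'm) set" where
  "rho_bar T P a = the_elem (verdier_proj T (thick T P) ` a)"

end

theory Submission
  imports Defs
begin

text \<open>
  The triangulated structure on \<open>\<Z>/[\<P>]\<close> is pulled back from the Verdier quotient \<open>\<U>\<close>, which is
  triangulated by the calculus of roofs. Three facts make this possible.

  First, \<open>\<rho>\<close> restricted to \<open>\<Z>\<close> is full, has kernel \<open>[\<P>]\<close> and is dense. The point is that a composite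
  \<open>X \<rightarrow> N \<rightarrow> Y\<close> with \<open>X\<close> in \<open>\<^sup>\<bottom>\<P>[>0]\<close>, \<open>N\<close> in \<open>thick \<P>\<close> and \<open>Y\<close> in \<open>\<P>[\<le>0]\<^sup>\<bottom>\<close> vanishes; density
  follows by removing, one shift of \<open>\<P>\<close> at a time, the finitely many obstructions left by (P2).

  Second, the connecting morphism \<open>X\<langle>1\<rangle> \<rightarrow> X[1]\<close> has cone \<open>P\<^sub>X[1]\<close>, so it becomes invertible in \<open>\<U>\<close> and
  identifies \<open>\<langle>1\<rangle>\<close> with the shift of \<open>\<U>\<close>.

  Third, a sequence in \<open>\<Z>/[\<P>]\<close> is a triangle exactly when its image in \<open>\<U>\<close> is: replacing
  \<open>f : X \<rightarrow> Y\<close> by \<open>X \<rightarrow> Y \<oplus> P\<^sub>X\<close> puts the cone of \<open>f\<close> into \<open>\<Z>\<close>, and triangles on a given morphism of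
  \<open>\<U>\<close> are unique up to isomorphism.
\<close>

section \<open>Categories and equivalences\<close>

text \<open>The vanishing of composites through \<open>thick T P\<close> is a race between two
  bounds. An object of the thick subcategory has no arrows to \<open>So m Y\<close> for large
  \<open>m\<close>, with one bound for all \<open>Y\<close> in \<open>R0\<close>; and an object of
  \<open>R0\<close> maps to such a deep shift without losing any arrow that starts in
  \<open>LP\<close>. A composite through the thick subcategory dies in the deep shift, so it was
  zero. No filtration of the thick subcategory has to be constructed.

  Approximation triangles are awkward representatives for checking axioms. Pulling back along a
  fully faithful functor turns each axiom into the same axiom of the Verdier quotient, so only the
  two descriptions of shift and triangles remain to be matched. The price is that the quotient must
  be built completely. Its octahedral axiom comes last: moving an octahedron of \<open>T\<close>
  along isomorphisms of the quotient already needs fillers and invertible maps of cones there, hence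
  the locale \<open>pretriangulated\<close>.

  The shift is only an equivalence, so desuspensions exist up to isomorphism. This is why negative
  shifts are traded for positive shifts of the other argument and why many arguments conjugate by an
  isomorphism \<open>e\<close>.\<close>

lemma in_Hom [simp]: "f \<in> Hom C X Y \<longleftrightarrow> f \<in> Arr C \<and> Dom C f = X \<and> Cod C f = Y"
  by (auto simp: Hom_def)

text \<open>With the inverse named, the cancellation laws and its domain and codomain become rewrite
  rules; the existential in \<open>iso_arrow\<close> offers none of these to the simplifier.\<close>

definition inverse_pair :: "('o, 'm, 'x) cat_data_scheme \<Rightarrow> 'm \<Rightarrow> 'm \<Rightarrow> bool" where
  "inverse_pair C f g \<longleftrightarrow> f \<in> Arr C \<and> g \<in> Arr C \<and> Dom C g = Cod C f \<and> Cod C g = Dom C f \<and>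
     g \<cdot>\<^bsub>C\<^esub> f = Ident C (Dom C f) \<and> f \<cdot>\<^bsub>C\<^esub> g = Ident C (Cod C f)"

lemma iso_arrow_iff: "iso_arrow C f \<longleftrightarrow> (\<exists>g. inverse_pair C f g)"
  by (auto simp: iso_arrow_def inverse_pair_def)

lemma inverse_pair_sym: "inverse_pair C f g \<Longrightarrow> inverse_pair C g f"
  by (simp add: inverse_pair_def)

lemma iso_arrowE:
  assumes "iso_arrow C f"
  obtains g where "inverse_pair C f g"
  using assms by (auto simp: iso_arrow_iff)

lemma isomorphicE:
  assumes "isomorphic C X Y"
  obtains f g where "inverse_pair C f g" "Dom C f = X" "Cod C f = Y"
  using assms by (auto simp: isomorphic_def iso_arrow_iff)

lemma isomorphicI: "inverse_pair C f g \<Longrightarrow> Dom C f = X \<Longrightarrow> Cod C f = Y \<Longrightarrow> isomorphic C X Y"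
  by (auto simp: isomorphic_def iso_arrow_iff inverse_pair_def)

lemma isomorphic_sym:
  assumes "isomorphic C X Y"
  shows "isomorphic C Y X"
proof -
  obtain f g where f: "inverse_pair C f g" "Dom C f = X" "Cod C f = Y"
    using assms by (rule isomorphicE)
  then show ?thesis
    by (intro isomorphicI[OF inverse_pair_sym[OF f(1)]]) (simp_all add: inverse_pair_def)
qed

context category begin

lemma comp_arr [simp]: "\<lbrakk>f \<in> Arr C; g \<in> Arr C; Cod C f = Dom C g\<rbrakk> \<Longrightarrow> g \<cdot> f \<in> Arr C"
  and dom_comp [simp]: "\<lbrakk>f \<in> Arr C; g \<in> Arr C; Cod C f = Dom C g\<rbrakk> \<Longrightarrow> Dom C (g \<cdot> f) = Dom C f"
  and cod_comp [simp]: "\<lbrakk>f \<in> Arr C; g \<in> Arr C; Cod C f = Dom C g\<rbrakk> \<Longrightarrow> Cod C (g \<cdot> f) = Cod C g"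
  using comp_hom[of f "Dom C f" "Cod C f" g "Cod C g"] by simp_all

lemma ident_arr [simp]: "X \<in> Obj C \<Longrightarrow> Ident C X \<in> Arr C"
  and dom_ident [simp]: "X \<in> Obj C \<Longrightarrow> Dom C (Ident C X) = X"
  and cod_ident [simp]: "X \<in> Obj C \<Longrightarrow> Cod C (Ident C X) = X"
  using ident_hom[of X] by simp_all

lemma ident_comp [simp]: "\<lbrakk>f \<in> Arr C; Cod C f = Y\<rbrakk> \<Longrightarrow> Ident C Y \<cdot> f = f"
  using ident_left[of f "Dom C f" Y] by simp

lemma comp_ident [simp]: "\<lbrakk>f \<in> Arr C; Dom C f = X\<rbrakk> \<Longrightarrow> f \<cdot> Ident C X = f"
  using ident_right[of f X "Cod C f"] by simp

lemma assoc [simp]: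
  "\<lbrakk>f \<in> Arr C; g \<in> Arr C; h \<in> Arr C; Cod C f = Dom C g; Cod C g = Dom C h\<rbrakk>
    \<Longrightarrow> (h \<cdot> g) \<cdot> f = h \<cdot> (g \<cdot> f)"
  using comp_assoc[of f "Dom C f" "Cod C f" g "Cod C g" h "Cod C h"] by simp

text \<open>Turns an equation into a rewrite rule that also applies inside right-nested composites.\<close>

lemma comp_reduce:
  "\<lbrakk>g \<cdot> f = k; f \<in> Arr C; g \<in> Arr C; Cod C f = Dom C g; x \<in> Arr C; Cod C x = Dom C f\<rbrakk>
    \<Longrightarrow> g \<cdot> (f \<cdot> x) = k \<cdot> x"
  by (metis assoc)

lemma inverse_pair_ident: "X \<in> Obj C \<Longrightarrow> inverse_pair C (Ident C X) (Ident C X)"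
  by (simp add: inverse_pair_def)

lemma iso_ident [simp]: "X \<in> Obj C \<Longrightarrow> iso_arrow C (Ident C X)"
  unfolding iso_arrow_iff by (rule exI) (rule inverse_pair_ident)

lemma inverse_pair_comp:
  assumes "inverse_pair C f f'" "inverse_pair C g g'" "Cod C f = Dom C g"
  shows "inverse_pair C (g \<cdot> f) (f' \<cdot> g')"
proof -
  have f: "f \<in> Arr C" "f' \<in> Arr C" "Dom C f' = Cod C f" "Cod C f' = Dom C f"
    "f' \<cdot> f = Ident C (Dom C f)" "f \<cdot> f' = Ident C (Cod C f)"
    and g: "g \<in> Arr C" "g' \<in> Arr C" "Dom C g' = Cod C g" "Cod C g' = Dom C g"
    "g' \<cdot> g = Ident C (Dom C g)" "g \<cdot> g' = Ident C (Cod C g)"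
    using assms by (auto simp: inverse_pair_def)
  show ?thesis
    using f g assms(3)
    by (simp add: inverse_pair_def comp_reduce[OF f(5)] comp_reduce[OF f(6)] comp_reduce[OF g(5)]
        comp_reduce[OF g(6)])
qed

lemma iso_comp: "\<lbrakk>iso_arrow C f; iso_arrow C g; Cod C f = Dom C g\<rbrakk> \<Longrightarrow> iso_arrow C (g \<cdot> f)"
  unfolding iso_arrow_iff by (elim exE) (rule exI, rule inverse_pair_comp)

lemma iso_arr: "iso_arrow C f \<Longrightarrow> f \<in> Arr C"
  by (simp add: iso_arrow_def)

lemma isomorphic_refl: "X \<in> Obj C \<Longrightarrow> isomorphic C X X"
  by (rule isomorphicI[OF inverse_pair_ident[of X]]) simp_all

lemma isomorphic_trans:
  assumes "isomorphic C X Y" "isomorphic C Y Z"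
  shows "isomorphic C X Z"
proof -
  obtain f f' where f: "inverse_pair C f f'" "Dom C f = X" "Cod C f = Y"
    using assms(1) by (rule isomorphicE)
  obtain g g' where g: "inverse_pair C g g'" "Dom C g = Y" "Cod C g = Z"
    using assms(2) by (rule isomorphicE)
  have "inverse_pair C (g \<cdot> f) (f' \<cdot> g')"
    using f g by (intro inverse_pair_comp) auto
  then show ?thesis
    by (rule isomorphicI) (use f g in \<open>simp_all add: inverse_pair_def\<close>)
qed

lemma inverse_pair_cancel:
  assumes "inverse_pair C f g"
  shows "\<lbrakk>x \<in> Arr C; Cod C x = Dom C f\<rbrakk> \<Longrightarrow> g \<cdot> (f \<cdot> x) = x"
    and "\<lbrakk>x \<in> Arr C; Cod C x = Cod C f\<rbrakk> \<Longrightarrow> f \<cdot> (g \<cdot> x) = x"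
    and "g \<cdot> f = Ident C (Dom C f)"
    and "f \<cdot> g = Ident C (Cod C f)"
    and "f \<in> Arr C" and "g \<in> Arr C" and "Dom C g = Cod C f" and "Cod C g = Dom C f"
proof -
  have f: "f \<in> Arr C" "g \<in> Arr C" "Dom C g = Cod C f" "Cod C g = Dom C f"
    "g \<cdot> f = Ident C (Dom C f)" "f \<cdot> g = Ident C (Cod C f)"
    using assms by (auto simp: inverse_pair_def)
  show "\<lbrakk>x \<in> Arr C; Cod C x = Dom C f\<rbrakk> \<Longrightarrow> g \<cdot> (f \<cdot> x) = x"
    using f by (simp add: comp_reduce[OF f(5)])
  show "\<lbrakk>x \<in> Arr C; Cod C x = Cod C f\<rbrakk> \<Longrightarrow> f \<cdot> (g \<cdot> x) = x"
    using f by (simp add: comp_reduce[OF f(6)])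
qed (use assms in \<open>auto simp: inverse_pair_def\<close>)

lemma iso_cancel_left:
  assumes "iso_arrow C f" "f \<cdot> x = f \<cdot> y" "x \<in> Arr C" "y \<in> Arr C" "Cod C x = Dom C f" "Cod C y = Dom C f"
  shows "x = y"
proof -
  obtain g where g: "inverse_pair C f g"
    using assms(1) by (rule iso_arrowE)
  have "g \<cdot> (f \<cdot> x) = x" "g \<cdot> (f \<cdot> y) = y"
    using inverse_pair_cancel(1)[OF g] assms(3-6) by auto
  then show ?thesis
    using assms(2) by metis
qed

lemma iso_cancel_right:
  assumes "iso_arrow C f" "x \<cdot> f = y \<cdot> f" "x \<in> Arr C" "y \<in> Arr C" "Dom C x = Cod C f" "Dom C y = Cod C f"
  shows "x = y"
proof -
  obtain g where g: "inverse_pair C f g"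
    using assms(1) by (rule iso_arrowE)
  note g' = inverse_pair_cancel[OF g]
  have "(x \<cdot> f) \<cdot> g = (y \<cdot> f) \<cdot> g"
    using assms(2) by simp
  then show ?thesis
    using g' assms(3-6) by simp
qed

text \<open>Yoneda: lifting the identity of the codomain gives a right inverse \<open>g\<close>, and
  injectivity applied to \<open>f \<cdot> (g \<cdot> f) = f\<close> makes it a left inverse.\<close>

lemma iso_arrow_by_hom:
  assumes f: "f \<in> Arr C"
    and inj: "\<And>x y. \<lbrakk>x \<in> Arr C; y \<in> Arr C; Dom C x = Dom C y; Cod C x = Dom C f; Cod C y = Dom C f;
      f \<cdot> x = f \<cdot> y\<rbrakk> \<Longrightarrow> x = y"
    and surj: "\<And>y. \<lbrakk>y \<in> Arr C; Cod C y = Cod C f\<rbrakk> \<Longrightarrow> \<exists>x. x \<in> Arr C \<and> Dom C x = Dom C y \<and> Cod C x = Dom C f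
      \<and> f \<cdot> x = y"
  shows "iso_arrow C f"
proof -
  have ob: "Dom C f \<in> Obj C" "Cod C f \<in> Obj C"
    using f dom_obj cod_obj by auto
  obtain g where g: "g \<in> Arr C" "Dom C g = Cod C f" "Cod C g = Dom C f" "f \<cdot> g = Ident C (Cod C f)"
    using surj[of "Ident C (Cod C f)"] ob by auto
  have 1: "f \<cdot> (g \<cdot> f) = f"
    using f g by (simp add: comp_reduce[OF g(4)])
  have "g \<cdot> f = Ident C (Dom C f)"
    by (rule inj) (use f g ob 1 in simp_all)
  then show ?thesis
    using f g by (auto simp: iso_arrow_iff inverse_pair_def)
qed

end

section \<open>Equivalences as fully faithful and essentially surjective functors\<close>

definition full_faithful ::
    "('o, 'm, 'x) cat_data_scheme \<Rightarrow> ('p, 'n, 'y) cat_data_scheme \<Rightarrow> ('o \<Rightarrow> 'p) \<Rightarrow> ('m \<Rightarrow> 'n) \<Rightarrow> bool" where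
  "full_faithful C D Fo Fa \<longleftrightarrow>
     (\<forall>X\<in>Obj C. \<forall>Y\<in>Obj C. bij_betw Fa (Hom C X Y) (Hom D (Fo X) (Fo Y)))"

definition ess_surj ::
    "('o, 'm, 'x) cat_data_scheme \<Rightarrow> ('p, 'n, 'y) cat_data_scheme \<Rightarrow> ('o \<Rightarrow> 'p) \<Rightarrow> bool" where
  "ess_surj C D Fo \<longleftrightarrow> (\<forall>Y\<in>Obj D. \<exists>X\<in>Obj C. isomorphic D (Fo X) Y)"

context cat_functor begin

lemma map_arr [simp]: "f \<in> Arr C \<Longrightarrow> Fa f \<in> Arr D"
  and dom_map [simp]: "f \<in> Arr C \<Longrightarrow> Dom D (Fa f) = Fo (Dom C f)"
  and cod_map [simp]: "f \<in> Arr C \<Longrightarrow> Cod D (Fa f) = Fo (Cod C f)"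
  using map_hom[of f "Dom C f" "Cod C f"] by simp_all

declare map_obj [simp] map_ident [simp]

lemma map_comp': "\<lbrakk>f \<in> Arr C; g \<in> Arr C; Cod C f = Dom C g\<rbrakk> \<Longrightarrow> Fa (g \<cdot>\<^bsub>C\<^esub> f) = Fa g \<cdot>\<^bsub>D\<^esub> Fa f"
  using map_comp[of f "Dom C f" "Cod C f" g "Cod C g"] by simp

lemma map_inverse_pair: 
  assumes "inverse_pair C f g"
  shows "inverse_pair D (Fa f) (Fa g)"
proof -
  have f: "f \<in> Arr C" "g \<in> Arr C" "Dom C g = Cod C f" "Cod C g = Dom C f"
    "g \<cdot>\<^bsub>C\<^esub> f = Ident C (Dom C f)" "f \<cdot>\<^bsub>C\<^esub> g = Ident C (Cod C f)"
    using assms by (auto simp: inverse_pair_def)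
  then show ?thesis
    using map_comp'[of f g] map_comp'[of g f] dom.dom_obj dom.cod_obj
    by (auto simp: inverse_pair_def)
qed

lemma map_iso: "iso_arrow C f \<Longrightarrow> iso_arrow D (Fa f)"
  using map_inverse_pair by (auto simp: iso_arrow_iff)

lemma map_isomorphic:
  assumes "isomorphic C X Y"
  shows "isomorphic D (Fo X) (Fo Y)"
proof -
  obtain f g where f: "inverse_pair C f g" "Dom C f = X" "Cod C f = Y"
    using assms by (rule isomorphicE)
  then show ?thesis
    by (intro isomorphicI[OF map_inverse_pair[OF f(1)]]) (simp_all add: inverse_pair_def)
qed

text \<open>Naturality of the unit writes \<open>f\<close> as a conjugate of
  \<open>Ga (Fa f)\<close> by isomorphisms, so \<open>Fa f\<close> determines
  \<open>f\<close>.\<close>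

lemma equivalence_imp_faithful:
  assumes "cat_functor D C Go Ga" "natural_iso C C (\<lambda>X. X) (\<lambda>f. f) (Go \<circ> Fo) (Ga \<circ> Fa) \<eta>"
    and "f \<in> Arr C" "g \<in> Arr C" "Dom C f = Dom C g" "Cod C f = Cod C g" "Fa f = Fa g"
  shows "f = g"
proof -
  have ob: "Dom C g \<in> Obj C" "Cod C g \<in> Obj C"
    using assms(4) dom.dom_obj dom.cod_obj by auto
  have "\<eta> (Cod C g) \<cdot>\<^bsub>C\<^esub> f = \<eta> (Cod C g) \<cdot>\<^bsub>C\<^esub> g"
    using assms unfolding natural_iso_def comp_apply by metis
  moreover have "iso_arrow C (\<eta> (Cod C g))" "Dom C (\<eta> (Cod C g)) = Cod C g"
    using assms(2) ob by (auto simp: natural_iso_def)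
  ultimately show ?thesis
    using assms(3-6) dom.iso_cancel_left[of "\<eta> (Cod C g)" f g] by simp
qed

lemma equivalence_imp_full_faithful:
  assumes G: "cat_functor D C Go Ga" and \<eta>: "natural_iso C C (\<lambda>X. X) (\<lambda>f. f) (Go \<circ> Fo) (Ga \<circ> Fa) \<eta>"
    and \<epsilon>: "natural_iso D D (Fo \<circ> Go) (Fa \<circ> Ga) (\<lambda>X. X) (\<lambda>f. f) \<epsilon>"
  shows "full_faithful C D Fo Fa" "ess_surj C D Fo"
proof -
  interpret G: cat_functor D C Go Ga by (rule G)
  have ff: "inj_on Fa (Hom C X Y)" for X Y
    using equivalence_imp_faithful[OF G \<eta>] by (auto simp: inj_on_def)
  \<comment> \<open>The other composite is isomorphic to the identity as well, so the same argument
    with \<open>\<epsilon>\<close> makes \<open>Ga\<close> faithful.\<close>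
  have Gf: "f = g" if h: "f \<in> Arr D" "g \<in> Arr D" "Dom D f = Dom D g" "Cod D f = Cod D g" "Ga f = Ga g" for f g
  proof -
    have ob: "Dom D g \<in> Obj D" "Cod D g \<in> Obj D"
      using h cod.dom_obj cod.cod_obj by auto
    have "f \<cdot>\<^bsub>D\<^esub> \<epsilon> (Dom D g) = g \<cdot>\<^bsub>D\<^esub> \<epsilon> (Dom D g)"
      using \<epsilon> h unfolding natural_iso_def comp_apply by metis
    moreover have "iso_arrow D (\<epsilon> (Dom D g))" "Cod D (\<epsilon> (Dom D g)) = Dom D g"
      using \<epsilon> ob by (auto simp: natural_iso_def)
    ultimately show ?thesis
      using h cod.iso_cancel_right[of "\<epsilon> (Dom D g)" f g] by simp
  qed
  have surj: "\<exists>f. f \<in> Arr C \<and> Dom C f = X \<and> Cod C f = Y \<and> Fa f = g"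
    if X: "X \<in> Obj C" and Y: "Y \<in> Obj C" and g: "g \<in> Arr D" "Dom D g = Fo X" "Cod D g = Fo Y" for X Y g
  proof -
    have i: "iso_arrow C (\<eta> X)" "Dom C (\<eta> X) = X" "Cod C (\<eta> X) = Go (Fo X)"
       "iso_arrow C (\<eta> Y)" "Dom C (\<eta> Y) = Y" "Cod C (\<eta> Y) = Go (Fo Y)"
      using \<eta> X Y by (auto simp: natural_iso_def)
    obtain e where e: "inverse_pair C (\<eta> Y) e"
      using i by (auto elim: iso_arrowE)
    note e' = dom.inverse_pair_cancel[OF e]
    have Xa: "\<eta> X \<in> Arr C"
      using i dom.iso_arr by auto
    \<comment> \<open>The candidate preimage is \<open>Ga g\<close> conjugated by the unit;
      naturality gives \<open>Ga (Fa ?f) = Ga g\<close>, and faithfulness of \<open>Ga\<close>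
      removes the outer functor.\<close>
    let ?f = "e \<cdot>\<^bsub>C\<^esub> (Ga g \<cdot>\<^bsub>C\<^esub> \<eta> X)"
    have f: "?f \<in> Arr C" "Dom C ?f = X" "Cod C ?f = Y"
      using Xa e' i g by simp_all
    have 1: "\<eta> Y \<cdot>\<^bsub>C\<^esub> ?f = Ga g \<cdot>\<^bsub>C\<^esub> \<eta> X"
      using Xa e' i g by simp
    have "\<eta> (Cod C ?f) \<cdot>\<^bsub>C\<^esub> ?f = Ga (Fa ?f) \<cdot>\<^bsub>C\<^esub> \<eta> (Dom C ?f)"
      using \<eta> f unfolding natural_iso_def comp_apply by blast
    then have "\<eta> Y \<cdot>\<^bsub>C\<^esub> ?f = Ga (Fa ?f) \<cdot>\<^bsub>C\<^esub> \<eta> X"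
      by (simp only: f)
    with 1 have "Ga (Fa ?f) = Ga g"
      using i Xa f g dom.iso_cancel_right[of "\<eta> X" "Ga (Fa ?f)" "Ga g"]
      by (simp del: dom.cod_comp dom.dom_comp)
    then have "Fa ?f = g"
      using f g by (intro Gf) (simp_all del: dom.cod_comp dom.dom_comp)
    then show ?thesis
      using f by blast
  qed
  show "full_faithful C D Fo Fa"
    unfolding full_faithful_def bij_betw_def
  proof (intro ballI conjI ff)
    fix X Y assume XY: "X \<in> Obj C" "Y \<in> Obj C"
    show "Fa ` Hom C X Y = Hom D (Fo X) (Fo Y)"
    proof (intro equalityI subsetI)
      fix g assume "g \<in> Hom D (Fo X) (Fo Y)"
      then show "g \<in> Fa ` Hom C X Y"
        using surj[OF XY, of g] by (auto simp: image_iff)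
    qed (use map_hom in blast)
  qed
  show "ess_surj C D Fo"
    unfolding ess_surj_def
  proof
    fix Y assume Y: "Y \<in> Obj D"
    then have "isomorphic D (Fo (Go Y)) Y"
      using \<epsilon> by (auto simp: natural_iso_def isomorphic_def)
    then show "\<exists>X\<in>Obj C. isomorphic D (Fo X) Y"
      using Y G.map_obj by blast
  qed
qed

lemma full_faithfulD:
  assumes "full_faithful C D Fo Fa"
  shows "\<lbrakk>f \<in> Arr C; g \<in> Arr C; Dom C f = Dom C g; Cod C f = Cod C g; Fa f = Fa g\<rbrakk> \<Longrightarrow> f = g"
    and "\<lbrakk>X \<in> Obj C; Y \<in> Obj C; k \<in> Arr D; Dom D k = Fo X; Cod D k = Fo Y\<rbrakk>
      \<Longrightarrow> \<exists>f. f \<in> Arr C \<and> Dom C f = X \<and> Cod C f = Y \<and> Fa f = k"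
proof -
  show "f = g" if h: "f \<in> Arr C" "g \<in> Arr C" "Dom C f = Dom C g" "Cod C f = Cod C g" "Fa f = Fa g"
  proof -
    have "inj_on Fa (Hom C (Dom C g) (Cod C g))"
      using assms h dom.dom_obj[of g] dom.cod_obj[of g] by (auto simp: full_faithful_def bij_betw_def)
    then show ?thesis
      using h by (auto simp: inj_on_def)
  qed
  show "\<exists>f. f \<in> Arr C \<and> Dom C f = X \<and> Cod C f = Y \<and> Fa f = k"
    if h: "X \<in> Obj C" "Y \<in> Obj C" "k \<in> Arr D" "Dom D k = Fo X" "Cod D k = Fo Y"
  proof -
    have "Fa ` Hom C X Y = Hom D (Fo X) (Fo Y)"
      using assms h by (auto simp: full_faithful_def bij_betw_def)
    moreover have "k \<in> Hom D (Fo X) (Fo Y)"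
      using h by simp
    ultimately have "k \<in> Fa ` Hom C X Y"
      by simp
    then show ?thesis
      by auto
  qed
qed

lemma full_faithful_reflects_inverse:
  assumes "full_faithful C D Fo Fa" "f \<in> Arr C" "g \<in> Arr C" "Dom C g = Cod C f" "Cod C g = Dom C f"
    "inverse_pair D (Fa f) (Fa g)"
  shows "inverse_pair C f g"
proof -
  have ob: "Dom C f \<in> Obj C" "Cod C f \<in> Obj C"
    using assms dom.dom_obj dom.cod_obj by auto
  have "g \<cdot>\<^bsub>C\<^esub> f = Ident C (Dom C f)"
    using assms(2-6) ob
    by - (rule full_faithfulD(1)[OF assms(1)], simp_all add: map_comp' inverse_pair_def)
  moreover have "f \<cdot>\<^bsub>C\<^esub> g = Ident C (Cod C f)"
    using assms(2-6) ob
    by - (rule full_faithfulD(1)[OF assms(1)], simp_all add: map_comp' inverse_pair_def)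
  ultimately show ?thesis
    using assms by (simp add: inverse_pair_def)
qed

lemma full_faithful_reflects_iso:
  assumes "full_faithful C D Fo Fa" "f \<in> Arr C" "iso_arrow D (Fa f)"
  shows "iso_arrow C f"
proof -
  have ob: "Dom C f \<in> Obj C" "Cod C f \<in> Obj C"
    using assms dom.dom_obj dom.cod_obj by auto
  obtain k where k: "inverse_pair D (Fa f) k"
    using assms(3) by (rule iso_arrowE)
  then obtain g where "g \<in> Arr C" "Dom C g = Cod C f" "Cod C g = Dom C f" "Fa g = k"
    using full_faithfulD(2)[OF assms(1), of "Cod C f" "Dom C f" k] ob assms(2) by (auto simp: inverse_pair_def)
  then show ?thesis
    using full_faithful_reflects_inverse[OF assms(1), of f g] k assms(2) by (auto simp: iso_arrow_iff)
qed

lemma full_faithful_reflects_isomorphic: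
  assumes ff: "full_faithful C D Fo Fa" and ob: "X \<in> Obj C" "Y \<in> Obj C" and "isomorphic D (Fo X) (Fo Y)"
  shows "isomorphic C X Y"
proof -
  obtain k k' where k: "inverse_pair D k k'" "Dom D k = Fo X" "Cod D k = Fo Y"
    using assms(4) by (rule isomorphicE)
  obtain f where f: "f \<in> Arr C" "Dom C f = X" "Cod C f = Y" "Fa f = k"
    using full_faithfulD(2)[OF ff ob, of k] k by (auto simp: inverse_pair_def)
  then have "iso_arrow C f"
    using full_faithful_reflects_iso[OF ff, of f] k(1) unfolding iso_arrow_iff[of D] by blast
  then show ?thesis
    unfolding isomorphic_def using f(1-3) by (intro bexI[of _ f]) auto
qed

text \<open>Object preimages are chosen together with isomorphisms \<open>e\<close>; on arrows the
  quasi-inverse is then forced, being the unique \<open>Fa\<close>-preimage of the conjugate by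
  \<open>e\<close>. Identities between arrows of \<open>C\<close> are checked after applying the
  faithful \<open>Fa\<close>.\<close>

lemma full_faithful_imp_equivalence:
  assumes ff: "full_faithful C D Fo Fa" and es: "ess_surj C D Fo"
  shows "cat_equivalence C D Fo Fa"
proof -
  have "\<exists>X e e'. X \<in> Obj C \<and> inverse_pair D e e' \<and> Dom D e = Fo X \<and> Cod D e = Y" if Y: "Y \<in> Obj D" for Y
    using es Y unfolding ess_surj_def by (meson isomorphicE)
  then obtain Go e e' where G: "\<And>Y. Y \<in> Obj D \<Longrightarrow> Go Y \<in> Obj C"
    and ee: "\<And>Y. Y \<in> Obj D \<Longrightarrow> inverse_pair D (e Y) (e' Y)"
    and "\<And>Y. Y \<in> Obj D \<Longrightarrow> Dom D (e Y) = Fo (Go Y)" and "\<And>Y. Y \<in> Obj D \<Longrightarrow> Cod D (e Y) = Y"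
    by metis
  then have e: "e Y \<in> Arr D" "e' Y \<in> Arr D" "Dom D (e Y) = Fo (Go Y)" "Cod D (e Y) = Y"
      "Dom D (e' Y) = Y" "Cod D (e' Y) = Fo (Go Y)" "e' Y \<cdot>\<^bsub>D\<^esub> e Y = Ident D (Fo (Go Y))"
      "e Y \<cdot>\<^bsub>D\<^esub> e' Y = Ident D Y" if "Y \<in> Obj D" for Y
    using ee[OF that] that by (auto simp: inverse_pair_def)
  define Ga where "Ga g = (SOME f. f \<in> Arr C \<and> Dom C f = Go (Dom D g) \<and> Cod C f = Go (Cod D g) \<and>
      Fa f = e' (Cod D g) \<cdot>\<^bsub>D\<^esub> (g \<cdot>\<^bsub>D\<^esub> e (Dom D g)))" for g
  have Ga: "Ga g \<in> Arr C \<and> Dom C (Ga g) = Go (Dom D g) \<and> Cod C (Ga g) = Go (Cod D g) \<and>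
      Fa (Ga g) = e' (Cod D g) \<cdot>\<^bsub>D\<^esub> (g \<cdot>\<^bsub>D\<^esub> e (Dom D g))" if g: "g \<in> Arr D" for g
    unfolding Ga_def
  proof (rule someI_ex, rule full_faithfulD(2)[OF ff])
    have ob: "Dom D g \<in> Obj D" "Cod D g \<in> Obj D"
      using g cod.dom_obj cod.cod_obj by auto
    show "Go (Dom D g) \<in> Obj C" "Go (Cod D g) \<in> Obj C"
      using ob G by auto
    show "e' (Cod D g) \<cdot>\<^bsub>D\<^esub> (g \<cdot>\<^bsub>D\<^esub> e (Dom D g)) \<in> Arr D"
      "Dom D (e' (Cod D g) \<cdot>\<^bsub>D\<^esub> (g \<cdot>\<^bsub>D\<^esub> e (Dom D g))) = Fo (Go (Dom D g))"
      "Cod D (e' (Cod D g) \<cdot>\<^bsub>D\<^esub> (g \<cdot>\<^bsub>D\<^esub> e (Dom D g))) = Fo (Go (Cod D g))"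
      using g e[OF ob(1)] e[OF ob(2)] by simp_all
  qed
  have Gfun: "cat_functor D C Go Ga"
  proof (unfold_locales)
    fix X assume X: "X \<in> Obj D"
    show "Go X \<in> Obj C" by (rule G[OF X])
    show "Ga (Ident D X) = Ident C (Go X)"
      using Ga[of "Ident D X"] X G[OF X] e[OF X] by (intro full_faithfulD(1)[OF ff]) simp_all
  next
    fix f X Y assume "f \<in> Hom D X Y"
    then show "Ga f \<in> Hom C (Go X) (Go Y)"
      using Ga[of f] by auto
  next
    fix f X Y g Z assume "f \<in> Hom D X Y" "g \<in> Hom D Y Z"
    then have f: "f \<in> Arr D" "Dom D f = X" "Cod D f = Y" and g: "g \<in> Arr D" "Dom D g = Y" "Cod D g = Z"
      by auto
    have ob: "X \<in> Obj D" "Y \<in> Obj D" "Z \<in> Obj D"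
      using f g cod.dom_obj cod.cod_obj by auto
    note es = e[OF ob(1)] e[OF ob(2)] e[OF ob(3)]
    have "Fa (Ga (g \<cdot>\<^bsub>D\<^esub> f)) = Fa (Ga g \<cdot>\<^bsub>C\<^esub> Ga f)"
      using Ga[of f] Ga[of g] Ga[of "g \<cdot>\<^bsub>D\<^esub> f"] f g es cod.comp_reduce[OF es(16)]
      by (simp add: map_comp')
    then show "Ga (g \<cdot>\<^bsub>D\<^esub> f) = Ga g \<cdot>\<^bsub>C\<^esub> Ga f"
      using Ga[of f] Ga[of g] Ga[of "g \<cdot>\<^bsub>D\<^esub> f"] f g by (intro full_faithfulD(1)[OF ff]) simp_all
  qed
  interpret G: cat_functor D C Go Ga by (rule Gfun)
  define \<eta> where "\<eta> X = (SOME f. f \<in> Arr C \<and> Dom C f = X \<and> Cod C f = Go (Fo X) \<and> Fa f = e' (Fo X))" for X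
  have \<eta>: "\<eta> X \<in> Arr C \<and> Dom C (\<eta> X) = X \<and> Cod C (\<eta> X) = Go (Fo X) \<and> Fa (\<eta> X) = e' (Fo X)"
    if X: "X \<in> Obj C" for X
    unfolding \<eta>_def
    by (rule someI_ex, rule full_faithfulD(2)[OF ff]) (use X G e[of "Fo X"] in auto)
  have "natural_iso C C (\<lambda>X. X) (\<lambda>f. f) (Go \<circ> Fo) (Ga \<circ> Fa) \<eta>"
    unfolding natural_iso_def
  proof (intro conjI ballI)
    fix X assume X: "X \<in> Obj C"
    show "\<eta> X \<in> Hom C X ((Go \<circ> Fo) X)"
      using \<eta>[OF X] by simp
    show "iso_arrow C (\<eta> X)"
      using \<eta>[OF X] inverse_pair_sym[OF ee[of "Fo X"]] X
      by (intro full_faithful_reflects_iso[OF ff]) (auto simp: iso_arrow_iff)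
  next
    fix f assume f: "f \<in> Arr C"
    then have ob: "Dom C f \<in> Obj C" "Cod C f \<in> Obj C" "Fo (Dom C f) \<in> Obj D" "Fo (Cod C f) \<in> Obj D"
      using dom.dom_obj dom.cod_obj by auto
    show "\<eta> (Cod C f) \<cdot>\<^bsub>C\<^esub> f = (Ga \<circ> Fa) f \<cdot>\<^bsub>C\<^esub> \<eta> (Dom C f)"
      using f \<eta>[OF ob(1)] \<eta>[OF ob(2)] Ga[of "Fa f"] e[OF ob(3)] e[OF ob(4)]
      by (intro full_faithfulD(1)[OF ff]) (simp_all add: map_comp')
  qed
  moreover have "natural_iso D D (Fo \<circ> Go) (Fa \<circ> Ga) (\<lambda>X. X) (\<lambda>f. f) e"
    unfolding natural_iso_def
  proof (intro conjI ballI)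
    fix X assume X: "X \<in> Obj D"
    show "e X \<in> Hom D ((Fo \<circ> Go) X) X" "iso_arrow D (e X)"
      using e[OF X] ee[OF X] by (auto simp: iso_arrow_iff)
  next
    fix f assume f: "f \<in> Arr D"
    then have ob: "Dom D f \<in> Obj D" "Cod D f \<in> Obj D"
      using cod.dom_obj cod.cod_obj by auto
    show "e (Cod D f) \<cdot>\<^bsub>D\<^esub> (Fa \<circ> Ga) f = f \<cdot>\<^bsub>D\<^esub> e (Dom D f)"
      using f e[OF ob(1)] e[OF ob(2)] Ga[OF f] cod.comp_reduce[OF e(8)[OF ob(2)]] by simp
  qed
  ultimately show ?thesis
    unfolding cat_equivalence_def using cat_functor_axioms Gfun by blast
qed

end

text \<open>The shifts of the quotients are proved to be equivalences in this form, which asks for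
  no explicit quasi-inverse.\<close>

lemma cat_equivalence_iff:
  "cat_equivalence C D Fo Fa \<longleftrightarrow> cat_functor C D Fo Fa \<and> full_faithful C D Fo Fa \<and> ess_surj C D Fo"
proof
  assume "cat_equivalence C D Fo Fa"
  then obtain Go Ga \<eta> \<epsilon> where F: "cat_functor C D Fo Fa" and G: "cat_functor D C Go Ga"
      "natural_iso C C (\<lambda>X. X) (\<lambda>f. f) (Go \<circ> Fo) (Ga \<circ> Fa) \<eta>"
      "natural_iso D D (Fo \<circ> Go) (Fa \<circ> Ga) (\<lambda>X. X) (\<lambda>f. f) \<epsilon>"
    unfolding cat_equivalence_def by (elim conjE exE)
  show "cat_functor C D Fo Fa \<and> full_faithful C D Fo Fa \<and> ess_surj C D Fo"
    by (intro conjI F cat_functor.equivalence_imp_full_faithful[OF F G])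
next
  assume "cat_functor C D Fo Fa \<and> full_faithful C D Fo Fa \<and> ess_surj C D Fo"
  then show "cat_equivalence C D Fo Fa"
    by (elim conjE) (rule cat_functor.full_faithful_imp_equivalence)
qed

section \<open>Additive categories and functors\<close>

lemma hom_group_simps [simp]:
  "carrier (hom_group C X Y) = Hom C X Y" "monoid.mult (hom_group C X Y) = Add C"
  "one (hom_group C X Y) = Zero C X Y"
  by (simp_all add: hom_group_def)

text \<open>Direct sums are split off because those of the Verdier quotient are images of direct
  sums under the projection: the projection must be known to be additive before the quotient is
  known to have them.\<close>

locale preadditive_category = category C
  for C :: "('o, 'm, 'x) preadd_data_scheme" (structure) +
  assumes hom_comm_group: "\<lbrakk>X \<in> Obj C; Y \<in> Obj C\<rbrakk> \<Longrightarrow> comm_group (hom_group C X Y)"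
    and comp_add_left: "\<lbrakk>f \<in> Hom C X Y; g \<in> Hom C Y Z; g' \<in> Hom C Y Z\<rbrakk>
          \<Longrightarrow> (g \<boxplus> g') \<cdot> f = (g \<cdot> f) \<boxplus> (g' \<cdot> f)"
    and comp_add_right: "\<lbrakk>f \<in> Hom C X Y; f' \<in> Hom C X Y; g \<in> Hom C Y Z\<rbrakk>
          \<Longrightarrow> g \<cdot> (f \<boxplus> f') = (g \<cdot> f) \<boxplus> (g \<cdot> f')"

sublocale additive_category \<subseteq> preadditive_category
  by (rule preadditive_category.intro[OF category_axioms preadditive_category_axioms.intro])
    (fact hom_comm_group comp_add_left comp_add_right)+

context preadditive_category begin

lemma zero_arr [simp]: "\<lbrakk>X \<in> Obj C; Y \<in> Obj C\<rbrakk> \<Longrightarrow> Zero C X Y \<in> Arr C"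
  and dom_zero [simp]: "\<lbrakk>X \<in> Obj C; Y \<in> Obj C\<rbrakk> \<Longrightarrow> Dom C (Zero C X Y) = X"
  and cod_zero [simp]: "\<lbrakk>X \<in> Obj C; Y \<in> Obj C\<rbrakk> \<Longrightarrow> Cod C (Zero C X Y) = Y"
proof -
  assume ob: "X \<in> Obj C" "Y \<in> Obj C"
  interpret comm_group "hom_group C X Y" by (rule hom_comm_group[OF ob])
  show "Zero C X Y \<in> Arr C" "Dom C (Zero C X Y) = X" "Cod C (Zero C X Y) = Y"
    using one_closed by simp_all
qed

lemma add_arr [simp]: "\<lbrakk>f \<in> Arr C; g \<in> Arr C; Dom C f = Dom C g; Cod C f = Cod C g\<rbrakk> \<Longrightarrow> f \<boxplus> g \<in> Arr C"
  and dom_add [simp]: "\<lbrakk>f \<in> Arr C; g \<in> Arr C; Dom C f = Dom C g; Cod C f = Cod C g\<rbrakk> \<Longrightarrow> Dom C (f \<boxplus> g) = Dom C g"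
  and cod_add [simp]: "\<lbrakk>f \<in> Arr C; g \<in> Arr C; Dom C f = Dom C g; Cod C f = Cod C g\<rbrakk> \<Longrightarrow> Cod C (f \<boxplus> g) = Cod C g"
  and add_comm: "\<lbrakk>f \<in> Arr C; g \<in> Arr C; Dom C f = Dom C g; Cod C f = Cod C g\<rbrakk> \<Longrightarrow> f \<boxplus> g = g \<boxplus> f"
proof -
  assume h: "f \<in> Arr C" "g \<in> Arr C" "Dom C f = Dom C g" "Cod C f = Cod C g"
  then have ob: "Dom C g \<in> Obj C" "Cod C g \<in> Obj C"
    using dom_obj cod_obj by auto
  interpret comm_group "hom_group C (Dom C g) (Cod C g)" by (rule hom_comm_group[OF ob])
  show "f \<boxplus> g \<in> Arr C" "Dom C (f \<boxplus> g) = Dom C g" "Cod C (f \<boxplus> g) = Cod C g" "f \<boxplus> g = g \<boxplus> f"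
    using m_closed[of f g] m_comm[of f g] h by simp_all
qed

lemma add_assoc:
  assumes h: "f \<in> Arr C" "g \<in> Arr C" "k \<in> Arr C" "Dom C f = Dom C g" "Cod C f = Cod C g"
    "Dom C g = Dom C k" "Cod C g = Cod C k"
  shows "(f \<boxplus> g) \<boxplus> k = f \<boxplus> (g \<boxplus> k)"
proof -
  have ob: "Dom C g \<in> Obj C" "Cod C g \<in> Obj C"
    using dom_obj cod_obj h by auto
  interpret comm_group "hom_group C (Dom C g) (Cod C g)" by (rule hom_comm_group[OF ob])
  show ?thesis
    using m_assoc[of f g k] h by simp
qed

lemma neg_arr [simp]: "f \<in> Arr C \<Longrightarrow> neg C f \<in> Arr C"
  and dom_neg [simp]: "f \<in> Arr C \<Longrightarrow> Dom C (neg C f) = Dom C f"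
  and cod_neg [simp]: "f \<in> Arr C \<Longrightarrow> Cod C (neg C f) = Cod C f"
  and add_neg: "\<lbrakk>f \<in> Arr C; Dom C f = X; Cod C f = Y\<rbrakk> \<Longrightarrow> f \<boxplus> neg C f = Zero C X Y"
  and neg_add: "\<lbrakk>f \<in> Arr C; Dom C f = X; Cod C f = Y\<rbrakk> \<Longrightarrow> neg C f \<boxplus> f = Zero C X Y"
  and add_zero [simp]: "\<lbrakk>f \<in> Arr C; Dom C f = X; Cod C f = Y\<rbrakk> \<Longrightarrow> f \<boxplus> Zero C X Y = f"
  and zero_add [simp]: "\<lbrakk>f \<in> Arr C; Dom C f = X; Cod C f = Y\<rbrakk> \<Longrightarrow> Zero C X Y \<boxplus> f = f"
proof -
  assume h: "f \<in> Arr C"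
  then have ob: "Dom C f \<in> Obj C" "Cod C f \<in> Obj C"
    using dom_obj cod_obj by auto
  interpret comm_group "hom_group C (Dom C f) (Cod C f)" by (rule hom_comm_group[OF ob])
  show "neg C f \<in> Arr C" "Dom C (neg C f) = Dom C f" "Cod C (neg C f) = Cod C f"
    using inv_closed[of f] h by (simp_all add: neg_def)
  assume "Dom C f = X" "Cod C f = Y"
  then show "f \<boxplus> neg C f = Zero C X Y" "neg C f \<boxplus> f = Zero C X Y"
    "f \<boxplus> Zero C X Y = f" "Zero C X Y \<boxplus> f = f"
    using r_inv[of f] l_inv[of f] r_one[of f] l_one[of f] h by (simp_all add: neg_def)
qed

lemma neg_unique:
  assumes "f \<boxplus> g = Zero C X Y" "f \<in> Arr C" "g \<in> Arr C" "Dom C f = X" "Dom C g = X" "Cod C f = Y" "Cod C g = Y"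
  shows "neg C f = g"
proof -
  have ob: "X \<in> Obj C" "Y \<in> Obj C"
    using assms dom_obj cod_obj by auto
  have "neg C f \<boxplus> (f \<boxplus> g) = (neg C f \<boxplus> f) \<boxplus> g"
    using assms(2-) by (simp add: add_assoc)
  also have "\<dots> = g"
    using assms(2-) ob by (simp add: neg_add)
  finally show ?thesis
    using assms ob by simp
qed

lemma neg_neg [simp]: "f \<in> Arr C \<Longrightarrow> neg C (neg C f) = f"
  by (rule neg_unique[of _ _ "Dom C f" "Cod C f"]) (simp_all add: neg_add)

lemma neg_zero [simp]: "\<lbrakk>X \<in> Obj C; Y \<in> Obj C\<rbrakk> \<Longrightarrow> neg C (Zero C X Y) = Zero C X Y"
  by (rule neg_unique[of _ _ X Y]) simp_all

lemma diff_zero_imp_eq: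
  assumes "f \<boxplus> neg C g = Zero C X Y" "f \<in> Arr C" "g \<in> Arr C" "Dom C f = X" "Dom C g = X"
    "Cod C f = Y" "Cod C g = Y"
  shows "f = g"
proof -
  have "neg C f = neg C g"
    by (rule neg_unique) (use assms in simp_all)
  then have "neg C (neg C f) = neg C (neg C g)"
    by simp
  then show ?thesis
    using assms by simp
qed

lemma comp_add: "\<lbrakk>f \<in> Arr C; f' \<in> Arr C; g \<in> Arr C; Dom C f = Dom C f'; Cod C f = Cod C f'; Cod C f' = Dom C g\<rbrakk>
    \<Longrightarrow> g \<cdot> (f \<boxplus> f') = (g \<cdot> f) \<boxplus> (g \<cdot> f')"
  using comp_add_right[of f "Dom C f'" "Cod C f'" f' g "Cod C g"] by simp

lemma add_comp: "\<lbrakk>f \<in> Arr C; g \<in> Arr C; g' \<in> Arr C; Dom C g = Dom C g'; Cod C g = Cod C g'; Cod C f = Dom C g'\<rbrakk>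
    \<Longrightarrow> (g \<boxplus> g') \<cdot> f = (g \<cdot> f) \<boxplus> (g' \<cdot> f)"
  using comp_add_left[of f "Dom C f" "Cod C f" g "Cod C g'" g'] by simp

lemma add_self_imp_zero:
  assumes "f \<boxplus> f = f" "f \<in> Arr C" "Dom C f = X" "Cod C f = Y"
  shows "f = Zero C X Y"
proof -
  have "(f \<boxplus> f) \<boxplus> neg C f = f"
    using assms(2-) dom_obj[of f] cod_obj[of f] by (simp add: add_assoc add_neg)
  then show ?thesis
    using assms by (simp add: add_neg)
qed

lemma comp_zero [simp]:
  assumes h: "g \<in> Arr C" "Dom C g = Y" "X \<in> Obj C"
  shows "g \<cdot> Zero C X Y = Zero C X (Cod C g)"
proof -
  have ob: "Y \<in> Obj C"
    using h dom_obj by auto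
  have "(g \<cdot> Zero C X Y) \<boxplus> (g \<cdot> Zero C X Y) = g \<cdot> (Zero C X Y \<boxplus> Zero C X Y)"
    using h ob by (simp only: comp_add zero_arr dom_zero cod_zero)
  then show ?thesis
    using h ob by (intro add_self_imp_zero) simp_all
qed

lemma zero_comp [simp]:
  assumes h: "f \<in> Arr C" "Cod C f = Y" "Z \<in> Obj C"
  shows "Zero C Y Z \<cdot> f = Zero C (Dom C f) Z"
proof -
  have ob: "Y \<in> Obj C"
    using h cod_obj by auto
  have "(Zero C Y Z \<cdot> f) \<boxplus> (Zero C Y Z \<cdot> f) = (Zero C Y Z \<boxplus> Zero C Y Z) \<cdot> f"
    using h ob by (simp only: add_comp zero_arr dom_zero cod_zero)
  then show ?thesis
    using h ob by (intro add_self_imp_zero) simp_all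
qed

lemma comp_neg [simp]:
  assumes h: "f \<in> Arr C" "g \<in> Arr C" "Cod C f = Dom C g"
  shows "g \<cdot> neg C f = neg C (g \<cdot> f)"
proof (rule neg_unique[symmetric])
  show "(g \<cdot> f) \<boxplus> (g \<cdot> neg C f) = Zero C (Dom C f) (Cod C g)"
    using h dom_obj[of f] by (simp add: comp_add[symmetric] add_neg)
qed (use h in simp_all)

lemma neg_comp [simp]:
  assumes h: "f \<in> Arr C" "g \<in> Arr C" "Cod C f = Dom C g"
  shows "neg C g \<cdot> f = neg C (g \<cdot> f)"
proof (rule neg_unique[symmetric])
  show "(g \<cdot> f) \<boxplus> (neg C g \<cdot> f) = Zero C (Dom C f) (Cod C g)"
    using h cod_obj[of g] by (simp add: add_comp[symmetric] add_neg)
qed (use h in simp_all)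

text \<open>A morphism into or out of \<open>N\<close> can be composed with the identity of
  \<open>N\<close>. The equational criterion is the form that additive functors preserve.\<close>

lemma zero_object_iff: "zero_object C N \<longleftrightarrow> N \<in> Obj C \<and> Ident C N = Zero C N N"
proof
  assume N: "zero_object C N"
  then have ob: "N \<in> Obj C"
    by (simp add: zero_object_def)
  then have "\<exists>!f. f \<in> Hom C N N"
    using N unfolding zero_object_def by blast
  moreover have "Ident C N \<in> Hom C N N" "Zero C N N \<in> Hom C N N"
    using ob by simp_all
  ultimately show "N \<in> Obj C \<and> Ident C N = Zero C N N"
    using ob by (metis (no_types))
next
  assume N: "N \<in> Obj C \<and> Ident C N = Zero C N N"
  have in0: "f = Zero C X N" if "f \<in> Hom C X N" "X \<in> Obj C" for X f
  proof -
    have "f = Ident C N \<cdot> f" using that by simp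
    also have "\<dots> = Zero C N N \<cdot> f" using N by simp
    also have "\<dots> = Zero C X N" using N that zero_comp[of f N N] by simp
    finally show ?thesis .
  qed
  have out0: "f = Zero C N X" if "f \<in> Hom C N X" "X \<in> Obj C" for X f
  proof -
    have "f = f \<cdot> Ident C N" using that by simp
    also have "\<dots> = f \<cdot> Zero C N N" using N by simp
    also have "\<dots> = Zero C N X" using N that comp_zero[of f N N] by simp
    finally show ?thesis .
  qed
  show "zero_object C N"
    unfolding zero_object_def
  proof (intro conjI ballI)
    fix X assume X: "X \<in> Obj C"
    show "\<exists>!f. f \<in> Hom C X N"
      by (rule ex1I[of _ "Zero C X N"]) (use X N in0[OF _ X] in auto)
    show "\<exists>!f. f \<in> Hom C N X"
      by (rule ex1I[of _ "Zero C N X"]) (use X N out0[OF _ X] in auto)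
  qed (use N in simp)
qed

lemma zero_object_obj: "zero_object C N \<Longrightarrow> N \<in> Obj C"
  by (simp add: zero_object_iff)

lemma to_zero_object: "\<lbrakk>zero_object C N; f \<in> Arr C; Cod C f = N; Dom C f = X\<rbrakk> \<Longrightarrow> f = Zero C X N"
  by (metis zero_object_iff ident_comp zero_comp)

lemma from_zero_object: "\<lbrakk>zero_object C N; f \<in> Arr C; Dom C f = N; Cod C f = X\<rbrakk> \<Longrightarrow> f = Zero C N X"
  by (metis zero_object_iff comp_ident comp_zero)

section \<open>Isomorphism criteria, exactness on Hom groups and the five lemma\<close>

lemma iso_lift:
  assumes "iso_arrow C a" "x \<in> Arr C" "Cod C x = Cod C a"
  obtains y where "y \<in> Arr C" "Dom C y = Dom C x" "Cod C y = Dom C a" "a \<cdot> y = x"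
proof -
  obtain b where b: "inverse_pair C a b"
    using assms(1) by (rule iso_arrowE)
  show ?thesis
    using assms(2,3) inverse_pair_cancel[OF b] by (intro that[of "b \<cdot> x"]) simp_all
qed

text \<open>Taking differences reduces injectivity on Hom groups to a trivial kernel.\<close>

lemma iso_arrow_by_kernel:
  assumes f: "f \<in> Arr C"
    and ker: "\<And>x. \<lbrakk>x \<in> Arr C; Cod C x = Dom C f; f \<cdot> x = Zero C (Dom C x) (Cod C f)\<rbrakk>
      \<Longrightarrow> x = Zero C (Dom C x) (Cod C x)"
    and surj: "\<And>y. \<lbrakk>y \<in> Arr C; Cod C y = Cod C f\<rbrakk> \<Longrightarrow> \<exists>x. x \<in> Arr C \<and> Dom C x = Dom C y \<and> Cod C x = Dom C f
      \<and> f \<cdot> x = y"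
  shows "iso_arrow C f"
proof (rule iso_arrow_by_hom[OF f _ surj])
  fix x y assume h: "x \<in> Arr C" "y \<in> Arr C" "Dom C x = Dom C y" "Cod C x = Dom C f" "Cod C y = Dom C f"
      "f \<cdot> x = f \<cdot> y"
  have "f \<cdot> (x \<boxplus> neg C y) = Zero C (Dom C y) (Cod C f)"
    using h f by (simp add: comp_add add_neg)
  then have "x \<boxplus> neg C y = Zero C (Dom C y) (Cod C y)"
    using ker[of "x \<boxplus> neg C y"] h f by simp
  then show "x = y"
    by (rule diff_zero_imp_eq) (use h in simp_all)
qed

text \<open>This makes \<open>f\<close> a weak kernel of \<open>g\<close>: Hom(A, -) is exact at the
  middle for every object \<open>A\<close>. In the absence of images, exactness is tested on arrows
  into the sequence.\<close>

definition hom_exact :: "'m \<Rightarrow> 'm \<Rightarrow> bool" where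
  "hom_exact f g \<longleftrightarrow> f \<in> Arr C \<and> g \<in> Arr C \<and> Cod C f = Dom C g \<and> g \<cdot> f = Zero C (Dom C f) (Cod C g) \<and>
     (\<forall>x\<in>Arr C. Cod C x = Cod C f \<longrightarrow> g \<cdot> x = Zero C (Dom C x) (Cod C g) \<longrightarrow>
       (\<exists>z. z \<in> Arr C \<and> Dom C z = Dom C x \<and> Cod C z = Dom C f \<and> f \<cdot> z = x))"

lemma hom_exactD:
  assumes "hom_exact f g"
  shows "f \<in> Arr C" "g \<in> Arr C" "Cod C f = Dom C g" "g \<cdot> f = Zero C (Dom C f) (Cod C g)"
  using assms by (auto simp: hom_exact_def)

lemma hom_exactE:
  assumes "hom_exact f g" "x \<in> Arr C" "Cod C x = Cod C f" "g \<cdot> x = Zero C (Dom C x) (Cod C g)"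
  obtains z where "z \<in> Arr C" "Dom C z = Dom C x" "Cod C z = Dom C f" "f \<cdot> z = x"
  using assms unfolding hom_exact_def by blast

text \<open>The usual diagram chase, with arrows out of an arbitrary object in the role of elements.
  The rows become exact sequences of groups, and \<open>c\<close> is invertible because it is
  bijective on all Hom groups into it.\<close>

lemma five_lemma:
  assumes e: "hom_exact f g" "hom_exact g h" "hom_exact h k"
    and e': "hom_exact f' g'" "hom_exact g' h'" "hom_exact h' k'"
    and a: "iso_arrow C a" "Dom C a = Dom C f" "Cod C a = Dom C f'"
    and b: "iso_arrow C b" "Dom C b = Dom C g" "Cod C b = Dom C g'"
    and c: "c \<in> Arr C" "Dom C c = Dom C h" "Cod C c = Dom C h'"
    and d: "iso_arrow C d" "Dom C d = Dom C k" "Cod C d = Dom C k'"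
    and m: "iso_arrow C m" "Dom C m = Cod C k" "Cod C m = Cod C k'"
    and sq: "b \<cdot> f = f' \<cdot> a" "c \<cdot> g = g' \<cdot> b" "d \<cdot> h = h' \<cdot> c" "m \<cdot> k = k' \<cdot> d"
  shows "iso_arrow C c"
proof (rule iso_arrow_by_kernel[OF c(1)])
  note t = hom_exactD(1-3)[OF e(1)] hom_exactD(1-3)[OF e(2)] hom_exactD(1-3)[OF e(3)]
    hom_exactD(1-3)[OF e'(1)] hom_exactD(1-3)[OF e'(2)] hom_exactD(1-3)[OF e'(3)]
    iso_arr[OF a(1)] iso_arr[OF b(1)] iso_arr[OF d(1)] iso_arr[OF m(1)] a(2,3) b(2,3) c d(2,3) m(2,3)
  note r = comp_reduce[OF sq(1)] comp_reduce[OF sq(2)] comp_reduce[OF sq(3)] comp_reduce[OF sq(4)]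
  fix x assume x: "x \<in> Arr C" "Cod C x = Dom C c" "c \<cdot> x = Zero C (Dom C x) (Cod C c)"
  have ob: "Dom C x \<in> Obj C"
    using x dom_obj by auto
  have ob': "Dom C k \<in> Obj C" "Dom C k' \<in> Obj C" "Dom C g' \<in> Obj C" "Dom C f \<in> Obj C" "Dom C h \<in> Obj C"
    using t dom_obj by auto
  have "d \<cdot> (h \<cdot> x) = d \<cdot> Zero C (Dom C x) (Cod C h)"
    using t x ob by (simp add: r)
  then have "h \<cdot> x = Zero C (Dom C x) (Cod C h)"
    by (rule iso_cancel_left[OF d(1)]) (use t x ob ob' in simp_all)
  then obtain y where y: "y \<in> Arr C" "Dom C y = Dom C x" "Cod C y = Dom C g" "g \<cdot> y = x"
    using hom_exactE[OF e(2), of x] x t by auto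
  have "g' \<cdot> (b \<cdot> y) = c \<cdot> (g \<cdot> y)"
    using t y(1-3) by (simp add: r)
  then have "g' \<cdot> (b \<cdot> y) = Zero C (Dom C x) (Cod C g')"
    using x y t by simp
  then obtain z where z: "z \<in> Arr C" "Dom C z = Dom C x" "Cod C z = Dom C f'" "f' \<cdot> z = b \<cdot> y"
    using hom_exactE[OF e'(1), of "b \<cdot> y"] y t by auto
  obtain w where w: "w \<in> Arr C" "Dom C w = Dom C x" "Cod C w = Dom C f" "a \<cdot> w = z"
    using iso_lift[OF a(1), of z] z t by auto
  have "b \<cdot> (f \<cdot> w) = b \<cdot> y"
    using t w z by (simp add: r)
  then have "f \<cdot> w = y"
    by (rule iso_cancel_left[OF b(1)]) (use t w y in simp_all)
  then have "x = g \<cdot> (f \<cdot> w)"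
    using y by simp
  also have "\<dots> = Zero C (Dom C x) (Cod C x)"
    using comp_reduce[OF hom_exactD(4)[OF e(1)]] t w ob' x by simp
  finally show "x = Zero C (Dom C x) (Cod C x)" .
next
  note t = hom_exactD(1-3)[OF e(1)] hom_exactD(1-3)[OF e(2)] hom_exactD(1-3)[OF e(3)]
    hom_exactD(1-3)[OF e'(1)] hom_exactD(1-3)[OF e'(2)] hom_exactD(1-3)[OF e'(3)]
    iso_arr[OF a(1)] iso_arr[OF b(1)] iso_arr[OF d(1)] iso_arr[OF m(1)] a(2,3) b(2,3) c d(2,3) m(2,3)
  note r = comp_reduce[OF sq(1)] comp_reduce[OF sq(2)] comp_reduce[OF sq(3)] comp_reduce[OF sq(4)]
  fix y assume y: "y \<in> Arr C" "Cod C y = Cod C c"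
  have ob: "Dom C y \<in> Obj C" "Cod C k \<in> Obj C" "Cod C k' \<in> Obj C"
    using y t dom_obj cod_obj by auto
  obtain w where w: "w \<in> Arr C" "Dom C w = Dom C y" "Cod C w = Dom C k" "d \<cdot> w = h' \<cdot> y"
    using iso_lift[OF d(1), of "h' \<cdot> y"] y t by auto
  have "m \<cdot> (k \<cdot> w) = k' \<cdot> (d \<cdot> w)"
    using t w y by (simp add: r)
  also have "\<dots> = Zero C (Dom C y) (Cod C k')"
    using t w y ob by (simp add: comp_reduce[OF hom_exactD(4)[OF e'(3)]])
  also have "\<dots> = m \<cdot> Zero C (Dom C y) (Cod C k)"
    using t ob by simp
  finally have "k \<cdot> w = Zero C (Dom C y) (Cod C k)"
    by (rule iso_cancel_left[OF m(1)]) (use t w ob in simp_all)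
  then obtain z where z: "z \<in> Arr C" "Dom C z = Dom C y" "Cod C z = Dom C h" "h \<cdot> z = w"
    using hom_exactE[OF e(3), of w] w t by auto
  \<comment> \<open>\<open>c \<cdot> z\<close> agrees with \<open>y\<close> only as seen by
    \<open>h'\<close>. The error \<open>?v\<close> is annihilated by \<open>h'\<close>, hence comes
    from the left, where \<open>b\<close> is invertible; adding \<open>g \<cdot> u\<close> to
    \<open>z\<close> corrects it.\<close>
  let ?v = "y \<boxplus> neg C (c \<cdot> z)"
  have "h' \<cdot> (c \<cdot> z) = d \<cdot> (h \<cdot> z)"
    using t z(1-3) by (simp add: r)
  then have "h' \<cdot> (c \<cdot> z) = h' \<cdot> y"
    using z w by simp
  then have "h' \<cdot> ?v = Zero C (Dom C ?v) (Cod C h')"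
    using t z y by (simp add: comp_add add_neg)
  then obtain v where v: "v \<in> Arr C" "Dom C v = Dom C y" "Cod C v = Dom C g'" "g' \<cdot> v = ?v"
    using hom_exactE[OF e'(2), of ?v] y z t by auto
  obtain u where u: "u \<in> Arr C" "Dom C u = Dom C y" "Cod C u = Dom C g" "b \<cdot> u = v"
    using iso_lift[OF b(1), of v] v t by auto
  have "c \<cdot> ((g \<cdot> u) \<boxplus> z) = (g' \<cdot> (b \<cdot> u)) \<boxplus> (c \<cdot> z)"
    using t u z by (simp add: comp_add r)
  also have "\<dots> = ?v \<boxplus> (c \<cdot> z)"
    using u v by simp
  also have "\<dots> = y"
    using t y z by (simp add: add_assoc neg_add)
  finally show "\<exists>x. x \<in> Arr C \<and> Dom C x = Dom C y \<and> Cod C x = Dom C c \<and> c \<cdot> x = y"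
    using t u z by (intro exI[of _ "(g \<cdot> u) \<boxplus> z"]) simp
qed

end

section \<open>Additive functors\<close>

locale additive_functor = dom: preadditive_category C + cod: preadditive_category D + cat_functor C D Fo Fa
  for C :: "('o, 'm, 'x) preadd_data_scheme" and D :: "('p, 'n, 'y) preadd_data_scheme"
    and Fo :: "'o \<Rightarrow> 'p" and Fa :: "'m \<Rightarrow> 'n" +
  assumes additive: "additive_maps C D Fo Fa"
begin

lemma map_add: "\<lbrakk>f \<in> Arr C; g \<in> Arr C; Dom C f = Dom C g; Cod C f = Cod C g\<rbrakk>
    \<Longrightarrow> Fa (f \<boxplus>\<^bsub>C\<^esub> g) = Fa f \<boxplus>\<^bsub>D\<^esub> Fa g"
  using additive dom.dom_obj[of g] dom.cod_obj[of g] unfolding additive_maps_def hom_def by auto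

lemma map_zero [simp]:
  assumes "X \<in> Obj C" "Y \<in> Obj C"
  shows "Fa (Zero C X Y) = Zero D (Fo X) (Fo Y)"
proof (rule cod.add_self_imp_zero)
  show "Fa (Zero C X Y) \<boxplus>\<^bsub>D\<^esub> Fa (Zero C X Y) = Fa (Zero C X Y)"
    using assms map_add[of "Zero C X Y" "Zero C X Y"] by simp
qed (use assms in simp_all)

lemma map_neg [simp]:
  assumes "f \<in> Arr C"
  shows "Fa (neg C f) = neg D (Fa f)"
proof (rule cod.neg_unique[symmetric])
  show "Fa f \<boxplus>\<^bsub>D\<^esub> Fa (neg C f) = Zero D (Fo (Dom C f)) (Fo (Cod C f))"
    using assms dom.dom_obj dom.cod_obj map_add[of f "neg C f"] by (simp add: dom.add_neg)
qed (use assms in simp_all)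

lemma map_zero_object: "zero_object C N \<Longrightarrow> zero_object D (Fo N)"
  unfolding dom.zero_object_iff cod.zero_object_iff using map_ident map_zero map_obj by metis

lemma map_biproduct:
  assumes "biproduct C A B S"
  shows "biproduct D (Fo A) (Fo B) (Fo S)"
proof -
  obtain i j p q where ob: "A \<in> Obj C" "B \<in> Obj C" "S \<in> Obj C"
    and a: "i \<in> Arr C" "Dom C i = A" "Cod C i = S" "j \<in> Arr C" "Dom C j = B" "Cod C j = S"
      "p \<in> Arr C" "Dom C p = S" "Cod C p = A" "q \<in> Arr C" "Dom C q = S" "Cod C q = B"
    and e: "p \<cdot>\<^bsub>C\<^esub> i = Ident C A" "q \<cdot>\<^bsub>C\<^esub> j = Ident C B" "p \<cdot>\<^bsub>C\<^esub> j = Zero C B A" "q \<cdot>\<^bsub>C\<^esub> i = Zero C A B"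
      "(i \<cdot>\<^bsub>C\<^esub> p) \<boxplus>\<^bsub>C\<^esub> (j \<cdot>\<^bsub>C\<^esub> q) = Ident C S"
    using assms unfolding biproduct_def by auto
  have "Fa (p \<cdot>\<^bsub>C\<^esub> i) = Fa (Ident C A)" "Fa (q \<cdot>\<^bsub>C\<^esub> j) = Fa (Ident C B)" "Fa (p \<cdot>\<^bsub>C\<^esub> j) = Fa (Zero C B A)"
      "Fa (q \<cdot>\<^bsub>C\<^esub> i) = Fa (Zero C A B)" "Fa ((i \<cdot>\<^bsub>C\<^esub> p) \<boxplus>\<^bsub>C\<^esub> (j \<cdot>\<^bsub>C\<^esub> q)) = Fa (Ident C S)"
    using e by simp_all
  then have e': "Fa p \<cdot>\<^bsub>D\<^esub> Fa i = Ident D (Fo A)" "Fa q \<cdot>\<^bsub>D\<^esub> Fa j = Ident D (Fo B)"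
     "Fa p \<cdot>\<^bsub>D\<^esub> Fa j = Zero D (Fo B) (Fo A)" "Fa q \<cdot>\<^bsub>D\<^esub> Fa i = Zero D (Fo A) (Fo B)"
     "(Fa i \<cdot>\<^bsub>D\<^esub> Fa p) \<boxplus>\<^bsub>D\<^esub> (Fa j \<cdot>\<^bsub>D\<^esub> Fa q) = Ident D (Fo S)"
    using a ob by (simp_all del: e add: map_comp' map_add)
  show ?thesis
    unfolding biproduct_def
    using ob a e' by (intro conjI bexI[of _ "Fa i"] bexI[of _ "Fa j"] bexI[of _ "Fa p"] bexI[of _ "Fa
      q"]) simp_all
qed

end

section \<open>Shifts and triangles\<close>

lemma is_seq_iff: "is_seq C So (f, g, h) \<longleftrightarrow> f \<in> Arr C \<and> g \<in> Arr C \<and> h \<in> Arr C \<and>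
     Cod C f = Dom C g \<and> Cod C g = Dom C h \<and> Cod C h = So (Dom C f)"
  by (simp add: is_seq_def)

lemma seq_morphism_iff: "seq_morphism C Sa (f, g, h) (f', g', h') (a, b, c) \<longleftrightarrow>
     a \<in> Hom C (Dom C f) (Dom C f') \<and> b \<in> Hom C (Dom C g) (Dom C g') \<and>
     c \<in> Hom C (Dom C h) (Dom C h') \<and>
     b \<cdot>\<^bsub>C\<^esub> f = f' \<cdot>\<^bsub>C\<^esub> a \<and> c \<cdot>\<^bsub>C\<^esub> g = g' \<cdot>\<^bsub>C\<^esub> b \<and> Sa a \<cdot>\<^bsub>C\<^esub> h = h' \<cdot>\<^bsub>C\<^esub> c"
  by (simp add: seq_morphism_def)

lemma seq_isomorphicI:
  assumes "is_seq C So t" "is_seq C So t'" "seq_morphism C Sa t t' (a, b, c)"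
    "iso_arrow C a" "iso_arrow C b" "iso_arrow C c"
  shows "seq_isomorphic C So Sa t t'"
  using assms unfolding seq_isomorphic_def by blast

text \<open>The shift is separated from the triangles so that statements about sequences can be used
  in a quotient whose triangles have not yet been studied.\<close>

locale additive_shift = additive_category T
  for T :: "('o, 'm, 'x) triang_data_scheme" (structure) +
  assumes shift_equivalence: "cat_equivalence T T (ShO T) (ShA T)"
    and shift_additive: "additive_maps T T (ShO T) (ShA T)"

sublocale additive_shift \<subseteq> sh: additive_functor T T "ShO T" "ShA T"
proof -
  interpret f: cat_functor T T "ShO T" "ShA T"
    using shift_equivalence by (simp add: cat_equivalence_iff)
  show "additive_functor T T (ShO T) (ShA T)"
    by unfold_locales (rule shift_additive)
qed

context additive_shift begin

lemma sh_ff: "full_faithful T T (ShO T) (ShA T)"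
  and sh_es: "ess_surj T T (ShO T)"
  using shift_equivalence by (simp_all add: cat_equivalence_iff)

lemmas sh_faithful = sh.full_faithfulD(1)[OF sh_ff]
lemmas sh_full = sh.full_faithfulD(2)[OF sh_ff]

lemma desuspend:
  assumes "Y \<in> Obj T"
  obtains X e e' where "X \<in> Obj T" "inverse_pair T e e'" "Dom T e = ShO T X" "Cod T e = Y"
  using sh_es assms unfolding ess_surj_def by (meson isomorphicE)

lemma sh_comp: "\<lbrakk>f \<in> Arr T; g \<in> Arr T; Cod T f = Dom T g\<rbrakk> \<Longrightarrow> ShA T (g \<cdot> f) = ShA T g \<cdot> ShA T f"
  by (rule sh.map_comp')

abbreviation So :: "nat \<Rightarrow> 'o \<Rightarrow> 'o" where "So n \<equiv> ShO T ^^ n"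
abbreviation Sa :: "nat \<Rightarrow> 'm \<Rightarrow> 'm" where "Sa n \<equiv> ShA T ^^ n"

lemma Sa_hom: "f \<in> Hom T X Y \<Longrightarrow> Sa n f \<in> Hom T (So n X) (So n Y)"
  by (induction n) auto

lemma Sa_arr [simp]: "f \<in> Arr T \<Longrightarrow> Sa n f \<in> Arr T"
  and dom_Sa [simp]: "f \<in> Arr T \<Longrightarrow> Dom T (Sa n f) = So n (Dom T f)"
  and cod_Sa [simp]: "f \<in> Arr T \<Longrightarrow> Cod T (Sa n f) = So n (Cod T f)"
  using Sa_hom[of f "Dom T f" "Cod T f" n] by simp_all

lemma So_obj [simp]: "X \<in> Obj T \<Longrightarrow> So n X \<in> Obj T"
  by (induction n) auto

lemma So_isomorphic: "isomorphic T X Y \<Longrightarrow> isomorphic T (So n X) (So n Y)"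
  by (induction n) (simp_all add: sh.map_isomorphic)

lemma Sa_inverse_pair: "inverse_pair T f g \<Longrightarrow> inverse_pair T (Sa n f) (Sa n g)"
  by (induction n) (simp_all add: sh.map_inverse_pair)

lemma Sa_full:
  "\<lbrakk>X \<in> Obj T; Y \<in> Obj T; k \<in> Arr T; Dom T k = So n X; Cod T k = So n Y\<rbrakk>
      \<Longrightarrow> \<exists>f. f \<in> Arr T \<and> Dom T f = X \<and> Cod T f = Y \<and> Sa n f = k"
proof (induction n arbitrary: k)
  case (Suc n)
  then obtain k' where k': "k' \<in> Arr T" "Dom T k' = So n X" "Cod T k' = So n Y" "ShA T k' = k"
    using sh_full[of "So n X" "So n Y" k] by auto
  with Suc.IH[of k'] Suc.prems show ?case
    by auto
qed simp

lemma desuspend_n: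
  assumes "Y \<in> Obj T"
  obtains X e e' where "X \<in> Obj T" "inverse_pair T e e'" "Dom T e = So n X" "Cod T e = Y"
proof -
  have "\<exists>X. X \<in> Obj T \<and> isomorphic T (So n X) Y"
    using assms
  proof (induction n arbitrary: Y)
    case 0
    then show ?case
      using isomorphic_refl by auto
  next
    case (Suc n)
    obtain Y' e e' where Y': "Y' \<in> Obj T" "inverse_pair T e e'" "Dom T e = ShO T Y'" "Cod T e = Y"
      using desuspend[OF Suc.prems] by metis
    then have Y'': "isomorphic T (ShO T Y') Y"
      by (intro isomorphicI)
    obtain X where X: "X \<in> Obj T" "isomorphic T (So n X) Y'"
      using Suc.IH[OF Y'(1)] by blast
    have "isomorphic T (So (Suc n) X) (ShO T Y')"
      using sh.map_isomorphic[OF X(2)] by simp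
    then show ?case
      using X(1) isomorphic_trans[OF _ Y''] by blast
  qed
  then show ?thesis
    using that by (meson isomorphicE)
qed

text \<open>The rows are prolonged by the shift of the first arrow, so that \<open>a\<close>,
  \<open>b\<close> and their shifts surround the third component.\<close>

lemma five_lemma_seq:
  assumes e: "hom_exact f g" "hom_exact g h" "hom_exact h (ShA T f)"
    and e': "hom_exact f' g'" "hom_exact g' h'" "hom_exact h' (ShA T f')"
    and m: "seq_morphism T (ShA T) (f, g, h) (f', g', h') (a, b, c)"
    and ab: "iso_arrow T a" "iso_arrow T b"
  shows "iso_arrow T c"
proof -
  note t = hom_exactD(1-3)[OF e(1)] hom_exactD(1-3)[OF e(2)] hom_exactD(1-3)[OF e(3)]
    hom_exactD(1-3)[OF e'(1)] hom_exactD(1-3)[OF e'(2)] hom_exactD(1-3)[OF e'(3)]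
  have m': "a \<in> Arr T" "Dom T a = Dom T f" "Cod T a = Dom T f'" "b \<in> Arr T" "Dom T b = Dom T g"
     "Cod T b = Dom T g'" "c \<in> Arr T" "Dom T c = Dom T h" "Cod T c = Dom T h'"
     "b \<cdot> f = f' \<cdot> a" "c \<cdot> g = g' \<cdot> b" "ShA T a \<cdot> h = h' \<cdot> c"
    using m by (auto simp: seq_morphism_iff)
  show ?thesis
  proof (rule five_lemma[OF e e' ab(1) _ _ ab(2)])
    show "iso_arrow T (ShA T a)" "iso_arrow T (ShA T b)"
      using ab sh.map_iso by auto
    have "ShA T (b \<cdot> f) = ShA T (f' \<cdot> a)"
      using m' by simp
    then show "ShA T b \<cdot> ShA T f = ShA T f' \<cdot> ShA T a"
      using t m' sh_comp[of f b] sh_comp[of a f'] by simp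
  qed (use t m' in simp_all)
qed

text \<open>Rotating a triangle inserts a sign; exactness does not see it.\<close>

lemma hom_exact_sign:
  assumes "hom_exact f g"
  shows "hom_exact f (neg T g)" "hom_exact (neg T f) g"
proof -
  note t = hom_exactD[OF assms]
  have ob: "Dom T f \<in> Obj T" "Cod T g \<in> Obj T"
    using t dom_obj cod_obj by auto
  show "hom_exact f (neg T g)"
    unfolding hom_exact_def
  proof (intro conjI ballI impI)
    fix x assume x: "x \<in> Arr T" "Cod T x = Cod T f" "neg T g \<cdot> x = Zero T (Dom T x) (Cod T (neg T g))"
    have "neg T (g \<cdot> x) = Zero T (Dom T x) (Cod T g)"
      using x t by simp
    then have "neg T (neg T (g \<cdot> x)) = neg T (Zero T (Dom T x) (Cod T g))"
      by (rule arg_cong)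
    then have "g \<cdot> x = Zero T (Dom T x) (Cod T g)"
      using x t ob dom_obj[of x] by simp
    then show "\<exists>z. z \<in> Arr T \<and> Dom T z = Dom T x \<and> Cod T z = Dom T f \<and> f \<cdot> z = x"
      using assms x unfolding hom_exact_def by blast
  qed (use t ob in simp_all)
  show "hom_exact (neg T f) g"
    unfolding hom_exact_def
  proof (intro conjI ballI impI)
    fix x assume x: "x \<in> Arr T" "Cod T x = Cod T (neg T f)" "g \<cdot> x = Zero T (Dom T x) (Cod T g)"
    then obtain z where z: "z \<in> Arr T" "Dom T z = Dom T x" "Cod T z = Dom T f" "f \<cdot> z = x"
      using hom_exactE[OF assms, of x] t by auto
    then show "\<exists>z. z \<in> Arr T \<and> Dom T z = Dom T x \<and> Cod T z = Dom T (neg T f) \<and> neg T f \<cdot> z = x"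
      using t x(1) by (intro exI[of _ "neg T z"]) simp
  qed (use t ob in simp_all)
qed

end

text \<open>All axioms except the octahedral one. Exactness and uniqueness of cones follow from
  these alone, and the Verdier quotient needs them before its octahedral axiom can be
  proved.\<close>

locale pretriangulated = additive_shift T
  for T :: "('o, 'm, 'x) triang_data_scheme" (structure) +
  assumes tri_seq: "t \<in> Tri T \<Longrightarrow> is_seq T (ShO T) t"
    and tri_iso: "\<lbrakk>t \<in> Tri T; seq_isomorphic T (ShO T) (ShA T) t' t\<rbrakk> \<Longrightarrow> t' \<in> Tri T"
    and tri_ident: "\<lbrakk>X \<in> Obj T; zero_object T N\<rbrakk>
          \<Longrightarrow> (Ident T X, Zero T X N, Zero T N (ShO T X)) \<in> Tri T"
    and tri_cone: "f \<in> Arr T \<Longrightarrow> \<exists>g h. (f, g, h) \<in> Tri T"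
    and tri_rotate: "is_seq T (ShO T) (f, g, h)
          \<Longrightarrow> (f, g, h) \<in> Tri T \<longleftrightarrow> (g, h, neg T (ShA T f)) \<in> Tri T"
    and tri_fill: "\<lbrakk>(f, g, h) \<in> Tri T; (f', g', h') \<in> Tri T;
            a \<in> Hom T (Dom T f) (Dom T f'); b \<in> Hom T (Cod T f) (Cod T f'); b \<cdot> f = f' \<cdot> a\<rbrakk>
          \<Longrightarrow> \<exists>c. seq_morphism T (ShA T) (f, g, h) (f', g', h') (a, b, c)"

sublocale triangulated_category \<subseteq> pretriangulated
proof -
  interpret additive_shift T
    by unfold_locales (rule shift_equivalence, rule shift_additive)
  show "pretriangulated T"
    by unfold_locales (fact tri_seq tri_iso tri_ident tri_cone tri_rotate tri_fill)+
qed

section \<open>Long exact sequences, uniqueness of cones, signs\<close>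

context pretriangulated begin

lemma tri_arr:
  assumes "(f, g, h) \<in> Tri T"
  shows "f \<in> Arr T" "g \<in> Arr T" "h \<in> Arr T" "Cod T f = Dom T g" "Cod T g = Dom T h"
    "Cod T h = ShO T (Dom T f)" "Dom T f \<in> Obj T" "Dom T g \<in> Obj T" "Dom T h \<in> Obj T"
  using tri_seq[OF assms] dom_obj by (auto simp: is_seq_iff)

lemma rotate: "(f, g, h) \<in> Tri T \<Longrightarrow> (g, h, neg T (ShA T f)) \<in> Tri T"
  using tri_rotate[OF tri_seq] by blast

lemma fillE:
  assumes "(f, g, h) \<in> Tri T" "(f', g', h') \<in> Tri T" "a \<in> Arr T" "Dom T a = Dom T f" "Cod T a = Dom T f'"
    "b \<in> Arr T" "Dom T b = Cod T f" "Cod T b = Cod T f'" "b \<cdot> f = f' \<cdot> a"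
  obtains c where "c \<in> Arr T" "Dom T c = Cod T g" "Cod T c = Cod T g'" "c \<cdot> g = g' \<cdot> b"
    "ShA T a \<cdot> h = h' \<cdot> c" "seq_morphism T (ShA T) (f, g, h) (f', g', h') (a, b, c)"
proof -
  obtain c where "seq_morphism T (ShA T) (f, g, h) (f', g', h') (a, b, c)"
    using tri_fill[OF assms(1,2), of a b] assms by auto
  then show ?thesis
    using tri_arr[OF assms(1)] tri_arr[OF assms(2)] by (intro that[of c]) (auto simp: seq_morphism_iff)
qed

lemma zero_object_obtain: obtains N where "zero_object T N" "N \<in> Obj T"
  using zero_object_exists zero_object_obj by blast

text \<open>Fill in a morphism from the identity triangle of the domain of \<open>f\<close>, with
  first components the identity and \<open>f\<close>: the second square shows that
  \<open>g \<cdot> f\<close> factors through a zero object.\<close>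

lemma comp_tri_zero1:
  assumes t: "(f, g, h) \<in> Tri T"
  shows "g \<cdot> f = Zero T (Dom T f) (Cod T g)"
proof -
  note a = tri_arr[OF t]
  obtain N where N: "zero_object T N" "N \<in> Obj T"
    by (rule zero_object_obtain)
  obtain c where c: "c \<in> Arr T" "Dom T c = Cod T (Zero T (Dom T f) N)" "Cod T c = Cod T g"
     "c \<cdot> Zero T (Dom T f) N = g \<cdot> f"
    using fillE[OF tri_ident[OF a(7) N(1)] t, of "Ident T (Dom T f)" f] a by auto
  then show ?thesis
    using a N comp_zero[of c N "Dom T f"] by simp
qed

lemma tri_exact1:
  assumes t: "(f, g, h) \<in> Tri T"
  shows "hom_exact f g"
  unfolding hom_exact_def
proof (intro conjI ballI impI)
  note a = tri_arr[OF t]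
  show "f \<in> Arr T" "g \<in> Arr T" "Cod T f = Dom T g" "g \<cdot> f = Zero T (Dom T f) (Cod T g)"
    using a comp_tri_zero1[OF t] by auto
  fix x assume x: "x \<in> Arr T" "Cod T x = Cod T f" "g \<cdot> x = Zero T (Dom T x) (Cod T g)"
  let ?A = "Dom T x"
  have A: "?A \<in> Obj T"
    using x dom_obj by auto
  have Z: "Cod T g \<in> Obj T"
    using a by simp
  obtain N where N: "zero_object T N" "N \<in> Obj T"
    by (rule zero_object_obtain)
  \<comment> \<open>The identity triangle of the domain of \<open>x\<close> and the given triangle
    are both rotated once. Then \<open>x\<close> becomes the first component and the filler is an
    arrow between shifts, whose desuspension is the required factorization.\<close>
  obtain c where c: "c \<in> Arr T" "Dom T c = ShO T ?A" "Cod T c = ShO T (Dom T f)"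
     "ShA T x \<cdot> neg T (ShA T (Ident T ?A)) = neg T (ShA T f) \<cdot> c"
    using fillE[OF rotate[OF tri_ident[OF A N(1)]] rotate[OF t], of x "Zero T N (Cod T g)"] a x A N Z
    by auto
  obtain z where z: "z \<in> Arr T" "Dom T z = ?A" "Cod T z = Dom T f" "ShA T z = c"
    using sh_full[OF A a(7) c(1-3)] by blast
  have "neg T (neg T (ShA T x)) = neg T (neg T (ShA T f \<cdot> c))"
    using c a x A by simp
  then have "ShA T x = ShA T (f \<cdot> z)"
    using c a x A z sh_comp[of z f] by simp
  then have "x = f \<cdot> z"
    by (rule sh_faithful[rotated 4]) (use a x z in simp_all)
  then show "\<exists>z. z \<in> Arr T \<and> Dom T z = Dom T x \<and> Cod T z = Dom T f \<and> f \<cdot> z = x"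
    using z by blast
qed

lemma tri_exact2: "(f, g, h) \<in> Tri T \<Longrightarrow> hom_exact g h"
  by (rule tri_exact1[OF rotate])

text \<open>Two rotations give exactness at the shifted domain up to a sign, which
  \<open>hom_exact_sign\<close> removes.\<close>

lemma tri_exact3:
  assumes t: "(f, g, h) \<in> Tri T"
  shows "hom_exact h (ShA T f)"
  using hom_exact_sign(1)[OF tri_exact1[OF rotate[OF rotate[OF t]]]] tri_arr[OF t] by simp

lemmas tri_exact = tri_exact1 tri_exact2 tri_exact3

lemma comp_tri_zero2:
  assumes t: "(f, g, h) \<in> Tri T"
  shows "h \<cdot> g = Zero T (Dom T g) (ShO T (Dom T f))" "ShA T f \<cdot> h = Zero T (Dom T h) (ShO T (Cod T f))"
  using hom_exactD(4)[OF tri_exact2[OF t]] hom_exactD(4)[OF tri_exact3[OF t]] tri_arr[OF t] by simp_all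

lemma fill_iso:
  assumes t: "(f, g, h) \<in> Tri T" "(f', g', h') \<in> Tri T"
    and m: "seq_morphism T (ShA T) (f, g, h) (f', g', h') (a, b, c)" "iso_arrow T a" "iso_arrow T b"
  shows "iso_arrow T c"
  by (rule five_lemma_seq[OF tri_exact[OF t(1)] tri_exact[OF t(2)] m])

lemma cone_unique:
  assumes t: "(f, g, h) \<in> Tri T" "(f, g', h') \<in> Tri T"
  shows "isomorphic T (Cod T g) (Cod T g')"
proof -
  note a = tri_arr[OF t(1)]
  have f: "Cod T f \<in> Obj T"
    using a by simp
  obtain c where c: "c \<in> Arr T" "Dom T c = Cod T g" "Cod T c = Cod T g'" 
     "seq_morphism T (ShA T) (f, g, h) (f, g', h') (Ident T (Dom T f), Ident T (Cod T f), c)"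
    by (rule fillE[OF t, of "Ident T (Dom T f)" "Ident T (Cod T f)"]) (use a(1,7) f in simp_all)
  have "iso_arrow T c"
    by (rule fill_iso[OF t c(4)]) (use a(7) f in simp_all)
  then show ?thesis
    using c unfolding isomorphic_def by (intro bexI[of _ c]) simp_all
qed

text \<open>Since \<open>ShO T N\<close> is again a zero object, one rotation turns this sequence
  into the identity triangle of \<open>A\<close>.\<close>

lemma tri_zero_ident:
  assumes N: "zero_object T N" and A: "A \<in> Obj T"
  shows "(Zero T N A, Ident T A, Zero T A (ShO T N)) \<in> Tri T"
proof -
  have N': "N \<in> Obj T" "zero_object T (ShO T N)"
    using N zero_object_obj sh.map_zero_object by auto
  then have "is_seq T (ShO T) (Zero T N A, Ident T A, Zero T A (ShO T N))"
    using A by (simp add: is_seq_iff)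
  then show ?thesis
    using tri_rotate[of "Zero T N A" "Ident T A" "Zero T A (ShO T N)"] tri_ident[OF A N'(2)] A N' by simp
qed

text \<open>Weak cokernel property, dual to \<open>tri_exact1\<close>: fill in a morphism to the
  triangle \<open>0 \<rightarrow> A \<rightarrow> A\<close> with middle component
  \<open>x\<close>.\<close>

lemma tri_extend1:
  assumes t: "(f, g, h) \<in> Tri T" and x: "x \<in> Arr T" "Dom T x = Cod T f" "x \<cdot> f = Zero T (Dom T f) (Cod T x)"
  obtains z where "z \<in> Arr T" "Dom T z = Cod T g" "Cod T z = Cod T x" "z \<cdot> g = x"
proof -
  note a = tri_arr[OF t]
  have A: "Cod T x \<in> Obj T"
    using x cod_obj by auto
  obtain N where N: "zero_object T N" "N \<in> Obj T"
    by (rule zero_object_obtain)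
  obtain c where c: "c \<in> Arr T" "Dom T c = Cod T g" "Cod T c = Cod T x" "c \<cdot> g = Ident T (Cod T x) \<cdot> x"
    using fillE[OF t tri_zero_ident[OF N(1) A], of "Zero T (Dom T f) N" x] a x A N by auto
  then show ?thesis
    using x A by (intro that[of c]) simp_all
qed

lemma tri_extend2:
  assumes t: "(f, g, h) \<in> Tri T" and x: "x \<in> Arr T" "Dom T x = Cod T g" "x \<cdot> g = Zero T (Dom T g) (Cod T x)"
  obtains z where "z \<in> Arr T" "Dom T z = ShO T (Dom T f)" "Cod T z = Cod T x" "z \<cdot> h = x"
  using tri_extend1[OF rotate[OF t] x] tri_arr[OF t] by metis

lemma tri_extend3:
  assumes t: "(f, g, h) \<in> Tri T" and x: "x \<in> Arr T" "Dom T x = Cod T h" "x \<cdot> h = Zero T (Dom T h) (Cod T x)"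
  obtains z where "z \<in> Arr T" "Dom T z = ShO T (Cod T f)" "Cod T z = Cod T x" "z \<cdot> ShA T f = x"
proof -
  note a = tri_arr[OF t]
  obtain z where z: "z \<in> Arr T" "Dom T z = Cod T (neg T (ShA T f))" "Cod T z = Cod T x"
    "z \<cdot> neg T (ShA T f) = x"
    using tri_extend1[OF rotate[OF rotate[OF t]] x] by metis
  then show ?thesis
    using a by (intro that[of "neg T z"]) simp_all
qed

text \<open>The cone of \<open>g\<close> is a shift up to the isomorphism \<open>e\<close>, and
  desuspending its last arrow gives \<open>f\<close>. The sign put into \<open>f\<close> cancels the
  one introduced by rotation.\<close>

lemma cocone:
  assumes g: "g \<in> Arr T"
  obtains f h where "(f, g, h) \<in> Tri T"
proof -
  obtain k l where t: "(g, k, l) \<in> Tri T"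
    using tri_cone[OF g] by blast
  note a = tri_arr[OF t]
  have W: "Cod T k \<in> Obj T"
    using a by simp
  obtain X e e' where X: "X \<in> Obj T" and e: "inverse_pair T e e'" "Dom T e = ShO T X" "Cod T e = Cod T k"
    using desuspend[OF W] by metis
  note e' = inverse_pair_cancel[OF e(1)]
  have Y: "Dom T g \<in> Obj T"
    using a by simp
  obtain f where f: "f \<in> Arr T" "Dom T f = X" "Cod T f = Dom T g" "ShA T f = neg T (l \<cdot> e)"
    using sh_full[OF X Y, of "neg T (l \<cdot> e)"] a e e' by auto
  have s: "is_seq T (ShO T) (f, g, e' \<cdot> k)"
    using f a e e' g by (simp add: is_seq_iff)
  have "seq_isomorphic T (ShO T) (ShA T) (g, e' \<cdot> k, l \<cdot> e) (g, k, l)"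
  proof (rule seq_isomorphicI)
    show "seq_morphism T (ShA T) (g, e' \<cdot> k, l \<cdot> e) (g, k, l) (Ident T (Dom T g), Ident T (Cod T g), e)"
      using a e(2,3) e' g Y by (simp add: seq_morphism_iff)
    show "iso_arrow T e"
      using e by (auto simp: iso_arrow_iff)
  qed (use a e(2,3) e' g Y in \<open>simp_all add: is_seq_iff\<close>)
  then have "(g, e' \<cdot> k, l \<cdot> e) \<in> Tri T"
    by (rule tri_iso[OF t])
  then have "(f, g, e' \<cdot> k) \<in> Tri T"
    using tri_rotate[OF s] f a e(2,3) e' by simp
  then show ?thesis
    by (rule that)
qed

lemma neg_iso: "iso_arrow T f \<Longrightarrow> iso_arrow T (neg T f)"
  unfolding iso_arrow_iff inverse_pair_def
  by (elim exE conjE, rule_tac x="neg T g" in exI) (simp add: dom_obj cod_obj)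

text \<open>Two sign changes amount to conjugation by minus the identity on the middle
  object.\<close>

lemma tri_sign:
  assumes t: "(f, g, h) \<in> Tri T"
  shows "(neg T f, neg T g, h) \<in> Tri T"
proof (rule tri_iso[OF t])
  note a = tri_arr[OF t]
  show "seq_isomorphic T (ShO T) (ShA T) (neg T f, neg T g, h) (f, g, h)"
  proof (rule seq_isomorphicI)
    show "seq_morphism T (ShA T) (neg T f, neg T g, h) (f, g, h) (Ident T (Dom T f), neg T (Ident T (Dom
      T g)), Ident T (Dom T h))"
      using a by (simp add: seq_morphism_iff)
  qed (use a in \<open>simp_all add: is_seq_iff neg_iso\<close>)
qed

text \<open>Three rotations negate all three shifted arrows; two of the signs can be removed
  again.\<close>

lemma tri_shift:
  assumes t: "(f, g, h) \<in> Tri T"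
  shows "(ShA T f, ShA T g, neg T (ShA T h)) \<in> Tri T"
  using tri_sign[OF rotate[OF rotate[OF rotate[OF t]]]] tri_arr[OF t] by simp

text \<open>The last arrow is left open because its sign alternates with \<open>n\<close>.\<close>

lemma tri_shift_n:
  assumes t: "(f, g, h) \<in> Tri T"
  obtains h' where "(Sa n f, Sa n g, h') \<in> Tri T"
proof -
  have "\<exists>h'. (Sa n f, Sa n g, h') \<in> Tri T"
  proof (induction n)
    case (Suc n)
    then show ?case
      using tri_shift by fastforce
  qed (use t in auto)
  then show ?thesis
    using that by blast
qed

text \<open>Comparison with the identity triangle of the domain makes the cone isomorphic to a zero
  object.\<close>

lemma iso_arrow_imp_zero_cone:
  assumes t: "(f, g, h) \<in> Tri T" and f: "iso_arrow T f"
  shows "zero_object T (Cod T g)"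
proof -
  note a = tri_arr[OF t]
  obtain N where N: "zero_object T N" "N \<in> Obj T"
    by (rule zero_object_obtain)
  have X: "Dom T f \<in> Obj T"
    using a by simp
  obtain c where c: "c \<in> Arr T" "Dom T c = N" "Cod T c = Cod T g" 
     "seq_morphism T (ShA T) (Ident T (Dom T f), Zero T (Dom T f) N, Zero T N (ShO T (Dom T f))) (f, g,
       h) (Ident T (Dom T f), f, c)"
    by (rule fillE[OF tri_ident[OF X N(1)] t, of "Ident T (Dom T f)" f]) (use a N in simp_all)
  have "iso_arrow T c"
    by (rule fill_iso[OF tri_ident[OF X N(1)] t c(4)]) (use f X in simp_all)
  then obtain d where "inverse_pair T c d"
    by (rule iso_arrowE)
  note d = inverse_pair_cancel[OF this]
  have "c = Zero T N (Cod T g)"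
    by (rule from_zero_object[OF N(1) c(1-3)])
  then have "c \<cdot> d = Zero T N (Cod T g) \<cdot> d"
    by (rule arg_cong)
  then have "Ident T (Cod T g) = Zero T (Cod T g) (Cod T g)"
    using d(4-8) c(2,3) a(5,9) N(2) by simp
  then show ?thesis
    using a(5,9) by (simp add: zero_object_iff)
qed

end

lemma (in category) inverse_square:
  assumes i: "inverse_pair C a a'" "inverse_pair C b b'" and eq: "b \<cdot> f = f' \<cdot> a"
    and t: "f \<in> Arr C" "f' \<in> Arr C" "Dom C f = Dom C a" "Cod C f = Dom C b" "Dom C f' = Cod C a"
      "Cod C f' = Cod C b"
  shows "b' \<cdot> f' = f \<cdot> a'"
proof -
  note a = inverse_pair_cancel[OF i(1)] and b = inverse_pair_cancel[OF i(2)]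
  have "b' \<cdot> f' = b' \<cdot> ((f' \<cdot> a) \<cdot> a')"
    using a(4-8) t by simp
  also have "\<dots> = b' \<cdot> ((b \<cdot> f) \<cdot> a')"
    using eq by simp
  also have "\<dots> = f \<cdot> a'"
    using a(5-8) b t by simp
  finally show ?thesis .
qed

section \<open>Morphisms and isomorphisms of sequences\<close>

context additive_shift begin

lemma seq_morphism_comp:
  assumes s: "is_seq T (ShO T) (f, g, h)" "is_seq T (ShO T) (f', g', h')" "is_seq T (ShO T) (f'', g'', h'')"
    and m: "seq_morphism T (ShA T) (f, g, h) (f', g', h') (a, b, c)"
      "seq_morphism T (ShA T) (f', g', h') (f'', g'', h'') (a', b', c')"
  shows "seq_morphism T (ShA T) (f, g, h) (f'', g'', h'') (a' \<cdot> a, b' \<cdot> b, c' \<cdot> c)"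
proof -
  have t: "f \<in> Arr T" "g \<in> Arr T" "h \<in> Arr T" "Cod T f = Dom T g" "Cod T g = Dom T h"
    "Cod T h = ShO T (Dom T f)"
     "f' \<in> Arr T" "g' \<in> Arr T" "h' \<in> Arr T" "Cod T f' = Dom T g'" "Cod T g' = Dom T h'"
     "Cod T h' = ShO T (Dom T f')"
     "f'' \<in> Arr T" "g'' \<in> Arr T" "h'' \<in> Arr T" "Cod T f'' = Dom T g''" "Cod T g'' = Dom T h''"
     "Cod T h'' = ShO T (Dom T f'')"
    using s by (auto simp: is_seq_iff)
  have c: "a \<in> Arr T" "Dom T a = Dom T f" "Cod T a = Dom T f'" "b \<in> Arr T" "Dom T b = Dom T g"
    "Cod T b = Dom T g'"
     "c \<in> Arr T" "Dom T c = Dom T h" "Cod T c = Dom T h'"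
     "a' \<in> Arr T" "Dom T a' = Dom T f'" "Cod T a' = Dom T f''" "b' \<in> Arr T" "Dom T b' = Dom T g'"
     "Cod T b' = Dom T g''"
     "c' \<in> Arr T" "Dom T c' = Dom T h'" "Cod T c' = Dom T h''"
    using m by (auto simp: seq_morphism_iff)
  have e: "b \<cdot> f = f' \<cdot> a" "c \<cdot> g = g' \<cdot> b" "ShA T a \<cdot> h = h' \<cdot> c"
      "b' \<cdot> f' = f'' \<cdot> a'" "c' \<cdot> g' = g'' \<cdot> b'" "ShA T a' \<cdot> h' = h'' \<cdot> c'"
    using m by (auto simp: seq_morphism_iff)
  show ?thesis
    using t c by (simp add: seq_morphism_iff sh_comp e comp_reduce[OF e(4)] comp_reduce[OF e(5)]
      comp_reduce[OF e(6)])
qed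

lemma seq_morphism_inverse:
  assumes s: "is_seq T (ShO T) (f, g, h)" "is_seq T (ShO T) (f', g', h')"
    and m: "seq_morphism T (ShA T) (f, g, h) (f', g', h') (a, b, c)"
    and i: "inverse_pair T a a'" "inverse_pair T b b'" "inverse_pair T c c'"
  shows "seq_morphism T (ShA T) (f', g', h') (f, g, h) (a', b', c')"
proof -
  have t: "f \<in> Arr T" "g \<in> Arr T" "h \<in> Arr T" "Cod T f = Dom T g" "Cod T g = Dom T h"
    "Cod T h = ShO T (Dom T f)"
     "f' \<in> Arr T" "g' \<in> Arr T" "h' \<in> Arr T" "Cod T f' = Dom T g'" "Cod T g' = Dom T h'"
     "Cod T h' = ShO T (Dom T f')"
    using s by (auto simp: is_seq_iff)
  have c: "Dom T a = Dom T f" "Cod T a = Dom T f'" "Dom T b = Dom T g" "Cod T b = Dom T g'"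
     "Dom T c = Dom T h" "Cod T c = Dom T h'" "a \<in> Arr T"
    using m by (auto simp: seq_morphism_iff)
  have e: "b \<cdot> f = f' \<cdot> a" "c \<cdot> g = g' \<cdot> b" "ShA T a \<cdot> h = h' \<cdot> c"
    using m by (auto simp: seq_morphism_iff)
  have "b' \<cdot> f' = f \<cdot> a'"
    by (rule inverse_square[OF i(1,2) e(1)]) (use t c in simp_all)
  moreover have "c' \<cdot> g' = g \<cdot> b'"
    by (rule inverse_square[OF i(2,3) e(2)]) (use t c in simp_all)
  moreover have "ShA T a' \<cdot> h' = h \<cdot> c'"
    by (rule inverse_square[OF i(3) sh.map_inverse_pair[OF i(1)] e(3)]) (use t c in simp_all)
  ultimately show ?thesis
    using c t inverse_pair_cancel(6-8)[OF i(1)] inverse_pair_cancel(6-8)[OF i(2)]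
      inverse_pair_cancel(6-8)[OF i(3)]
    by (simp add: seq_morphism_iff)
qed

lemma seq_isomorphic_sym:
  assumes "seq_isomorphic T (ShO T) (ShA T) t t'"
  shows "seq_isomorphic T (ShO T) (ShA T) t' t"
proof -
  obtain f g h f' g' h' where e: "t = (f, g, h)" "t' = (f', g', h')"
    by (cases t, cases t')
  obtain a b c where s: "is_seq T (ShO T) t"
    "is_seq T (ShO T) t'" and m: "seq_morphism T (ShA T) t t' (a, b, c)"
    and i: "iso_arrow T a" "iso_arrow T b" "iso_arrow T c"
    using assms unfolding seq_isomorphic_def by blast
  obtain a' b' c' where i': "inverse_pair T a a'" "inverse_pair T b b'" "inverse_pair T c c'"
    using i unfolding iso_arrow_iff by blast
  have "seq_morphism T (ShA T) t' t (a', b', c')"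
    unfolding e by (rule seq_morphism_inverse[OF s[unfolded e] m[unfolded e] i'])
  then show ?thesis
    by (rule seq_isomorphicI[OF s(2,1)]) (use inverse_pair_sym[OF i'(1)] inverse_pair_sym[OF i'(2)]
      inverse_pair_sym[OF i'(3)] in \<open>auto simp: iso_arrow_iff\<close>)
qed

lemma seq_isomorphic_trans:
  assumes "seq_isomorphic T (ShO T) (ShA T) t t'" "seq_isomorphic T (ShO T) (ShA T) t' t''"
  shows "seq_isomorphic T (ShO T) (ShA T) t t''"
proof -
  obtain f g h f' g' h' f'' g'' h'' where e: "t = (f, g, h)" "t' = (f', g', h')" "t'' = (f'', g'', h'')"
    by (cases t, cases t', cases t'')
  obtain a b c where s: "is_seq T (ShO T) t"
    "is_seq T (ShO T) t'" and m: "seq_morphism T (ShA T) t t' (a, b, c)"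
    and i: "iso_arrow T a" "iso_arrow T b" "iso_arrow T c"
    using assms(1) unfolding seq_isomorphic_def by blast
  obtain a' b' c' where s': "is_seq T (ShO T) t''" and m': "seq_morphism T (ShA T) t' t'' (a', b', c')"
    and i': "iso_arrow T a'" "iso_arrow T b'" "iso_arrow T c'"
    using assms(2) unfolding seq_isomorphic_def by blast
  have c: "Cod T a = Dom T a'" "Cod T b = Dom T b'" "Cod T c = Dom T c'"
    using m m' unfolding e by (auto simp: seq_morphism_iff)
  have "seq_morphism T (ShA T) t t'' (a' \<cdot> a, b' \<cdot> b, c' \<cdot> c)"
    unfolding e by (rule seq_morphism_comp[OF s[unfolded e] s'[unfolded e] m[unfolded e] m'[unfolded e]])
  then show ?thesis
    by (rule seq_isomorphicI[OF s(1) s']) (use iso_comp[OF i(1) i'(1) c(1)] iso_comp[OF i(2) i'(2) c(2)]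
      iso_comp[OF i(3) i'(3) c(3)] in auto)
qed

lemma seq_isomorphic_refl:
  assumes "is_seq T (ShO T) (f, g, h)"
  shows "seq_isomorphic T (ShO T) (ShA T) (f, g, h) (f, g, h)"
proof -
  have "f \<in> Arr T" "g \<in> Arr T" "h \<in> Arr T" "Cod T f = Dom T g" "Cod T g = Dom T h" "Cod T h = ShO T (Dom T f)"
    and ob: "Dom T f \<in> Obj T" "Dom T g \<in> Obj T" "Dom T h \<in> Obj T"
    using assms dom_obj by (auto simp: is_seq_iff)
  then have "seq_morphism T (ShA T) (f, g, h) (f, g, h) (Ident T (Dom T f), Ident T (Dom T g), Ident T
    (Dom T h))"
    by (simp add: seq_morphism_iff)
  then show ?thesis
    by (rule seq_isomorphicI[OF assms assms]) (use ob in simp_all)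
qed

lemma seq_isomorphic_rotate:
  assumes s: "is_seq T (ShO T) (f, g, h)" "is_seq T (ShO T) (f', g', h')"
  shows "seq_isomorphic T (ShO T) (ShA T) (f, g, h) (f', g', h') \<longleftrightarrow>
    seq_isomorphic T (ShO T) (ShA T) (g, h, neg T (ShA T f)) (g', h', neg T (ShA T f'))"
proof
  have t: "f \<in> Arr T" "g \<in> Arr T" "h \<in> Arr T" "Cod T f = Dom T g" "Cod T g = Dom T h"
    "Cod T h = ShO T (Dom T f)"
     "f' \<in> Arr T" "g' \<in> Arr T" "h' \<in> Arr T" "Cod T f' = Dom T g'" "Cod T g' = Dom T h'"
     "Cod T h' = ShO T (Dom T f')"
    using s by (auto simp: is_seq_iff)
  have s': "is_seq T (ShO T) (g, h, neg T (ShA T f))" "is_seq T (ShO T) (g', h', neg T (ShA T f'))"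
    using t by (auto simp: is_seq_iff)
  {
    assume "seq_isomorphic T (ShO T) (ShA T) (f, g, h) (f', g', h')"
    then obtain a b c where m: "seq_morphism T (ShA T) (f, g, h) (f', g', h') (a, b, c)"
      and i: "iso_arrow T a" "iso_arrow T b" "iso_arrow T c"
      unfolding seq_isomorphic_def by blast
    have c: "a \<in> Arr T" "Dom T a = Dom T f" "Cod T a = Dom T f'" "b \<in> Arr T" "Dom T b = Dom T g"
      "Cod T b = Dom T g'"
      "c \<in> Arr T" "Dom T c = Dom T h" "Cod T c = Dom T h'"
      and e: "b \<cdot> f = f' \<cdot> a" "c \<cdot> g = g' \<cdot> b" "ShA T a \<cdot> h = h' \<cdot> c"
      using m by (auto simp: seq_morphism_iff)
    have "ShA T (b \<cdot> f) = ShA T (f' \<cdot> a)"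
      using e(1) by simp
    then have "ShA T b \<cdot> ShA T f = ShA T f' \<cdot> ShA T a"
      using t c by (simp add: sh_comp)
    then have "seq_morphism T (ShA T) (g, h, neg T (ShA T f)) (g', h', neg T (ShA T f')) (b, c, ShA T a)"
      using t c e by (simp add: seq_morphism_iff)
    then show "seq_isomorphic T (ShO T) (ShA T) (g, h, neg T (ShA T f)) (g', h', neg T (ShA T f'))"
      by (rule seq_isomorphicI[OF s']) (use i sh.map_iso in auto)
  next
    assume "seq_isomorphic T (ShO T) (ShA T) (g, h, neg T (ShA T f)) (g', h', neg T (ShA T f'))"
    then obtain b c d where m: "seq_morphism T (ShA T) (g, h, neg T (ShA T f)) (g', h', neg T (ShA T f'))
      (b, c, d)"
      and i: "iso_arrow T b" "iso_arrow T c" "iso_arrow T d"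
      unfolding seq_isomorphic_def by blast
    have c: "b \<in> Arr T" "Dom T b = Dom T g" "Cod T b = Dom T g'"
      "c \<in> Arr T" "Dom T c = Dom T h" "Cod T c = Dom T h'" "d \<in> Arr T" "Dom T d = ShO T (Dom T f)"
      "Cod T d = ShO T (Dom T f')"
      and e: "c \<cdot> g = g' \<cdot> b" "d \<cdot> h = h' \<cdot> c" and e3: "ShA T b \<cdot> neg T (ShA T f) = neg T (ShA T f') \<cdot> d"
      using m t unfolding seq_morphism_iff by simp_all
    \<comment> \<open>The component \<open>d\<close> joins two shifts, so fullness supplies the
      missing first component; faithfulness then cancels the shift in the first square.\<close>
    obtain a where a: "a \<in> Arr T" "Dom T a = Dom T f" "Cod T a = Dom T f'" "ShA T a = d"
      using sh_full[OF dom_obj[OF t(1)] dom_obj[OF t(7)] c(7-9)] by blast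
    have "neg T (ShA T (b \<cdot> f)) = neg T (ShA T (f' \<cdot> a))"
      using e3 t c a by (simp add: sh_comp)
    then have "neg T (neg T (ShA T (b \<cdot> f))) = neg T (neg T (ShA T (f' \<cdot> a)))"
      by (rule arg_cong)
    then have "ShA T (b \<cdot> f) = ShA T (f' \<cdot> a)"
      using t c a by simp
    then have "b \<cdot> f = f' \<cdot> a"
      by (rule sh_faithful[rotated 4]) (use t c a in simp_all)
    then have "seq_morphism T (ShA T) (f, g, h) (f', g', h') (a, b, c)"
      using t c a e by (simp add: seq_morphism_iff)
    then show "seq_isomorphic T (ShO T) (ShA T) (f, g, h) (f', g', h')"
      by (rule seq_isomorphicI[OF s]) (use i a sh.full_faithful_reflects_iso[OF sh_ff, of a] in auto)
  }
qed

end

context pretriangulated begin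

lemma tri_isoE:
  assumes t: "(f, g, h) \<in> Tri T" "(f', g', h') \<in> Tri T"
    and a: "iso_arrow T a" "Dom T a = Dom T f" "Cod T a = Dom T f'"
    and b: "iso_arrow T b" "Dom T b = Cod T f" "Cod T b = Cod T f'" and eq: "b \<cdot> f = f' \<cdot> a"
  obtains c where "iso_arrow T c" "c \<in> Arr T" "Dom T c = Cod T g" "Cod T c = Cod T g'" "c \<cdot> g = g' \<cdot> b"
    "ShA T a \<cdot> h = h' \<cdot> c" "seq_morphism T (ShA T) (f, g, h) (f', g', h') (a, b, c)"
proof -
  obtain c where c: "c \<in> Arr T" "Dom T c = Cod T g" "Cod T c = Cod T g'" "c \<cdot> g = g' \<cdot> b"
    "ShA T a \<cdot> h = h' \<cdot> c" "seq_morphism T (ShA T) (f, g, h) (f', g', h') (a, b, c)"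
    by (rule fillE[OF t iso_arr[OF a(1)] a(2,3) iso_arr[OF b(1)] b(2,3) eq])
  have "iso_arrow T c"
    by (rule fill_iso[OF t c(6) a(1) b(1)])
  then show ?thesis
    using that c by blast
qed

lemma tri_unique:
  assumes t: "(f, g, h) \<in> Tri T" "(f, g', h') \<in> Tri T"
  shows "seq_isomorphic T (ShO T) (ShA T) (f, g, h) (f, g', h')"
proof -
  have ob: "Dom T f \<in> Obj T" "Cod T f \<in> Obj T" "f \<in> Arr T"
    using tri_arr[OF t(1)] by auto
  obtain c where c: "iso_arrow T c"
    "seq_morphism T (ShA T) (f, g, h) (f, g', h') (Ident T (Dom T f), Ident T (Cod T f), c)"
    by (rule tri_isoE[OF t, of "Ident T (Dom T f)" "Ident T (Cod T f)"]) (use ob in simp_all)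
  show ?thesis
    by (rule seq_isomorphicI[OF tri_seq[OF t(1)] tri_seq[OF t(2)] c(2)]) (use ob c in simp_all)
qed

text \<open>Isomorphisms of two composable pairs induce isomorphisms \<open>p\<close>,
  \<open>q\<close>, \<open>r\<close> of the three cones, and the octahedron is conjugated by these.
  It serves the Verdier quotient, where every composable pair is isomorphic to one coming from
  \<open>T\<close>.\<close>

lemma octahedral_transport:
  assumes a: "iso_arrow T a" "Dom T a = Dom T f0" "Cod T a = Dom T f"
    and b: "iso_arrow T b" "Dom T b = Dom T g0" "Cod T b = Dom T g"
    and c: "iso_arrow T c" "Dom T c = Cod T g0" "Cod T c = Cod T g"
    and sq: "b \<cdot> f0 = f \<cdot> a" "c \<cdot> g0 = g \<cdot> b"
    and fg: "Cod T f = Dom T g" "Cod T f0 = Dom T g0"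
    and t0: "(f0, f0', f0'') \<in> Tri T" "(g0, g0', g0'') \<in> Tri T" "(g0 \<cdot> f0, k0', k0'') \<in> Tri T"
    and t: "(f, f', f'') \<in> Tri T" "(g, g', g'') \<in> Tri T" "(g \<cdot> f, k', k'') \<in> Tri T"
    and uv: "(u0, v0, ShA T f0' \<cdot> g0'') \<in> Tri T" "Dom T u0 = Cod T f0'" "Cod T u0 = Cod T k0'"
      "Dom T v0 = Cod T k0'" "Cod T v0 = Cod T g0'"
      "u0 \<cdot> f0' = k0' \<cdot> g0" "k0'' \<cdot> u0 = f0''" "v0 \<cdot> k0' = g0'" "g0'' \<cdot> v0 = ShA T f0 \<cdot> k0''"
  shows "\<exists>u v. (u, v, ShA T f' \<cdot> g'') \<in> Tri T \<and> u \<cdot> f' = k' \<cdot> g \<and> k'' \<cdot> u = f'' \<and> v \<cdot> k' = g' \<and>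
    g'' \<cdot> v = ShA T f \<cdot> k''"
proof -
  have A: "f0 \<in> Arr T" "f0' \<in> Arr T" "f0'' \<in> Arr T" "g0 \<in> Arr T" "g0' \<in> Arr T" "g0'' \<in> Arr T"
    "k0' \<in> Arr T" "k0'' \<in> Arr T"
      "Dom T f0' = Dom T g0" "Dom T f0'' = Cod T f0'" "Cod T f0'' = ShO T (Dom T f0)"
      "Dom T g0' = Cod T g0" "Dom T g0'' = Cod T g0'" "Cod T g0'' = ShO T (Dom T g0)"
      "Dom T k0' = Cod T g0" "Dom T k0'' = Cod T k0'" "Cod T k0'' = ShO T (Dom T f0)"
    using tri_arr[OF t0(1)] tri_arr[OF t0(2)] tri_arr[OF t0(3)] fg(2) by simp_all
  have B: "f \<in> Arr T" "f' \<in> Arr T" "f'' \<in> Arr T" "g \<in> Arr T" "g' \<in> Arr T" "g'' \<in> Arr T" "k' \<in> Arr T"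
    "k'' \<in> Arr T"
      "Dom T f' = Dom T g" "Dom T f'' = Cod T f'" "Cod T f'' = ShO T (Dom T f)"
      "Dom T g' = Cod T g" "Dom T g'' = Cod T g'" "Cod T g'' = ShO T (Dom T g)"
      "Dom T k' = Cod T g" "Dom T k'' = Cod T k'" "Cod T k'' = ShO T (Dom T f)"
    using tri_arr[OF t(1)] tri_arr[OF t(2)] tri_arr[OF t(3)] fg(1) by simp_all
  have ia: "a \<in> Arr T" "b \<in> Arr T" "c \<in> Arr T"
    using a b c iso_arr by auto
  have uv': "u0 \<in> Arr T" "v0 \<in> Arr T"
    using tri_arr[OF uv(1)] by auto
  have sq3: "c \<cdot> (g0 \<cdot> f0) = (g \<cdot> f) \<cdot> a"
    using A(1,4) B(1,4) ia a b c fg by (simp add: comp_reduce[OF sq(2)] sq(1))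
  have Ssq: "ShA T b \<cdot> ShA T f0 = ShA T f \<cdot> ShA T a"
    using arg_cong[OF sq(1), of "ShA T"] A(1,4) B(1,4) ia a b fg by (simp add: sh_comp)
  obtain p where p: "iso_arrow T p" "p \<in> Arr T" "Dom T p = Cod T f0'" "Cod T p = Cod T f'" "p \<cdot> f0' = f' \<cdot> b"
      "ShA T a \<cdot> f0'' = f'' \<cdot> p"
    by (rule tri_isoE[OF t0(1) t(1) a b(1) _ _ sq(1)]) (use b fg in simp_all)
  obtain q where q: "iso_arrow T q" "q \<in> Arr T" "Dom T q = Cod T g0'" "Cod T q = Cod T g'" "q \<cdot> g0' = g' \<cdot> c"
      "ShA T b \<cdot> g0'' = g'' \<cdot> q"
    by (rule tri_isoE[OF t0(2) t(2) b c sq(2)])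
  obtain r where r: "iso_arrow T r" "r \<in> Arr T" "Dom T r = Cod T k0'" "Cod T r = Cod T k'" "r \<cdot> k0' = k' \<cdot> c"
      "ShA T a \<cdot> k0'' = k'' \<cdot> r"
    by (rule tri_isoE[OF t0(3) t(3) a(1) _ _ c(1) _ _ sq3]) (use A(1,4) B(1,4) a c fg in simp_all)
  obtain p' where p': "inverse_pair T p p'"
    using p(1) by (rule iso_arrowE)
  obtain q' where q': "inverse_pair T q q'"
    using q(1) by (rule iso_arrowE)
  obtain r' where r': "inverse_pair T r r'"
    using r(1) by (rule iso_arrowE)
  note pc = inverse_pair_cancel[OF p'] and qc = inverse_pair_cancel[OF q'] and rc = inverse_pair_cancel[OF r']
  define u v where "u = r \<cdot> (u0 \<cdot> p')" and "v = q \<cdot> (v0 \<cdot> r')"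
  have u: "u \<in> Arr T" "Dom T u = Cod T f'" "Cod T u = Cod T k'"
    unfolding u_def using r(2-4) pc(6-8) p(3,4) uv' uv(2,3) by simp_all
  have v: "v \<in> Arr T" "Dom T v = Cod T k'" "Cod T v = Cod T g'"
    unfolding v_def using q(2-4) rc(6-8) r(3,4) uv' uv(4,5) by simp_all
  have up: "u \<cdot> p = r \<cdot> u0"
    unfolding u_def using r(2-4) pc(3,5-8) p(3,4) uv' uv(2,3) by simp
  have vr: "v \<cdot> r = q \<cdot> v0"
    unfolding v_def using q(2-4) rc(3,5-8) r(3,4) uv' uv(4,5) by simp
  \<comment> \<open>Each of the four relations is verified after precomposition with an isomorphism,
    where it turns into the corresponding relation of the given octahedron.\<close>
  have 1: "u \<cdot> f' = k' \<cdot> g"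
  proof (rule iso_cancel_right[OF b(1)])
    have "(u \<cdot> f') \<cdot> b = u \<cdot> (p \<cdot> f0')"
      using u B ia b p by simp
    also have "\<dots> = r \<cdot> (k0' \<cdot> g0)"
      using u A p(2-4) uv' uv(2,3) r(2-4) by (simp add: comp_reduce[OF up] uv(6))
    also have "\<dots> = (k' \<cdot> c) \<cdot> g0"
      using A r(2-4) by (simp add: comp_reduce[OF r(5)])
    also have "\<dots> = (k' \<cdot> g) \<cdot> b"
      using A B ia b c by (simp add: sq(2))
    finally show "(u \<cdot> f') \<cdot> b = (k' \<cdot> g) \<cdot> b" .
  qed (use u B b in simp_all)
  have 2: "k'' \<cdot> u = f''"
  proof (rule iso_cancel_right[OF p(1)])
    have "(k'' \<cdot> u) \<cdot> p = k'' \<cdot> (r \<cdot> u0)"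
      using u B p(2-4) by (simp add: up)
    also have "\<dots> = ShA T a \<cdot> (k0'' \<cdot> u0)"
      using A B ia a r(2-4) uv' uv(2,3) by (simp add: comp_reduce[OF r(6)])
    also have "\<dots> = f'' \<cdot> p"
      using uv(7) p(6) by simp
    finally show "(k'' \<cdot> u) \<cdot> p = f'' \<cdot> p" .
  qed (use u B p(2-4) in simp_all)
  have 3: "v \<cdot> k' = g'"
  proof (rule iso_cancel_right[OF c(1)])
    have "(v \<cdot> k') \<cdot> c = v \<cdot> (r \<cdot> k0')"
      using v B ia c r by simp
    also have "\<dots> = q \<cdot> g0'"
      using v A r(2-4) uv' uv(4,5) q(2-4) by (simp add: comp_reduce[OF vr] uv(8))
    also have "\<dots> = g' \<cdot> c"
      by (rule q(5))
    finally show "(v \<cdot> k') \<cdot> c = g' \<cdot> c" .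
  qed (use v B c in simp_all)
  have 4: "g'' \<cdot> v = ShA T f \<cdot> k''"
  proof (rule iso_cancel_right[OF r(1)])
    have "(g'' \<cdot> v) \<cdot> r = g'' \<cdot> (q \<cdot> v0)"
      using v B r(2-4) by (simp add: vr)
    also have "\<dots> = ShA T b \<cdot> (g0'' \<cdot> v0)"
      using A B ia b q(2-4) uv' uv(4,5) by (simp add: comp_reduce[OF q(6)])
    also have "\<dots> = ShA T f \<cdot> (ShA T a \<cdot> k0'')"
      using A B ia a b fg by (simp add: uv(9) comp_reduce[OF Ssq])
    also have "\<dots> = (ShA T f \<cdot> k'') \<cdot> r"
      using B r(2-4) by (simp add: r(6))
    finally show "(g'' \<cdot> v) \<cdot> r = (ShA T f \<cdot> k'') \<cdot> r" .
  qed (use v B r(2-4) in simp_all)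
  have s: "is_seq T (ShO T) (u, v, ShA T f' \<cdot> g'')"
    using u v B by (simp add: is_seq_iff)
  have Sp: "ShA T p \<cdot> ShA T f0' = ShA T f' \<cdot> ShA T b"
    using arg_cong[OF p(5), of "ShA T"] A B ia b p(2-4) by (simp add: sh_comp)
  have "seq_morphism T (ShA T) (u0, v0, ShA T f0' \<cdot> g0'') (u, v, ShA T f' \<cdot> g'') (p, r, q)"
    using u v A B ia b p(2-4) q(2-4) r(2-4) uv' uv(2-5) up vr
    by (simp add: seq_morphism_iff comp_reduce[OF Sp] q(6))
  then have "seq_isomorphic T (ShO T) (ShA T) (u0, v0, ShA T f0' \<cdot> g0'') (u, v, ShA T f' \<cdot> g'')"
    by (rule seq_isomorphicI[OF tri_seq[OF uv(1)] s]) (use p q r in auto)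
  then have "(u, v, ShA T f' \<cdot> g'') \<in> Tri T"
    by (rule tri_iso[OF uv(1) seq_isomorphic_sym])
  then show ?thesis
    using 1 2 3 4 by blast
qed

end

section \<open>Vanishing of morphisms and thick subcategories\<close>

context additive_shift begin

lemma unshift_iso:
  assumes "X \<in> Obj T"
  shows "unshift T X \<in> Obj T" "isomorphic T (ShO T (unshift T X)) X"
proof -
  have "\<exists>Y. Y \<in> Obj T \<and> isomorphic T (ShO T Y) X"
    using sh_es assms unfolding ess_surj_def by blast
  from someI_ex[OF this] show "unshift T X \<in> Obj T" "isomorphic T (ShO T (unshift T X)) X"
    unfolding unshift_def by auto
qed

lemma hom_vanishI: "\<lbrakk>X \<in> Obj T; Y \<in> Obj T; \<And>f. \<lbrakk>f \<in> Arr T; Dom T f = X; Cod T f = Y\<rbrakk> \<Longrightarrow> f = Zero T X Y\<rbrakk>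
  \<Longrightarrow> hom_vanish T X Y"
  unfolding hom_vanish_def by auto

lemma hom_vanishD:
  assumes "hom_vanish T X Y" "f \<in> Arr T" "Dom T f = X" "Cod T f = Y"
  shows "f = Zero T X Y"
proof -
  have "f \<in> Hom T X Y"
    using assms by simp
  then show ?thesis
    using assms(1) unfolding hom_vanish_def by blast
qed

lemma hom_vanish_iso:
  assumes v: "hom_vanish T X Y" and i: "isomorphic T X X'" "isomorphic T Y Y'" 
  shows "hom_vanish T X' Y'"
proof -
  obtain a a' where a: "inverse_pair T a a'" "Dom T a = X" "Cod T a = X'"
    using i(1) by (rule isomorphicE)
  obtain b b' where b: "inverse_pair T b b'" "Dom T b = Y" "Cod T b = Y'"
    using i(2) by (rule isomorphicE)
  note ac = inverse_pair_cancel[OF a(1)] and bc = inverse_pair_cancel[OF b(1)]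
  have ob: "X' \<in> Obj T" "Y' \<in> Obj T" "X \<in> Obj T" "Y \<in> Obj T"
    using dom_obj[OF ac(5)] cod_obj[OF ac(5)] dom_obj[OF bc(5)] cod_obj[OF bc(5)] a b by auto
  show ?thesis
  proof (rule hom_vanishI[OF ob(1,2)])
    fix f assume f: "f \<in> Arr T" "Dom T f = X'" "Cod T f = Y'"
    have "b' \<cdot> (f \<cdot> a) = Zero T X Y"
      by (rule hom_vanishD[OF v]) (use f a(2,3) b(2,3) ac(5-8) bc(5-8) in simp_all)
    then have "b \<cdot> ((b' \<cdot> (f \<cdot> a)) \<cdot> a') = b \<cdot> (Zero T X Y \<cdot> a')"
      by simp
    then show "f = Zero T X' Y'"
      using f a(2,3) b(2,3) ac bc ob by simp
  qed
qed

lemma hom_vanish_shift: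
  assumes ob: "X \<in> Obj T" "Y \<in> Obj T"
  shows "hom_vanish T (So n X) (So n Y) \<longleftrightarrow> hom_vanish T X Y"
proof (induction n)
  case (Suc n)
  have "hom_vanish T (ShO T A) (ShO T B) \<longleftrightarrow> hom_vanish T A B" if AB: "A \<in> Obj T" "B \<in> Obj T" for A B
  proof
    assume v: "hom_vanish T A B"
    show "hom_vanish T (ShO T A) (ShO T B)"
    proof (rule hom_vanishI)
      fix k assume "k \<in> Arr T" "Dom T k = ShO T A" "Cod T k = ShO T B"
      then obtain f where "f \<in> Arr T" "Dom T f = A" "Cod T f = B" "ShA T f = k"
        using sh_full[OF AB] by blast
      then show "k = Zero T (ShO T A) (ShO T B)"
        using hom_vanishD[OF v, of f] AB by auto
    qed (use AB in simp_all)
  next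
    assume v: "hom_vanish T (ShO T A) (ShO T B)"
    show "hom_vanish T A B"
    proof (rule hom_vanishI[OF AB])
      fix f assume f: "f \<in> Arr T" "Dom T f = A" "Cod T f = B"
      have "ShA T f = ShA T (Zero T A B)"
        using hom_vanishD[OF v, of "ShA T f"] f AB by simp
      then show "f = Zero T A B"
        by (rule sh_faithful[rotated 4]) (use f AB in simp_all)
    qed
  qed
  then show ?case
    using Suc ob by simp
qed simp

lemma So_add: "So m (So n X) = So (m + n) X"
  by (simp add: funpow_add)

lemma So_Suc: "So n (ShO T X) = So (Suc n) X"
  by (simp add: funpow_swap1)

lemma unshift_n:
  assumes "X \<in> Obj T"
  shows "(unshift T ^^ n) X \<in> Obj T \<and> isomorphic T (So n ((unshift T ^^ n) X)) X"
proof (induction n)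
  case 0
  then show ?case
    using assms isomorphic_refl by simp
next
  case (Suc n)
  let ?Y = "(unshift T ^^ n) X"
  have Y: "?Y \<in> Obj T" "isomorphic T (So n ?Y) X"
    using Suc by auto
  have "isomorphic T (So n (ShO T (unshift T ?Y))) (So n ?Y)"
    by (rule So_isomorphic[OF unshift_iso(2)[OF Y(1)]])
  then have "isomorphic T (So n (ShO T (unshift T ?Y))) X"
    by (rule isomorphic_trans[OF _ Y(2)])
  then show ?case
    using unshift_iso(1)[OF Y(1)] by (simp add: So_Suc)
qed

text \<open>Negative shifts are chosen only up to isomorphism. Moving them to the other argument
  describes the perpendicular classes by iterates of \<open>ShO T\<close> alone.\<close>

lemma hom_vanish_neg_shift:
  assumes ob: "A \<in> Obj T" "X \<in> Obj T"
  shows "hom_vanish T (shift T A (- int n)) X \<longleftrightarrow> hom_vanish T A (So n X)"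
proof -
  let ?A = "(unshift T ^^ n) A"
  have A: "?A \<in> Obj T" "isomorphic T (So n ?A) A"
    using unshift_n[OF ob(1)] by auto
  have "shift T A (- int n) = ?A"
    by (cases "n = 0") (simp_all add: shift_def)
  then have "hom_vanish T (shift T A (- int n)) X \<longleftrightarrow> hom_vanish T (So n ?A) (So n X)"
    using hom_vanish_shift[OF A(1) ob(2)] by simp
  also have "\<dots> \<longleftrightarrow> hom_vanish T A (So n X)"
    using hom_vanish_iso[OF _ A(2) isomorphic_refl] hom_vanish_iso[OF _ isomorphic_sym[OF A(2)]
      isomorphic_refl] ob So_obj
    by blast
  finally show ?thesis .
qed

lemma shift_int: "shift T X (int n) = So n X"
  by (simp add: shift_def)

text \<open>\<open>Suc n\<close> runs through the positive degrees as natural numbers, which makes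
  induction on the degree available.\<close>

lemma left_perp_iff:
  "X \<in> left_perp T P \<longleftrightarrow> X \<in> Obj T \<and> (\<forall>n. \<forall>A\<in>P. hom_vanish T X (So (Suc n) A))"
proof -
  have "(\<forall>i>0. \<forall>A\<in>P. hom_vanish T X (shift T A i)) \<longleftrightarrow> (\<forall>n. \<forall>A\<in>P. hom_vanish T X (So (Suc n) A))"
  proof (intro iffI allI impI)
    fix n assume "\<forall>i>0. \<forall>A\<in>P. hom_vanish T X (shift T A i)"
    then have "\<forall>A\<in>P. hom_vanish T X (shift T A (int (Suc n)))"
      by simp
    then show "\<forall>A\<in>P. hom_vanish T X (So (Suc n) A)"
      unfolding shift_int .
  next
    fix i :: int assume "i > 0" and h: "\<forall>n. \<forall>A\<in>P. hom_vanish T X (So (Suc n) A)"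
    then obtain n where "i = int (Suc n)"
      by (metis gr0_conv_Suc zero_less_imp_eq_int)
    then show "\<forall>A\<in>P. hom_vanish T X (shift T A i)"
      using h shift_int by metis
  qed
  then show ?thesis
    by (simp add: left_perp_def)
qed

lemma right_perp_iff:
  assumes "P \<subseteq> Obj T"
  shows "X \<in> right_perp T P \<longleftrightarrow> X \<in> Obj T \<and> (\<forall>n. \<forall>A\<in>P. hom_vanish T A (So (Suc n) X))"
proof (cases "X \<in> Obj T")
  case True
  have "(\<forall>i<0. \<forall>A\<in>P. hom_vanish T (shift T A i) X) \<longleftrightarrow> (\<forall>n. \<forall>A\<in>P. hom_vanish T A (So (Suc n) X))"
  proof (intro iffI allI impI)
    fix n assume "\<forall>i<0. \<forall>A\<in>P. hom_vanish T (shift T A i) X"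
    then have "\<forall>A\<in>P. hom_vanish T (shift T A (- int (Suc n))) X"
      by simp
    then show "\<forall>A\<in>P. hom_vanish T A (So (Suc n) X)"
      using hom_vanish_neg_shift[OF _ True] assms by blast
  next
    fix i :: int assume "i < 0" and h: "\<forall>n. \<forall>A\<in>P. hom_vanish T A (So (Suc n) X)"
    then obtain n where "i = - int (Suc n)"
      by (metis gr0_conv_Suc zero_less_imp_eq_int neg_0_less_iff_less add.inverse_inverse)
    then show "\<forall>A\<in>P. hom_vanish T (shift T A i) X"
      using h hom_vanish_neg_shift[OF _ True] assms by blast
  qed
  then show ?thesis
    by (simp add: right_perp_def)
qed (simp add: right_perp_def)

end

context pretriangulated begin

text \<open>Hom(A, -) of the triangle shifted \<open>n\<close> times is exact, and the wanted group
  sits between the two that vanish.\<close>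

lemma vanish_covariant:
  assumes t: "(f, g, h) \<in> Tri T" and v: "hom_vanish T A (So n (Cod T f))"
    "hom_vanish T A (So (Suc n) (Dom T f))"
    and A: "A \<in> Obj T"
  shows "hom_vanish T A (So n (Cod T g))"
proof (rule hom_vanishI[OF A])
  note a = tri_arr[OF t]
  show "So n (Cod T g) \<in> Obj T"
    using a by simp
  fix x assume x: "x \<in> Arr T" "Dom T x = A" "Cod T x = So n (Cod T g)"
  obtain h' where t': "(Sa n f, Sa n g, h') \<in> Tri T"
    using tri_shift_n[OF t] by blast
  note b = tri_arr[OF t']
  have "h' \<cdot> x = Zero T A (So (Suc n) (Dom T f))"
    by (rule hom_vanishD[OF v(2)]) (use a b x in simp_all)
  then obtain z where z: "z \<in> Arr T" "Dom T z = A" "Cod T z = So n (Cod T f)" "Sa n g \<cdot> z = x"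
    using hom_exactE[OF tri_exact2[OF t'], of x] a b x by auto
  have "z = Zero T A (So n (Cod T f))"
    by (rule hom_vanishD[OF v(1) z(1-3)])
  then show "x = Zero T A (So n (Cod T g))"
    using z(4) a A by simp
qed

lemma vanish_contravariant:
  assumes t: "(f, g, h) \<in> Tri T" and v: "hom_vanish T (Cod T f) B"
    "hom_vanish T (ShO T (Dom T f)) B" and B: "B \<in> Obj T"
  shows "hom_vanish T (Cod T g) B"
proof (rule hom_vanishI[OF _ B])
  note a = tri_arr[OF t]
  show "Cod T g \<in> Obj T"
    using a by simp
  fix x assume x: "x \<in> Arr T" "Dom T x = Cod T g" "Cod T x = B"
  have "x \<cdot> g = Zero T (Cod T f) B"
    by (rule hom_vanishD[OF v(1)]) (use a x in simp_all)
  then obtain z where z: "z \<in> Arr T" "Dom T z = ShO T (Dom T f)" "Cod T z = B" "z \<cdot> h = x"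
    using tri_extend2[OF t x(1,2)] a x by auto
  have "z = Zero T (ShO T (Dom T f)) B"
    by (rule hom_vanishD[OF v(2) z(1-3)])
  then show "x = Zero T (Cod T g) B"
    using z(4) a B by simp
qed

text \<open>\<open>tri_extend3\<close> solves the problem one shift higher, for
  \<open>ShA T x\<close>; the solution is then desuspended.\<close>

lemma tri_extend0:
  assumes t: "(f, g, h) \<in> Tri T" and x: "x \<in> Arr T" "Dom T x = Dom T f"
    "ShA T x \<cdot> h = Zero T (Cod T g) (ShO T (Cod T x))"
  obtains z where "z \<in> Arr T" "Dom T z = Cod T f" "Cod T z = Cod T x" "z \<cdot> f = x"
proof -
  note a = tri_arr[OF t]
  obtain y where y: "y \<in> Arr T" "Dom T y = ShO T (Cod T f)" "Cod T y = ShO T (Cod T x)" "y \<cdot> ShA T f = ShA T x"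
    by (rule tri_extend3[OF t, of "ShA T x"]) (use x a in simp_all)
  have ob: "Cod T f \<in> Obj T" "Cod T x \<in> Obj T"
    using a x cod_obj by auto
  obtain z where z: "z \<in> Arr T" "Dom T z = Cod T f" "Cod T z = Cod T x" "ShA T z = y"
    using sh_full[OF ob y(1-3)] by blast
  have "ShA T (z \<cdot> f) = ShA T x"
    using z y a by (simp add: sh_comp)
  then have "z \<cdot> f = x"
    by (rule sh_faithful[rotated 4]) (use z a x in simp_all)
  then show ?thesis
    using that z by blast
qed

end

section \<open>Thick closures\<close>

context triangulated_category begin

lemma Obj_triangulated_subcategory: "triangulated_subcategory T (Obj T)"
  unfolding triangulated_subcategory_def iso_closed_def
proof (intro conjI ballI allI impI)
  show "shift T X 1 \<in> Obj T" if "X \<in> Obj T" for X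
    using that shift_int[of X 1] by simp
  show "shift T X (- 1) \<in> Obj T" if "X \<in> Obj T" for X
    using unshift_iso(1)[OF that] by (simp add: shift_def)
  show "case t of (f, g, h) \<Rightarrow> Dom T f \<in> Obj T \<and> Cod T f \<in> Obj T \<longrightarrow> Cod T g \<in> Obj T" if "t \<in> Tri T" for t
    using that tri_arr(2) cod_obj by (cases t) auto
qed (use zero_object_obj in auto)

lemma Obj_summand_closed: "summand_closed T (Obj T)"
  unfolding summand_closed_def biproduct_def by blast

lemma thick_least: "\<lbrakk>S \<subseteq> D; triangulated_subcategory T D; summand_closed T D\<rbrakk> \<Longrightarrow> thick T S \<subseteq> D"
  unfolding thick_def by blast

lemma thick_superset: "S \<subseteq> thick T S"
  unfolding thick_def by blast

text \<open>Every closure condition passes to intersections. The hypothesis on \<open>S\<close>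
  makes \<open>Obj T\<close> a member of the intersected family, which keeps the intersection inside
  \<open>Obj T\<close>.\<close>

lemma thick_triangulated:
  assumes S: "S \<subseteq> Obj T"
  shows "triangulated_subcategory T (thick T S)"
proof -
  let ?F = "{D. S \<subseteq> D \<and> triangulated_subcategory T D \<and> summand_closed T D}"
  have F: "iso_closed T D" "\<And>M. zero_object T M \<Longrightarrow> M \<in> D" "\<And>X. X \<in> D \<Longrightarrow> shift T X 1 \<in> D \<and> shift T X (- 1) \<in> D"
    "\<And>f g h. \<lbrakk>(f, g, h) \<in> Tri T; Dom T f \<in> D; Cod T f \<in> D\<rbrakk> \<Longrightarrow> Cod T g \<in> D" if "D \<in> ?F" for D
    using that unfolding triangulated_subcategory_def by blast+
  have in_thick: "X \<in> thick T S \<longleftrightarrow> (\<forall>D\<in>?F. X \<in> D)" for X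
    unfolding thick_def by blast
  show ?thesis
    unfolding triangulated_subcategory_def
  proof (intro conjI allI impI ballI)
    show "thick T S \<subseteq> Obj T"
      by (rule thick_least[OF S Obj_triangulated_subcategory Obj_summand_closed])
    show "iso_closed T (thick T S)"
      unfolding iso_closed_def
    proof (intro ballI impI)
      fix X Y assume h: "X \<in> thick T S" "Y \<in> Obj T" "isomorphic T X Y"
      show "Y \<in> thick T S"
        unfolding in_thick
      proof
        fix D assume D: "D \<in> ?F"
        then show "Y \<in> D"
          using F(1)[OF D] h unfolding in_thick iso_closed_def by blast
      qed
    qed
    show "M \<in> thick T S" if "zero_object T M" for M
      unfolding in_thick using F(2) that by blast
    fix X assume X: "X \<in> thick T S"
    show "shift T X 1 \<in> thick T S" "shift T X (- 1) \<in> thick T S"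
      unfolding in_thick using F(3) X[unfolded in_thick] by blast+
  next
    fix t assume t: "t \<in> Tri T"
    obtain f g h where e: "t = (f, g, h)"
      by (cases t)
    have "Cod T g \<in> thick T S" if "Dom T f \<in> thick T S" "Cod T f \<in> thick T S"
      unfolding in_thick
    proof
      fix D assume D: "D \<in> ?F"
      show "Cod T g \<in> D"
        by (rule F(4)[OF D t[unfolded e]]) (use that D in \<open>simp_all add: in_thick\<close>)
    qed
    then show "case t of (f, g, h) \<Rightarrow> Dom T f \<in> thick T S \<and> Cod T f \<in> thick T S \<longrightarrow> Cod T g \<in> thick T S"
      by (simp add: e)
  qed
qed

end

lemma (in preadditive_category) biproductE:
  assumes "biproduct C A B M"
  obtains i j p q where "i \<in> Arr C" "Dom C i = A" "Cod C i = M" "j \<in> Arr C" "Dom C j = B" "Cod C j = M"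
      "p \<in> Arr C" "Dom C p = M" "Cod C p = A" "q \<in> Arr C" "Dom C q = M" "Cod C q = B"
      "p \<cdot> i = Ident C A" "q \<cdot> j = Ident C B" "p \<cdot> j = Zero C B A" "q \<cdot> i = Zero C A B"
      "(i \<cdot> p) \<boxplus> (j \<cdot> q) = Ident C M" "A \<in> Obj C" "B \<in> Obj C" "M \<in> Obj C"
  using assms unfolding biproduct_def by auto

context additive_shift begin

lemma So_biproduct: "biproduct T A B M \<Longrightarrow> biproduct T (So n A) (So n B) (So n M)"
  by (induction n) (simp_all add: sh.map_biproduct)

lemma hom_vanish_biproduct:
  assumes b: "biproduct T A B M"
  shows "\<lbrakk>hom_vanish T A Y; hom_vanish T B Y; Y \<in> Obj T\<rbrakk> \<Longrightarrow> hom_vanish T M Y"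
    and "\<lbrakk>hom_vanish T Y A; hom_vanish T Y B; Y \<in> Obj T\<rbrakk> \<Longrightarrow> hom_vanish T Y M"
proof -
  obtain i j p q where a: "i \<in> Arr T" "Dom T i = A" "Cod T i = M" "j \<in> Arr T" "Dom T j = B" "Cod T j = M"
      "p \<in> Arr T" "Dom T p = M" "Cod T p = A" "q \<in> Arr T" "Dom T q = M" "Cod T q = B"
      and e: "(i \<cdot> p) \<boxplus> (j \<cdot> q) = Ident T M" and ob: "A \<in> Obj T" "B \<in> Obj T" "M \<in> Obj T"
    using b by (rule biproductE)
  {
    assume v: "hom_vanish T A Y" "hom_vanish T B Y" and Y: "Y \<in> Obj T"
    show "hom_vanish T M Y"
    proof (rule hom_vanishI[OF ob(3) Y])
      fix f assume f: "f \<in> Arr T" "Dom T f = M" "Cod T f = Y"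
      have z: "f \<cdot> i = Zero T A Y" "f \<cdot> j = Zero T B Y"
        by (rule hom_vanishD[OF v(1)] hom_vanishD[OF v(2)]; use f a in simp)+
      have "f = f \<cdot> ((i \<cdot> p) \<boxplus> (j \<cdot> q))"
        unfolding e using f by simp
      also have "\<dots> = Zero T M Y"
        using f a ob Y by (simp add: comp_add comp_reduce[OF z(1)] comp_reduce[OF z(2)])
      finally show "f = Zero T M Y" .
    qed
  next
    assume v: "hom_vanish T Y A" "hom_vanish T Y B" and Y: "Y \<in> Obj T"
    show "hom_vanish T Y M"
    proof (rule hom_vanishI[OF Y ob(3)])
      fix f assume f: "f \<in> Arr T" "Dom T f = Y" "Cod T f = M"
      have z: "p \<cdot> f = Zero T Y A" "q \<cdot> f = Zero T Y B"
        by (rule hom_vanishD[OF v(1)] hom_vanishD[OF v(2)]; use f a in simp)+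
      have "f = ((i \<cdot> p) \<boxplus> (j \<cdot> q)) \<cdot> f"
        unfolding e using f by simp
      also have "\<dots> = Zero T Y M"
        using f a ob Y by (simp add: add_comp z)
      finally show "f = Zero T Y M" .
    qed
  }
qed

end

context triangulated_category begin

lemma octahedron:
  assumes fg: "Cod T f = Dom T g" and t: "(f, f', f'') \<in> Tri T" "(g, g', g'') \<in> Tri T"
    "(g \<cdot> f, k', k'') \<in> Tri T"
  obtains u v where "(u, v, ShA T f' \<cdot> g'') \<in> Tri T" "u \<in> Arr T" "v \<in> Arr T"
    "Dom T u = Cod T f'" "Cod T u = Cod T k'" "Dom T v = Cod T k'" "Cod T v = Cod T g'"
    "u \<cdot> f' = k' \<cdot> g" "k'' \<cdot> u = f''" "v \<cdot> k' = g'" "g'' \<cdot> v = ShA T f \<cdot> k''"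
proof -
  obtain u v where uv: "(u, v, ShA T f' \<cdot> g'') \<in> Tri T"
      "u \<cdot> f' = k' \<cdot> g" "k'' \<cdot> u = f''" "v \<cdot> k' = g'" "g'' \<cdot> v = ShA T f \<cdot> k''"
    using tri_octahedral[OF fg t] by blast
  note A = tri_arr[OF uv(1)]
  have a: "f \<in> Arr T" "f' \<in> Arr T" "f'' \<in> Arr T" "g \<in> Arr T" "g' \<in> Arr T" "g'' \<in> Arr T" "k'' \<in> Arr T"
      "Cod T f' = Dom T f''" "Cod T g' = Dom T g''" "Cod T k' = Dom T k''" "Cod T k'' = ShO T (Dom T f)"
      "Cod T g'' = ShO T (Dom T g)" "Dom T f' = Dom T g"
    using tri_arr[OF t(1)] tri_arr[OF t(2)] tri_arr[OF t(3)] fg by simp_all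
  have 1: "Cod T v = Cod T g'"
    using A(5) a fg by simp
  text \<open>The last two equations force the types of \<open>v\<close> and \<open>u\<close>, which the axiom does not state.\<close>
  have "Dom T (g'' \<cdot> v) = Dom T (ShA T f \<cdot> k'')"
    using uv(5) by simp
  then have 2: "Dom T v = Cod T k'"
    using A 1 a fg by simp
  have "Dom T (k'' \<cdot> u) = Dom T f''"
    using uv(3) by simp
  then have 3: "Dom T u = Cod T f'"
    using A 2 a by simp
  show ?thesis
    using that[OF uv(1) A(1,2) 3 _ 2 1 uv(2-5)] A(4) 2 by simp
qed

end

section \<open>Transport of a triangulated structure\<close>

text \<open>\<open>\<phi>\<close> compares the two shifts. Its naturality determines
  \<open>ShA C\<close> on arrows, so functoriality, additivity and invertibility of the shift are
  derived in this locale instead of being checked on a concrete description of it.\<close>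

locale shift_transport = C: additive_category C + additive_functor C D Fo Fa + D: triangulated_category D
  for C :: "('o, 'm, 'x) triang_data_scheme" and D :: "('p, 'n, 'y) triang_data_scheme"
    and Fo :: "'o \<Rightarrow> 'p" and Fa :: "'m \<Rightarrow> 'n" +
  fixes \<phi> :: "'o \<Rightarrow> 'n"
  assumes ff: "full_faithful C D Fo Fa"
    and es: "ess_surj C D Fo"
    and shO_obj [simp]: "X \<in> Obj C \<Longrightarrow> ShO C X \<in> Obj C"
    and shA_hom: "f \<in> Hom C X Y \<Longrightarrow> ShA C f \<in> Hom C (ShO C X) (ShO C Y)"
    and phi_hom: "X \<in> Obj C \<Longrightarrow> \<phi> X \<in> Hom D (Fo (ShO C X)) (ShO D (Fo X))"
    and phi_iso: "X \<in> Obj C \<Longrightarrow> iso_arrow D (\<phi> X)"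
    and phi_natural: "f \<in> Arr C \<Longrightarrow> \<phi> (Cod C f) \<cdot>\<^bsub>D\<^esub> Fa (ShA C f) = ShA D (Fa f) \<cdot>\<^bsub>D\<^esub> \<phi> (Dom C f)"
begin

lemma shA_arr [simp]: "f \<in> Arr C \<Longrightarrow> ShA C f \<in> Arr C"
  and dom_shA [simp]: "f \<in> Arr C \<Longrightarrow> Dom C (ShA C f) = ShO C (Dom C f)"
  and cod_shA [simp]: "f \<in> Arr C \<Longrightarrow> Cod C (ShA C f) = ShO C (Cod C f)"
  using shA_hom[of f "Dom C f" "Cod C f"] by simp_all

lemma phi_arr [simp]: "X \<in> Obj C \<Longrightarrow> \<phi> X \<in> Arr D"
  and dom_phi [simp]: "X \<in> Obj C \<Longrightarrow> Dom D (\<phi> X) = Fo (ShO C X)"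
  and cod_phi [simp]: "X \<in> Obj C \<Longrightarrow> Cod D (\<phi> X) = ShO D (Fo X)"
  using phi_hom by simp_all

lemmas faithful = full_faithfulD(1)[OF ff]
lemmas full = full_faithfulD(2)[OF ff]

text \<open>\<open>\<phi> Y\<close> is invertible and \<open>Fa\<close> is faithful, so at most one
  arrow makes the naturality square commute. Identities for the shift are obtained by checking this
  square.\<close>

lemma shA_unique:
  assumes f: "f \<in> Arr C" "Dom C f = X" "Cod C f = Y"
    and u: "u \<in> Arr C" "Dom C u = ShO C X" "Cod C u = ShO C Y"
    and eq: "\<phi> Y \<cdot>\<^bsub>D\<^esub> Fa u = ShA D (Fa f) \<cdot>\<^bsub>D\<^esub> \<phi> X"
  shows "ShA C f = u"
proof (rule faithful)
  have ob: "X \<in> Obj C" "Y \<in> Obj C"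
    using f C.dom_obj C.cod_obj by auto
  have "\<phi> Y \<cdot>\<^bsub>D\<^esub> Fa (ShA C f) = \<phi> Y \<cdot>\<^bsub>D\<^esub> Fa u"
    using phi_natural[OF f(1)] f eq by simp
  then show "Fa (ShA C f) = Fa u"
    by (rule cod.iso_cancel_left[OF phi_iso[OF ob(2)]]) (use f u ob in simp_all)
qed (use f u in simp_all)

lemma shift_functor: "additive_functor C C (ShO C) (ShA C)"
proof unfold_locales
  fix X assume X: "X \<in> Obj C"
  show "ShO C X \<in> Obj C"
    using X by simp
  show "ShA C (Ident C X) = Ident C (ShO C X)"
    by (rule shA_unique[of _ X X]) (use X in simp_all)
next
  fix f X Y g Z assume f: "f \<in> Hom C X Y" and g: "g \<in> Hom C Y Z"
  have ob: "X \<in> Obj C" "Y \<in> Obj C" "Z \<in> Obj C"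
    using f g C.dom_obj C.cod_obj by auto
  have nf: "\<phi> Y \<cdot>\<^bsub>D\<^esub> Fa (ShA C f) = ShA D (Fa f) \<cdot>\<^bsub>D\<^esub> \<phi> X"
    and ng: "\<phi> Z \<cdot>\<^bsub>D\<^esub> Fa (ShA C g) = ShA D (Fa g) \<cdot>\<^bsub>D\<^esub> \<phi> Y"
    using phi_natural[of f] phi_natural[of g] f g by auto
  show "ShA C (g \<cdot>\<^bsub>C\<^esub> f) = ShA C g \<cdot>\<^bsub>C\<^esub> ShA C f"
  proof (rule shA_unique[of _ X Z])
    show "\<phi> Z \<cdot>\<^bsub>D\<^esub> Fa (ShA C g \<cdot>\<^bsub>C\<^esub> ShA C f) = ShA D (Fa (g \<cdot>\<^bsub>C\<^esub> f)) \<cdot>\<^bsub>D\<^esub> \<phi> X"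
      using f g ob by (simp add: map_comp' D.sh_comp cod.comp_reduce[OF ng] nf)
  qed (use f g in simp_all)
next
  show "additive_maps C C (ShO C) (ShA C)"
    unfolding additive_maps_def
  proof (intro ballI homI)
    fix X Y f g assume ob: "X \<in> Obj C" "Y \<in> Obj C"
      and "f \<in> carrier (hom_group C X Y)" "g \<in> carrier (hom_group C X Y)"
    then have f: "f \<in> Hom C X Y" and g: "g \<in> Hom C X Y"
      by simp_all
    have nf: "\<phi> Y \<cdot>\<^bsub>D\<^esub> Fa (ShA C f) = ShA D (Fa f) \<cdot>\<^bsub>D\<^esub> \<phi> X"
      and ng: "\<phi> Y \<cdot>\<^bsub>D\<^esub> Fa (ShA C g) = ShA D (Fa g) \<cdot>\<^bsub>D\<^esub> \<phi> X"
      using phi_natural[of f] phi_natural[of g] f g by auto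
    have "ShA C (f \<boxplus>\<^bsub>C\<^esub> g) = ShA C f \<boxplus>\<^bsub>C\<^esub> ShA C g"
    proof (rule shA_unique[of _ X Y])
      show "\<phi> Y \<cdot>\<^bsub>D\<^esub> Fa (ShA C f \<boxplus>\<^bsub>C\<^esub> ShA C g) = ShA D (Fa (f \<boxplus>\<^bsub>C\<^esub> g)) \<cdot>\<^bsub>D\<^esub> \<phi> X"
        using f g ob by (simp add: map_add D.sh.map_add cod.comp_add cod.add_comp nf ng)
    qed (use f g in simp_all)
    then show "ShA C (f \<otimes>\<^bsub>hom_group C X Y\<^esub> g) = ShA C f \<otimes>\<^bsub>hom_group C (ShO C X) (ShO C Y)\<^esub> ShA C g"
      by simp
  qed simp
qed (use shA_hom in blast)

lemma shift_eq: "cat_equivalence C C (ShO C) (ShA C)"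
proof -
  interpret sh: additive_functor C C "ShO C" "ShA C"
    by (rule shift_functor)
  have 1: "full_faithful C C (ShO C) (ShA C)"
    unfolding full_faithful_def bij_betw_def
  proof (intro ballI conjI inj_onI equalityI subsetI)
    fix X Y f g assume ob: "X \<in> Obj C" "Y \<in> Obj C" and f: "f \<in> Hom C X Y" and g: "g \<in> Hom C X Y"
      and eq: "ShA C f = ShA C g"
    have "ShA D (Fa f) \<cdot>\<^bsub>D\<^esub> \<phi> X = ShA D (Fa g) \<cdot>\<^bsub>D\<^esub> \<phi> X"
      using phi_natural[of f] phi_natural[of g] f g eq by simp
    then have "ShA D (Fa f) = ShA D (Fa g)"
      by (rule cod.iso_cancel_right[OF phi_iso[OF ob(1)]]) (use f g ob in simp_all)
    then have "Fa f = Fa g"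
      by (rule D.sh_faithful[rotated 4]) (use f g in simp_all)
    then show "f = g"
      by (rule faithful[rotated 4]) (use f g in simp_all)
  next
    fix X Y k assume ob: "X \<in> Obj C" "Y \<in> Obj C" and "k \<in> Hom C (ShO C X) (ShO C Y)"
    then have k: "k \<in> Arr C" "Dom C k = ShO C X" "Cod C k = ShO C Y"
      by auto
    obtain \<psi> where "inverse_pair D (\<phi> X) \<psi>"
      using phi_iso[OF ob(1)] by (rule iso_arrowE)
    note \<psi> = cod.inverse_pair_cancel[OF this]
    \<comment> \<open>Carry \<open>k\<close> to \<open>D\<close>, conjugate it by
      \<open>\<phi>\<close> into an arrow between shifts, and desuspend it there.\<close>
    obtain m where m: "m \<in> Arr D" "Dom D m = Fo X" "Cod D m = Fo Y" "ShA D m = \<phi> Y \<cdot>\<^bsub>D\<^esub> (Fa k \<cdot>\<^bsub>D\<^esub> \<psi>)"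
      using D.sh_full[of "Fo X" "Fo Y" "\<phi> Y \<cdot>\<^bsub>D\<^esub> (Fa k \<cdot>\<^bsub>D\<^esub> \<psi>)"] ob k \<psi> by auto
    obtain f where f: "f \<in> Arr C" "Dom C f = X" "Cod C f = Y" "Fa f = m"
      using full[OF ob m(1-3)] by blast
    have "ShA C f = k"
      by (rule shA_unique[OF f(1-3) k]) (use m f k ob \<psi> in simp)
    then show "k \<in> ShA C ` Hom C X Y"
      using f by force
  qed (use shA_hom in auto)
  have 2: "ess_surj C C (ShO C)"
    unfolding ess_surj_def
  proof
    fix Y assume Y: "Y \<in> Obj C"
    obtain W where W: "W \<in> Obj D" "isomorphic D (ShO D W) (Fo Y)"
      using D.sh_es Y unfolding ess_surj_def by (meson map_obj)
    obtain X where X: "X \<in> Obj C" "isomorphic D (Fo X) W"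
      using es W(1) unfolding ess_surj_def by blast
    have "isomorphic D (Fo (ShO C X)) (ShO D (Fo X))"
      unfolding isomorphic_def using phi_hom[OF X(1)] phi_iso[OF X(1)] by blast
    moreover have "isomorphic D (ShO D (Fo X)) (ShO D W)"
      by (rule D.sh.map_isomorphic[OF X(2)])
    ultimately have "isomorphic D (Fo (ShO C X)) (Fo Y)"
      using cod.isomorphic_trans W(2) by blast
    then show "\<exists>X\<in>Obj C. isomorphic C (ShO C X) Y"
      using full_faithful_reflects_isomorphic[OF ff _ Y] X(1) shO_obj by blast
  qed
  show ?thesis
    using 1 2 sh.cat_functor_axioms by (simp add: cat_equivalence_iff)
qed

sublocale C_sh: additive_shift C
  by unfold_locales (use shift_eq shift_functor in \<open>simp_all add: additive_functor_def
    additive_functor_axioms_def\<close>)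

text \<open>Only the third square involves the shift; naturality moves \<open>\<phi>\<close> past it
  and invertibility cancels \<open>\<phi>\<close>.\<close>

lemma map_seq_morphism:
  assumes s: "is_seq C (ShO C) (f, g, h)" "is_seq C (ShO C) (f', g', h')"
    and c: "a \<in> Hom C (Dom C f) (Dom C f')" "b \<in> Hom C (Dom C g) (Dom C g')" "c \<in> Hom C (Dom C h) (Dom C h')"
  shows "seq_morphism C (ShA C) (f, g, h) (f', g', h') (a, b, c) \<longleftrightarrow>
    seq_morphism D (ShA D) (Fa f, Fa g, \<phi> (Dom C f) \<cdot>\<^bsub>D\<^esub> Fa h) (Fa f', Fa g', \<phi> (Dom C f') \<cdot>\<^bsub>D\<^esub> Fa h')
      (Fa a, Fa b, Fa c)"
proof -
  have s': "f \<in> Arr C" "g \<in> Arr C" "h \<in> Arr C" "Cod C f = Dom C g" "Cod C g = Dom C h"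
    "Cod C h = ShO C (Dom C f)"
     "f' \<in> Arr C" "g' \<in> Arr C" "h' \<in> Arr C" "Cod C f' = Dom C g'" "Cod C g' = Dom C h'"
     "Cod C h' = ShO C (Dom C f')"
    using s by (auto simp: is_seq_iff)
  have c': "a \<in> Arr C" "Dom C a = Dom C f" "Cod C a = Dom C f'" "b \<in> Arr C" "Dom C b = Dom C g"
    "Cod C b = Dom C g'"
     "c \<in> Arr C" "Dom C c = Dom C h" "Cod C c = Dom C h'"
    using c by auto
  have ob: "Dom C f \<in> Obj C" "Dom C f' \<in> Obj C"
    using s' C.dom_obj by auto
  have n: "\<phi> (Dom C f') \<cdot>\<^bsub>D\<^esub> Fa (ShA C a) = ShA D (Fa a) \<cdot>\<^bsub>D\<^esub> \<phi> (Dom C f)"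
    using phi_natural[OF c'(1)] c' by simp
  have 1: "b \<cdot>\<^bsub>C\<^esub> f = f' \<cdot>\<^bsub>C\<^esub> a \<longleftrightarrow> Fa b \<cdot>\<^bsub>D\<^esub> Fa f = Fa f' \<cdot>\<^bsub>D\<^esub> Fa a"
    using faithful[of "b \<cdot>\<^bsub>C\<^esub> f" "f' \<cdot>\<^bsub>C\<^esub> a"] map_comp'[of f b] map_comp'[of a f'] s' c' by auto
  have 2: "c \<cdot>\<^bsub>C\<^esub> g = g' \<cdot>\<^bsub>C\<^esub> b \<longleftrightarrow> Fa c \<cdot>\<^bsub>D\<^esub> Fa g = Fa g' \<cdot>\<^bsub>D\<^esub> Fa b"
    using faithful[of "c \<cdot>\<^bsub>C\<^esub> g" "g' \<cdot>\<^bsub>C\<^esub> b"] map_comp'[of g c] map_comp'[of b g'] s' c' by auto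
  have l: "ShA D (Fa a) \<cdot>\<^bsub>D\<^esub> (\<phi> (Dom C f) \<cdot>\<^bsub>D\<^esub> Fa h) = \<phi> (Dom C f') \<cdot>\<^bsub>D\<^esub> Fa (ShA C a \<cdot>\<^bsub>C\<^esub> h)"
    using s' c' ob by (simp add: map_comp' cod.comp_reduce[OF n])
  have r: "(\<phi> (Dom C f') \<cdot>\<^bsub>D\<^esub> Fa h') \<cdot>\<^bsub>D\<^esub> Fa c = \<phi> (Dom C f') \<cdot>\<^bsub>D\<^esub> Fa (h' \<cdot>\<^bsub>C\<^esub> c)"
    using s' c' ob by (simp add: map_comp')
  have 3: "ShA C a \<cdot>\<^bsub>C\<^esub> h = h' \<cdot>\<^bsub>C\<^esub> c \<longleftrightarrow>
     ShA D (Fa a) \<cdot>\<^bsub>D\<^esub> (\<phi> (Dom C f) \<cdot>\<^bsub>D\<^esub> Fa h) = (\<phi> (Dom C f') \<cdot>\<^bsub>D\<^esub> Fa h') \<cdot>\<^bsub>D\<^esub> Fa c"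
  proof
    assume "ShA D (Fa a) \<cdot>\<^bsub>D\<^esub> (\<phi> (Dom C f) \<cdot>\<^bsub>D\<^esub> Fa h) = (\<phi> (Dom C f') \<cdot>\<^bsub>D\<^esub> Fa h') \<cdot>\<^bsub>D\<^esub> Fa c"
    then have "\<phi> (Dom C f') \<cdot>\<^bsub>D\<^esub> Fa (ShA C a \<cdot>\<^bsub>C\<^esub> h) = \<phi> (Dom C f') \<cdot>\<^bsub>D\<^esub> Fa (h' \<cdot>\<^bsub>C\<^esub> c)"
      unfolding l r .
    then have "Fa (ShA C a \<cdot>\<^bsub>C\<^esub> h) = Fa (h' \<cdot>\<^bsub>C\<^esub> c)"
      by (rule cod.iso_cancel_left[OF phi_iso[OF ob(2)]]) (use s' c' ob in simp_all)
    then show "ShA C a \<cdot>\<^bsub>C\<^esub> h = h' \<cdot>\<^bsub>C\<^esub> c"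
      by (rule faithful[rotated 4]) (use s' c' in simp_all)
  qed (simp only: l r)
  have 4: "Fa a \<in> Hom D (Dom D (Fa f)) (Dom D (Fa f'))" "Fa b \<in> Hom D (Dom D (Fa g)) (Dom D (Fa g'))"
     "Fa c \<in> Hom D (Dom D (\<phi> (Dom C f) \<cdot>\<^bsub>D\<^esub> Fa h)) (Dom D (\<phi> (Dom C f') \<cdot>\<^bsub>D\<^esub> Fa h'))"
    using s' c' ob by simp_all
  show ?thesis
    unfolding seq_morphism_iff using c 4 1 2 3 by argo
qed

lemma map_seq: "is_seq C (ShO C) (f, g, h) \<Longrightarrow> is_seq D (ShO D) (Fa f, Fa g, \<phi> (Dom C f) \<cdot>\<^bsub>D\<^esub> Fa h)"
  using C.dom_obj by (auto simp: is_seq_iff)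

lemma seq_isomorphic_iff:
  assumes s: "is_seq C (ShO C) (f, g, h)" "is_seq C (ShO C) (f', g', h')"
  shows "seq_isomorphic C (ShO C) (ShA C) (f, g, h) (f', g', h') \<longleftrightarrow>
    seq_isomorphic D (ShO D) (ShA D) (Fa f, Fa g, \<phi> (Dom C f) \<cdot>\<^bsub>D\<^esub> Fa h) (Fa f', Fa g', \<phi> (Dom C f') \<cdot>\<^bsub>D\<^esub>
      Fa h')"
    (is "_ \<longleftrightarrow> seq_isomorphic D _ _ ?t ?t'")
proof
  assume "seq_isomorphic C (ShO C) (ShA C) (f, g, h) (f', g', h')"
  then obtain a b c where m: "seq_morphism C (ShA C) (f, g, h) (f', g', h') (a, b, c)"
    and i: "iso_arrow C a" "iso_arrow C b" "iso_arrow C c"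
    unfolding seq_isomorphic_def by blast
  have "seq_morphism D (ShA D) ?t ?t' (Fa a, Fa b, Fa c)"
    using m map_seq_morphism[OF s, of a b c] unfolding seq_morphism_iff[of C] by blast
  then show "seq_isomorphic D (ShO D) (ShA D) ?t ?t'"
    by (rule seq_isomorphicI[OF map_seq[OF s(1)] map_seq[OF s(2)]]) (use i map_iso in auto)
next
  have s': "f \<in> Arr C" "g \<in> Arr C" "h \<in> Arr C"
     "f' \<in> Arr C" "g' \<in> Arr C" "h' \<in> Arr C"
    using s by (auto simp: is_seq_iff)
  then have ob: "Dom C f \<in> Obj C" "Dom C g \<in> Obj C" "Dom C h \<in> Obj C" "Dom C f' \<in> Obj C"
    "Dom C g' \<in> Obj C" "Dom C h' \<in> Obj C"
    using C.dom_obj by auto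
  have d: "Cod D (Fa h) = Dom D (\<phi> (Dom C f))" "Cod D (Fa h') = Dom D (\<phi> (Dom C f'))"
    using s ob by (auto simp: is_seq_iff)
  assume "seq_isomorphic D (ShO D) (ShA D) ?t ?t'"
  then obtain a b c where m: "seq_morphism D (ShA D) ?t ?t' (a, b, c)"
    and i: "iso_arrow D a" "iso_arrow D b" "iso_arrow D c"
    unfolding seq_isomorphic_def by blast
  obtain a' where a': "a' \<in> Arr C" "Dom C a' = Dom C f" "Cod C a' = Dom C f'" "Fa a' = a"
    using full[OF ob(1,4), of a] m s' by (auto simp: seq_morphism_iff)
  obtain b' where b': "b' \<in> Arr C" "Dom C b' = Dom C g" "Cod C b' = Dom C g'" "Fa b' = b"
    using full[OF ob(2,5), of b] m s' by (auto simp: seq_morphism_iff)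
  obtain c' where c': "c' \<in> Arr C" "Dom C c' = Dom C h" "Cod C c' = Dom C h'" "Fa c' = c"
    using full[OF ob(3,6), of c] m s' ob d by (auto simp: seq_morphism_iff)
  have "seq_morphism C (ShA C) (f, g, h) (f', g', h') (a', b', c')"
    using m map_seq_morphism[OF s, of a' b' c'] a' b' c' by simp
  then show "seq_isomorphic C (ShO C) (ShA C) (f, g, h) (f', g', h')"
    by (rule seq_isomorphicI[OF s]) (use i a' b' c' full_faithful_reflects_iso[OF ff] in auto)
qed

end

text \<open>The pulled-back triangulation. The image of a last arrow ends in
  \<open>Fo (ShO C X)\<close> and needs \<open>\<phi>\<close> to reach the shift of
  \<open>Fo X\<close> in \<open>D\<close>.\<close>

locale transport = shift_transport +
  assumes Tri_iff: "(f, g, h) \<in> Tri C \<longleftrightarrow>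
      is_seq C (ShO C) (f, g, h) \<and> (Fa f, Fa g, \<phi> (Dom C f) \<cdot>\<^bsub>D\<^esub> Fa h) \<in> Tri D"
begin

lemma Tri_I: "\<lbrakk>is_seq C (ShO C) (f, g, h); (Fa f, Fa g, \<phi> (Dom C f) \<cdot>\<^bsub>D\<^esub> Fa h) \<in> Tri D\<rbrakk> \<Longrightarrow> (f, g, h) \<in> Tri C"
  by (simp add: Tri_iff)

text \<open>The cone formed in \<open>D\<close> need not be in the image of \<open>Fo\<close>. It is
  replaced by an isomorphic object that is, and the two arrows at it are lifted by fullness, the
  second after division by \<open>\<phi>\<close>.\<close>

lemma transported_cone:
  assumes f: "f \<in> Arr C"
  shows "\<exists>g h. (f, g, h) \<in> Tri C"
proof -
  have ob: "Dom C f \<in> Obj C" "Cod C f \<in> Obj C"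
    using f C.dom_obj C.cod_obj by auto
  obtain k l where t: "(Fa f, k, l) \<in> Tri D"
    using D.tri_cone[of "Fa f"] f by auto
  note a = D.tri_arr[OF t]
  obtain Z where Z: "Z \<in> Obj C" "isomorphic D (Fo Z) (Dom D l)"
    using es a(9) unfolding ess_surj_def by blast
  obtain e e' where e: "inverse_pair D e e'" "Dom D e = Fo Z" "Cod D e = Dom D l"
    using Z(2) by (rule isomorphicE)
  note e' = cod.inverse_pair_cancel[OF e(1)]
  obtain g where g: "g \<in> Arr C" "Dom C g = Cod C f" "Cod C g = Z" "Fa g = e' \<cdot>\<^bsub>D\<^esub> k"
    using full[OF ob(2) Z(1), of "e' \<cdot>\<^bsub>D\<^esub> k"] f a e(2,3) e' by auto
  obtain m where m: "m \<in> Arr D" "Dom D m = Fo Z" "Cod D m = Fo (ShO C (Dom C f))"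
    "\<phi> (Dom C f) \<cdot>\<^bsub>D\<^esub> m = l \<cdot>\<^bsub>D\<^esub> e"
    using cod.iso_lift[OF phi_iso[OF ob(1)], of "l \<cdot>\<^bsub>D\<^esub> e"] f a e(2,3) e' ob by auto
  obtain h where h: "h \<in> Arr C" "Dom C h = Z" "Cod C h = ShO C (Dom C f)" "Fa h = m"
    using full[OF Z(1) shO_obj[OF ob(1)] m(1-3)] by blast
  have "(f, g, h) \<in> Tri C"
  proof (rule Tri_I)
    show s: "is_seq C (ShO C) (f, g, h)"
      using f g h by (simp add: is_seq_iff)
    show "(Fa f, Fa g, \<phi> (Dom C f) \<cdot>\<^bsub>D\<^esub> Fa h) \<in> Tri D"
    proof (rule D.tri_iso[OF t], rule seq_isomorphicI[OF map_seq[OF s] D.tri_seq[OF t]])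
      show "seq_morphism D (ShA D) (Fa f, Fa g, \<phi> (Dom C f) \<cdot>\<^bsub>D\<^esub> Fa h) (Fa f, k, l)
          (Ident D (Fo (Dom C f)), Ident D (Fo (Cod C f)), e)"
        using f g(1-3) h(1-3) a ob m(4) by (simp add: seq_morphism_iff g(4) h(4) e(2,3) e')
      show "iso_arrow D e"
        using e(1) by (auto simp: iso_arrow_iff)
    qed (use ob in simp_all)
  qed
  then show ?thesis
    by blast
qed

text \<open>The octahedron on the image in \<open>D\<close> is lifted arrow by arrow. Where the last
  arrow of a triangle occurs, \<open>\<phi>\<close> has to be moved by naturality or cancelled
  before faithfulness applies.\<close>

lemma transported_octahedral:
  assumes fg: "Cod C f = Dom C g" and t1: "(f, f', f'') \<in> Tri C" and t2: "(g, g', g'') \<in> Tri C"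
    and t3: "(g \<cdot>\<^bsub>C\<^esub> f, k', k'') \<in> Tri C"
  shows "\<exists>u v. (u, v, ShA C f' \<cdot>\<^bsub>C\<^esub> g'') \<in> Tri C \<and>
    u \<cdot>\<^bsub>C\<^esub> f' = k' \<cdot>\<^bsub>C\<^esub> g \<and> k'' \<cdot>\<^bsub>C\<^esub> u = f'' \<and> v \<cdot>\<^bsub>C\<^esub> k' = g' \<and> g'' \<cdot>\<^bsub>C\<^esub> v = ShA C f \<cdot>\<^bsub>C\<^esub> k''"
proof -
  have i: "is_seq C (ShO C) (f, f', f'')" "is_seq C (ShO C) (g, g', g'')" "is_seq C (ShO C) (g \<cdot>\<^bsub>C\<^esub> f, k', k'')"
    using t1 t2 t3 by (auto simp: Tri_iff)
  have a: "f \<in> Arr C" "f' \<in> Arr C" "f'' \<in> Arr C" "g \<in> Arr C" "g' \<in> Arr C" "g'' \<in> Arr C" "k' \<in> Arr C"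
    "k'' \<in> Arr C"
    "Cod C f' = Dom C f''" "Cod C f'' = ShO C (Dom C f)"
    "Cod C g' = Dom C g''" "Cod C g'' = ShO C (Dom C g)"
    "Cod C k' = Dom C k''"
    using i by (auto simp: is_seq_iff)
  have b: "Cod C g = Dom C g'" "Dom C f' = Dom C g" "Dom C k' = Dom C g'" "Cod C k'' = ShO C (Dom C f)"
    using i a fg by (auto simp: is_seq_iff)
  have ob: "Dom C f \<in> Obj C" "Dom C g \<in> Obj C" "Dom C f'' \<in> Obj C" "Dom C k'' \<in> Obj C" "Dom C g'' \<in> Obj C"
    using a C.dom_obj by auto
  have T1: "(Fa f, Fa f', \<phi> (Dom C f) \<cdot>\<^bsub>D\<^esub> Fa f'') \<in> Tri D"
    and T2: "(Fa g, Fa g', \<phi> (Dom C g) \<cdot>\<^bsub>D\<^esub> Fa g'') \<in> Tri D"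
    and T3: "(Fa g \<cdot>\<^bsub>D\<^esub> Fa f, Fa k', \<phi> (Dom C f) \<cdot>\<^bsub>D\<^esub> Fa k'') \<in> Tri D"
    using t1 t2 t3 a fg by (simp_all add: Tri_iff map_comp')
  have c: "Cod D (Fa f) = Dom D (Fa g)"
    using a fg by simp
  obtain u v where uv: "(u, v, ShA D (Fa f') \<cdot>\<^bsub>D\<^esub> (\<phi> (Dom C g) \<cdot>\<^bsub>D\<^esub> Fa g'')) \<in> Tri D"
      and u: "u \<in> Arr D" "Dom D u = Fo (Dom C f'')" "Cod D u = Fo (Dom C k'')"
      and v: "v \<in> Arr D" "Dom D v = Fo (Dom C k'')" "Cod D v = Fo (Dom C g'')"
      and eq: "u \<cdot>\<^bsub>D\<^esub> Fa f' = Fa k' \<cdot>\<^bsub>D\<^esub> Fa g"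
      "(\<phi> (Dom C f) \<cdot>\<^bsub>D\<^esub> Fa k'') \<cdot>\<^bsub>D\<^esub> u = \<phi> (Dom C f) \<cdot>\<^bsub>D\<^esub> Fa f''"
      "v \<cdot>\<^bsub>D\<^esub> Fa k' = Fa g'"
      "(\<phi> (Dom C g) \<cdot>\<^bsub>D\<^esub> Fa g'') \<cdot>\<^bsub>D\<^esub> v = ShA D (Fa f) \<cdot>\<^bsub>D\<^esub> (\<phi> (Dom C f) \<cdot>\<^bsub>D\<^esub> Fa k'')"
    by (rule D.octahedron[OF c T1 T2 T3]) (use a in simp)
  obtain u' where u': "u' \<in> Arr C" "Dom C u' = Dom C f''" "Cod C u' = Dom C k''" "Fa u' = u"
    using full[OF ob(3,4) u] by blast
  obtain v' where v': "v' \<in> Arr C" "Dom C v' = Dom C k''" "Cod C v' = Dom C g''" "Fa v' = v"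
    using full[OF ob(4,5) v] by blast
  have nf: "\<phi> (Dom C f'') \<cdot>\<^bsub>D\<^esub> Fa (ShA C f') = ShA D (Fa f') \<cdot>\<^bsub>D\<^esub> \<phi> (Dom C g)"
    using phi_natural[OF a(2)] a b by simp
  have nf': "\<phi> (Dom C g) \<cdot>\<^bsub>D\<^esub> Fa (ShA C f) = ShA D (Fa f) \<cdot>\<^bsub>D\<^esub> \<phi> (Dom C f)"
    using phi_natural[OF a(1)] fg by simp
  have "(u', v', ShA C f' \<cdot>\<^bsub>C\<^esub> g'') \<in> Tri C"
  proof (rule Tri_I)
    show "is_seq C (ShO C) (u', v', ShA C f' \<cdot>\<^bsub>C\<^esub> g'')"
      using u' v' a b by (simp add: is_seq_iff)
    have "\<phi> (Dom C u') \<cdot>\<^bsub>D\<^esub> Fa (ShA C f' \<cdot>\<^bsub>C\<^esub> g'') = ShA D (Fa f') \<cdot>\<^bsub>D\<^esub> (\<phi> (Dom C g) \<cdot>\<^bsub>D\<^esub> Fa g'')"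
      using u' a b ob by (simp add: map_comp' cod.comp_reduce[OF nf])
    then show "(Fa u', Fa v', \<phi> (Dom C u') \<cdot>\<^bsub>D\<^esub> Fa (ShA C f' \<cdot>\<^bsub>C\<^esub> g'')) \<in> Tri D"
      using uv u'(4) v'(4) by (simp only:)
  qed
  moreover have "u' \<cdot>\<^bsub>C\<^esub> f' = k' \<cdot>\<^bsub>C\<^esub> g"
  proof (rule faithful)
    show "Fa (u' \<cdot>\<^bsub>C\<^esub> f') = Fa (k' \<cdot>\<^bsub>C\<^esub> g)"
      using eq(1) u' a b by (simp add: map_comp')
  qed (use u' a b in simp_all)
  moreover have "k'' \<cdot>\<^bsub>C\<^esub> u' = f''"
  proof (rule faithful)
    have "\<phi> (Dom C f) \<cdot>\<^bsub>D\<^esub> Fa (k'' \<cdot>\<^bsub>C\<^esub> u') = \<phi> (Dom C f) \<cdot>\<^bsub>D\<^esub> Fa f''"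
      using eq(2) u u' a b ob by (simp add: map_comp')
    then show "Fa (k'' \<cdot>\<^bsub>C\<^esub> u') = Fa f''"
      by (rule cod.iso_cancel_left[OF phi_iso[OF ob(1)]]) (use u' a b ob in simp_all)
  qed (use u' a b in simp_all)
  moreover have "v' \<cdot>\<^bsub>C\<^esub> k' = g'"
  proof (rule faithful)
    show "Fa (v' \<cdot>\<^bsub>C\<^esub> k') = Fa g'"
      using eq(3) v' a b by (simp add: map_comp')
  qed (use v' a b in simp_all)
  moreover have "g'' \<cdot>\<^bsub>C\<^esub> v' = ShA C f \<cdot>\<^bsub>C\<^esub> k''"
  proof (rule faithful)
    have "\<phi> (Dom C g) \<cdot>\<^bsub>D\<^esub> Fa (g'' \<cdot>\<^bsub>C\<^esub> v') = \<phi> (Dom C g) \<cdot>\<^bsub>D\<^esub> Fa (ShA C f \<cdot>\<^bsub>C\<^esub> k'')"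
      using eq(4) v v' a b ob fg by (simp add: map_comp' cod.comp_reduce[OF nf'])
    then show "Fa (g'' \<cdot>\<^bsub>C\<^esub> v') = Fa (ShA C f \<cdot>\<^bsub>C\<^esub> k'')"
      by (rule cod.iso_cancel_left[OF phi_iso[OF ob(2)]]) (use v' a b ob fg in simp_all)
  qed (use v' a b fg in simp_all)
  ultimately show ?thesis
    by blast
qed

lemma transported_fill:
  assumes t: "(f, g, h) \<in> Tri C" "(f', g', h') \<in> Tri C"
    and ab: "a \<in> Hom C (Dom C f) (Dom C f')" "b \<in> Hom C (Cod C f) (Cod C f')" "b \<cdot>\<^bsub>C\<^esub> f = f' \<cdot>\<^bsub>C\<^esub> a"
  shows "\<exists>c. seq_morphism C (ShA C) (f, g, h) (f', g', h') (a, b, c)"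
proof -
  have s: "is_seq C (ShO C) (f, g, h)" "is_seq C (ShO C) (f', g', h')"
    and T: "(Fa f, Fa g, \<phi> (Dom C f) \<cdot>\<^bsub>D\<^esub> Fa h) \<in> Tri D" "(Fa f', Fa g', \<phi> (Dom C f') \<cdot>\<^bsub>D\<^esub> Fa h') \<in> Tri D"
    using t by (auto simp: Tri_iff)
  have s': "f \<in> Arr C" "g \<in> Arr C" "h \<in> Arr C" "Cod C f = Dom C g" "Cod C g = Dom C h"
    "Cod C h = ShO C (Dom C f)"
     "f' \<in> Arr C" "g' \<in> Arr C" "h' \<in> Arr C" "Cod C f' = Dom C g'" "Cod C g' = Dom C h'"
     "Cod C h' = ShO C (Dom C f')"
    using s by (auto simp: is_seq_iff)
  then have ob: "Dom C f \<in> Obj C" "Dom C f' \<in> Obj C" "Dom C h \<in> Obj C" "Dom C h' \<in> Obj C"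
    using C.dom_obj by auto
  have "Fa (b \<cdot>\<^bsub>C\<^esub> f) = Fa (f' \<cdot>\<^bsub>C\<^esub> a)"
    using ab(3) by simp
  then have "Fa b \<cdot>\<^bsub>D\<^esub> Fa f = Fa f' \<cdot>\<^bsub>D\<^esub> Fa a"
    using ab(1,2) s' by (simp add: map_comp')
  then obtain c where c: "seq_morphism D (ShA D) (Fa f, Fa g, \<phi> (Dom C f) \<cdot>\<^bsub>D\<^esub> Fa h)
      (Fa f', Fa g', \<phi> (Dom C f') \<cdot>\<^bsub>D\<^esub> Fa h') (Fa a, Fa b, c)"
    using D.tri_fill[OF T, of "Fa a" "Fa b"] ab s' by auto
  have "c \<in> Arr D" "Dom D c = Fo (Dom C h)" "Cod D c = Fo (Dom C h')"
    using c s' ob by (auto simp: seq_morphism_iff)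
  then obtain c' where c': "c' \<in> Arr C" "Dom C c' = Dom C h" "Cod C c' = Dom C h'" "Fa c' = c"
    using full[OF ob(3,4), of c] by blast
  have "seq_morphism C (ShA C) (f, g, h) (f', g', h') (a, b, c')"
    using map_seq_morphism[OF s, of a b c'] c' c ab s' by simp
  then show ?thesis
    by blast
qed

text \<open>Rotating the image and taking the image of the rotation give sequences that differ by
  \<open>\<phi>\<close> on the third object, hence isomorphic ones.\<close>

lemma transported_rotate:
  assumes s: "is_seq C (ShO C) (f, g, h)"
  shows "(f, g, h) \<in> Tri C \<longleftrightarrow> (g, h, neg C (ShA C f)) \<in> Tri C"
proof -
  have s': "f \<in> Arr C" "g \<in> Arr C" "h \<in> Arr C" "Cod C f = Dom C g" "Cod C g = Dom C h"
    "Cod C h = ShO C (Dom C f)"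
    using s by (auto simp: is_seq_iff)
  then have ob: "Dom C f \<in> Obj C" "Dom C g \<in> Obj C" "Dom C h \<in> Obj C"
    using C.dom_obj by auto
  have r: "is_seq C (ShO C) (g, h, neg C (ShA C f))"
    using s' by (simp add: is_seq_iff)
  have n: "\<phi> (Dom C g) \<cdot>\<^bsub>D\<^esub> Fa (ShA C f) = ShA D (Fa f) \<cdot>\<^bsub>D\<^esub> \<phi> (Dom C f)"
    using phi_natural[OF s'(1)] s' by simp
  let ?h = "\<phi> (Dom C f) \<cdot>\<^bsub>D\<^esub> Fa h"
  let ?t = "(Fa g, Fa h, \<phi> (Dom C g) \<cdot>\<^bsub>D\<^esub> Fa (neg C (ShA C f)))" and ?t' = "(Fa g, ?h, neg D (ShA D (Fa f)))"
  have s2: "is_seq D (ShO D) ?t" "is_seq D (ShO D) ?t'"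
    using s' ob by (simp_all add: is_seq_iff)
  obtain \<psi> where p: "inverse_pair D (\<phi> (Dom C f)) \<psi>"
    using phi_iso[OF ob(1)] by (rule iso_arrowE)
  note \<psi> = cod.inverse_pair_cancel[OF p]
  have 1: "seq_isomorphic D (ShO D) (ShA D) ?t ?t'"
  proof (rule seq_isomorphicI[OF s2])
    show "seq_morphism D (ShA D) ?t ?t' (Ident D (Fo (Dom C g)), Ident D (Fo (Dom C h)), \<phi> (Dom C f))"
      using s' ob by (simp add: seq_morphism_iff n)
  qed (use ob phi_iso in simp_all)
  have 2: "seq_isomorphic D (ShO D) (ShA D) ?t' ?t"
  proof (rule seq_isomorphicI[OF s2(2,1)])
    show "seq_morphism D (ShA D) ?t' ?t (Ident D (Fo (Dom C g)), Ident D (Fo (Dom C h)), \<psi>)"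
      using s' ob \<psi> by (simp add: seq_morphism_iff cod.comp_reduce[OF n])
    show "iso_arrow D \<psi>"
      using inverse_pair_sym[OF p] by (auto simp: iso_arrow_iff)
  qed (use ob in simp_all)
  have "(Fa f, Fa g, ?h) \<in> Tri D \<longleftrightarrow> ?t' \<in> Tri D"
    by (rule D.tri_rotate[OF map_seq[OF s]])
  also have "\<dots> \<longleftrightarrow> ?t \<in> Tri D"
    using D.tri_iso[OF _ 1] D.tri_iso[OF _ 2] by blast
  finally show ?thesis
    using s r by (simp add: Tri_iff)
qed

theorem transported_triangulated: "triangulated_category C"
proof unfold_locales
  fix t assume t: "t \<in> Tri C"
  obtain f g h where [simp]: "t = (f, g, h)"
    by (cases t)
  show "is_seq C (ShO C) t"
    using t by (simp add: Tri_iff)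
next
  fix t t' assume t: "t \<in> Tri C" "seq_isomorphic C (ShO C) (ShA C) t' t"
  obtain f g h f' g' h' where [simp]: "t = (f, g, h)" "t' = (f', g', h')"
    by (cases t, cases t')
  have s: "is_seq C (ShO C) (f', g', h')" "is_seq C (ShO C) (f, g, h)"
    using t by (auto simp: seq_isomorphic_def)
  show "t' \<in> Tri C"
    using t D.tri_iso seq_isomorphic_iff[OF s] s by (simp add: Tri_iff)
next
  fix X N assume X: "X \<in> Obj C" and N: "zero_object C N"
  have N': "N \<in> Obj C"
    using N C.zero_object_obj by blast
  show "(Ident C X, Zero C X N, Zero C N (ShO C X)) \<in> Tri C"
  proof (rule Tri_I)
    show "(Fa (Ident C X), Fa (Zero C X N), \<phi> (Dom C (Ident C X)) \<cdot>\<^bsub>D\<^esub> Fa (Zero C N (ShO C X))) \<in> Tri D"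
      using D.tri_ident[OF map_obj[OF X] map_zero_object[OF N]] X N' by simp
  qed (use X N' in \<open>simp add: is_seq_iff\<close>)
qed (fact shift_eq additive_functor.additive[OF shift_functor] transported_cone transported_rotate
      transported_fill transported_octahedral)+

theorem transported_equivalence: "triangle_equivalence C D Fo Fa"
  unfolding triangle_equivalence_def
proof
  interpret C': triangulated_category C
    by (rule transported_triangulated)
  have "triangle_functor C D Fo Fa \<phi>"
  proof (unfold_locales, rule additive)
    show "natural_iso C D (Fo \<circ> ShO C) (Fa \<circ> ShA C) (ShO D \<circ> Fo) (ShA D \<circ> Fa) \<phi>"
      unfolding natural_iso_def comp_apply using phi_hom phi_iso phi_natural by blast
  qed (simp add: Tri_iff)
  then show "\<exists>\<phi>. triangle_functor C D Fo Fa \<phi>"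
    by blast
qed (rule full_faithful_imp_equivalence[OF ff es])

end

section \<open>Calculus of fractions\<close>

locale verdier = triangulated_category T
  for T :: "('o, 'm, 'x) triang_data_scheme" (structure) +
  fixes N :: "'o set"
  assumes tri_sub: "triangulated_subcategory T N"
begin

abbreviation S :: "'m set" where "S \<equiv> mult_sys T N"

lemma N_obj: "X \<in> N \<Longrightarrow> X \<in> Obj T"
  using tri_sub unfolding triangulated_subcategory_def by blast

lemma N_iso: "\<lbrakk>X \<in> N; isomorphic T X Y; Y \<in> Obj T\<rbrakk> \<Longrightarrow> Y \<in> N"
  using tri_sub unfolding triangulated_subcategory_def iso_closed_def by blast

lemma N_zero: "zero_object T X \<Longrightarrow> X \<in> N"
  using tri_sub unfolding triangulated_subcategory_def by blast

lemma N_shift: "X \<in> N \<Longrightarrow> ShO T X \<in> N"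
  and N_unshift_obj: "X \<in> N \<Longrightarrow> unshift T X \<in> N"
proof -
  assume "X \<in> N"
  then have "shift T X 1 \<in> N" "shift T X (- 1) \<in> N"
    using tri_sub unfolding triangulated_subcategory_def by blast+
  then show "ShO T X \<in> N" "unshift T X \<in> N"
    by (simp_all add: shift_def)
qed

text \<open>As the shift is fully faithful, \<open>unshift\<close> applied to \<open>ShO T X\<close>
  gives back \<open>X\<close> up to isomorphism.\<close>

lemma N_unshift:
  assumes "X \<in> Obj T" "ShO T X \<in> N"
  shows "X \<in> N"
proof -
  have "isomorphic T (unshift T (ShO T X)) X"
    by (rule sh.full_faithful_reflects_isomorphic[OF sh_ff]) (use assms unshift_iso[of "ShO T X"] in auto)
  then show ?thesis
    using N_iso[OF N_unshift_obj[OF assms(2)]] assms by blast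
qed

lemma N_tri3: "\<lbrakk>(f, g, h) \<in> Tri T; Dom T f \<in> N; Cod T f \<in> N\<rbrakk> \<Longrightarrow> Cod T g \<in> N"
  using tri_sub unfolding triangulated_subcategory_def by blast

text \<open>Rotation moves the wanted object, up to a shift, to the place of the cone.\<close>

lemma N_tri1:
  assumes t: "(f, g, h) \<in> Tri T" and "Cod T f \<in> N" "Cod T g \<in> N"
  shows "Dom T f \<in> N"
  by (rule N_unshift) (use N_tri3[OF rotate[OF t]] tri_arr[OF t] assms in simp_all)

lemma N_tri2:
  assumes t: "(f, g, h) \<in> Tri T" and "Dom T f \<in> N" "Cod T g \<in> N"
  shows "Cod T f \<in> N"
  by (rule N_unshift) (use N_tri3[OF rotate[OF rotate[OF t]]] tri_arr[OF t] assms N_shift in simp_all)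

lemma S_arr: "s \<in> S \<Longrightarrow> s \<in> Arr T"
  by (simp add: mult_sys_def)

text \<open>Cones are unique up to isomorphism and \<open>N\<close> is closed under isomorphism, so
  any triangle on \<open>s\<close> decides membership.\<close>

lemma S_iff:
  assumes t: "(s, g, h) \<in> Tri T"
  shows "s \<in> S \<longleftrightarrow> Cod T g \<in> N"
proof
  assume "s \<in> S"
  then obtain g' h' where t': "(s, g', h') \<in> Tri T" "Cod T g' \<in> N"
    unfolding mult_sys_def by blast
  then show "Cod T g \<in> N"
    using N_iso[OF t'(2) cone_unique[OF t'(1) t]] tri_arr[OF t] by simp
qed (use tri_arr[OF t] t in \<open>auto simp: mult_sys_def\<close>)

lemma S_coneE:
  assumes "s \<in> S"
  obtains g h where "(s, g, h) \<in> Tri T" "Cod T g \<in> N"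
  using assms unfolding mult_sys_def by blast

lemma S_iff_cocone:
  assumes t: "(w, s, k) \<in> Tri T"
  shows "s \<in> S \<longleftrightarrow> Dom T w \<in> N"
  using S_iff[OF rotate[OF t]] N_shift[of "Dom T w"] N_unshift[of "Dom T w"] tri_arr[OF t] by auto

lemma S_iso: assumes "iso_arrow T s" shows "s \<in> S"
proof -
  obtain g h where t: "(s, g, h) \<in> Tri T"
    using tri_cone[of s] iso_arr[OF assms] by blast
  show ?thesis
    using S_iff[OF t] N_zero[OF iso_arrow_imp_zero_cone[OF t assms]] by simp
qed

lemma S_ident: "X \<in> Obj T \<Longrightarrow> Ident T X \<in> S"
  by (rule S_iso) simp

text \<open>The octahedral axiom places the cones of \<open>w\<close>, \<open>s \<cdot> w\<close>
  and \<open>s\<close> in one triangle. The last lies in \<open>N\<close>, so the first two lie in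
  \<open>N\<close> together or not at all.\<close>

lemma S_octahedron:
  assumes w: "w \<in> Arr T" "s \<in> S" "Cod T w = Dom T s"
  shows "s \<cdot> w \<in> S \<longleftrightarrow> w \<in> S"
proof -
  have s: "s \<in> Arr T"
    using w S_arr by blast
  have sw: "s \<cdot> w \<in> Arr T"
    using w s by simp
  obtain g1 h1 where 1: "(w, g1, h1) \<in> Tri T"
    using tri_cone[OF w(1)] by blast
  obtain g2 h2 where 2: "(s, g2, h2) \<in> Tri T"
    using tri_cone[OF s] by blast
  obtain g3 h3 where 3: "(s \<cdot> w, g3, h3) \<in> Tri T"
    using tri_cone[OF sw] by blast
  obtain u v where uv: "(u, v, ShA T g1 \<cdot> h2) \<in> Tri T" "Dom T u = Cod T g1" "Cod T u = Cod T g3"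
      "Cod T v = Cod T g2"
    by (rule octahedron[OF w(3) 1 2 3])
  have "Cod T v \<in> N"
    using S_iff[OF 2] w(2) uv by simp
  then have "Cod T u \<in> N \<longleftrightarrow> Dom T u \<in> N"
    using N_tri1[OF uv(1)] N_tri2[OF uv(1)] by blast
  then show ?thesis
    using S_iff[OF 1] S_iff[OF 3] uv by simp
qed

lemma S_comp: "\<lbrakk>w \<in> S; s \<in> S; Cod T w = Dom T s\<rbrakk> \<Longrightarrow> s \<cdot> w \<in> S"
  using S_octahedron S_arr by blast

lemma S_shift: assumes "s \<in> Arr T" shows "ShA T s \<in> S \<longleftrightarrow> s \<in> S"
proof -
  obtain g h where t: "(s, g, h) \<in> Tri T"
    using tri_cone[OF assms] by blast
  show ?thesis
    using S_iff[OF t] S_iff[OF tri_shift[OF t]] N_shift[of "Cod T g"] N_unshift[of "Cod T g"] tri_arr[OF t]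
    by auto
qed

text \<open>With \<open>g\<close> the map from the codomain of \<open>t\<close> to its cone, let
  \<open>u\<close> be the cocone of \<open>g \<cdot> f\<close>. The cone of \<open>u\<close> is that
  of \<open>t\<close>, so \<open>u\<close> is in \<open>S\<close>; and since \<open>g\<close> kills
  \<open>f \<cdot> u\<close>, this composite factors through \<open>t\<close>.\<close>

lemma S_ore:
  assumes f: "f \<in> Arr T" and t: "t \<in> S" "Cod T f = Cod T t"
  obtains u h where "u \<in> S" "u \<in> Arr T" "Cod T u = Dom T f" "h \<in> Arr T" "Dom T h = Dom T u" "Cod T h = Dom T t"
    "f \<cdot> u = t \<cdot> h"
proof -
  obtain g k where gk: "(t, g, k) \<in> Tri T" "Cod T g \<in> N"
    using t(1) by (rule S_coneE)
  note a = tri_arr[OF gk(1)]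
  have gf: "g \<cdot> f \<in> Arr T"
    using a f t by simp
  obtain u l where u: "(u, g \<cdot> f, l) \<in> Tri T"
    by (rule cocone[OF gf])
  note b = tri_arr[OF u]
  have Cu: "Cod T u = Dom T f"
    using b(4) a f t by simp
  have "g \<cdot> (f \<cdot> u) = Zero T (Dom T (f \<cdot> u)) (Cod T g)"
    using comp_tri_zero1[OF u] a b(1) Cu f t by simp
  then obtain h where h: "h \<in> Arr T" "Dom T h = Dom T (f \<cdot> u)" "Cod T h = Dom T t" "t \<cdot> h = f \<cdot> u"
    using hom_exactE[OF tri_exact1[OF gk(1)], of "f \<cdot> u"] b(1) Cu f t by auto
  have "u \<in> S"
    using S_iff[OF u] gk(2) a f t by simp
  then show ?thesis
    by - (rule that[of u h], use h b(1) Cu f in simp_all)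
qed

text \<open>Take the cocone of \<open>a\<close>: its own cone is the object of \<open>N\<close>
  through which the composite passes.\<close>

lemma S_kill:
  assumes ab: "a \<in> Arr T" "b \<in> Arr T" "Cod T a = Dom T b" "Cod T a \<in> N"
  obtains u where "u \<in> S" "u \<in> Arr T" "Cod T u = Dom T a" "(b \<cdot> a) \<cdot> u = Zero T (Dom T u) (Cod T b)"
proof -
  obtain u l where u: "(u, a, l) \<in> Tri T"
    by (rule cocone[OF ab(1)])
  note A = tri_arr[OF u]
  have "b \<cdot> (a \<cdot> u) = Zero T (Dom T u) (Cod T b)"
    using comp_tri_zero1[OF u] ab A by simp
  then show ?thesis
    by - (rule that[of u], use S_iff[OF u] ab A in simp_all)
qed

text \<open>Converse of \<open>S_kill\<close>: an arrow killed by \<open>u\<close> factors through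
  the cone of \<open>u\<close>.\<close>

lemma S_killed:
  assumes u: "u \<in> S" "x \<in> Arr T" "Cod T u = Dom T x" "x \<cdot> u = Zero T (Dom T u) (Cod T x)"
  obtains a b where "a \<in> Arr T" "b \<in> Arr T" "Cod T a = Dom T b" "Cod T a \<in> N" "x = b \<cdot> a"
proof -
  obtain g h where t: "(u, g, h) \<in> Tri T" "Cod T g \<in> N"
    using u(1) by (rule S_coneE)
  obtain z where "z \<in> Arr T" "Dom T z = Cod T g" "Cod T z = Cod T x" "z \<cdot> g = x"
    by (rule tri_extend1[OF t(1) u(2)]) (use u(3,4) in simp_all)
  then show ?thesis
    by - (rule that[of g z], use t(2) tri_arr[OF t(1)] in simp_all)
qed

text \<open>The difference is killed by \<open>t\<close>, so it factors through the cocone of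
  \<open>t\<close>, which lies in \<open>N\<close>; then \<open>S_kill\<close> applies.\<close>

lemma S_equalize:
  assumes f: "f \<in> Arr T" "f' \<in> Arr T" "Dom T f = Dom T f'" "Cod T f = Cod T f'"
    and t: "t \<in> S" "Dom T t = Cod T f'" "t \<cdot> f = t \<cdot> f'"
  obtains u where "u \<in> S" "u \<in> Arr T" "Cod T u = Dom T f'" "f \<cdot> u = f' \<cdot> u"
proof -
  have t': "t \<in> Arr T"
    using t S_arr by blast
  obtain w k where w: "(w, t, k) \<in> Tri T"
    by (rule cocone[OF t'])
  note A = tri_arr[OF w]
  let ?d = "f \<boxplus> neg T f'"
  have "t \<cdot> ?d = Zero T (Dom T ?d) (Cod T t)"
    using f t t' by (simp add: comp_add add_neg)
  then obtain a where a: "a \<in> Arr T" "Dom T a = Dom T f'" "Cod T a = Dom T w" "w \<cdot> a = ?d"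
    using hom_exactE[OF tri_exact1[OF w], of ?d] f t A by auto
  have aN: "Cod T a \<in> N"
    using S_iff_cocone[OF w] t(1) a by simp
  obtain u where u: "u \<in> S" "u \<in> Arr T" "Cod T u = Dom T f'" "?d \<cdot> u = Zero T (Dom T u) (Cod T f')"
    by (rule S_kill[of a w]) (use a A t aN in simp_all)
  have "(f \<cdot> u) \<boxplus> neg T (f' \<cdot> u) = Zero T (Dom T u) (Cod T f')"
    using u f by (simp add: add_comp)
  then have "f \<cdot> u = f' \<cdot> u"
    by (rule diff_zero_imp_eq) (use u f in simp_all)
  then show ?thesis
    using that[of u] u by blast
qed

section \<open>Equivalence of roofs\<close>

abbreviation "R \<equiv> roof_rel T N"
abbreviation "cl s f \<equiv> roof_class T N (s, f)"

definition roof :: "'m \<Rightarrow> 'm \<Rightarrow> bool" where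
  "roof s f \<longleftrightarrow> s \<in> S \<and> s \<in> Arr T \<and> f \<in> Arr T \<and> Dom T s = Dom T f"

lemma roofs_iff: "(s, f) \<in> roofs T N \<longleftrightarrow> roof s f"
  using S_arr by (auto simp: roofs_def roof_def)

lemma R_iff: "((s, f), (s', f')) \<in> R \<longleftrightarrow> roof s f \<and> roof s' f' \<and> Cod T s = Cod T s' \<and> Cod T f = Cod T f' \<and>
     (\<exists>u u'. u \<in> Arr T \<and> u' \<in> Arr T \<and> Dom T u = Dom T u' \<and> Cod T u = Dom T s \<and> Cod T u' = Dom T s' \<and>
        s \<cdot> u = s' \<cdot> u' \<and> f \<cdot> u = f' \<cdot> u' \<and> s \<cdot> u \<in> S)"
proof -
  have "(\<exists>W. \<exists>u\<in>Hom T W A. \<exists>u'\<in>Hom T W B. Q u u') \<longleftrightarrow> (\<exists>u u'. u \<in> Arr T \<and> u' \<in> Arr T \<and>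
      Dom T u = Dom T u' \<and> Cod T u = A \<and> Cod T u' = B \<and> Q u u')" for A B Q
  proof
    assume "\<exists>W. \<exists>u\<in>Hom T W A. \<exists>u'\<in>Hom T W B. Q u u'"
    then obtain W u u' where "u \<in> Hom T W A" "u' \<in> Hom T W B" "Q u u'"
      by blast
    then show "\<exists>u u'. u \<in> Arr T \<and> u' \<in> Arr T \<and> Dom T u = Dom T u' \<and> Cod T u = A \<and> Cod T u' = B \<and> Q u u'"
      by (intro exI[of _ u] exI[of _ u']) simp
  next
    assume "\<exists>u u'. u \<in> Arr T \<and> u' \<in> Arr T \<and> Dom T u = Dom T u' \<and> Cod T u = A \<and> Cod T u' = B \<and> Q u u'"
    then obtain u u' where "u \<in> Hom T (Dom T u') A" "u' \<in> Hom T (Dom T u') B" "Q u u'"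
      by auto
    then show "\<exists>W. \<exists>u\<in>Hom T W A. \<exists>u'\<in>Hom T W B. Q u u'"
      by blast
  qed
  then show ?thesis
    unfolding roof_rel_def by (simp add: roofs_iff)
qed

text \<open>The relation only puts the composite \<open>s \<cdot> u\<close> into \<open>S\<close>;
  two-out-of-three adds the comparison arrows themselves.\<close>

lemma R_E:
  assumes "((s, f), (s', f')) \<in> R"
  obtains u u' where "u \<in> S" "u' \<in> S" "u \<in> Arr T" "u' \<in> Arr T" "Dom T u = Dom T u'" "Cod T u = Dom T s"
    "Cod T u' = Dom T s'" "s \<cdot> u = s' \<cdot> u'" "f \<cdot> u = f' \<cdot> u'" "s \<cdot> u \<in> S"
proof -
  obtain u u' where u: "u \<in> Arr T" "u' \<in> Arr T" "Dom T u = Dom T u'" "Cod T u = Dom T s"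
    "Cod T u' = Dom T s'" "s \<cdot> u = s' \<cdot> u'" "f \<cdot> u = f' \<cdot> u'" "s \<cdot> u \<in> S" and r: "roof s f" "roof s' f'"
    using assms unfolding R_iff by blast
  have "u \<in> S" "u' \<in> S"
    using S_octahedron[of u s] S_octahedron[of u' s'] u r unfolding roof_def by auto
  then show ?thesis
    using that u by blast
qed

lemma R_I:
  assumes "roof s f" "roof s' f'" "Cod T s = Cod T s'" "Cod T f = Cod T f'"
    "u \<in> Arr T" "u' \<in> Arr T" "Dom T u = Dom T u'" "Cod T u = Dom T s" "Cod T u' = Dom T s'"
    "s \<cdot> u = s' \<cdot> u'" "f \<cdot> u = f' \<cdot> u'" "s \<cdot> u \<in> S"
  shows "((s, f), (s', f')) \<in> R"
  unfolding R_iff using assms by blast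

lemma R_refine:
  assumes "roof s f" "w \<in> S" "Cod T w = Dom T s"
  shows "((s, f), (s \<cdot> w, f \<cdot> w)) \<in> R" "roof (s \<cdot> w) (f \<cdot> w)"
proof -
  have w: "w \<in> Arr T" "Dom T w \<in> Obj T"
    using assms S_arr dom_obj by auto
  show r: "roof (s \<cdot> w) (f \<cdot> w)"
    using assms w S_comp unfolding roof_def by auto
  show "((s, f), (s \<cdot> w, f \<cdot> w)) \<in> R"
    by (rule R_I[OF assms(1) r, of w "Ident T (Dom T w)"]) (use assms w r in \<open>auto simp: roof_def\<close>)
qed

lemma R_sym: "(a, b) \<in> R \<Longrightarrow> (b, a) \<in> R"
proof -
  obtain s f s' f' where [simp]: "a = (s, f)" "b = (s', f')"
    by (cases a, cases b)
  assume "(a, b) \<in> R"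
  then have h: "((s, f), (s', f')) \<in> R"
    by simp
  then obtain u u' where u: "u \<in> Arr T" "u' \<in> Arr T" "Dom T u = Dom T u'" "Cod T u = Dom T s"
    "Cod T u' = Dom T s'" "s \<cdot> u = s' \<cdot> u'" "f \<cdot> u = f' \<cdot> u'" "s \<cdot> u \<in> S"
    by (rule R_E)
  have "((s', f'), (s, f)) \<in> R"
    by (rule R_I[of _ _ _ _ u' u]) (use u h[unfolded R_iff] in auto)
  then show ?thesis
    by simp
qed

lemma R_trans: 
  assumes "(a, b) \<in> R" "(b, c) \<in> R"
  shows "(a, c) \<in> R"
proof -
  obtain s f s' f' s'' f'' where e: "a = (s, f)" "b = (s', f')" "c = (s'', f'')"
    by (cases a, cases b, cases c)
  have 1: "((s, f), (s', f')) \<in> R" and 2: "((s', f'), (s'', f'')) \<in> R"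
    using assms e by auto
  obtain u u' where u: "u \<in> S" "u' \<in> S" "u \<in> Arr T" "u' \<in> Arr T" "Dom T u = Dom T u'" "Cod T u = Dom T s"
    "Cod T u' = Dom T s'" "s \<cdot> u = s' \<cdot> u'" "f \<cdot> u = f' \<cdot> u'" "s \<cdot> u \<in> S"
    using 1 by (rule R_E)
  obtain v v' where v: "v \<in> S" "v' \<in> S" "v \<in> Arr T" "v' \<in> Arr T" "Dom T v = Dom T v'" "Cod T v = Dom T s'"
    "Cod T v' = Dom T s''" "s' \<cdot> v = s'' \<cdot> v'" "f' \<cdot> v = f'' \<cdot> v'" "s' \<cdot> v \<in> S"
    using 2 by (rule R_E)
  have r: "roof s f" "roof s' f'" "roof s'' f''" "Cod T s = Cod T s'" "Cod T f = Cod T f'"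
    "Cod T s' = Cod T s''" "Cod T f' = Cod T f''"
    using 1 2 unfolding R_iff by auto
  \<comment> \<open>\<open>u'\<close> and \<open>v\<close> end at the apex of the middle roof; an
    Ore square over them dominates both comparisons.\<close>
  obtain p q where p: "p \<in> S" "p \<in> Arr T" "Cod T p = Dom T u'" "q \<in> Arr T" "Dom T q = Dom T p"
    "Cod T q = Dom T v"
    "u' \<cdot> p = v \<cdot> q"
    by (rule S_ore[of u' v]) (use u v in simp_all)
  have t: "s \<in> Arr T" "f \<in> Arr T" "s' \<in> Arr T" "f' \<in> Arr T" "s'' \<in> Arr T" "f'' \<in> Arr T" "Dom T s = Dom T f"
     "Dom T s' = Dom T f'" "Dom T s'' = Dom T f''"
    using r unfolding roof_def by auto
  have "((s, f), (s'', f'')) \<in> R"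
  proof (rule R_I[OF r(1,3), of "u \<cdot> p" "v' \<cdot> q"])
    have "s \<cdot> (u \<cdot> p) = s' \<cdot> (u' \<cdot> p)"
      using u p(1-3) t by (simp add: comp_reduce[OF u(8)])
    also have "\<dots> = s'' \<cdot> (v' \<cdot> q)"
      using v p t by (simp add: comp_reduce[OF v(8)])
    finally show "s \<cdot> (u \<cdot> p) = s'' \<cdot> (v' \<cdot> q)" .
    have "f \<cdot> (u \<cdot> p) = f' \<cdot> (u' \<cdot> p)"
      using u p(1-3) t by (simp add: comp_reduce[OF u(9)])
    also have "\<dots> = f'' \<cdot> (v' \<cdot> q)"
      using v p t by (simp add: comp_reduce[OF v(9)])
    finally show "f \<cdot> (u \<cdot> p) = f'' \<cdot> (v' \<cdot> q)" .
    have "u \<cdot> p \<in> S"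
      by (rule S_comp) (use u p in simp_all)
    then show "s \<cdot> (u \<cdot> p) \<in> S"
      by (rule S_comp) (use u p r(1) in \<open>simp_all add: roof_def\<close>)
  qed (use u v p t r in simp_all)
  then show ?thesis
    using e by simp
qed

lemma R_equiv: "equiv (roofs T N) R"
proof (rule equivI)
  show "refl_on (roofs T N) R"
  proof (rule refl_onI)
    fix x assume x: "x \<in> roofs T N"
    obtain s f where e: "x = (s, f)" by (cases x)
    then have r: "roof s f"
      using x roofs_iff by simp
    then have "Dom T s \<in> Obj T"
      using dom_obj unfolding roof_def by blast
    then show "(x, x) \<in> R"
      unfolding e by (intro R_I[OF r r, of "Ident T (Dom T s)"
        "Ident T (Dom T s)"]) (use r in \<open>auto simp: roof_def\<close>)
  qed
  show "sym R"
    by (rule symI) (rule R_sym)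
  show "trans R"
    by (rule transI) (rule R_trans)
qed (auto simp: roof_rel_def)

lemma cl_eq_iff: "\<lbrakk>roof s f; roof s' f'\<rbrakk> \<Longrightarrow> cl s f = cl s' f' \<longleftrightarrow> ((s, f), (s', f')) \<in> R"
  unfolding roof_class_def using eq_equiv_class_iff[OF R_equiv] roofs_iff by blast

lemma in_cl_iff: "roof s f \<Longrightarrow> r \<in> cl s f \<longleftrightarrow> ((s, f), r) \<in> R"
  by (simp add: roof_class_def)

lemma cl_refine: "\<lbrakk>roof s f; w \<in> S; Cod T w = Dom T s\<rbrakk> \<Longrightarrow> cl (s \<cdot> w) (f \<cdot> w) = cl s f"
  using cl_eq_iff R_refine by metis

section \<open>Composition of roofs and the quotient category\<close>

abbreviation "U \<equiv> verdier_quotient T N"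

lemmas vq_defs = verdier_quotient_def verdier_preadd_def preadd_data.extend_def triang_data.fields_def

lemma Obj_U [simp]: "Obj U = Obj T"
  by (simp add: vq_defs)

lemma Arr_U: "a \<in> Arr U \<longleftrightarrow> (\<exists>s f. roof s f \<and> a = cl s f)"
  by (auto simp: vq_defs quotient_def roof_class_def roofs_iff[symmetric])

lemma U_arrE:
  assumes "a \<in> Arr U"
  obtains s f where "roof s f" "a = cl s f"
  using assms Arr_U by blast

lemma cl_arr [simp]: "roof s f \<Longrightarrow> cl s f \<in> Arr U"
  using Arr_U by blast

text \<open>Every operation on classes is a \<open>the_elem\<close> of a set of results. To evaluate
  it, exhibit one result and show that all others equal it; the second half is
  well-definedness.\<close>

lemma the_elem_const: "\<lbrakk>x \<in> A; \<And>y. y \<in> A \<Longrightarrow> y = x\<rbrakk> \<Longrightarrow> the_elem A = x"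
  by (metis singleton_iff subsetI subset_antisym empty_subsetI insert_subset the_elem_eq)

lemma cl_self: "roof s f \<Longrightarrow> (s, f) \<in> cl s f"
  using cl_eq_iff in_cl_iff by blast

lemma dom_cl [simp]: assumes r: "roof s f" shows "Dom U (cl s f) = Cod T s"
proof -
  have "the_elem ((\<lambda>(s, f). Cod T s) ` cl s f) = Cod T s"
  proof (rule the_elem_const)
    show "Cod T s \<in> (\<lambda>(s, f). Cod T s) ` cl s f"
      using cl_self[OF r] by force
  qed (use r in \<open>auto simp: in_cl_iff R_iff\<close>)
  then show ?thesis
    by (simp add: vq_defs)
qed

lemma cod_cl [simp]: assumes r: "roof s f" shows "Cod U (cl s f) = Cod T f"
proof -
  have "the_elem ((\<lambda>(s, f). Cod T f) ` cl s f) = Cod T f"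
  proof (rule the_elem_const)
    show "Cod T f \<in> (\<lambda>(s, f). Cod T f) ` cl s f"
      using cl_self[OF r] by force
  qed (use r in \<open>auto simp: in_cl_iff R_iff\<close>)
  then show ?thesis
    by (simp add: vq_defs)
qed

text \<open>The completing squares exactly as they enter the definition of \<open>Comp\<close>, with
  the typing of \<open>u\<close> and \<open>h\<close> spelled out.\<close>

definition ore :: "'m \<Rightarrow> 'm \<Rightarrow> 'm \<Rightarrow> 'm \<Rightarrow> bool" where
  "ore f t u h \<longleftrightarrow> u \<in> S \<and> u \<in> Arr T \<and> Cod T u = Dom T f \<and> h \<in> Arr T \<and> Dom T h = Dom T u \<and>
     Cod T h = Dom T t \<and> f \<cdot> u = t \<cdot> h"

lemma ore_roof:
  assumes "roof s f" "roof t g" "Cod T f = Cod T t" "ore f t u h"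
  shows "roof (s \<cdot> u) (g \<cdot> h)"
proof -
  have "s \<cdot> u \<in> S"
    by (rule S_comp) (use assms in \<open>simp_all add: roof_def ore_def\<close>)
  then show ?thesis
    using assms by (simp add: roof_def ore_def)
qed

text \<open>An Ore square over \<open>u\<close> and \<open>u'\<close> makes the left legs agree.
  Then \<open>h \<cdot> v\<close> and \<open>h' \<cdot> v'\<close> agree only after composition with
  \<open>t\<close>, and \<open>w\<close> equalizes them.\<close>

lemma ore_unique:
  assumes r: "roof s f" "roof t g" "Cod T f = Cod T t" and o: "ore f t u h" "ore f t u' h'"
  shows "((s \<cdot> u, g \<cdot> h), (s \<cdot> u', g \<cdot> h')) \<in> R"
proof -
  have t: "s \<in> Arr T" "f \<in> Arr T" "t \<in> Arr T" "g \<in> Arr T" "Dom T s = Dom T f" "Dom T t = Dom T g"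
    "s \<in> S" "t \<in> S"
    using r by (auto simp: roof_def)
  have u: "u \<in> S" "u \<in> Arr T" "Cod T u = Dom T f" "h \<in> Arr T" "Dom T h = Dom T u"
    "Cod T h = Dom T g" "f \<cdot> u = t \<cdot> h"
    and u': "u' \<in> S" "u' \<in> Arr T" "Cod T u' = Dom T f" "h' \<in> Arr T" "Dom T h' = Dom T u'"
      "Cod T h' = Dom T g" "f \<cdot> u' = t \<cdot> h'"
    using o t by (auto simp: ore_def)
  obtain v v' where v: "v \<in> S" "v \<in> Arr T" "Cod T v = Dom T u" "v' \<in> Arr T" "Dom T v' = Dom T v"
    "Cod T v' = Dom T u'"
      "u \<cdot> v = u' \<cdot> v'"
    by (rule S_ore[of u u']) (use u u' in simp_all)
  have "t \<cdot> (h \<cdot> v) = f \<cdot> (u \<cdot> v)"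
    using u v(1-6) t by (simp add: comp_reduce[OF u(7)])
  also have "\<dots> = t \<cdot> (h' \<cdot> v')"
    using u' v t r(3) by (simp add: comp_reduce[OF u'(7)])
  finally have eq: "t \<cdot> (h \<cdot> v) = t \<cdot> (h' \<cdot> v')" .
  obtain w where w: "w \<in> S" "w \<in> Arr T" "Cod T w = Dom T v" "(h \<cdot> v) \<cdot> w = (h' \<cdot> v') \<cdot> w"
    by (rule S_equalize[OF _ _ _ _ t(8) _ eq]) (use u u' v t in simp_all)
  have w': "h \<cdot> (v \<cdot> w) = h' \<cdot> (v' \<cdot> w)"
    using w u u' v by simp
  have vw: "v \<cdot> w \<in> S"
    by (rule S_comp) (use v w in simp_all)
  show ?thesis
  proof (rule R_I[OF ore_roof[OF r o(1)] ore_roof[OF r o(2)], of "v \<cdot> w" "v' \<cdot> w"])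
    show "(s \<cdot> u) \<cdot> (v \<cdot> w) = (s \<cdot> u') \<cdot> (v' \<cdot> w)"
      using t u u' v w(1-3) by (simp add: comp_reduce[OF v(7)])
    show "(g \<cdot> h) \<cdot> (v \<cdot> w) = (g \<cdot> h') \<cdot> (v' \<cdot> w)"
      using t u u' v w(1-3) w' by simp
    have "s \<cdot> u \<in> S"
      by (rule S_comp) (use u t in simp_all)
    then show "(s \<cdot> u) \<cdot> (v \<cdot> w) \<in> S"
      by (rule S_comp[OF vw]) (use t u v w in simp_all)
  qed (use t u u' v w in simp_all)
qed

lemma ore_exists: "\<lbrakk>roof s f; roof t g; Cod T f = Cod T t\<rbrakk> \<Longrightarrow> \<exists>u h. ore f t u h"
  unfolding roof_def ore_def using S_ore by metis

lemma ore_coarsen: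
  assumes r: "roof s f" "roof t g" "Cod T f = Cod T t"
    and p: "p \<in> S" "Cod T p = Dom T s" and q: "q \<in> S" "Cod T q = Dom T t"
    and o: "ore (f \<cdot> p) (t \<cdot> q) u h"
  shows "ore f t (p \<cdot> u) (q \<cdot> h)"
proof -
  have t: "s \<in> Arr T" "f \<in> Arr T" "t \<in> Arr T" "g \<in> Arr T" "Dom T s = Dom T f" "Dom T t = Dom T g"
    "p \<in> Arr T" "q \<in> Arr T"
    using r p q S_arr by (auto simp: roof_def)
  have "p \<cdot> u \<in> S"
    by (rule S_comp) (use o t p in \<open>simp_all add: ore_def\<close>)
  moreover have "u \<in> Arr T" "Cod T u = Dom T (f \<cdot> p)" "h \<in> Arr T" "Dom T h = Dom T u" "Cod T h = Dom T (t \<cdot> q)"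
      "(f \<cdot> p) \<cdot> u = (t \<cdot> q) \<cdot> h"
    using o unfolding ore_def by blast+
  ultimately show ?thesis
    using t p q r(3) by (simp add: ore_def)
qed

text \<open>Refine both pairs of equivalent roofs to common ones by \<open>p\<close> and
  \<open>q\<close>. A square for the refined roofs serves, after coarsening, for either pair of
  representatives, and \<open>ore_unique\<close> compares it with the given squares.\<close>

lemma comp_wd:
  assumes r: "((s, f), (s', f')) \<in> R" "((t, g), (t', g')) \<in> R" "Cod T f = Cod T t"
    and o: "ore f t u h" "ore f' t' u' h'"
  shows "((s \<cdot> u, g \<cdot> h), (s' \<cdot> u', g' \<cdot> h')) \<in> R"
proof -
  obtain p p' where p: "p \<in> S" "p' \<in> S" "p \<in> Arr T" "p' \<in> Arr T" "Dom T p = Dom T p'" "Cod T p = Dom T s"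
    "Cod T p' = Dom T s'" "s \<cdot> p = s' \<cdot> p'" "f \<cdot> p = f' \<cdot> p'" "s \<cdot> p \<in> S"
    using r(1) by (rule R_E)
  obtain q q' where q: "q \<in> S" "q' \<in> S" "q \<in> Arr T" "q' \<in> Arr T" "Dom T q = Dom T q'" "Cod T q = Dom T t"
    "Cod T q' = Dom T t'" "t \<cdot> q = t' \<cdot> q'" "g \<cdot> q = g' \<cdot> q'" "t \<cdot> q \<in> S"
    using r(2) by (rule R_E)
  have ro: "roof s f" "roof s' f'" "roof t g" "roof t' g'" "Cod T f' = Cod T t'"
    using r by (auto simp: R_iff)
  have t: "s \<in> Arr T" "f \<in> Arr T" "t \<in> Arr T" "g \<in> Arr T" "Dom T s = Dom T f" "Dom T t = Dom T g"
    "s' \<in> Arr T" "f' \<in> Arr T" "t' \<in> Arr T" "g' \<in> Arr T" "Dom T s' = Dom T f'" "Dom T t' = Dom T g'"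
    using ro by (auto simp: roof_def)
  have r1: "roof (s \<cdot> p) (f \<cdot> p)" "roof (t \<cdot> q) (g \<cdot> q)"
    using R_refine(2) ro p q by auto
  obtain v k where o': "ore (f \<cdot> p) (t \<cdot> q) v k"
    using ore_exists[OF r1] t p(3,6) q(3,6) r(3) by auto
  then have o'': "ore (f' \<cdot> p') (t' \<cdot> q') v k"
    using p q by simp
  have v: "v \<in> Arr T" "Cod T v = Dom T p" "k \<in> Arr T" "Cod T k = Dom T q" "Dom T k = Dom T v"
    using o' t p(3,6) q(3,6) by (auto simp: ore_def)
  have "((s \<cdot> u, g \<cdot> h), (s \<cdot> (p \<cdot> v), g \<cdot> (q \<cdot> k))) \<in> R"
    by (rule ore_unique[OF ro(1,3) r(3) o(1) ore_coarsen[OF ro(1,3) r(3) p(1,6) q(1,6) o']])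
  moreover have "((s' \<cdot> u', g' \<cdot> h'), (s' \<cdot> (p' \<cdot> v), g' \<cdot> (q' \<cdot> k))) \<in> R"
    by (rule ore_unique[OF ro(2,4,5) o(2) ore_coarsen[OF ro(2,4,5) p(2,7) q(2,7) o'']])
  moreover have "s \<cdot> (p \<cdot> v) = s' \<cdot> (p' \<cdot> v)" "g \<cdot> (q \<cdot> k) = g' \<cdot> (q' \<cdot> k)"
    using t v p q by (simp_all add: comp_reduce[OF p(8)] comp_reduce[OF q(9)])
  ultimately show ?thesis
    using R_trans R_sym by metis
qed

lemma comp_cl:
  assumes r: "roof s f" "roof t g" "Cod T f = Cod T t" and o: "ore f t u h"
  shows "cl t g \<cdot>\<^bsub>U\<^esub> cl s f = cl (s \<cdot> u) (g \<cdot> h)"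
proof -
  define a b where "a = cl s f" and "b = cl t g"
  let ?A = "{cl (s \<cdot> u) (g \<cdot> h) | s f t g u h. (s, f) \<in> a \<and> (t, g) \<in> b \<and> u \<in> mult_sys T N \<and> Cod T u = Dom T f \<and>
        h \<in> Hom T (Dom T u) (Dom T t) \<and> f \<cdot> u = t \<cdot> h}"
  have "the_elem ?A = cl (s \<cdot> u) (g \<cdot> h)"
  proof (rule the_elem_const)
    show "cl (s \<cdot> u) (g \<cdot> h) \<in> ?A"
      by (rule CollectI, rule exI[of _ s], rule exI[of _ f], rule exI[of _ t], rule exI[of _ g],
          rule exI[of _ u], rule exI[of _ h])
        (use cl_self[OF r(1)] cl_self[OF r(2)] o in \<open>simp add: ore_def a_def b_def\<close>)
  next
    fix y assume "y \<in> ?A"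
    then obtain s' f' t' g' u' h' where y: "y = cl (s' \<cdot> u') (g' \<cdot> h')" "(s', f') \<in> a" "(t', g') \<in> b"
        and o': "ore f' t' u' h'"
      unfolding ore_def using S_arr by auto
    have 1: "((s, f), (s', f')) \<in> R" and 2: "((t, g), (t', g')) \<in> R"
      using y r unfolding a_def b_def by (simp_all add: in_cl_iff)
    have "((s \<cdot> u, g \<cdot> h), (s' \<cdot> u', g' \<cdot> h')) \<in> R"
      by (rule comp_wd[OF 1 2 r(3) o o'])
    then show "y = cl (s \<cdot> u) (g \<cdot> h)"
      unfolding y(1) using cl_eq_iff[of "s \<cdot> u" "g \<cdot> h" "s' \<cdot> u'" "g' \<cdot> h'"] unfolding R_iff by metis
  qed
  then show ?thesis
    unfolding a_def[symmetric] b_def[symmetric] by (simp add: vq_defs)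
qed

lemma ident_U: "X \<in> Obj T \<Longrightarrow> Ident U X = cl (Ident T X) (Ident T X)"
  by (simp add: vq_defs)

lemma zero_U: "Zero U X Y = cl (Ident T X) (Zero T X Y)"
  by (simp add: vq_defs)

lemma roof_ident [simp]: "\<lbrakk>f \<in> Arr T; Dom T f = X\<rbrakk> \<Longrightarrow> roof (Ident T X) f"
  using S_ident[of X] dom_obj[of f] by (auto simp: roof_def)

lemma U_homE:
  assumes "a \<in> Hom U X Y"
  obtains s f where "roof s f" "a = cl s f" "Cod T s = X" "Cod T f = Y" "s \<in> S" "s \<in> Arr T"
    "f \<in> Arr T" "Dom T s = Dom T f"
  using assms by (auto elim!: U_arrE simp: roof_def)

lemma comp_clE:
  assumes r: "roof s f" "roof t g" "Cod T f = Cod T t"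
  obtains u h where "ore f t u h" "cl t g \<cdot>\<^bsub>U\<^esub> cl s f = cl (s \<cdot> u) (g \<cdot> h)" "roof (s \<cdot> u) (g \<cdot> h)"
  using ore_exists[OF r] comp_cl[OF r] ore_roof[OF r] by blast

lemma U_category: "category U"
proof
  fix a assume "a \<in> Arr U"
  then obtain s f where "roof s f" "a = cl s f"
    by (rule U_arrE)
  then show "Dom U a \<in> Obj U" "Cod U a \<in> Obj U"
    using cod_obj by (auto simp: roof_def)
next
  fix X assume X: "X \<in> Obj U"
  then show "Ident U X \<in> Hom U X X"
    by (simp add: ident_U)
next
  fix a b X Y Z assume "a \<in> Hom U X Y" "b \<in> Hom U Y Z"
  then obtain s f t g where a: "roof s f" "a = cl s f" "Cod T s = X" "Cod T f = Y"
    and b: "roof t g" "b = cl t g" "Cod T t = Y" "Cod T g = Z"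
    by (elim U_homE)
  obtain u h where o: "ore f t u h" "b \<cdot>\<^bsub>U\<^esub> a = cl (s \<cdot> u) (g \<cdot> h)" "roof (s \<cdot> u) (g \<cdot> h)"
    using comp_clE[OF a(1) b(1)] a b by auto
  have "Cod T (s \<cdot> u) = X" "Cod T (g \<cdot> h) = Z"
    using a b o(1) by (auto simp: ore_def roof_def)
  then show "b \<cdot>\<^bsub>U\<^esub> a \<in> Hom U X Z"
    using o by simp
next
  fix a X Y assume "a \<in> Hom U X Y"
  then obtain s f where a: "roof s f" "a = cl s f" "Cod T s = X" "Cod T f = Y" "s \<in> S" "s \<in> Arr T"
    "f \<in> Arr T" "Dom T s = Dom T f"
    by (rule U_homE)
  then have ob: "X \<in> Obj T" "Y \<in> Obj T" "Dom T f \<in> Obj T"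
    using cod_obj dom_obj by auto
  have "ore f (Ident T Y) (Ident T (Dom T f)) f"
    using a ob S_ident by (simp add: ore_def)
  then show "Ident U Y \<cdot>\<^bsub>U\<^esub> a = a"
    using comp_cl[OF a(1), of "Ident T Y" "Ident T Y"] a ob by (simp add: ident_U)
  have "ore (Ident T X) s s (Ident T (Dom T f))"
    using a ob S_ident by (simp add: ore_def)
  then show "a \<cdot>\<^bsub>U\<^esub> Ident U X = a"
    using comp_cl[OF _ a(1), of "Ident T X" "Ident T X"] a ob by (simp add: ident_U)
next
  fix a b c W X Y Z assume "a \<in> Hom U W X" "b \<in> Hom U X Y" "c \<in> Hom U Y Z"
  then obtain s f t g q k where a: "roof s f" "a = cl s f" "Cod T s = W" "Cod T f = X" "s \<in> S"
    "s \<in> Arr T" "f \<in> Arr T" "Dom T s = Dom T f"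
    and b: "roof t g" "b = cl t g" "Cod T t = X" "Cod T g = Y" "t \<in> S" "t \<in> Arr T" "g \<in> Arr T"
      "Dom T t = Dom T g"
    and c: "roof q k" "c = cl q k" "Cod T q = Y" "Cod T k = Z" "q \<in> S" "q \<in> Arr T" "k \<in> Arr T"
      "Dom T q = Dom T k"
    by (elim U_homE)
  obtain u h where o1: "ore f t u h" "b \<cdot>\<^bsub>U\<^esub> a = cl (s \<cdot> u) (g \<cdot> h)" "roof (s \<cdot> u) (g \<cdot> h)"
    using comp_clE[OF a(1) b(1)] a b by auto
  obtain v k' where o2: "ore g q v k'" "c \<cdot>\<^bsub>U\<^esub> b = cl (t \<cdot> v) (k \<cdot> k')" "roof (t \<cdot> v) (k \<cdot> k')"
    using comp_clE[OF b(1) c(1)] b c by auto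
  have u: "u \<in> S" "u \<in> Arr T" "Cod T u = Dom T f" "h \<in> Arr T" "Dom T h = Dom T u"
    "Cod T h = Dom T g" "f \<cdot> u = t \<cdot> h"
    using o1(1) b by (auto simp: ore_def)
  have v: "v \<in> S" "v \<in> Arr T" "Cod T v = Dom T g" "k' \<in> Arr T" "Dom T k' = Dom T v"
    "Cod T k' = Dom T k" "g \<cdot> v = q \<cdot> k'"
    using o2(1) c by (auto simp: ore_def)
  \<comment> \<open>A third Ore square joins the two given ones. The pasted squares compute both
    bracketings by the same roof.\<close>
  obtain w w' where w: "w \<in> S" "w \<in> Arr T" "Cod T w = Dom T h" "w' \<in> Arr T" "Dom T w' = Dom T w"
    "Cod T w' = Dom T v"
      "h \<cdot> w = v \<cdot> w'"
    by (rule S_ore[of h v]) (use u v in simp_all)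
  have 1: "ore (g \<cdot> h) q w (k' \<cdot> w')"
    unfolding ore_def
  proof (intro conjI)
    show "(g \<cdot> h) \<cdot> w = q \<cdot> (k' \<cdot> w')"
      using u v w b c by (simp add: comp_reduce[OF v(7)])
  qed (use u v w b c in simp_all)
  have 2: "ore f (t \<cdot> v) (u \<cdot> w) w'"
    unfolding ore_def
  proof (intro conjI)
    show "u \<cdot> w \<in> S"
      by (rule S_comp) (use u w in simp_all)
    show "f \<cdot> (u \<cdot> w) = (t \<cdot> v) \<cdot> w'"
      using u v w a b by (simp add: comp_reduce[OF u(7)])
  qed (use u v w a b in simp_all)
  have "c \<cdot>\<^bsub>U\<^esub> (b \<cdot>\<^bsub>U\<^esub> a) = cl ((s \<cdot> u) \<cdot> w) (k \<cdot> (k' \<cdot> w'))"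
    unfolding o1(2) c(2) by (rule comp_cl[OF o1(3) c(1) _ 1]) (use u b c in simp)
  moreover have "(c \<cdot>\<^bsub>U\<^esub> b) \<cdot>\<^bsub>U\<^esub> a = cl (s \<cdot> (u \<cdot> w)) ((k \<cdot> k') \<cdot> w')"
    unfolding o2(2) a(2) by (rule comp_cl[OF a(1) o2(3) _ 2]) (use v a b in simp)
  moreover have "(s \<cdot> u) \<cdot> w = s \<cdot> (u \<cdot> w)" "(k \<cdot> k') \<cdot> w' = k \<cdot> (k' \<cdot> w')"
    using u v w a c by simp_all
  ultimately show "(c \<cdot>\<^bsub>U\<^esub> b) \<cdot>\<^bsub>U\<^esub> a = c \<cdot>\<^bsub>U\<^esub> (b \<cdot>\<^bsub>U\<^esub> a)"
    by simp
qed

section \<open>Addition of roofs\<close>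

lemma common_denominator:
  assumes "roof s f" "roof t g" "Cod T s = Cod T t"
  obtains u h where "u \<in> S" "h \<in> S" "u \<in> Arr T" "h \<in> Arr T" "Cod T u = Dom T s" "Cod T h = Dom T t"
    "Dom T u = Dom T h"
    "s \<cdot> u = t \<cdot> h" "roof (s \<cdot> u) (f \<cdot> u)" "roof (s \<cdot> u) (g \<cdot> h)" "cl s f = cl (s \<cdot> u) (f \<cdot> u)"
    "cl t g = cl (s \<cdot> u) (g \<cdot> h)"
proof -
  have t: "s \<in> S" "s \<in> Arr T" "f \<in> Arr T" "Dom T s = Dom T f" "t \<in> S" "t \<in> Arr T" "g \<in> Arr T"
    "Dom T t = Dom T g"
    using assms by (auto simp: roof_def)
  obtain u h where u: "u \<in> S" "u \<in> Arr T" "Cod T u = Dom T s" "h \<in> Arr T" "Dom T h = Dom T u"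
    "Cod T h = Dom T t" "s \<cdot> u = t \<cdot> h"
    by (rule S_ore[OF t(2,5) assms(3)])
  have "s \<cdot> u \<in> S"
    by (rule S_comp) (use t u in simp_all)
  then have h: "h \<in> S"
    using S_octahedron[of h t] u t by simp
  show ?thesis
    using that[OF u(1) h u(2,4,3,6) u(5)[symmetric] u(7) R_refine(2)[OF assms(1) u(1,3)] _ cl_refine[OF
      assms(1) u(1,3), symmetric]]
      R_refine(2)[OF assms(2) h u(6)] cl_refine[OF assms(2) h u(6)] u(7) by simp
qed

lemma U_homE2:
  assumes "a \<in> Hom U X Y" "b \<in> Hom U X Z"
  obtains s f g where "roof s f" "roof s g" "a = cl s f" "b = cl s g" "Cod T s = X" "Cod T f = Y" "Cod T g = Z"
    "s \<in> S" "s \<in> Arr T" "f \<in> Arr T" "g \<in> Arr T" "Dom T s = Dom T f" "Dom T g = Dom T f"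
proof -
  obtain s f t g where a: "roof s f" "a = cl s f" "Cod T s = X" "Cod T f = Y"
    and b: "roof t g" "b = cl t g" "Cod T t = X" "Cod T g = Z"
    using assms by (elim U_homE)
  have e: "Cod T s = Cod T t"
    using a b by simp
  obtain u h where u: "u \<in> Arr T" "h \<in> Arr T" "Cod T u = Dom T s" "Cod T h = Dom T t" "Dom T u = Dom T h"
    "roof (s \<cdot> u) (f \<cdot> u)" "roof (s \<cdot> u) (g \<cdot> h)" "cl s f = cl (s \<cdot> u) (f \<cdot> u)" "cl t g = cl (s \<cdot> u) (g \<cdot> h)"
    by (rule common_denominator[OF a(1) b(1) e])
  have t: "s \<in> Arr T" "f \<in> Arr T" "g \<in> Arr T" "Dom T s = Dom T f" "Dom T t = Dom T g"
    using a b by (auto simp: roof_def)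
  have m: "s \<cdot> u \<in> S"
    using u(6) by (simp add: roof_def)
  show ?thesis
    by (rule that[OF u(6,7)]) (use a b u(1-5,8,9) t m in simp_all)
qed

lemma add_wd:
  assumes r: "((s, f), (s', f')) \<in> R" "((s, g), (s', g')) \<in> R" and c: "Cod T f = Cod T g"
  shows "((s, f \<boxplus> g), (s', f' \<boxplus> g')) \<in> R"
proof -
  have ro: "roof s f" "roof s' f'" "roof s g" "roof s' g'" "Cod T s = Cod T s'" "Cod T f = Cod T f'"
    "Cod T g = Cod T g'"
    using r by (auto simp: R_iff)
  then have t: "s \<in> S" "s' \<in> S" "s \<in> Arr T" "s' \<in> Arr T" "f \<in> Arr T" "f' \<in> Arr T" "g \<in> Arr T" "g' \<in> Arr T"
    "Dom T f = Dom T s" "Dom T g = Dom T s" "Dom T f' = Dom T s'" "Dom T g' = Dom T s'" "Cod T f' = Cod T g'"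
    using c by (auto simp: roof_def)
  obtain u u' where u: "u \<in> S" "u' \<in> S" "u \<in> Arr T" "u' \<in> Arr T" "Dom T u = Dom T u'" "Cod T u = Dom T s"
    "Cod T u' = Dom T s'" "s \<cdot> u = s' \<cdot> u'" "f \<cdot> u = f' \<cdot> u'" "s \<cdot> u \<in> S"
    using r(1) by (rule R_E)
  obtain v v' where v: "v \<in> S" "v' \<in> S" "v \<in> Arr T" "v' \<in> Arr T" "Dom T v = Dom T v'" "Cod T v = Dom T s"
    "Cod T v' = Dom T s'" "s \<cdot> v = s' \<cdot> v'" "g \<cdot> v = g' \<cdot> v'" "s \<cdot> v \<in> S"
    using r(2) by (rule R_E)
  \<comment> \<open>The two equivalences come with different witnesses \<open>u\<close> and
    \<open>v\<close>, whereas addition needs a common one.\<close>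
  obtain p q where p: "p \<in> S" "p \<in> Arr T" "Cod T p = Dom T u" "q \<in> Arr T" "Dom T q = Dom T p"
    "Cod T q = Dom T v"
    "u \<cdot> p = v \<cdot> q"
    by (rule S_ore[of u v]) (use u v in simp_all)
  have "s' \<cdot> (u' \<cdot> p) = s \<cdot> (u \<cdot> p)"
    using u p(1-6) t by (simp add: comp_reduce[OF u(8)])
  also have "\<dots> = s' \<cdot> (v' \<cdot> q)"
    using v p t by (simp add: comp_reduce[OF v(8)])
  finally have eq: "s' \<cdot> (u' \<cdot> p) = s' \<cdot> (v' \<cdot> q)" .
  \<comment> \<open>On the primed side the refined witnesses agree only after composition with
    \<open>s'\<close>. As \<open>s'\<close> is in \<open>S\<close>, they agree after precomposition
    with a suitable \<open>w\<close>.\<close>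
  obtain w where w: "w \<in> S" "w \<in> Arr T" "Cod T w = Dom T (v' \<cdot> q)" "(u' \<cdot> p) \<cdot> w = (v' \<cdot> q) \<cdot> w"
    by (rule S_equalize[OF _ _ _ _ t(2) _ eq]) (use u v p t in simp_all)
  have w': "Cod T w = Dom T p" "u' \<cdot> (p \<cdot> w) = v' \<cdot> (q \<cdot> w)"
    using w u v p by simp_all
  have pw: "p \<cdot> w \<in> S"
    by (rule S_comp) (use p w w' in simp_all)
  have z: "u \<cdot> (p \<cdot> w) = v \<cdot> (q \<cdot> w)"
    using u v p(1-6) w(1,2) w'(1) by (simp add: comp_reduce[OF p(7)])
  have ff: "f \<cdot> (u \<cdot> (p \<cdot> w)) = f' \<cdot> (u' \<cdot> (p \<cdot> w))"
    using t u p(1-6) w(1,2) w'(1) by (simp add: comp_reduce[OF u(9)])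
  have "g \<cdot> (u \<cdot> (p \<cdot> w)) = g \<cdot> (v \<cdot> (q \<cdot> w))"
    using z by simp
  also have "\<dots> = g' \<cdot> (v' \<cdot> (q \<cdot> w))"
    using t v p(1-6) w(1,2) w'(1) by (simp add: comp_reduce[OF v(9)])
  also have "\<dots> = g' \<cdot> (u' \<cdot> (p \<cdot> w))"
    using w'(2) by simp
  finally have gg: "g \<cdot> (u \<cdot> (p \<cdot> w)) = g' \<cdot> (u' \<cdot> (p \<cdot> w))" .
  show ?thesis
  proof (rule R_I[of _ _ _ _ "u \<cdot> (p \<cdot> w)" "u' \<cdot> (p \<cdot> w)"])
    show "s \<cdot> (u \<cdot> (p \<cdot> w)) = s' \<cdot> (u' \<cdot> (p \<cdot> w))"
      using t u p(1-6) w(1,2) w'(1) by (simp add: comp_reduce[OF u(8)])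
    show "(f \<boxplus> g) \<cdot> (u \<cdot> (p \<cdot> w)) = (f' \<boxplus> g') \<cdot> (u' \<cdot> (p \<cdot> w))"
      using t u p(1-6) w(1,2) w'(1) ff gg c by (simp add: add_comp)
    have "u \<cdot> (p \<cdot> w) \<in> S"
      by (rule S_comp[OF pw]) (use u p w w' in simp_all)
    then show "s \<cdot> (u \<cdot> (p \<cdot> w)) \<in> S"
      by (rule S_comp) (use t u p w w' in simp_all)
  qed (use t u p ro w(1,2) w'(1) c in \<open>simp_all add: roof_def\<close>)
qed

lemma roof_add: "\<lbrakk>roof s f; roof s g; Cod T f = Cod T g\<rbrakk> \<Longrightarrow> roof s (f \<boxplus> g)"
  by (simp add: roof_def)

lemma add_cl:
  assumes r: "roof s f" "roof s g" "Cod T f = Cod T g"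
  shows "cl s f \<boxplus>\<^bsub>U\<^esub> cl s g = cl s (f \<boxplus> g)"
proof -
  define a b where "a = cl s f" and "b = cl s g"
  let ?A = "{cl s (f \<boxplus> g) | s f g. (s, f) \<in> a \<and> (s, g) \<in> b}"
  have "the_elem ?A = cl s (f \<boxplus> g)"
  proof (rule the_elem_const)
    show "cl s (f \<boxplus> g) \<in> ?A"
      by (rule CollectI, rule exI[of _ s], rule exI[of _ f], rule exI[of _ g])
        (use cl_self[OF r(1)] cl_self[OF r(2)] in \<open>simp add: a_def b_def\<close>)
  next
    fix y assume "y \<in> ?A"
    then obtain s' f' g' where y: "y = cl s' (f' \<boxplus> g')" "(s', f') \<in> a" "(s', g') \<in> b"
      by blast
    have "((s, f), (s', f')) \<in> R" "((s, g), (s', g')) \<in> R"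
      using y r unfolding a_def b_def by (simp_all add: in_cl_iff)
    then have "((s, f \<boxplus> g), (s', f' \<boxplus> g')) \<in> R"
      by (rule add_wd[OF _ _ r(3)])
    then show "y = cl s (f \<boxplus> g)"
      unfolding y(1) using cl_eq_iff[of s "f \<boxplus> g" s' "f' \<boxplus> g'"] unfolding R_iff by metis
  qed
  then show ?thesis
    unfolding a_def[symmetric] b_def[symmetric] by (simp add: vq_defs)
qed

text \<open>The zero class can be given any denominator, so it can be added to a class without
  changing the left leg.\<close>

lemma zero_cl:
  assumes "roof s f" "Y \<in> Obj T"
  shows "cl s (Zero T (Dom T s) Y) = Zero U (Cod T s) Y"
proof -
  have s: "s \<in> S" "s \<in> Arr T" "Cod T s \<in> Obj T"
    using assms cod_obj by (auto simp: roof_def)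
  have "cl (Ident T (Cod T s) \<cdot> s) (Zero T (Cod T s) Y \<cdot> s) = cl (Ident T (Cod T s)) (Zero T (Cod T s) Y)"
    by (rule cl_refine) (use s assms in simp_all)
  then show ?thesis
    using s assms by (simp add: zero_U)
qed

lemma U_hom_comm_group:
  assumes ob: "X \<in> Obj T" "Y \<in> Obj T"
  shows "comm_group (hom_group U X Y)"
proof (rule comm_groupI, simp_all only: hom_group_simps)
  show "Zero U X Y \<in> Hom U X Y"
    using ob by (simp add: zero_U)
next
  fix a b assume "a \<in> Hom U X Y" "b \<in> Hom U X Y"
  then obtain s f g where r: "roof s f" "roof s g" "a = cl s f" "b = cl s g" "Cod T s = X"
    "Cod T f = Y" "Cod T g = Y"
    "s \<in> S" "s \<in> Arr T" "f \<in> Arr T" "g \<in> Arr T" "Dom T s = Dom T f" "Dom T g = Dom T f"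
    by (rule U_homE2)
  then show "a \<boxplus>\<^bsub>U\<^esub> b \<in> Hom U X Y"
    using add_cl[of s f g] roof_add[of s f g] by simp
  show "a \<boxplus>\<^bsub>U\<^esub> b = b \<boxplus>\<^bsub>U\<^esub> a"
    using r add_cl[of s f g] add_cl[of s g f] add_comm[of f g] by simp
next
  fix a b c assume h: "a \<in> Hom U X Y" "b \<in> Hom U X Y" "c \<in> Hom U X Y"
  obtain s f g where r: "roof s f" "roof s g" "a = cl s f" "b = cl s g" "Cod T s = X" "Cod T f = Y"
    "Cod T g = Y"
    "s \<in> S" "s \<in> Arr T" "f \<in> Arr T" "g \<in> Arr T" "Dom T s = Dom T f" "Dom T g = Dom T f"
    using h(1,2) by (rule U_homE2)
  obtain t k where c: "roof t k" "c = cl t k" "Cod T t = X" "Cod T k = Y" "t \<in> S" "t \<in> Arr T"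
    "k \<in> Arr T" "Dom T t = Dom T k"
    using h(3) by (rule U_homE)
  have e: "Cod T s = Cod T t"
    using r c by simp
  obtain u v where u: "u \<in> S" "u \<in> Arr T" "v \<in> Arr T" "Cod T u = Dom T s" "Cod T v = Dom T t"
    "Dom T u = Dom T v"
    "roof (s \<cdot> u) (f \<cdot> u)" "roof (s \<cdot> u) (k \<cdot> v)" "cl s f = cl (s \<cdot> u) (f \<cdot> u)" "c = cl (s \<cdot> u) (k \<cdot> v)"
    using common_denominator[OF r(1) c(1) e] c(2) by metis
  have u': "cl s g = cl (s \<cdot> u) (g \<cdot> u)" "roof (s \<cdot> u) (g \<cdot> u)"
    using cl_refine[OF r(2) u(1,4)] R_refine(2)[OF r(2) u(1,4)] by auto
  show "a \<boxplus>\<^bsub>U\<^esub> b \<boxplus>\<^bsub>U\<^esub> c = a \<boxplus>\<^bsub>U\<^esub> (b \<boxplus>\<^bsub>U\<^esub> c)"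
    unfolding r(3,4) u(9,10) u'(1)
    using u u' r c by (simp add: add_cl roof_add add_assoc)
next
  fix a assume "a \<in> Hom U X Y"
  then obtain s f where a: "roof s f" "a = cl s f" "Cod T s = X" "Cod T f = Y" "s \<in> S" "s \<in> Arr T"
    "f \<in> Arr T" "Dom T s = Dom T f"
    by (rule U_homE)
  have D: "Dom T f \<in> Obj T"
    using a dom_obj by auto
  have z: "Zero U X Y = cl s (Zero T (Dom T s) Y)"
    using zero_cl[OF a(1) ob(2)] a by simp
  have rz: "roof s (Zero T (Dom T s) Y)"
    using a D ob by (simp add: roof_def)
  show "Zero U X Y \<boxplus>\<^bsub>U\<^esub> a = a"
    unfolding z a(2) using a rz D ob by (simp add: add_cl)
  have rn: "roof s (neg T f)"
    using a by (simp add: roof_def)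
  have "cl s (neg T f) \<boxplus>\<^bsub>U\<^esub> a = Zero U X Y"
    unfolding z a(2) using a rn D ob by (simp add: add_cl neg_add)
  moreover have "cl s (neg T f) \<in> Hom U X Y"
    using rn a by simp
  ultimately show "\<exists>y\<in>Hom U X Y. y \<boxplus>\<^bsub>U\<^esub> a = Zero U X Y"
    by blast
qed

lemma U_preadditive: "preadditive_category U"
proof (rule preadditive_category.intro[OF U_category preadditive_category_axioms.intro])
  fix X Y assume "X \<in> Obj U" "Y \<in> Obj U"
  then show "comm_group (hom_group U X Y)"
    using U_hom_comm_group by simp
next
  fix a b b' X Y Z assume h: "a \<in> Hom U X Y" "b \<in> Hom U Y Z" "b' \<in> Hom U Y Z"
  obtain t g g' where b: "roof t g" "roof t g'" "b = cl t g" "b' = cl t g'" "Cod T t = Y"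
    "Cod T g = Z" "Cod T g' = Z"
    "t \<in> S" "t \<in> Arr T" "g \<in> Arr T" "g' \<in> Arr T" "Dom T t = Dom T g" "Dom T g' = Dom T g"
    using h(2,3) by (rule U_homE2)
  obtain s f where a: "roof s f" "a = cl s f" "Cod T s = X" "Cod T f = Y" "s \<in> S" "s \<in> Arr T"
    "f \<in> Arr T" "Dom T s = Dom T f"
    using h(1) by (rule U_homE)
  have e: "Cod T f = Cod T t"
    using a b by simp
  obtain u k where o: "ore f t u k"
    using ore_exists[OF a(1) b(1) e] by blast
  have k: "k \<in> Arr T" "Cod T k = Dom T t"
    using o by (auto simp: ore_def)
  have c: "cl t g \<cdot>\<^bsub>U\<^esub> cl s f = cl (s \<cdot> u) (g \<cdot> k)" "cl t g' \<cdot>\<^bsub>U\<^esub> cl s f = cl (s \<cdot> u) (g' \<cdot> k)"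
      "cl t (g \<boxplus> g') \<cdot>\<^bsub>U\<^esub> cl s f = cl (s \<cdot> u) ((g \<boxplus> g') \<cdot> k)"
    using comp_cl[OF a(1) b(1) e o] comp_cl[OF a(1) b(2) e o] comp_cl[OF a(1) roof_add[OF b(1,2)] e o] b by auto
  have r: "roof (s \<cdot> u) (g \<cdot> k)" "roof (s \<cdot> u) (g' \<cdot> k)"
    using ore_roof[OF a(1) b(1) e o] ore_roof[OF a(1) b(2) e o] by auto
  show "(b \<boxplus>\<^bsub>U\<^esub> b') \<cdot>\<^bsub>U\<^esub> a = (b \<cdot>\<^bsub>U\<^esub> a) \<boxplus>\<^bsub>U\<^esub> (b' \<cdot>\<^bsub>U\<^esub> a)"
    unfolding b(3,4) a(2) using b r k by (simp add: add_cl c add_comp)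
next
  fix a a' b X Y Z assume h: "a \<in> Hom U X Y" "a' \<in> Hom U X Y" "b \<in> Hom U Y Z"
  obtain s f f' where a: "roof s f" "roof s f'" "a = cl s f" "a' = cl s f'" "Cod T s = X"
    "Cod T f = Y" "Cod T f' = Y"
    "s \<in> S" "s \<in> Arr T" "f \<in> Arr T" "f' \<in> Arr T" "Dom T s = Dom T f" "Dom T f' = Dom T f"
    using h(1,2) by (rule U_homE2)
  obtain t g where b: "roof t g" "b = cl t g" "Cod T t = Y" "Cod T g = Z" "t \<in> S" "t \<in> Arr T"
    "g \<in> Arr T" "Dom T t = Dom T g"
    using h(3) by (rule U_homE)
  have e: "Cod T f = Cod T t" "Cod T f' = Cod T t" "Cod T (f \<boxplus> f') = Cod T t"
    using a b by simp_all
  obtain u k where o: "ore f t u k"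
    using ore_exists[OF a(1) b(1) e(1)] by blast
  have u: "u \<in> S" "u \<in> Arr T" "Cod T u = Dom T f" "k \<in> Arr T" "Dom T k = Dom T u"
    "Cod T k = Dom T t" "f \<cdot> u = t \<cdot> k"
    using o by (auto simp: ore_def)
  have fu: "f' \<cdot> u \<in> Arr T" "Cod T (f' \<cdot> u) = Cod T t"
    using u a e by simp_all
  \<comment> \<open>The second square is built over \<open>f' \<cdot> u\<close>, so that the squares
    for \<open>f\<close> and \<open>f'\<close> share the arrow \<open>u \<cdot> v\<close> and can be
    added.\<close>
  obtain v k' where v: "v \<in> S" "v \<in> Arr T" "Cod T v = Dom T (f' \<cdot> u)" "k' \<in> Arr T"
    "Dom T k' = Dom T v" "Cod T k' = Dom T t"
      "(f' \<cdot> u) \<cdot> v = t \<cdot> k'"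
    by (rule S_ore[OF fu(1) b(5) fu(2)])
  have v': "Cod T v = Dom T u" "f' \<cdot> (u \<cdot> v) = t \<cdot> k'"
    using v u a by simp_all
  have uv: "u \<cdot> v \<in> S"
    by (rule S_comp) (use u v v' in simp_all)
  have o1: "ore f t (u \<cdot> v) (k \<cdot> v)" and o2: "ore f' t (u \<cdot> v) k'"
    and o3: "ore (f \<boxplus> f') t (u \<cdot> v) ((k \<cdot> v) \<boxplus> k')"
    using uv u v(1,2,4-6) v' a b by (simp_all add: ore_def comp_reduce[OF u(7)] add_comp comp_add)
  have c: "cl t g \<cdot>\<^bsub>U\<^esub> cl s f = cl (s \<cdot> (u \<cdot> v)) (g \<cdot> (k \<cdot> v))"
    "cl t g \<cdot>\<^bsub>U\<^esub> cl s f' = cl (s \<cdot> (u \<cdot> v)) (g \<cdot> k')"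
      "cl t g \<cdot>\<^bsub>U\<^esub> cl s (f \<boxplus> f') = cl (s \<cdot> (u \<cdot> v)) (g \<cdot> ((k \<cdot> v) \<boxplus> k'))"
    using comp_cl[OF a(1) b(1) e(1) o1] comp_cl[OF a(2) b(1) e(2) o2] comp_cl[OF roof_add[OF a(1,2)] b(1)
      e(3) o3] a by auto
  have r: "roof (s \<cdot> (u \<cdot> v)) (g \<cdot> (k \<cdot> v))" "roof (s \<cdot> (u \<cdot> v)) (g \<cdot> k')"
    using ore_roof[OF a(1) b(1) e(1) o1] ore_roof[OF a(2) b(1) e(2) o2] by auto
  show "b \<cdot>\<^bsub>U\<^esub> (a \<boxplus>\<^bsub>U\<^esub> a') = (b \<cdot>\<^bsub>U\<^esub> a) \<boxplus>\<^bsub>U\<^esub> (b \<cdot>\<^bsub>U\<^esub> a')"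
    unfolding a(3,4) b(2) using a b r u v v' by (simp add: add_cl c comp_add)
qed

section \<open>The projection to the quotient\<close>

abbreviation "Q \<equiv> verdier_proj T N"

lemma Q_cl: "f \<in> Arr T \<Longrightarrow> Q f = cl (Ident T (Dom T f)) f"
  by (simp add: verdier_proj_def)

lemma Q_comp_cl:
  assumes "roof s f" "g \<in> Arr T" "Dom T g = Cod T f"
  shows "Q g \<cdot>\<^bsub>U\<^esub> cl s f = cl s (g \<cdot> f)"
proof -
  have t: "s \<in> Arr T" "f \<in> Arr T" "Dom T s = Dom T f" "Dom T f \<in> Obj T" "Cod T f \<in> Obj T"
    using assms dom_obj cod_obj by (auto simp: roof_def)
  have o: "ore f (Ident T (Cod T f)) (Ident T (Dom T f)) f"
    using t S_ident by (simp add: ore_def)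
  show ?thesis
    using comp_cl[OF assms(1) _ _ o, of g] assms t by (simp add: Q_cl)
qed

text \<open>A class is the fraction of \<open>Q f\<close> by \<open>Q s\<close>, and composing with
  \<open>Q s\<close> clears the denominator. Later arguments clear denominators in this way instead
  of composing roofs.\<close>

lemma cl_comp_Q:
  assumes "roof s f"
  shows "cl s f \<cdot>\<^bsub>U\<^esub> Q s = Q f"
proof -
  have t: "s \<in> Arr T" "f \<in> Arr T" "Dom T s = Dom T f" "Dom T f \<in> Obj T"
    using assms dom_obj by (auto simp: roof_def)
  have o: "ore s s (Ident T (Dom T f)) (Ident T (Dom T f))"
    using t S_ident by (simp add: ore_def)
  show ?thesis
    using comp_cl[OF _ assms _ o, of "Ident T (Dom T f)"] t by (simp add: Q_cl)
qed

lemma Q_functor: "additive_functor T U (\<lambda>X. X) Q"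
proof -
  interpret U: preadditive_category U
    by (rule U_preadditive)
  show ?thesis
  proof unfold_locales
    show "additive_maps T U (\<lambda>X. X) Q"
      unfolding additive_maps_def hom_def
      by (auto simp: Q_cl add_cl)
  next
    fix f g X Y Z assume "f \<in> Hom T X Y" "g \<in> Hom T Y Z"
    then show "Q (g \<cdot> f) = Q g \<cdot>\<^bsub>U\<^esub> Q f"
      using Q_comp_cl[of "Ident T X" f g] by (simp add: Q_cl)
  qed (auto simp: Q_cl ident_U dom_obj)
qed

end

sublocale verdier \<subseteq> Q: additive_functor T "verdier_quotient T N" "\<lambda>X. X" "verdier_proj T N"
  by (rule Q_functor)

context verdier begin

text \<open>The inverse of a projected denominator is the roof with trivial numerator.\<close>

lemma Q_iso:
  assumes "s \<in> S"
  shows "inverse_pair U (Q s) (cl s (Ident T (Dom T s)))"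
proof -
  have s: "s \<in> Arr T" "Dom T s \<in> Obj T" "Cod T s \<in> Obj T"
    using assms S_arr dom_obj cod_obj by auto
  have r: "roof s (Ident T (Dom T s))" "roof s s"
    using assms s by (auto simp: roof_def)
  have "cl s s = cl (Ident T (Cod T s)) (Ident T (Cod T s))"
    using cl_refine[of "Ident T (Cod T s)" "Ident T (Cod T s)" s] assms s by simp
  then show ?thesis
    using s r cl_comp_Q[OF r(1)] Q_comp_cl[OF r(1), of s] by (simp add: inverse_pair_def ident_U Q_cl)
qed

lemma Q_iso_arrow: "s \<in> S \<Longrightarrow> iso_arrow U (Q s)"
  using Q_iso by (auto simp: iso_arrow_iff)

text \<open>Forward, both roofs have identities as left legs, so their comparison arrows coincide;
  backward, \<open>Q u\<close> is invertible and cancels.\<close>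

lemma Q_eq_iff:
  assumes f: "f \<in> Arr T" "g \<in> Arr T" "Dom T f = Dom T g" "Cod T f = Cod T g"
  shows "Q f = Q g \<longleftrightarrow> (\<exists>u. u \<in> S \<and> u \<in> Arr T \<and> Cod T u = Dom T g \<and> f \<cdot> u = g \<cdot> u)"
proof
  assume "Q f = Q g"
  then have "((Ident T (Dom T g), f), (Ident T (Dom T g), g)) \<in> R"
    using f by (subst cl_eq_iff[symmetric]) (simp_all add: Q_cl)
  then obtain u u' where u: "u \<in> S" "u \<in> Arr T" "u' \<in> Arr T" "Cod T u = Dom T (Ident T (Dom T g))"
    "Cod T u' = Dom T (Ident T (Dom T g))" "Ident T (Dom T g) \<cdot> u = Ident T (Dom T g) \<cdot> u'" "f \<cdot> u = g \<cdot> u'"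
    by (rule R_E)
  then show "\<exists>u. u \<in> S \<and> u \<in> Arr T \<and> Cod T u = Dom T g \<and> f \<cdot> u = g \<cdot> u"
    using f dom_obj[of g] by (intro exI[of _ u]) simp
next
  assume "\<exists>u. u \<in> S \<and> u \<in> Arr T \<and> Cod T u = Dom T g \<and> f \<cdot> u = g \<cdot> u"
  then obtain u where u: "u \<in> S" "u \<in> Arr T" "Cod T u = Dom T g" "f \<cdot> u = g \<cdot> u"
    by blast
  have "Q f \<cdot>\<^bsub>U\<^esub> Q u = Q g \<cdot>\<^bsub>U\<^esub> Q u"
    using u f by (simp add: Q.map_comp'[symmetric])
  then show "Q f = Q g"
    by (rule Q.cod.iso_cancel_right[OF Q_iso_arrow[OF u(1)]]) (use u f in simp_all)
qed

lemma Q_zero_iff: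
  assumes f: "f \<in> Arr T" "Dom T f = X" "Cod T f = Y"
  shows "Q f = Zero U X Y \<longleftrightarrow> (\<exists>u. u \<in> S \<and> u \<in> Arr T \<and> Cod T u = X \<and> f \<cdot> u = Zero T (Dom T u) Y)"
proof -
  have ob: "X \<in> Obj T" "Y \<in> Obj T"
    using f dom_obj cod_obj by auto
  have "Q f = Q (Zero T X Y) \<longleftrightarrow> (\<exists>u. u \<in> S \<and> u \<in> Arr T \<and> Cod T u = X \<and> f \<cdot> u = Zero T X Y \<cdot> u)"
    using Q_eq_iff[of f "Zero T X Y"] f ob by simp
  also have "\<dots> \<longleftrightarrow> (\<exists>u. u \<in> S \<and> u \<in> Arr T \<and> Cod T u = X \<and> f \<cdot> u = Zero T (Dom T u) Y)"
    using ob by (intro ex_cong1) (auto simp: zero_comp)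
  finally show ?thesis
    using ob Q.map_zero by simp
qed

text \<open>The objects are those of \<open>T\<close>, so the additive functor \<open>Q\<close>
  already produces a zero object and all direct sums.\<close>

lemma U_additive: "additive_category U"
proof (rule additive_category.intro[OF U_category additive_category_axioms.intro])
  show "\<exists>M. zero_object U M"
    using zero_object_exists Q.map_zero_object by blast
  show "\<exists>M. biproduct U A B M" if "A \<in> Obj U" "B \<in> Obj U" for A B
    using biproduct_exists[of A B] that Q.map_biproduct by (metis Obj_U)
qed (fact Q.cod.hom_comm_group Q.cod.comp_add_left Q.cod.comp_add_right)+

lemma U_simps [simp]: "ShO U = ShO T" "ShA U = verdier_shift T N"
  by (simp_all add: vq_defs)

end

section \<open>Triangles in the Verdier quotient\<close>

sublocale verdier \<subseteq> U: additive_category "verdier_quotient T N"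
  by (rule U_additive)

context verdier begin

section \<open>The shift of the quotient\<close>

lemma R_shift:
  assumes "((s, f), (s', f')) \<in> R"
  shows "((ShA T s, ShA T f), (ShA T s', ShA T f')) \<in> R"
proof -
  obtain u u' where u: "u \<in> S" "u' \<in> S" "u \<in> Arr T" "u' \<in> Arr T" "Dom T u = Dom T u'" "Cod T u = Dom T s"
    "Cod T u' = Dom T s'" "s \<cdot> u = s' \<cdot> u'" "f \<cdot> u = f' \<cdot> u'" "s \<cdot> u \<in> S"
    using assms by (rule R_E)
  have r: "roof s f" "roof s' f'" "Cod T s = Cod T s'" "Cod T f = Cod T f'"
    using assms by (auto simp: R_iff)
  then have t: "s \<in> S" "s' \<in> S" "s \<in> Arr T" "s' \<in> Arr T" "f \<in> Arr T" "f' \<in> Arr T"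
    "Dom T f = Dom T s" "Dom T f' = Dom T s'"
    by (auto simp: roof_def)
  have "ShA T (s \<cdot> u) \<in> S"
    using u t S_shift by simp
  moreover have "ShA T (s \<cdot> u) = ShA T s \<cdot> ShA T u" "ShA T (s' \<cdot> u') = ShA T s' \<cdot> ShA T u'"
      "ShA T (f \<cdot> u) = ShA T f \<cdot> ShA T u" "ShA T (f' \<cdot> u') = ShA T f' \<cdot> ShA T u'"
    using u(3-7) t by (simp_all add: sh_comp)
  ultimately show ?thesis
    using u t r S_shift by (intro R_I[of _ _ _ _ "ShA T u" "ShA T u'"]) (simp_all add: roof_def)
qed

lemma roof_shift: "roof s f \<Longrightarrow> roof (ShA T s) (ShA T f)"
  using S_shift by (auto simp: roof_def)

lemma shift_cl:
  assumes r: "roof s f"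
  shows "verdier_shift T N (cl s f) = cl (ShA T s) (ShA T f)"
  unfolding verdier_shift_def
proof (rule the_elem_const)
  show "cl (ShA T s) (ShA T f) \<in> (\<lambda>(s, f). roof_class T N (ShA T s, ShA T f)) ` cl s f"
    using cl_self[OF r] by force
next
  fix y assume "y \<in> (\<lambda>(s, f). roof_class T N (ShA T s, ShA T f)) ` cl s f"
  then obtain s' f' where y: "(s', f') \<in> cl s f" "y = cl (ShA T s') (ShA T f')"
    by auto
  then have "((ShA T s, ShA T f), (ShA T s', ShA T f')) \<in> R"
    using R_shift r by (simp add: in_cl_iff)
  then show "y = cl (ShA T s) (ShA T f)"
    unfolding y(2) using cl_eq_iff[of "ShA T s" "ShA T f" "ShA T s'" "ShA T f'"] unfolding R_iff by metis
qed

abbreviation "VS \<equiv> verdier_shift T N"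

lemma VS_Q: "f \<in> Arr T \<Longrightarrow> VS (Q f) = Q (ShA T f)"
  using shift_cl[of "Ident T (Dom T f)" f] dom_obj by (simp add: Q_cl)

lemma U_shift_functor: "additive_functor U U (ShO T) VS"
proof unfold_locales
  fix a X Y assume "a \<in> Hom U X Y"
  then obtain s f where a: "roof s f" "a = cl s f" "Cod T s = X" "Cod T f = Y" "s \<in> S" "s \<in> Arr T"
    "f \<in> Arr T" "Dom T s = Dom T f"
    by (rule U_homE)
  show "VS a \<in> Hom U (ShO T X) (ShO T Y)"
    unfolding a(2) shift_cl[OF a(1)] using a roof_shift[OF a(1)] by simp
next
  fix X assume "X \<in> Obj U"
  then show "VS (Ident U X) = Ident U (ShO T X)" "ShO T X \<in> Obj U"
    using shift_cl[of "Ident T X" "Ident T X"] by (simp_all add: ident_U)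
next
  fix a b X Y Z assume "a \<in> Hom U X Y" "b \<in> Hom U Y Z"
  then obtain s f t g where a: "roof s f" "a = cl s f" "Cod T s = X" "Cod T f = Y"
    and b: "roof t g" "b = cl t g" "Cod T t = Y" "Cod T g = Z"
    by (elim U_homE)
  have e: "Cod T f = Cod T t"
    using a b by simp
  obtain u h where o: "ore f t u h"
    using ore_exists[OF a(1) b(1) e] by blast
  have t: "s \<in> Arr T" "f \<in> Arr T" "Dom T s = Dom T f" "t \<in> Arr T" "g \<in> Arr T" "Dom T t = Dom T g"
    using a b by (auto simp: roof_def)
  have u: "u \<in> S" "u \<in> Arr T" "Cod T u = Dom T f" "h \<in> Arr T" "Dom T h = Dom T u"
    "Cod T h = Dom T t" "f \<cdot> u = t \<cdot> h"
    using o by (auto simp: ore_def)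
  have "ShA T f \<cdot> ShA T u = ShA T t \<cdot> ShA T h"
    using arg_cong[OF u(7), of "ShA T"] u(1-6) t by (simp add: sh_comp)
  then have o': "ore (ShA T f) (ShA T t) (ShA T u) (ShA T h)"
    using u S_shift t by (simp add: ore_def)
  have e': "Cod T (ShA T f) = Cod T (ShA T t)"
    using e t by simp
  have "VS (b \<cdot>\<^bsub>U\<^esub> a) = cl (ShA T (s \<cdot> u)) (ShA T (g \<cdot> h))"
    unfolding a(2) b(2) comp_cl[OF a(1) b(1) e o] by (rule shift_cl[OF ore_roof[OF a(1) b(1) e o]])
  also have "\<dots> = cl (ShA T s \<cdot> ShA T u) (ShA T g \<cdot> ShA T h)"
    using u(1-6) t by (simp add: sh_comp)
  also have "\<dots> = VS b \<cdot>\<^bsub>U\<^esub> VS a"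
    unfolding a(2) b(2) shift_cl[OF a(1)] shift_cl[OF b(1)]
    by (rule comp_cl[OF roof_shift[OF a(1)] roof_shift[OF b(1)] e' o', symmetric])
  finally show "VS (b \<cdot>\<^bsub>U\<^esub> a) = VS b \<cdot>\<^bsub>U\<^esub> VS a" .
next
  show "additive_maps U U (ShO T) VS"
    unfolding additive_maps_def
  proof (intro ballI homI, unfold hom_group_simps)
    fix X Y a b assume "a \<in> Hom U X Y" "b \<in> Hom U X Y"
    then obtain s f g where r: "roof s f" "roof s g" "a = cl s f" "b = cl s g" "Cod T s = X"
      "Cod T f = Y" "Cod T g = Y"
      "s \<in> S" "s \<in> Arr T" "f \<in> Arr T" "g \<in> Arr T" "Dom T s = Dom T f" "Dom T g = Dom T f"
      by (rule U_homE2)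
    have "VS (a \<boxplus>\<^bsub>U\<^esub> b) = cl (ShA T s) (ShA T (f \<boxplus> g))"
      using r shift_cl[OF roof_add[OF r(1,2)]] by (simp add: add_cl)
    also have "\<dots> = cl (ShA T s) (ShA T f \<boxplus> ShA T g)"
      using r by (simp add: sh.map_add)
    also have "\<dots> = VS a \<boxplus>\<^bsub>U\<^esub> VS b"
      using r roof_shift[OF r(1)] roof_shift[OF r(2)] by (simp add: add_cl shift_cl)
    finally show "VS (a \<boxplus>\<^bsub>U\<^esub> b) = VS a \<boxplus>\<^bsub>U\<^esub> VS b" .
  next
    fix X Y a assume "a \<in> Hom U X Y"
    then obtain s f where a: "roof s f" "a = cl s f" "Cod T s = X" "Cod T f = Y" "s \<in> S" "s \<in> Arr T"
      "f \<in> Arr T" "Dom T s = Dom T f"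
      by (rule U_homE)
    show "VS a \<in> Hom U (ShO T X) (ShO T Y)"
      unfolding a(2) shift_cl[OF a(1)] using a roof_shift[OF a(1)] by simp
  qed
qed

lemma U_shift_equivalence: "cat_equivalence U U (ShO T) VS"
proof -
  interpret VS: additive_functor U U "ShO T" VS
    by (rule U_shift_functor)
  have "full_faithful U U (ShO T) VS"
    unfolding full_faithful_def bij_betw_def
  proof (intro ballI conjI inj_onI subset_antisym[OF image_subsetI subsetI])
    fix X Y a b assume aH: "a \<in> Hom U X Y" and bH: "b \<in> Hom U X Y" and eq: "VS a = VS b"
    obtain s f g where r: "roof s f" "roof s g" "a = cl s f" "b = cl s g" "Cod T s = X"
      "Cod T f = Y" "Cod T g = Y"
      "s \<in> S" "s \<in> Arr T" "f \<in> Arr T" "g \<in> Arr T" "Dom T s = Dom T f" "Dom T g = Dom T f"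
      by (rule U_homE2[OF aH bH])
    have "Q (ShA T f) = VS a \<cdot>\<^bsub>U\<^esub> Q (ShA T s)"
      using cl_comp_Q[OF roof_shift[OF r(1)]] r shift_cl[OF r(1)] by simp
    also have "\<dots> = Q (ShA T g)"
      unfolding eq using cl_comp_Q[OF roof_shift[OF r(2)]] r shift_cl[OF r(2)] by simp
    finally obtain u where u: "u \<in> S" "u \<in> Arr T" "Cod T u = Dom T (ShA T g)" "ShA T f \<cdot> u = ShA T g \<cdot> u"
      using Q_eq_iff[of "ShA T f" "ShA T g"] r by auto
    have D: "Dom T u \<in> Obj T" "Dom T g \<in> Obj T"
      using u r dom_obj by auto
    \<comment> \<open>The equalizing arrow \<open>u\<close> starts at an object that need not be a
      shift. Precomposition with \<open>e\<close> makes its domain a shift, so that it can be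
      desuspended.\<close>
    obtain V e e' where V: "V \<in> Obj T" "inverse_pair T e e'" "Dom T e = ShO T V" "Cod T e = Dom T u"
      using desuspend[OF D(1)] by metis
    have e: "e \<in> Arr T" "e \<in> S"
      using V S_iso[of e] by (auto simp: inverse_pair_def iso_arrow_iff)
    obtain w where w: "w \<in> Arr T" "Dom T w = V" "Cod T w = Dom T g" "ShA T w = u \<cdot> e"
      using sh_full[OF V(1) D(2), of "u \<cdot> e"] u e V r by auto
    have "u \<cdot> e \<in> S"
      by (rule S_comp) (use u e V in simp_all)
    then have wS: "w \<in> S"
      using S_shift[OF w(1)] w(4) by simp
    have "ShA T (f \<cdot> w) = ShA T f \<cdot> (u \<cdot> e)"
      using w r by (simp add: sh_comp)
    also have "\<dots> = ShA T g \<cdot> (u \<cdot> e)"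
      using u e V r by (simp add: comp_reduce[OF u(4)])
    also have "\<dots> = ShA T (g \<cdot> w)"
      using w r by (simp add: sh_comp)
    finally have "f \<cdot> w = g \<cdot> w"
      by (rule sh_faithful[rotated 4]) (use w r in simp_all)
    then have Qfg: "Q f = Q g"
      using Q_eq_iff[of f g] w wS r by auto
    have "a \<cdot>\<^bsub>U\<^esub> Q s = b \<cdot>\<^bsub>U\<^esub> Q s"
      using Qfg cl_comp_Q r by simp
    then show "a = b"
      by (rule Q.cod.iso_cancel_right[OF Q_iso_arrow[OF r(8)]]) (use r in simp_all)
  next
    fix X Y a assume ob: "X \<in> Obj U" "Y \<in> Obj U" and "a \<in> Hom U (ShO T X) (ShO T Y)"
    then obtain s f where a: "roof s f" "a = cl s f" "Cod T s = ShO T X" "Cod T f = ShO T Y" "s \<in> S"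
      "s \<in> Arr T" "f \<in> Arr T" "Dom T s = Dom T f"
      by (elim U_homE)
    have ob': "X \<in> Obj T" "Y \<in> Obj T" "Dom T f \<in> Obj T"
      using ob a dom_obj by auto
    \<comment> \<open>The apex of the roof is replaced by a shift, after which both legs
      desuspend.\<close>
    obtain V e e' where V: "V \<in> Obj T" "inverse_pair T e e'" "Dom T e = ShO T V" "Cod T e = Dom T f"
      using desuspend[OF ob'(3)] by metis
    have e: "e \<in> Arr T" "e \<in> S"
      using V S_iso[of e] by (auto simp: inverse_pair_def iso_arrow_iff)
    obtain w where w: "w \<in> Arr T" "Dom T w = V" "Cod T w = X" "ShA T w = s \<cdot> e"
      using sh_full[OF V(1) ob'(1), of "s \<cdot> e"] e V a by auto
    obtain k where k: "k \<in> Arr T" "Dom T k = V" "Cod T k = Y" "ShA T k = f \<cdot> e"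
      using sh_full[OF V(1) ob'(2), of "f \<cdot> e"] e V a by auto
    have "s \<cdot> e \<in> S"
      by (rule S_comp) (use a e V in simp_all)
    then have wS: "w \<in> S"
      using S_shift[OF w(1)] w(4) by simp
    have r: "roof w k"
      using w k wS by (simp add: roof_def)
    have "VS (cl w k) = cl (s \<cdot> e) (f \<cdot> e)"
      using shift_cl[OF r] w k by simp
    also have "\<dots> = a"
      using cl_refine[OF a(1) e(2)] V a by simp
    finally show "a \<in> VS ` Hom U X Y"
      using r w k by (intro image_eqI[of _ _ "cl w k"]) simp_all
  qed (use VS.map_hom in blast)
  moreover have "ess_surj U U (ShO T)"
    using sh_es Q.map_isomorphic unfolding ess_surj_def Obj_U by blast
  ultimately show ?thesis
    using VS.cat_functor_axioms by (simp add: cat_equivalence_iff)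
qed

lemma U_additive_shift: "additive_shift U"
  by (rule additive_shift.intro[OF U_additive additive_shift_axioms.intro])
    (simp_all add: U_shift_equivalence additive_functor.additive[OF U_shift_functor])

end

sublocale verdier \<subseteq> U: additive_shift "verdier_quotient T N"
  by (rule U_additive_shift)

section \<open>Triangles of the quotient\<close>

context verdier begin

text \<open>Once the denominator of \<open>a\<close> is cleared, the vanishing of its composite with
  \<open>Q g\<close> holds in \<open>T\<close> after a further denominator \<open>u\<close>;
  exactness in \<open>T\<close> then lifts the numerator.\<close>

lemma Q_exact:
  assumes e: "hom_exact f g"
  shows "Q.cod.hom_exact (Q f) (Q g)"
  unfolding Q.cod.hom_exact_def
proof (intro conjI ballI impI)
  note t = hom_exactD[OF e]
  have ob: "Dom T f \<in> Obj T" "Dom T g \<in> Obj T" "Cod T g \<in> Obj T"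
    using t dom_obj cod_obj by auto
  show "Q f \<in> Arr U" "Q g \<in> Arr U" "Cod U (Q f) = Dom U (Q g)"
    using t by simp_all
  show "Q g \<cdot>\<^bsub>U\<^esub> Q f = Zero U (Dom U (Q f)) (Cod U (Q g))"
    using t ob Q.map_comp'[of f g] by simp
  fix a assume a0: "a \<in> Arr U" "Cod U a = Cod U (Q f)" "Q g \<cdot>\<^bsub>U\<^esub> a = Zero U (Dom U a) (Cod U (Q g))"
  have aH: "a \<in> Hom U (Dom U a) (Cod T f)"
    using a0 t by simp
  obtain s k where a: "roof s k" "a = cl s k" "Cod T s = Dom U a" "Cod T k = Cod T f" "s \<in> S"
    "s \<in> Arr T" "k \<in> Arr T" "Dom T s = Dom T k"
    by (rule U_homE[OF aH])
  have ob2: "Dom U a \<in> Obj T" "Dom T k \<in> Obj T"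
    using a cod_obj[of s] dom_obj[of k] by simp_all
  have "Q (g \<cdot> k) = Q g \<cdot>\<^bsub>U\<^esub> (a \<cdot>\<^bsub>U\<^esub> Q s)"
    using a t cl_comp_Q[OF a(1)] Q.map_comp'[of k g] by simp
  also have "\<dots> = (Q g \<cdot>\<^bsub>U\<^esub> a) \<cdot>\<^bsub>U\<^esub> Q s"
    using a0(1,2) a(3,6) t(1-3) Q.cod.assoc[of "Q s" a "Q g"] by simp
  also have "\<dots> = Zero U (Dom T k) (Cod T g)"
    unfolding a0(3) using a(3,5-8) t(1-3) ob ob2 by simp
  finally obtain u where u: "u \<in> S" "u \<in> Arr T" "Cod T u = Dom T k" "(g \<cdot> k) \<cdot> u = Zero T (Dom T u) (Cod T g)"
    using Q_zero_iff[of "g \<cdot> k" "Dom T k" "Cod T g"] a t by auto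
  have gku: "g \<cdot> (k \<cdot> u) = Zero T (Dom T (k \<cdot> u)) (Cod T g)"
    using u a t by simp
  obtain z where z: "z \<in> Arr T" "Dom T z = Dom T (k \<cdot> u)" "Cod T z = Dom T f" "f \<cdot> z = k \<cdot> u"
    by (rule hom_exactE[OF e _ _ gku]) (use u a t in simp_all)
  have su: "s \<cdot> u \<in> S"
    by (rule S_comp) (use u a in simp_all)
  have rz: "roof (s \<cdot> u) z"
    using su z(1-3) u a by (simp add: roof_def)
  have "Q f \<cdot>\<^bsub>U\<^esub> cl (s \<cdot> u) z = cl (s \<cdot> u) (k \<cdot> u)"
    using Q_comp_cl[OF rz t(1)] z by simp
  also have "\<dots> = a"
    using cl_refine[OF a(1) u(1)] u a by simp
  finally show "\<exists>z. z \<in> Arr U \<and> Dom U z = Dom U a \<and> Cod U z = Dom U (Q f) \<and> Q f \<cdot>\<^bsub>U\<^esub> z = a"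
    using rz z u a t by (intro exI[of _ "cl (s \<cdot> u) z"]) simp
qed

lemma Q_exact_tri:
  assumes t: "(f, g, h) \<in> Tri T"
  shows "Q.cod.hom_exact (Q f) (Q g)" "Q.cod.hom_exact (Q g) (Q h)" "Q.cod.hom_exact (Q h) (VS (Q f))"
  using Q_exact[OF tri_exact1[OF t]] Q_exact[OF tri_exact2[OF t]] Q_exact[OF tri_exact3[OF t]] tri_arr[OF t]
  by (simp_all add: VS_Q)

lemma Q_seq: "is_seq T (ShO T) (f, g, h) \<Longrightarrow> is_seq U (ShO T) (Q f, Q g, Q h)"
  by (auto simp: is_seq_iff)

lemma Q_seq_morphism:
  assumes s: "is_seq T (ShO T) (f, g, h)" "is_seq T (ShO T) (f', g', h')"
    and m: "seq_morphism T (ShA T) (f, g, h) (f', g', h') (a, b, c)"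
  shows "seq_morphism U VS (Q f, Q g, Q h) (Q f', Q g', Q h') (Q a, Q b, Q c)"
proof -
  have t: "f \<in> Arr T" "g \<in> Arr T" "h \<in> Arr T" "Cod T f = Dom T g" "Cod T g = Dom T h"
    "Cod T h = ShO T (Dom T f)"
     "f' \<in> Arr T" "g' \<in> Arr T" "h' \<in> Arr T" "Cod T f' = Dom T g'" "Cod T g' = Dom T h'"
     "Cod T h' = ShO T (Dom T f')"
    using s by (auto simp: is_seq_iff)
  have c: "a \<in> Arr T" "Dom T a = Dom T f" "Cod T a = Dom T f'" "b \<in> Arr T" "Dom T b = Dom T g"
    "Cod T b = Dom T g'"
     "c \<in> Arr T" "Dom T c = Dom T h" "Cod T c = Dom T h'"
    and e: "b \<cdot> f = f' \<cdot> a" "c \<cdot> g = g' \<cdot> b" "ShA T a \<cdot> h = h' \<cdot> c"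
    using m by (auto simp: seq_morphism_iff)
  show ?thesis
    using t c e Q.map_comp'[of f b] Q.map_comp'[of a f'] Q.map_comp'[of g c] Q.map_comp'[of b g']
      Q.map_comp'[of h "ShA T a"] Q.map_comp'[of c h'] by (simp add: seq_morphism_iff VS_Q)
qed

text \<open>The arrows \<open>a\<close> and \<open>b\<close> carry denominators, so filling in
  \<open>T\<close> does not apply directly. A triangle on a common refinement \<open>k2\<close> maps
  to both given triangles; the map \<open>r\<close> to the first becomes invertible in the quotient,
  and \<open>\<gamma>\<close> composed with that inverse is the filler.\<close>

lemma Q_fill:
  assumes t: "(f, g, h) \<in> Tri T" "(f', g', h') \<in> Tri T"
    and a0: "a \<in> Hom U (Dom T f) (Dom T f')" and b0: "b \<in> Hom U (Cod T f) (Cod T f')"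
    and eq: "b \<cdot>\<^bsub>U\<^esub> Q f = Q f' \<cdot>\<^bsub>U\<^esub> a"
  shows "\<exists>c. seq_morphism U VS (Q f, Q g, Q h) (Q f', Q g', Q h') (a, b, c)"
proof -
  note A = tri_arr[OF t(1)] and A' = tri_arr[OF t(2)]
  obtain s \<alpha> where a: "roof s \<alpha>" "a = cl s \<alpha>" "Cod T s = Dom T f" "Cod T \<alpha> = Dom T f'" "s \<in> S"
    "s \<in> Arr T" "\<alpha> \<in> Arr T" "Dom T s = Dom T \<alpha>"
    using a0 by (rule U_homE)
  obtain t \<beta> where b: "roof t \<beta>" "b = cl t \<beta>" "Cod T t = Cod T f" "Cod T \<beta> = Cod T f'" "t \<in> S"
    "t \<in> Arr T" "\<beta> \<in> Arr T" "Dom T t = Dom T \<beta>"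
    using b0 by (rule U_homE)
  have fs: "f \<cdot> s \<in> Arr T" "Cod T (f \<cdot> s) = Cod T t"
    using A(1) a b by simp_all
  obtain u k where u: "u \<in> S" "u \<in> Arr T" "Cod T u = Dom T (f \<cdot> s)" "k \<in> Arr T" "Dom T k = Dom T u"
    "Cod T k = Dom T t"
      "(f \<cdot> s) \<cdot> u = t \<cdot> k"
    by (rule S_ore[OF fs(1) b(5) fs(2)])
  have u': "Cod T u = Dom T \<alpha>" "f \<cdot> (s \<cdot> u) = t \<cdot> k"
    using u(2,3,7) a A(1) by simp_all
  have "Q (\<beta> \<cdot> k) = b \<cdot>\<^bsub>U\<^esub> (Q t \<cdot>\<^bsub>U\<^esub> Q k)"
    using b0 b u(2-6) cl_comp_Q[OF b(1)] Q.cod.comp_reduce[OF cl_comp_Q[OF b(1)]] by (simp add: Q.map_comp')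
  also have "\<dots> = (b \<cdot>\<^bsub>U\<^esub> Q f) \<cdot>\<^bsub>U\<^esub> Q (s \<cdot> u)"
    using b0 b A(1) a u u' Q.map_comp'[of k t] Q.map_comp'[of "s \<cdot> u" f] by simp
  also have "\<dots> = Q f' \<cdot>\<^bsub>U\<^esub> (a \<cdot>\<^bsub>U\<^esub> (Q s \<cdot>\<^bsub>U\<^esub> Q u))"
    unfolding eq using a0 A'(1) a(3-8) u(2) u' Q.map_comp'[of u s] by simp
  also have "\<dots> = Q f' \<cdot>\<^bsub>U\<^esub> (Q \<alpha> \<cdot>\<^bsub>U\<^esub> Q u)"
    using a0 A'(1) a u(2) u' Q.cod.comp_reduce[OF cl_comp_Q[OF a(1)]] by simp
  also have "\<dots> = Q (f' \<cdot> (\<alpha> \<cdot> u))"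
    using A'(1) a u(2) u' by (simp add: Q.map_comp')
  finally have "Q (\<beta> \<cdot> k) = Q (f' \<cdot> (\<alpha> \<cdot> u))" .
  \<comment> \<open>The square with \<open>\<beta>\<close> commutes only in the quotient;
    precomposition with \<open>v\<close> makes it commute in \<open>T\<close>.\<close>
  then obtain v where v: "v \<in> S" "v \<in> Arr T" "Cod T v = Dom T u" "(\<beta> \<cdot> k) \<cdot> v = (f' \<cdot> (\<alpha> \<cdot> u)) \<cdot> v"
    using Q_eq_iff[of "\<beta> \<cdot> k" "f' \<cdot> (\<alpha> \<cdot> u)"] b u(2-6) u'(1) A'(1) a A' by auto
  define w where "w = u \<cdot> v"
  have w: "w \<in> S" "w \<in> Arr T" "Cod T w = Dom T \<alpha>" "Dom T w = Dom T v"
    unfolding w_def using S_comp[OF v(1) u(1)] v u u' by simp_all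
  define s2 \<alpha>2 k2 where "s2 = s \<cdot> w" and "\<alpha>2 = \<alpha> \<cdot> w" and "k2 = k \<cdot> v"
  have ty: "s2 \<in> Arr T" "Dom T s2 = Dom T v" "Cod T s2 = Dom T f" "\<alpha>2 \<in> Arr T" "Dom T \<alpha>2 = Dom T v"
    "Cod T \<alpha>2 = Dom T f'"
     "k2 \<in> Arr T" "Dom T k2 = Dom T v" "Cod T k2 = Dom T t"
    unfolding s2_def \<alpha>2_def k2_def using w a u v by simp_all
  have sq1: "t \<cdot> k2 = f \<cdot> s2"
    unfolding k2_def s2_def w_def using a b u(2,4-6) v(2,3) u'(1) A(1) comp_reduce[OF u'(2)] by simp
  have sq2: "\<beta> \<cdot> k2 = f' \<cdot> \<alpha>2"
    unfolding k2_def \<alpha>2_def w_def using a b u(2,4-6) v u'(1) A'(1) by simp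
  have s2S: "s2 \<in> S"
    unfolding s2_def by (rule S_comp) (use w a in simp_all)
  have acl: "roof s2 \<alpha>2" "a = cl s2 \<alpha>2"
    unfolding s2_def \<alpha>2_def using R_refine(2)[OF a(1) w(1)] cl_refine[OF a(1) w(1)] w a by simp_all
  obtain l m where T0: "(k2, l, m) \<in> Tri T"
    using tri_cone[OF ty(7)] by blast
  note B = tri_arr[OF T0]
  obtain r where r: "r \<in> Arr T" "Dom T r = Cod T l" "Cod T r = Cod T g" "r \<cdot> l = g \<cdot> t" "ShA T s2 \<cdot> m = h \<cdot> r"
      "seq_morphism T (ShA T) (k2, l, m) (f, g, h) (s2, t, r)"
    by (rule fillE[OF T0 t(1), of s2 t]) (use ty b sq1 in simp_all)
  obtain \<gamma> where \<gamma>: "\<gamma> \<in> Arr T" "Dom T \<gamma> = Cod T l" "Cod T \<gamma> = Cod T g'" "\<gamma> \<cdot> l = g' \<cdot> \<beta>"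
    "ShA T \<alpha>2 \<cdot> m = h' \<cdot> \<gamma>"
    by (rule fillE[OF T0 t(2), of \<alpha>2 \<beta>]) (use ty b sq2 in simp_all)
  have "seq_morphism U (ShA U) (Q k2, Q l, Q m) (Q f, Q g, Q h) (Q s2, Q t, Q r)"
    using Q_seq_morphism[OF tri_seq[OF T0] tri_seq[OF t(1)] r(6)] by simp
  \<comment> \<open>The outer components \<open>s2\<close> and \<open>t\<close> lie in
    \<open>S\<close>, and the projected rows are still exact, which is all that the five lemma asks
    for.\<close>
  then have Qr: "iso_arrow U (Q r)"
    by (rule U.five_lemma_seq[rotated 6])
      (use Q_exact_tri[OF T0] Q_exact_tri[OF t(1)] Q_iso_arrow[OF s2S] Q_iso_arrow[OF b(5)] in simp_all)
  obtain r' where r': "inverse_pair U (Q r) r'"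
    using Qr by (rule iso_arrowE)
  note rc = Q.cod.inverse_pair_cancel[OF r']
  define c where "c = Q \<gamma> \<cdot>\<^bsub>U\<^esub> r'"
  have c: "c \<in> Arr U" "Dom U c = Cod T g" "Cod U c = Cod T g'"
    unfolding c_def using rc(6-8) r(1-3) \<gamma>(1-3) by simp_all
  have cr: "c \<cdot>\<^bsub>U\<^esub> Q r = Q \<gamma>"
    unfolding c_def using rc(3,5-8) r(1-3) \<gamma>(1-3) by simp
  have bt: "b \<cdot>\<^bsub>U\<^esub> Q t = Q \<beta>" and as: "a \<cdot>\<^bsub>U\<^esub> Q s2 = Q \<alpha>2"
    using cl_comp_Q[OF b(1)] b(2) cl_comp_Q[OF acl(1)] acl(2) by simp_all
  have ab: "a \<in> Arr U" "Dom U a = Dom T f" "Cod U a = Dom T f'" "b \<in> Arr U" "Dom U b = Cod T f"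
    "Cod U b = Cod T f'"
    using a0 b0 by simp_all
  have 2: "c \<cdot>\<^bsub>U\<^esub> Q g = Q g' \<cdot>\<^bsub>U\<^esub> b"
  proof (rule Q.cod.iso_cancel_right[OF Q_iso_arrow[OF b(5)]])
    have "(c \<cdot>\<^bsub>U\<^esub> Q g) \<cdot>\<^bsub>U\<^esub> Q t = c \<cdot>\<^bsub>U\<^esub> (Q r \<cdot>\<^bsub>U\<^esub> Q l)"
      using c A b(3,6) r(1-4) B Q.map_comp'[of t g] Q.map_comp'[of l r] by simp
    also have "\<dots> = Q \<gamma> \<cdot>\<^bsub>U\<^esub> Q l"
      using c r(1-3) B by (simp add: Q.cod.comp_reduce[OF cr])
    also have "\<dots> = Q g' \<cdot>\<^bsub>U\<^esub> Q \<beta>"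
      using \<gamma>(1-4) B A' b(4,7) Q.map_comp'[of l \<gamma>] Q.map_comp'[of \<beta> g'] by simp
    also have "\<dots> = (Q g' \<cdot>\<^bsub>U\<^esub> b) \<cdot>\<^bsub>U\<^esub> Q t"
      using A' ab b(3,6) bt by simp
    finally show "(c \<cdot>\<^bsub>U\<^esub> Q g) \<cdot>\<^bsub>U\<^esub> Q t = (Q g' \<cdot>\<^bsub>U\<^esub> b) \<cdot>\<^bsub>U\<^esub> Q t" .
  qed (use c A A' ab b(3,6) in simp_all)
  have VSa: "VS a \<in> Arr U" "Dom U (VS a) = ShO T (Dom T f)" "Cod U (VS a) = ShO T (Dom T f')"
    using U.sh.map_arr[of a] U.sh.dom_map[of a] U.sh.cod_map[of a] ab by simp_all
  have VSas: "VS a \<cdot>\<^bsub>U\<^esub> Q (ShA T s2) = Q (ShA T \<alpha>2)"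
    using U.sh.map_comp'[of "Q s2" a] ab ty as by (simp add: VS_Q)
  have 3: "VS a \<cdot>\<^bsub>U\<^esub> Q h = Q h' \<cdot>\<^bsub>U\<^esub> c"
  proof (rule Q.cod.iso_cancel_right[OF Qr])
    have "(VS a \<cdot>\<^bsub>U\<^esub> Q h) \<cdot>\<^bsub>U\<^esub> Q r = VS a \<cdot>\<^bsub>U\<^esub> (Q (ShA T s2) \<cdot>\<^bsub>U\<^esub> Q m)"
      using VSa A B r(1-3,5) ty(1-3,8) Q.map_comp'[of r h] Q.map_comp'[of m "ShA T s2"] by simp
    also have "\<dots> = Q (ShA T \<alpha>2) \<cdot>\<^bsub>U\<^esub> Q m"
      using VSa B ty by (simp add: Q.cod.comp_reduce[OF VSas])
    also have "\<dots> = Q h' \<cdot>\<^bsub>U\<^esub> Q \<gamma>"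
      using \<gamma>(1-3,5) B A' ty Q.map_comp'[of \<gamma> h'] Q.map_comp'[of m "ShA T \<alpha>2"] by simp
    also have "\<dots> = (Q h' \<cdot>\<^bsub>U\<^esub> c) \<cdot>\<^bsub>U\<^esub> Q r"
      using c r(1-3) A' by (simp add: cr)
    finally show "(VS a \<cdot>\<^bsub>U\<^esub> Q h) \<cdot>\<^bsub>U\<^esub> Q r = (Q h' \<cdot>\<^bsub>U\<^esub> c) \<cdot>\<^bsub>U\<^esub> Q r" .
  qed (use c r(1-3) A A' VSa in simp_all)
  have "seq_morphism U VS (Q f, Q g, Q h) (Q f', Q g', Q h') (a, b, c)"
    using ab c A A' eq 2 3 by (simp add: seq_morphism_iff)
  then show ?thesis
    by blast
qed

text \<open>The set of triangles is defined through the record without shift and triangles.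
  Isomorphism of sequences sees only the underlying category, so the full record may be used
  instead.\<close>

lemma seq_isomorphic_preadd: "seq_isomorphic (verdier_preadd T N) = seq_isomorphic U"
  by (intro ext) (simp add: seq_isomorphic_def is_seq_def seq_morphism_def iso_arrow_def Hom_def
      verdier_quotient_def preadd_data.extend_def triang_data.fields_def verdier_preadd_def)

lemma Tri_U: "t \<in> Tri U \<longleftrightarrow> (\<exists>f g h. (f, g, h) \<in> Tri T \<and> seq_isomorphic U (ShO T) VS t (Q f, Q g, Q h))"
proof -
  have "Tri U = {t. \<exists>(f, g, h)\<in>Tri T. seq_isomorphic (verdier_preadd T N) (ShO T) VS t (Q f, Q g, Q h)}"
    by (simp add: verdier_quotient_def preadd_data.extend_def triang_data.fields_def)
  then show ?thesis
    unfolding seq_isomorphic_preadd by auto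
qed

lemma Q_tri: "(f, g, h) \<in> Tri T \<Longrightarrow> (Q f, Q g, Q h) \<in> Tri U"
  unfolding Tri_U using U.seq_isomorphic_refl[unfolded U_simps] Q_seq tri_seq by blast

lemma Q_seq_isomorphic:
  assumes "seq_isomorphic T (ShO T) (ShA T) (f, g, h) (f', g', h')"
  shows "seq_isomorphic U (ShO T) VS (Q f, Q g, Q h) (Q f', Q g', Q h')"
proof -
  obtain a b c where s: "is_seq T (ShO T) (f, g, h)" "is_seq T (ShO T) (f', g', h')"
    and m: "seq_morphism T (ShA T) (f, g, h) (f', g', h') (a, b, c)"
    and i: "iso_arrow T a" "iso_arrow T b" "iso_arrow T c"
    using assms unfolding seq_isomorphic_def by blast
  show ?thesis
    by (rule seq_isomorphicI[OF Q_seq[OF s(1)] Q_seq[OF s(2)] Q_seq_morphism[OF s m]])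
      (use i Q.map_iso in auto)
qed

lemma zero_objects_iso:
  assumes "zero_object U A" "zero_object U B"
  shows "iso_arrow U (Zero U A B)"
proof -
  have "A \<in> Obj T" "B \<in> Obj T" "Ident U A = Zero U A A" "Ident U B = Zero U B B"
    using assms unfolding Q.cod.zero_object_iff by simp_all
  then have "inverse_pair U (Zero U A B) (Zero U B A)"
    by (simp add: inverse_pair_def)
  then show ?thesis
    by (auto simp: iso_arrow_iff)
qed

lemma U_tri_rotate:
  assumes s: "is_seq U (ShO T) (f, g, h)"
  shows "(f, g, h) \<in> Tri U \<longleftrightarrow> (g, h, neg U (VS f)) \<in> Tri U"
proof
  assume "(f, g, h) \<in> Tri U"
  then obtain f0 g0 h0 where t: "(f0, g0, h0) \<in> Tri T" and i: "seq_isomorphic U (ShO T) VS (f, g, h) (Q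
    f0, Q g0, Q h0)"
    unfolding Tri_U by blast
  have "seq_isomorphic U (ShO T) VS (g, h, neg U (VS f)) (Q g0, Q h0, neg U (VS (Q f0)))"
    using U.seq_isomorphic_rotate[unfolded U_simps, OF s Q_seq[OF tri_seq[OF t]]] i by blast
  then have "seq_isomorphic U (ShO T) VS (g, h, neg U (VS f)) (Q g0, Q h0, Q (neg T (ShA T f0)))"
    using tri_arr[OF t] by (simp add: VS_Q)
  then show "(g, h, neg U (VS f)) \<in> Tri U"
    unfolding Tri_U using rotate[OF t] by blast
next
  assume "(g, h, neg U (VS f)) \<in> Tri U"
  then obtain g0 h0 k0 where t: "(g0, h0, k0) \<in> Tri T" and i: "seq_isomorphic U (ShO T) VS (g, h, neg U
    (VS f)) (Q g0, Q h0, Q k0)"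
    unfolding Tri_U by blast
  \<comment> \<open>To rotate back, \<open>g0\<close> is preceded by its cocone \<open>f1\<close>;
    uniqueness of triangles on \<open>g0\<close> identifies the rotation of the new triangle with
    the given one.\<close>
  obtain f1 h1 where t1: "(f1, g0, h1) \<in> Tri T"
    using cocone[of g0] tri_arr[OF t] by blast
  have "seq_isomorphic U (ShO T) VS (Q g0, Q h0, Q k0) (Q g0, Q h1, Q (neg T (ShA T f1)))"
    by (rule Q_seq_isomorphic[OF tri_unique[OF t rotate[OF t1]]])
  then have "seq_isomorphic U (ShO T) VS (Q g0, Q h0, Q k0) (Q g0, Q h1, neg U (VS (Q f1)))"
    using tri_arr[OF t1] by (simp add: VS_Q)
  then have "seq_isomorphic U (ShO T) VS (g, h, neg U (VS f)) (Q g0, Q h1, neg U (VS (Q f1)))"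
    by (rule U.seq_isomorphic_trans[unfolded U_simps, OF i])
  then have "seq_isomorphic U (ShO T) VS (f, g, h) (Q f1, Q g0, Q h1)"
    using U.seq_isomorphic_rotate[unfolded U_simps, OF s Q_seq[OF tri_seq[OF t1]]] by blast
  then show "(f, g, h) \<in> Tri U"
    unfolding Tri_U using t1 by blast
qed

text \<open>Conjugate by the isomorphisms to projected triangles, fill there by
  \<open>Q_fill\<close>, and conjugate back.\<close>

lemma U_tri_fill:
  assumes t: "(f, g, h) \<in> Tri U" "(f', g', h') \<in> Tri U"
    and ab: "a \<in> Hom U (Dom U f) (Dom U f')" "b \<in> Hom U (Cod U f) (Cod U f')" "b \<cdot>\<^bsub>U\<^esub> f = f' \<cdot>\<^bsub>U\<^esub> a"
  shows "\<exists>c. seq_morphism U VS (f, g, h) (f', g', h') (a, b, c)"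
proof -
  obtain f0 g0 h0 where t0: "(f0, g0, h0) \<in> Tri T" and "seq_isomorphic U (ShO T) VS (f, g, h) (Q f0, Q
    g0, Q h0)"
    using t(1) unfolding Tri_U by blast
  then obtain i1 i2 i3 where s: "is_seq U (ShO T) (f, g, h)" and s0: "is_seq U (ShO T) (Q f0, Q g0, Q h0)"
    and i: "seq_morphism U VS (f, g, h) (Q f0, Q g0, Q h0) (i1, i2, i3)" "iso_arrow U i1"
      "iso_arrow U i2" "iso_arrow U i3"
    unfolding seq_isomorphic_def by blast
  obtain f0' g0' h0' where t0': "(f0', g0', h0') \<in> Tri T" and "seq_isomorphic U (ShO T) VS (f', g', h')
    (Q f0', Q g0', Q h0')"
    using t(2) unfolding Tri_U by blast
  then obtain j1 j2 j3 where s': "is_seq U (ShO T) (f', g', h')"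
    and s0': "is_seq U (ShO T) (Q f0', Q g0', Q h0')"
    and j: "seq_morphism U VS (f', g', h') (Q f0', Q g0', Q h0') (j1, j2, j3)" "iso_arrow U j1"
      "iso_arrow U j2" "iso_arrow U j3"
    unfolding seq_isomorphic_def by blast
  obtain i1' i2' i3' where i': "inverse_pair U i1 i1'" "inverse_pair U i2 i2'" "inverse_pair U i3 i3'"
    using i(2-4) unfolding iso_arrow_iff by blast
  obtain j1' j2' j3' where j': "inverse_pair U j1 j1'" "inverse_pair U j2 j2'" "inverse_pair U j3 j3'"
    using j(2-4) unfolding iso_arrow_iff by blast
  have mi: "seq_morphism U VS (Q f0, Q g0, Q h0) (f, g, h) (i1', i2', i3')"
    by (rule U.seq_morphism_inverse[unfolded U_simps, OF s s0 i(1) i'])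
  have mj: "seq_morphism U VS (Q f0', Q g0', Q h0') (f', g', h') (j1', j2', j3')"
    by (rule U.seq_morphism_inverse[unfolded U_simps, OF s' s0' j(1) j'])
  have A: "f \<in> Arr U" "f' \<in> Arr U" "Cod U f = Dom U g" "Cod U f' = Dom U g'" "f0 \<in> Arr T"
    "f0' \<in> Arr T" "Cod T f0 = Dom T g0"
      "g0 \<in> Arr T" "g0' \<in> Arr T" "Cod T f0' = Dom T g0'"
    using s s' tri_arr[OF t0] tri_arr[OF t0'] by (auto simp: is_seq_iff)
  have I: "i1 \<in> Arr U" "Dom U i1 = Dom U f" "Cod U i1 = Dom T f0" "i2 \<in> Arr U" "Dom U i2 = Dom U g"
    "Cod U i2 = Dom T g0"
    "i1' \<in> Arr U" "Dom U i1' = Dom T f0" "Cod U i1' = Dom U f" "i2' \<in> Arr U" "Dom U i2' = Dom T g0"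
    "Cod U i2' = Dom U g"
    "i2' \<cdot>\<^bsub>U\<^esub> Q f0 = f \<cdot>\<^bsub>U\<^esub> i1'"
    using i(1) mi A by (auto simp: seq_morphism_iff)
  have J: "j1 \<in> Arr U" "Dom U j1 = Dom U f'" "Cod U j1 = Dom T f0'" "j2 \<in> Arr U"
    "Dom U j2 = Dom U g'" "Cod U j2 = Dom T g0'"
    "j1' \<in> Arr U" "Dom U j1' = Dom T f0'" "Cod U j1' = Dom U f'" "j2' \<in> Arr U"
    "Dom U j2' = Dom T g0'" "Cod U j2' = Dom U g'"
    "j2 \<cdot>\<^bsub>U\<^esub> f' = Q f0' \<cdot>\<^bsub>U\<^esub> j1"
    using j(1) mj A by (auto simp: seq_morphism_iff)
  have ab': "a \<in> Arr U" "Dom U a = Dom U f" "Cod U a = Dom U f'" "b \<in> Arr U" "Dom U b = Dom U g"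
    "Cod U b = Dom U g'"
    using ab A by auto
  let ?a = "j1 \<cdot>\<^bsub>U\<^esub> (a \<cdot>\<^bsub>U\<^esub> i1')" and ?b = "j2 \<cdot>\<^bsub>U\<^esub> (b \<cdot>\<^bsub>U\<^esub> i2')"
  have "?b \<cdot>\<^bsub>U\<^esub> Q f0 = j2 \<cdot>\<^bsub>U\<^esub> ((b \<cdot>\<^bsub>U\<^esub> f) \<cdot>\<^bsub>U\<^esub> i1')"
    using A I ab' J(4-6) by simp
  also have "\<dots> = (j2 \<cdot>\<^bsub>U\<^esub> f') \<cdot>\<^bsub>U\<^esub> (a \<cdot>\<^bsub>U\<^esub> i1')"
    unfolding ab(3) using A I(1-12) ab' J(4-6) by simp
  also have "\<dots> = Q f0' \<cdot>\<^bsub>U\<^esub> ?a"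
    unfolding J(13) using A I(1-12) ab' J(1-6) by simp
  finally have eq: "?b \<cdot>\<^bsub>U\<^esub> Q f0 = Q f0' \<cdot>\<^bsub>U\<^esub> ?a" .
  have "?a \<in> Hom U (Dom T f0) (Dom T f0')" "?b \<in> Hom U (Cod T f0) (Cod T f0')"
    using A I(1-12) ab' J(1-6) by simp_all
  then obtain c where c: "seq_morphism U VS (Q f0, Q g0, Q h0) (Q f0', Q g0', Q h0') (?a, ?b, c)"
    using Q_fill[OF t0 t0' _ _ eq] by blast
  have "seq_morphism U VS (f, g, h) (f', g', h') (j1' \<cdot>\<^bsub>U\<^esub> (?a \<cdot>\<^bsub>U\<^esub> i1), j2' \<cdot>\<^bsub>U\<^esub> (?b \<cdot>\<^bsub>U\<^esub> i2), j3' \<cdot>\<^bsub>U\<^esub>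
    (c \<cdot>\<^bsub>U\<^esub> i3))"
    by (rule U.seq_morphism_comp[unfolded U_simps, OF s s0' s' U.seq_morphism_comp[unfolded U_simps, OF s
      s0 s0' i(1) c] mj])
  moreover have "j1' \<cdot>\<^bsub>U\<^esub> (?a \<cdot>\<^bsub>U\<^esub> i1) = a"
    using I(1-12) J(1-12) ab' Q.cod.inverse_pair_cancel(3)[OF i'(1)] Q.cod.inverse_pair_cancel(1)[OF
      j'(1)] by simp
  moreover have "j2' \<cdot>\<^bsub>U\<^esub> (?b \<cdot>\<^bsub>U\<^esub> i2) = b"
    using I(1-12) J(1-12) ab' Q.cod.inverse_pair_cancel(3)[OF i'(2)] Q.cod.inverse_pair_cancel(1)[OF
      j'(2)] by simp
  ultimately show ?thesis
    by auto
qed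

text \<open>Write \<open>a\<close> as a fraction of \<open>f\<close> by \<open>s\<close>. The cone
  of \<open>f\<close> serves for \<open>a\<close>; moving the first object along \<open>s\<close>
  changes the last arrow by \<open>ShA T s\<close>.\<close>

lemma U_tri_cone:
  assumes "a \<in> Arr U"
  shows "\<exists>g h. (a, g, h) \<in> Tri U"
proof -
  obtain X Y where aH: "a \<in> Hom U X Y"
    using assms by simp
  obtain s f where a: "roof s f" "a = cl s f" "Cod T s = X" "Cod T f = Y" "s \<in> S" "s \<in> Arr T"
    "f \<in> Arr T" "Dom T s = Dom T f"
    using aH by (rule U_homE)
  obtain g h where t: "(f, g, h) \<in> Tri T"
    using tri_cone[OF a(7)] by blast
  note A = tri_arr[OF t]
  have ob: "Cod T f \<in> Obj T" "Cod T g \<in> Obj T"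
    using A by simp_all
  let ?t = "(a, Q g, Q (ShA T s \<cdot> h))"
  have s: "is_seq U (ShO T) ?t"
    using a A assms by (simp add: is_seq_iff)
  have "seq_isomorphic U (ShO T) VS (Q f, Q g, Q h) ?t"
  proof (rule seq_isomorphicI[OF Q_seq[OF tri_seq[OF t]] s])
    have "a \<cdot>\<^bsub>U\<^esub> Q s = Q f"
      using cl_comp_Q[OF a(1)] a(2) by simp
    then show "seq_morphism U VS (Q f, Q g, Q h) ?t (Q s, Ident U (Cod T f), Ident U (Cod T g))"
      using a(3-8) A ob aH by (simp add: seq_morphism_iff VS_Q Q.map_comp')
  qed (use ob Q_iso_arrow[OF a(5)] in simp_all)
  then show ?thesis
    unfolding Tri_U using t U.seq_isomorphic_sym[unfolded U_simps] by blast
qed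

lemma U_pretriangulated: "pretriangulated U"
proof (rule pretriangulated.intro[OF U_additive_shift pretriangulated_axioms.intro], unfold U_simps)
  show "is_seq U (ShO T) t" if "t \<in> Tri U" for t
    using that unfolding Tri_U seq_isomorphic_def by blast
  show "t' \<in> Tri U" if "t \<in> Tri U" "seq_isomorphic U (ShO T) VS t' t" for t t'
    using that U.seq_isomorphic_trans[unfolded U_simps] unfolding Tri_U by blast
  show "(Ident U X, Zero U X M, Zero U M (ShO T X)) \<in> Tri U" if X: "X \<in> Obj U" and M: "zero_object U M" for X M
  proof -
    \<comment> \<open>A zero object of the quotient need not be zero in \<open>T\<close>, so the
      identity triangle of \<open>T\<close> is formed with a genuine zero object and then
      compared.\<close>
    obtain Z where Z: "zero_object T Z" "Z \<in> Obj T"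
      by (rule zero_object_obtain)
    have X': "X \<in> Obj T" and M': "M \<in> Obj T"
      using X Q.cod.zero_object_obj[OF M] by simp_all
    have t: "(Ident T X, Zero T X Z, Zero T Z (ShO T X)) \<in> Tri T"
      by (rule tri_ident[OF X' Z(1)])
    have "seq_isomorphic U (ShO T) VS (Ident U X, Zero U X M, Zero U M (ShO T X)) (Q (Ident T X), Q (Zero
      T X Z), Q (Zero T Z (ShO T X)))"
    proof (rule seq_isomorphicI[OF _ Q_seq[OF tri_seq[OF t]]])
      show "is_seq U (ShO T) (Ident U X, Zero U X M, Zero U M (ShO T X))"
        using X' M' by (simp add: is_seq_iff)
      have "VS (Ident U X) = Ident U (ShO T X)"
        using U.sh.map_ident[of X] X' by simp
      then show "seq_morphism U VS (Ident U X, Zero U X M, Zero U M (ShO T X)) (Q (Ident T X), Q (Zero T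
        X Z), Q (Zero T Z (ShO T X)))
          (Ident U X, Ident U X, Zero U M Z)"
        using X' M' Z by (simp add: seq_morphism_iff)
      show "iso_arrow U (Zero U M Z)"
        by (rule zero_objects_iso[OF M Q.map_zero_object[OF Z(1)]])
    qed (use X' in simp_all)
    then show ?thesis
      unfolding Tri_U using t by blast
  qed
qed (fact U_tri_cone U_tri_rotate U_tri_fill)+

end

sublocale verdier \<subseteq> U: pretriangulated "verdier_quotient T N"
  by (rule U_pretriangulated)

context verdier begin

text \<open>An Ore square clears the denominators: in the quotient, the pair \<open>f\<close>,
  \<open>g\<close> is isomorphic to the projections of \<open>h\<close>, \<open>\<gamma>\<close>,
  which are composable in \<open>T\<close>. The octahedron of \<open>T\<close> on these is projected
  and transported.\<close>

lemma U_octahedral: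
  assumes fg: "Cod U f = Dom U g" and t: "(f, f', f'') \<in> Tri U" "(g, g', g'') \<in> Tri U"
    "(g \<cdot>\<^bsub>U\<^esub> f, k', k'') \<in> Tri U"
  shows "\<exists>u v. (u, v, VS f' \<cdot>\<^bsub>U\<^esub> g'') \<in> Tri U \<and> u \<cdot>\<^bsub>U\<^esub> f' = k' \<cdot>\<^bsub>U\<^esub> g \<and> k'' \<cdot>\<^bsub>U\<^esub> u = f'' \<and> v \<cdot>\<^bsub>U\<^esub> k' = g' \<and>
    g'' \<cdot>\<^bsub>U\<^esub> v = VS f \<cdot>\<^bsub>U\<^esub> k''"
proof -
  obtain X Y Z where fH: "f \<in> Hom U X Y" and gH: "g \<in> Hom U Y Z"
    using U.tri_arr(1)[OF t(1)] U.tri_arr(1)[OF t(2)] fg by simp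
  obtain s \<alpha> where a: "roof s \<alpha>" "f = cl s \<alpha>" "Cod T s = X" "Cod T \<alpha> = Y" "s \<in> S" "s \<in> Arr T"
    "\<alpha> \<in> Arr T" "Dom T s = Dom T \<alpha>"
    using fH by (rule U_homE)
  obtain t \<gamma> where b: "roof t \<gamma>" "g = cl t \<gamma>" "Cod T t = Y" "Cod T \<gamma> = Z" "t \<in> S" "t \<in> Arr T"
    "\<gamma> \<in> Arr T" "Dom T t = Dom T \<gamma>"
    using gH by (rule U_homE)
  have e: "Cod T \<alpha> = Cod T t"
    using a b by simp
  obtain u h where u: "u \<in> S" "u \<in> Arr T" "Cod T u = Dom T \<alpha>" "h \<in> Arr T" "Dom T h = Dom T u"
    "Cod T h = Dom T t"
      "\<alpha> \<cdot> u = t \<cdot> h"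
    by (rule S_ore[OF a(7) b(5) e])
  have su: "s \<cdot> u \<in> S"
    by (rule S_comp) (use a u in simp_all)
  have r: "roof (s \<cdot> u) (\<alpha> \<cdot> u)" "f = cl (s \<cdot> u) (\<alpha> \<cdot> u)"
    using R_refine(2)[OF a(1) u(1)] cl_refine[OF a(1) u(1)] a u(3) by simp_all
  have sq1: "Q t \<cdot>\<^bsub>U\<^esub> Q h = f \<cdot>\<^bsub>U\<^esub> Q (s \<cdot> u)"
    using cl_comp_Q[OF r(1)] r(2) u b Q.map_comp'[of h t] by simp
  have ob: "Cod T \<gamma> \<in> Obj T"
    using b cod_obj by blast
  have sq2: "Ident U (Cod T \<gamma>) \<cdot>\<^bsub>U\<^esub> Q \<gamma> = g \<cdot>\<^bsub>U\<^esub> Q t"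
    using cl_comp_Q[OF b(1)] b by simp
  obtain h1 h2 where t1: "(h, h1, h2) \<in> Tri T"
    using tri_cone[OF u(4)] by blast
  obtain \<gamma>1 \<gamma>2 where t2: "(\<gamma>, \<gamma>1, \<gamma>2) \<in> Tri T"
    using tri_cone[OF b(7)] by blast
  have hg: "Cod T h = Dom T \<gamma>"
    using u b by simp
  obtain k1 k2 where t3: "(\<gamma> \<cdot> h, k1, k2) \<in> Tri T"
    using tri_cone[of "\<gamma> \<cdot> h"] u(4) b(7) hg by auto
  obtain p q where pq: "(p, q, ShA T h1 \<cdot> \<gamma>2) \<in> Tri T" "p \<in> Arr T" "q \<in> Arr T"
    "Dom T p = Cod T h1" "Cod T p = Cod T k1" "Dom T q = Cod T k1" "Cod T q = Cod T \<gamma>1"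
    "p \<cdot> h1 = k1 \<cdot> \<gamma>" "k2 \<cdot> p = h2" "q \<cdot> k1 = \<gamma>1" "\<gamma>2 \<cdot> q = ShA T h \<cdot> k2"
    by (rule octahedron[OF hg t1 t2 t3])
  have A: "h \<in> Arr T" "h1 \<in> Arr T" "h2 \<in> Arr T" "\<gamma> \<in> Arr T" "\<gamma>1 \<in> Arr T" "\<gamma>2 \<in> Arr T" "k1 \<in> Arr T" "k2 \<in> Arr T"
      "Dom T h1 = Dom T \<gamma>" "Dom T h2 = Cod T h1" "Cod T h2 = ShO T (Dom T h)"
      "Dom T \<gamma>1 = Cod T \<gamma>" "Dom T \<gamma>2 = Cod T \<gamma>1" "Cod T \<gamma>2 = ShO T (Dom T \<gamma>)"
      "Dom T k1 = Cod T \<gamma>" "Dom T k2 = Cod T k1" "Cod T k2 = ShO T (Dom T h)"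
    using tri_arr[OF t1] tri_arr[OF t2] tri_arr[OF t3] hg by simp_all
  have T3: "(Q \<gamma> \<cdot>\<^bsub>U\<^esub> Q h, Q k1, Q k2) \<in> Tri U"
    using Q_tri[OF t3] A hg by (simp add: Q.map_comp')
  have T4: "(Q p, Q q, VS (Q h1) \<cdot>\<^bsub>U\<^esub> Q \<gamma>2) \<in> Tri U"
    using Q_tri[OF pq(1)] A by (simp add: Q.map_comp' VS_Q)
  have E: "Q p \<cdot>\<^bsub>U\<^esub> Q h1 = Q k1 \<cdot>\<^bsub>U\<^esub> Q \<gamma>" "Q k2 \<cdot>\<^bsub>U\<^esub> Q p = Q h2" "Q q \<cdot>\<^bsub>U\<^esub> Q k1 = Q \<gamma>1"
      "Q \<gamma>2 \<cdot>\<^bsub>U\<^esub> Q q = VS (Q h) \<cdot>\<^bsub>U\<^esub> Q k2"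
    using A pq(2-7) hg arg_cong[OF pq(8), of Q] arg_cong[OF pq(9), of Q] arg_cong[OF pq(10), of Q]
      arg_cong[OF pq(11), of Q]
    by (simp_all add: Q.map_comp' VS_Q)
  show ?thesis
    by (rule U.octahedral_transport[unfolded U_simps, OF Q_iso_arrow[OF su] _ _ Q_iso_arrow[OF b(5)] _ _
      _ _ _ sq1 sq2 fg _
          Q_tri[OF t1] Q_tri[OF t2] T3 t T4 _ _ _ _ E])
      (use A a b u(1-6) hg pq(2-7) ob in simp_all)
qed

lemma U_triangulated: "triangulated_category U"
proof (rule triangulated_category.intro[OF U_additive triangulated_category_axioms.intro])
  show "cat_equivalence U U (ShO U) (ShA U)" "additive_maps U U (ShO U) (ShA U)"
    by (fact U.shift_equivalence U.shift_additive)+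
qed (fact U.tri_seq U.tri_iso U.tri_ident U.tri_cone U.tri_rotate U.tri_fill U_octahedral[folded U_simps])+

end

section \<open>Presilting subcategories\<close>

locale silting = triangulated_category T
  for T :: "('o, 'm, 'x) triang_data_scheme" (structure) +
  fixes P :: "'o set"
  assumes presilting: "presilting T P"
    and P_add: "P = add_closure T P"
    and P1: "cond_P1 T P"
    and P2: "cond_P2 T P"
begin

lemma P_sub: "P \<subseteq> Obj T"
  using presilting by (simp add: presilting_def)

end

sublocale silting \<subseteq> verdier T "thick T P"
  by unfold_locales (rule thick_triangulated[OF P_sub])

context silting begin

abbreviation "LP \<equiv> left_perp T P"
abbreviation "RP \<equiv> right_perp T P"

lemma P_obj [simp]: "A \<in> P \<Longrightarrow> A \<in> Obj T"
  using P_sub by blast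

lemmas LP_iff = left_perp_iff[of _ P]
lemmas RP_iff = right_perp_iff[OF P_sub]

lemma P_LP: "A \<in> P \<Longrightarrow> A \<in> LP"
  using presilting unfolding presilting_def left_perp_def by blast

lemma P_vanish: "\<lbrakk>A \<in> P; B \<in> P\<rbrakk> \<Longrightarrow> hom_vanish T A (So (Suc n) B)"
  using P_LP unfolding LP_iff by blast

lemma P_RP: "A \<in> P \<Longrightarrow> A \<in> RP"
  unfolding RP_iff using P_vanish by simp

lemma P_N: "A \<in> P \<Longrightarrow> A \<in> thick T P"
  using thick_superset by blast

lemma LP_obj: "X \<in> LP \<Longrightarrow> X \<in> Obj T"
  by (simp add: left_perp_def)

lemma LP_vanish: "\<lbrakk>X \<in> LP; A \<in> P; n > 0\<rbrakk> \<Longrightarrow> hom_vanish T X (So n A)"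
  unfolding LP_iff by (metis gr0_conv_Suc)

lemma RP_vanish: "\<lbrakk>X \<in> RP; A \<in> P; n > 0\<rbrakk> \<Longrightarrow> hom_vanish T A (So n X)"
  unfolding RP_iff by (metis gr0_conv_Suc)

text \<open>The integer bound is turned into a natural number; the strict inequality is the form in
  which the inductions on the number of obstructions start.\<close>

lemma P2_bound:
  assumes "X \<in> Obj T"
  obtains n0 where "\<And>n A. \<lbrakk>n > n0; A \<in> P\<rbrakk> \<Longrightarrow> hom_vanish T X (So n A)"
    "\<And>n A. \<lbrakk>n > n0; A \<in> P\<rbrakk> \<Longrightarrow> hom_vanish T A (So n X)"
proof -
  obtain l0 where l0: "\<And>l A. \<lbrakk>l \<ge> l0; A \<in> P\<rbrakk> \<Longrightarrow> hom_vanish T X (shift T A l) \<and> hom_vanish T A (shift T X l)"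
    using P2 assms unfolding cond_P2_def by meson
  show ?thesis
  proof (rule that[of "nat l0"])
    fix n A assume "n > nat l0" "A \<in> P"
    then have "hom_vanish T X (shift T A (int n)) \<and> hom_vanish T A (shift T X (int n))"
      by (intro l0) simp_all
    then show "hom_vanish T X (So n A)" "hom_vanish T A (So n X)"
      by (simp_all only: shift_int)
  qed
qed

lemma left_approx:
  assumes "X \<in> LP"
  obtains j where "j \<in> Arr T" "Dom T j = X" "Cod T j \<in> P"
    "\<And>A x. \<lbrakk>A \<in> P; x \<in> Arr T; Dom T x = X; Cod T x = A\<rbrakk> \<Longrightarrow> \<exists>z. z \<in> Arr T \<and> Dom T z = Cod T j \<and> Cod T z = A
      \<and> z \<cdot> j = x"
proof -
  obtain j where j: "Dom T j = X" "left_approximation T P j"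
    using P1 assms unfolding cond_P1_def covariantly_finite_in_def by blast
  show ?thesis
  proof (rule that[of j])
    fix A x assume A: "A \<in> P" and x: "x \<in> Arr T" "Dom T x = X" "Cod T x = A"
    then have "x \<in> Hom T (Dom T j) A"
      using j by simp
    then obtain z where "z \<in> Hom T (Cod T j) A" "z \<cdot> j = x"
      using j A unfolding left_approximation_def by blast
    then show "\<exists>z. z \<in> Arr T \<and> Dom T z = Cod T j \<and> Cod T z = A \<and> z \<cdot> j = x"
      by auto
  qed (use j in \<open>auto simp: left_approximation_def\<close>)
qed

lemma right_approx:
  assumes "X \<in> RP"
  obtains j where "j \<in> Arr T" "Cod T j = X" "Dom T j \<in> P"
    "\<And>A x. \<lbrakk>A \<in> P; x \<in> Arr T; Dom T x = A; Cod T x = X\<rbrakk> \<Longrightarrow> \<exists>z. z \<in> Arr T \<and> Dom T z = A \<and> Cod T z = Dom T j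
      \<and> j \<cdot> z = x"
proof -
  obtain j where j: "Cod T j = X" "right_approximation T P j"
    using P1 assms unfolding cond_P1_def contravariantly_finite_in_def by blast
  show ?thesis
  proof (rule that[of j])
    fix A x assume A: "A \<in> P" and x: "x \<in> Arr T" "Dom T x = A" "Cod T x = X"
    then have "x \<in> Hom T A (Cod T j)"
      using j by simp
    then obtain z where "z \<in> Hom T A (Dom T j)" "j \<cdot> z = x"
      using j A unfolding right_approximation_def by blast
    then show "\<exists>z. z \<in> Arr T \<and> Dom T z = A \<and> Cod T z = Dom T j \<and> j \<cdot> z = x"
      by auto
  qed (use j in \<open>auto simp: right_approximation_def\<close>)
qed

text \<open>The class \<open>\<P>[\<le>0]\<^sup>\<bottom>\<close>.\<close>

definition R0 :: "'o set" where
  "R0 = {Y \<in> Obj T. \<forall>n. \<forall>A\<in>P. hom_vanish T A (So n Y)}"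

lemma R0_obj: "Y \<in> R0 \<Longrightarrow> Y \<in> Obj T"
  by (simp add: R0_def)

section \<open>Vanishing of composites through the thick subcategory\<close>

lemma RP_shift_R0: "Y \<in> RP \<Longrightarrow> ShO T Y \<in> R0"
  unfolding RP_iff R0_def by (simp add: So_Suc)

text \<open>Degree zero is the approximation property: an arrow from \<open>P\<close> to the cone
  lifts to \<open>W\<close> because \<open>P\<close> is presilting, then lifts through
  \<open>p\<close>, and so vanishes. Higher degrees vanish by the long exact sequence.\<close>

lemma right_approx_triangle:
  assumes W: "W \<in> RP"
  obtains p w k where "(p, w, k) \<in> Tri T" "Dom T p \<in> P" "Cod T p = W" "Cod T w \<in> R0"
proof -
  obtain p where p: "p \<in> Arr T" "Cod T p = W" "Dom T p \<in> P"
    "\<And>A x. \<lbrakk>A \<in> P; x \<in> Arr T; Dom T x = A; Cod T x = W\<rbrakk> \<Longrightarrow> \<exists>z. z \<in> Arr T \<and> Dom T z = A \<and> Cod T z = Dom T p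
      \<and> p \<cdot> z = x"
    by (rule right_approx[OF W]) blast
  obtain w k where t: "(p, w, k) \<in> Tri T"
    using tri_cone[OF p(1)] by blast
  note a = tri_arr[OF t]
  have ob: "Cod T w \<in> Obj T"
    using a by simp
  have "hom_vanish T A (So n (Cod T w))" if A: "A \<in> P" for n A
  proof (cases n)
    case 0
    have "hom_vanish T A (Cod T w)"
    proof (rule hom_vanishI)
      fix x assume x: "x \<in> Arr T" "Dom T x = A" "Cod T x = Cod T w"
      have "k \<cdot> x = Zero T A (So (Suc 0) (Dom T p))"
        by (rule hom_vanishD[OF P_vanish[OF A p(3)]]) (use a x in simp_all)
      then obtain z where z: "z \<in> Arr T" "Dom T z = A" "Cod T z = W" "w \<cdot> z = x"
        using hom_exactE[OF tri_exact2[OF t], of x] a x p by auto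
      obtain y where y: "y \<in> Arr T" "Dom T y = A" "Cod T y = Dom T p" "p \<cdot> y = z"
        using p(4)[OF A z(1-3)] by blast
      have "x = (w \<cdot> p) \<cdot> y"
        using y z a p by simp
      then show "x = Zero T A (Cod T w)"
        unfolding comp_tri_zero1[OF t] using y ob by simp
    qed (use A ob in simp_all)
    then show ?thesis
      using 0 by simp
  next
    case (Suc m)
    show ?thesis
      by (rule vanish_covariant[OF t]) (use A p(2,3) P_vanish[OF A p(3), of n] RP_vanish[OF W A, of n]
        Suc in simp_all)
  qed
  then show ?thesis
    using that[OF t p(3,2)] ob by (simp add: R0_def)
qed

text \<open>Iterated right approximations push \<open>Y\<close> into \<open>\<P>[\<le>n]\<^sup>\<bottom>\<close> without losing morphisms from
  \<open>\<^sup>\<bottom>\<P>[>0]\<close>; for large \<open>n\<close> a given object of the thick subcategory no longer sees the result.\<close>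

lemma R0_chain:
  assumes Y: "Y \<in> R0"
  shows "\<exists>Y' m. Y' \<in> R0 \<and> m \<in> Arr T \<and> Dom T m = Y \<and> Cod T m = So n Y' \<and>
    (\<forall>x\<in>Arr T. Dom T x \<in> LP \<longrightarrow> Cod T x = Y \<longrightarrow> m \<cdot> x = Zero T (Dom T x) (So n Y') \<longrightarrow> x = Zero T (Dom T x) Y)"
proof (induction n)
  case 0
  have "Y \<in> Obj T"
    using Y R0_obj by blast
  then show ?case
    using Y by (intro exI[of _ Y] exI[of _ "Ident T Y"]) simp
next
  case (Suc n)
  then obtain Y' m where Y': "Y' \<in> R0" and m: "m \<in> Arr T" "Dom T m = Y" "Cod T m = So n Y'"
    and inj: "\<And>x. \<lbrakk>x \<in> Arr T; Dom T x \<in> LP; Cod T x = Y; m \<cdot> x = Zero T (Dom T x) (So n Y')\<rbrakk>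
      \<Longrightarrow> x = Zero T (Dom T x) Y"
    by blast
  have Yo: "Y' \<in> Obj T"
    using Y' R0_obj by blast
  \<comment> \<open>Right approximations exist for objects of \<open>RP\<close>, so
    \<open>Y'\<close> is desuspended: its membership in \<open>R0\<close> puts \<open>W\<close> into
    \<open>RP\<close>.\<close>
  obtain W e e' where W: "W \<in> Obj T" and e: "inverse_pair T e e'" "Dom T e = ShO T W" "Cod T e = Y'"
    using desuspend[OF Yo] by metis
  have "W \<in> RP"
    unfolding RP_iff
  proof (intro conjI W allI ballI)
    fix k A assume A: "A \<in> P"
    have "isomorphic T (ShO T W) Y'"
      by (rule isomorphicI[OF e])
    then have i: "isomorphic T (So k Y') (So k (ShO T W))"
      by (rule isomorphic_sym[OF So_isomorphic])
    have "hom_vanish T A (So k Y')"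
      using Y' A by (simp add: R0_def)
    then show "hom_vanish T A (So (Suc k) W)"
      unfolding So_Suc[symmetric] by (rule hom_vanish_iso[OF _ isomorphic_refl[OF P_obj[OF A]] i])
  qed
  then obtain p w k where t: "(p, w, k) \<in> Tri T" "Dom T p \<in> P" "Cod T p = W" "Cod T w \<in> R0"
    by (rule right_approx_triangle)
  obtain k' where t': "(Sa (Suc n) p, Sa (Suc n) w, k') \<in> Tri T"
    using tri_shift_n[OF t(1)] by blast
  note a = tri_arr[OF t(1)]
  have ip: "inverse_pair T (Sa n e) (Sa n e')"
    by (rule Sa_inverse_pair[OF e(1)])
  note ec = inverse_pair_cancel[OF ip]
  have E: "Dom T (Sa n e') = So n Y'" "Cod T (Sa n e') = So (Suc n) W" "Sa n e' \<in> Arr T"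
    using ec(5-8) e inverse_pair_cancel(5-8)[OF e(1)] by (simp_all add: So_Suc[symmetric] del: funpow.simps)
  have iso: "iso_arrow T (Sa n e')"
    using inverse_pair_sym[OF ip] by (auto simp: iso_arrow_iff)
  have Sw: "Sa (Suc n) w \<in> Arr T" "Dom T (Sa (Suc n) w) = So (Suc n) W"
    "Cod T (Sa (Suc n) w) = So (Suc n) (Cod T w)"
    "Dom T (Sa (Suc n) p) = So (Suc n) (Dom T p)" "Cod T (Sa (Suc n) p) = So (Suc n) W"
    using a t(3) by simp_all
  let ?m = "Sa (Suc n) w \<cdot> (Sa n e' \<cdot> m)"
  have "x = Zero T (Dom T x) Y" if x: "x \<in> Arr T" "Dom T x \<in> LP" "Cod T x = Y"
    and z: "?m \<cdot> x = Zero T (Dom T x) (So (Suc n) (Cod T w))" for x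
  proof (rule inj[OF x])
    have X: "Dom T x \<in> Obj T"
      using x dom_obj by auto
    let ?y = "Sa n e' \<cdot> (m \<cdot> x)"
    have y: "?y \<in> Arr T" "Dom T ?y = Dom T x" "Cod T ?y = So (Suc n) W"
      using x m E by (simp_all del: funpow.simps)
    have "Sa (Suc n) w \<cdot> ?y = Zero T (Dom T ?y) (Cod T (Sa (Suc n) w))"
      using z x m E Sw by (simp del: funpow.simps)
    then obtain v where v: "v \<in> Arr T" "Dom T v = Dom T x" "Cod T v = So (Suc n) (Dom T p)"
      "Sa (Suc n) p \<cdot> v = ?y"
      using hom_exactE[OF tri_exact1[OF t'] y(1)] y Sw by metis
    \<comment> \<open>An arrow lost at this step would come from a positive shift of an object of
      \<open>P\<close>, and \<open>LP\<close> has no nonzero arrows there.\<close>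
    have "v = Zero T (Dom T x) (So (Suc n) (Dom T p))"
      by (rule hom_vanishD[OF LP_vanish[OF x(2) t(2)] v(1-3)]) simp
    then have "?y = Zero T (Dom T x) (So (Suc n) W)"
      using v(4) Sw a X comp_zero[of "Sa (Suc n) p" "So (Suc n) (Dom T p)"
        "Dom T x"] by (simp del: funpow.simps)
    also have "\<dots> = Sa n e' \<cdot> Zero T (Dom T x) (So n Y')"
      using E X Yo by (simp del: funpow.simps)
    finally show "m \<cdot> x = Zero T (Dom T x) (So n Y')"
      by (rule iso_cancel_left[OF iso]) (use x m E X Yo in simp_all)
  qed
  moreover have "?m \<in> Arr T" "Dom T ?m = Y" "Cod T ?m = So (Suc n) (Cod T w)"
    using m E Sw by (simp_all del: funpow.simps)
  ultimately show ?case
    using t(4) by blast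
qed

text \<open>The objects satisfying such a bound form a thick subcategory containing
  \<open>P\<close>. The bound must be uniform in \<open>Y\<close>, because
  \<open>thick_composite_zero\<close> fixes it before the object at the end of the chain is
  known.\<close>

lemma thick_bound:
  assumes "X \<in> thick T P"
  shows "\<exists>n. \<forall>m\<ge>n. \<forall>Y\<in>R0. hom_vanish T X (So m Y)"
proof -
  define D where "D = {X \<in> Obj T. \<exists>n. \<forall>m\<ge>n. \<forall>Y\<in>R0. hom_vanish T X (So m Y)}"
  have D_I: "X \<in> D" if "X \<in> Obj T" "\<And>m Y. \<lbrakk>m \<ge> n; Y \<in> R0\<rbrakk> \<Longrightarrow> hom_vanish T X (So m Y)" for X n
    unfolding D_def using that by blast
  have D_E: "\<exists>n. \<forall>m Y. m \<ge> n \<longrightarrow> Y \<in> R0 \<longrightarrow> hom_vanish T X (So m Y)" and D_obj: "X \<in> Obj T" if "X \<in> D" for X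
    using that unfolding D_def by blast+
  have iso: "isomorphic T X X' \<Longrightarrow> hom_vanish T X (So m Y) \<Longrightarrow> Y \<in> R0 \<Longrightarrow> hom_vanish T X' (So m Y)" for X X' m Y
    using hom_vanish_iso[OF _ _ isomorphic_refl] R0_obj So_obj by blast
  have sub: "P \<subseteq> D"
    by (intro subsetI D_I[of _ 0]) (simp_all add: R0_def)
  have tri: "triangulated_subcategory T D"
    unfolding triangulated_subcategory_def
  proof (intro conjI allI impI ballI)
    show "iso_closed T D"
      unfolding iso_closed_def
    proof (intro ballI impI)
      fix X X' assume X: "X \<in> D" and X': "X' \<in> Obj T" "isomorphic T X X'"
      obtain n where "\<And>m Y. \<lbrakk>m \<ge> n; Y \<in> R0\<rbrakk> \<Longrightarrow> hom_vanish T X (So m Y)"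
        using D_E[OF X] by blast
      then show "X' \<in> D"
        by (intro D_I[OF X'(1), of n] iso[OF X'(2)])
    qed
    show "M \<in> D" if M: "zero_object T M" for M
    proof -
      have "hom_vanish T M (So m Y)" if "Y \<in> R0" for m Y
        using from_zero_object[OF M] that R0_obj zero_object_obj[OF M] by (intro hom_vanishI) simp_all
      then show ?thesis
        by (intro D_I[OF zero_object_obj[OF M], of 0])
    qed
    fix X assume X: "X \<in> D"
    obtain n where n: "\<And>m Y. \<lbrakk>m \<ge> n; Y \<in> R0\<rbrakk> \<Longrightarrow> hom_vanish T X (So m Y)" and Xo: "X \<in> Obj T"
      using D_E[OF X] D_obj[OF X] by blast
    have "hom_vanish T (ShO T X) (So m Y)" if m: "m \<ge> Suc n" and Y: "Y \<in> R0" for m Y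
    proof -
      obtain k where k: "m = Suc k" "k \<ge> n"
        using m by (metis Suc_le_D Suc_le_mono)
      show ?thesis
        using hom_vanish_shift[of X "So k Y" "Suc 0"] n[OF k(2) Y] Xo R0_obj[OF Y] k(1) by simp
    qed
    then have "ShO T X \<in> D"
      by (intro D_I[OF sh.map_obj[OF Xo], of "Suc n"])
    then show "shift T X 1 \<in> D"
      using shift_int[of X 1] by simp
    let ?W = "unshift T X"
    have W: "?W \<in> Obj T" "isomorphic T (ShO T ?W) X"
      using unshift_iso[OF Xo] by auto
    have "hom_vanish T ?W (So m Y)" if m: "m \<ge> n" and Y: "Y \<in> R0" for m Y
    proof -
      have "hom_vanish T X (So (Suc m) Y)"
        by (rule n[OF _ Y]) (use m in simp)
      then have "hom_vanish T (ShO T ?W) (So (Suc m) Y)"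
        by (rule iso[OF isomorphic_sym[OF W(2)] _ Y])
      then show ?thesis
        using hom_vanish_shift[of ?W "So m Y" "Suc 0"] W R0_obj[OF Y] by simp
    qed
    then have "?W \<in> D"
      by (intro D_I[OF W(1), of n])
    then show "shift T X (- 1) \<in> D"
      by (simp add: shift_def)
  next
    fix t assume "t \<in> Tri T"
    moreover obtain f g h where e: "t = (f, g, h)"
      by (cases t)
    ultimately have t: "(f, g, h) \<in> Tri T"
      by simp
    have "Cod T g \<in> D" if h: "Dom T f \<in> D" "Cod T f \<in> D"
    proof -
      obtain n where n: "\<And>m Y. \<lbrakk>m \<ge> n; Y \<in> R0\<rbrakk> \<Longrightarrow> hom_vanish T (Dom T f) (So m Y)"
        using D_E[OF h(1)] by blast
      obtain k where k: "\<And>m Y. \<lbrakk>m \<ge> k; Y \<in> R0\<rbrakk> \<Longrightarrow> hom_vanish T (Cod T f) (So m Y)"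
        using D_E[OF h(2)] by blast
      \<comment> \<open>The cone also sees the shift of the domain of \<open>f\<close>, whose bound
        is one larger; hence \<open>Suc n\<close>.\<close>
      have "hom_vanish T (Cod T g) (So m Y)" if m: "m \<ge> max (Suc n) k" and Y: "Y \<in> R0" for m Y
      proof (rule vanish_contravariant[OF t])
        show "hom_vanish T (Cod T f) (So m Y)"
          by (rule k[OF _ Y]) (use m in simp)
        obtain l where l: "m = Suc l" "l \<ge> n"
          using m by (metis Suc_le_D Suc_le_mono max.boundedE)
        show "hom_vanish T (ShO T (Dom T f)) (So m Y)"
          using hom_vanish_shift[of "Dom T f" "So l Y"
            "Suc 0"] n[OF l(2) Y] tri_arr[OF t] R0_obj[OF Y] l(1) by simp
      qed (use R0_obj[OF Y] in simp)
      moreover have "Cod T g \<in> Obj T"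
        using tri_arr[OF t] by simp
      ultimately show ?thesis
        by (intro D_I[of _ "max (Suc n) k"])
    qed
    then show "case t of (f, g, h) \<Rightarrow> Dom T f \<in> D \<and> Cod T f \<in> D \<longrightarrow> Cod T g \<in> D"
      unfolding e by simp
  qed (use D_obj in blast)
  have sum: "summand_closed T D"
    unfolding summand_closed_def
  proof (intro ballI allI impI)
    fix X A B assume X: "X \<in> D" and b: "biproduct T A B X"
    obtain n where n: "\<And>m Y. \<lbrakk>m \<ge> n; Y \<in> R0\<rbrakk> \<Longrightarrow> hom_vanish T X (So m Y)"
      using D_E[OF X] by blast
    obtain i p where A: "A \<in> Obj T" and i: "i \<in> Arr T" "Dom T i = A" "Cod T i = X" "p \<in> Arr T"
      "Dom T p = X" "Cod T p = A"
        "p \<cdot> i = Ident T A"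
      using b unfolding biproduct_def by auto
    have "hom_vanish T A (So m Y)" if m: "m \<ge> n" and Y: "Y \<in> R0" for m Y
    proof (rule hom_vanishI[OF A])
      have Yo: "So m Y \<in> Obj T"
        using R0_obj[OF Y] by simp
      then show "So m Y \<in> Obj T" .
      fix x assume x: "x \<in> Arr T" "Dom T x = A" "Cod T x = So m Y"
      have "x \<cdot> p = Zero T X (So m Y)"
        by (rule hom_vanishD[OF n[OF m Y]]) (use x i in simp_all)
      then have "(x \<cdot> p) \<cdot> i = Zero T A (So m Y)"
        using i Yo by simp
      then show "x = Zero T A (So m Y)"
        using x i by simp
    qed
    then show "A \<in> D"
      by (intro D_I[OF A, of n])
  qed
  have "thick T P \<subseteq> D"
    by (rule thick_least[OF sub tri sum])
  then have "X \<in> D"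
    using assms by blast
  from D_E[OF this] show ?thesis
    by blast
qed

text \<open>Followed by \<open>m\<close>, the arrow \<open>b\<close> vanishes by the uniform bound,
  and \<open>m\<close> loses no arrow that starts in \<open>LP\<close>.\<close>

lemma thick_composite_zero:
  assumes a: "a \<in> Arr T" "Dom T a \<in> LP" "Cod T a \<in> thick T P" and b: "b \<in> Arr T" "Dom T b = Cod T a"
    "Cod T b \<in> R0"
  shows "b \<cdot> a = Zero T (Dom T a) (Cod T b)"
proof -
  obtain n where n: "\<And>m Y. \<lbrakk>m \<ge> n; Y \<in> R0\<rbrakk> \<Longrightarrow> hom_vanish T (Cod T a) (So m Y)"
    using thick_bound[OF a(3)] by blast
  obtain Y' m where Y': "Y' \<in> R0" and m: "m \<in> Arr T" "Dom T m = Cod T b" "Cod T m = So n Y'"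
    and inj: "\<And>x. \<lbrakk>x \<in> Arr T; Dom T x \<in> LP; Cod T x = Cod T b; m \<cdot> x = Zero T (Dom T x) (So n Y')\<rbrakk>
      \<Longrightarrow> x = Zero T (Dom T x) (Cod T b)"
    using R0_chain[OF b(3), of n] by blast
  have "m \<cdot> b = Zero T (Cod T a) (So n Y')"
    by (rule hom_vanishD[OF n[OF order_refl Y']]) (use m b in simp_all)
  then have "(m \<cdot> b) \<cdot> a = Zero T (Dom T a) (So n Y')"
    using a R0_obj[OF Y'] by simp
  then have "b \<cdot> a = Zero T (Dom T (b \<cdot> a)) (Cod T b)"
    by (intro inj) (use a b m in simp_all)
  then show ?thesis
    using a b by simp
qed

section \<open>Moving objects into Z along denominators\<close>

lemma N_So: "X \<in> thick T P \<Longrightarrow> So n X \<in> thick T P"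
  by (induction n) (simp_all add: N_shift)

lemma N_unshift_n: "\<lbrakk>X \<in> Obj T; So n X \<in> thick T P\<rbrakk> \<Longrightarrow> X \<in> thick T P"
proof (induction n)
  case (Suc n)
  then show ?case
    using N_unshift[of "So n X"] by simp
qed simp

text \<open>The obstruction in degree \<open>n+1\<close> is removed: desuspend \<open>X\<close> by
  \<open>n+1\<close>, take the cocone of a left \<open>P\<close>-approximation and shift back.
  Arrows from \<open>LP\<close> lift because objects of \<open>LP\<close> have no nonzero arrows to
  \<open>P[n+1]\<close>.\<close>

lemma left_coreflection_step:
  assumes X: "X \<in> Obj T" and v: "\<And>i A. \<lbrakk>i > Suc n; A \<in> P\<rbrakk> \<Longrightarrow> hom_vanish T X (So i A)"
  obtains f where "f \<in> S" "f \<in> Arr T" "Cod T f = X" "\<And>i A. \<lbrakk>i > n; A \<in> P\<rbrakk> \<Longrightarrow> hom_vanish T (Dom T f) (So i A)"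
    "\<And>x. \<lbrakk>x \<in> Arr T; Dom T x \<in> LP; Cod T x = X\<rbrakk> \<Longrightarrow> \<exists>y. y \<in> Arr T \<and> Dom T y = Dom T x \<and> Cod T y = Dom T f
      \<and> f \<cdot> y = x"
proof -
  let ?n = "Suc n"
  obtain W e e' where W: "W \<in> Obj T" and e: "inverse_pair T e e'" "Dom T e = So ?n W" "Cod T e = X"
    using desuspend_n[OF X] by metis
  note ec = inverse_pair_cancel[OF e(1)]
  have "W \<in> LP"
    unfolding LP_iff
  proof (intro conjI W allI ballI)
    fix i A assume A: "A \<in> P"
    have "hom_vanish T X (So (?n + Suc i) A)"
      by (rule v[OF _ A]) simp
    then have "hom_vanish T (So ?n W) (So ?n (So (Suc i) A))"
      unfolding So_add
      by (rule hom_vanish_iso[OF _ isomorphic_sym[OF isomorphicI[OF e]] isomorphic_refl[OF So_obj[OF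
        P_obj[OF A]]]])
    then show "hom_vanish T W (So (Suc i) A)"
      using hom_vanish_shift[of W "So (Suc i) A" ?n] W A P_obj So_obj by blast
  qed
  then obtain j where j: "j \<in> Arr T" "Dom T j = W" "Cod T j \<in> P"
    "\<And>A x. \<lbrakk>A \<in> P; x \<in> Arr T; Dom T x = W; Cod T x = A\<rbrakk> \<Longrightarrow> \<exists>z. z \<in> Arr T \<and> Dom T z = Cod T j \<and> Cod T z = A
      \<and> z \<cdot> j = x"
    by (rule left_approx) blast
  obtain w k where t: "(w, j, k) \<in> Tri T"
    by (rule cocone[OF j(1)])
  note a = tri_arr[OF t]
  obtain k' where t': "(Sa ?n w, Sa ?n j, k') \<in> Tri T"
    using tri_shift_n[OF t] by blast
  have w: "Sa ?n w \<in> Arr T" "Dom T (Sa ?n w) = So ?n (Dom T w)" "Cod T (Sa ?n w) = So ?n W"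
     "Sa ?n j \<in> Arr T" "Dom T (Sa ?n j) = So ?n W" "Cod T (Sa ?n j) = So ?n (Cod T j)"
    using a j by simp_all
  let ?f = "e \<cdot> Sa ?n w"
  have f: "?f \<in> Arr T" "Dom T ?f = So ?n (Dom T w)" "Cod T ?f = X"
    using w e ec(5) by (simp_all del: funpow.simps)
  have "Cod T (Sa ?n j) \<in> thick T P"
    unfolding w by (rule N_So[OF P_N[OF j(3)]])
  then have "Sa ?n w \<in> S"
    using S_iff[OF t'] by blast
  then have fS: "?f \<in> S"
    by (rule S_comp[OF _ S_iso]) (use w e in \<open>auto simp: iso_arrow_iff simp del: funpow.simps\<close>)
  have W1: "Dom T w \<in> Obj T"
    using a by simp
  \<comment> \<open>An arrow from the cocone extends to \<open>W\<close> because \<open>P\<close> is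
    presilting. In degree zero the extension passes through the approximation and vanishes on the
    cocone; in positive degrees it vanishes because \<open>W\<close> is in
    \<open>LP\<close>.\<close>
  have v': "hom_vanish T (Dom T w) (So i A)" if A: "A \<in> P" for i A
  proof (rule hom_vanishI[OF W1])
    have Ao: "So i A \<in> Obj T" "So (Suc i) A \<in> Obj T"
      using A by simp_all
    then show "So i A \<in> Obj T" by simp
    fix x assume x: "x \<in> Arr T" "Dom T x = Dom T w" "Cod T x = So i A"
    have "ShA T x \<cdot> k = Zero T (Cod T j) (So (Suc i) A)"
      by (rule hom_vanishD[OF P_vanish[OF j(3) A]]) (use x a in simp_all)
    then obtain z where z: "z \<in> Arr T" "Dom T z = Cod T w" "Cod T z = Cod T x" "z \<cdot> w = x"
      using tri_extend0[OF t x(1,2)] x(3) by auto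
    show "x = Zero T (Dom T w) (So i A)"
    proof (cases i)
      case 0
      have "Dom T z = W" "Cod T z = A"
        using z x a j(2) 0 by simp_all
      then obtain y where y: "y \<in> Arr T" "Dom T y = Cod T j" "Cod T y = A" "y \<cdot> j = z"
        using j(4)[OF A z(1)] by blast
      have "x = (y \<cdot> j) \<cdot> w"
        using y(4) z(4) by simp
      then have "x = y \<cdot> (j \<cdot> w)"
        using y(1-3) a by simp
      then show ?thesis
        unfolding comp_tri_zero1[OF t] using y W1 0 by simp
    next
      case (Suc r)
      have "z = Zero T W (So i A)"
        by (rule hom_vanishD[OF LP_vanish[OF \<open>W \<in> LP\<close> A]]) (use z x a j(2) Suc in simp_all)
      then show ?thesis
        using z(4) a j(2) Ao by simp
    qed
  qed
  show ?thesis
  proof (rule that[OF fS f(1,3)], unfold f(2))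
    fix i A assume i: "i > n" and A: "A \<in> P"
    then obtain r where r: "i = ?n + r"
      by (metis Suc_leI le_iff_add)
    show "hom_vanish T (So ?n (Dom T w)) (So i A)"
      unfolding r So_add[symmetric] using hom_vanish_shift[of "Dom T w"
        "So r A" ?n] v'[OF A, of r] W1 A P_obj So_obj by blast
  next
    fix x assume x: "x \<in> Arr T" "Dom T x \<in> LP" "Cod T x = X"
    let ?y = "e' \<cdot> x"
    have y: "?y \<in> Arr T" "Dom T ?y = Dom T x" "Cod T ?y = So ?n W"
      using x e ec(6-8) by (simp_all del: funpow.simps)
    have "Sa ?n j \<cdot> ?y = Zero T (Dom T x) (So ?n (Cod T j))"
      by (rule hom_vanishD[OF LP_vanish[OF x(2) j(3)]]) (use y w in \<open>simp_all del: funpow.simps\<close>)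
    then have "Sa ?n j \<cdot> ?y = Zero T (Dom T ?y) (Cod T (Sa ?n j))"
      unfolding y w .
    then obtain z where z: "z \<in> Arr T" "Dom T z = Dom T x" "Cod T z = So ?n (Dom T w)" "Sa ?n w \<cdot> z = ?y"
      using hom_exactE[OF tri_exact1[OF t'] y(1)] y w by metis
    have "?f \<cdot> z = e \<cdot> ?y"
      using z w e ec(5) by (simp del: funpow.simps)
    also have "\<dots> = x"
      using x e ec(2) by simp
    finally show "\<exists>y. y \<in> Arr T \<and> Dom T y = Dom T x \<and> Cod T y = So ?n (Dom T w) \<and> ?f \<cdot> y = x"
      using z by blast
  qed
qed

text \<open>The finitely many obstructions left by (P2) are removed from the top degree down. The
  lifting property is carried along for the proof that the projection is full.\<close>

lemma left_coreflection:
  assumes X: "X \<in> Obj T"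
  obtains f where "f \<in> S" "f \<in> Arr T" "Cod T f = X" "Dom T f \<in> LP"
    "\<And>x. \<lbrakk>x \<in> Arr T; Dom T x \<in> LP; Cod T x = X\<rbrakk> \<Longrightarrow> \<exists>y. y \<in> Arr T \<and> Dom T y = Dom T x \<and> Cod T y = Dom T f
      \<and> f \<cdot> y = x"
proof -
  obtain n where "\<And>i A. \<lbrakk>i > n; A \<in> P\<rbrakk> \<Longrightarrow> hom_vanish T X (So i A)"
    using P2_bound[OF X] by metis
  then have "\<exists>f. f \<in> S \<and> f \<in> Arr T \<and> Cod T f = X \<and> Dom T f \<in> LP \<and>
    (\<forall>x. x \<in> Arr T \<longrightarrow> Dom T x \<in> LP \<longrightarrow> Cod T x = X \<longrightarrow> (\<exists>y. y \<in> Arr T \<and> Dom T y = Dom T x \<and> Cod T y = Dom T f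
      \<and> f \<cdot> y = x))"
    using X
  proof (induction n arbitrary: X)
    case 0
    have "X \<in> LP"
      unfolding LP_iff using 0 by blast
    then show ?case
      using 0(2) S_ident by (intro exI[of _ "Ident T X"]) auto
  next
    case (Suc n)
    obtain f where f: "f \<in> S" "f \<in> Arr T" "Cod T f = X" "\<And>i A. \<lbrakk>i > n; A \<in> P\<rbrakk> \<Longrightarrow> hom_vanish T (Dom T f) (So i A)"
      "\<And>x. \<lbrakk>x \<in> Arr T; Dom T x \<in> LP; Cod T x = X\<rbrakk> \<Longrightarrow> \<exists>y. y \<in> Arr T \<and> Dom T y = Dom T x \<and> Cod T y = Dom T f
        \<and> f \<cdot> y = x"
      using left_coreflection_step[OF Suc.prems(2,1)] by blast
    obtain g where g: "g \<in> S" "g \<in> Arr T" "Cod T g = Dom T f" "Dom T g \<in> LP"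
      "\<And>x. \<lbrakk>x \<in> Arr T; Dom T x \<in> LP; Cod T x = Dom T f\<rbrakk> \<Longrightarrow> \<exists>y. y \<in> Arr T \<and> Dom T y = Dom T x
        \<and> Cod T y = Dom T g \<and> g \<cdot> y = x"
      using Suc.IH[OF f(4) dom_obj[OF f(2)]] by blast
    have "f \<cdot> g \<in> S"
      by (rule S_comp[OF g(1) f(1) g(3)])
    moreover have "\<exists>y. y \<in> Arr T \<and> Dom T y = Dom T x \<and> Cod T y = Dom T g \<and> (f \<cdot> g) \<cdot> y = x"
      if x: "x \<in> Arr T" "Dom T x \<in> LP" "Cod T x = X" for x
    proof -
      obtain y where y: "y \<in> Arr T" "Dom T y = Dom T x" "Cod T y = Dom T f" "f \<cdot> y = x"
        using f(5)[OF x] by blast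
      obtain z where z: "z \<in> Arr T" "Dom T z = Dom T y" "Cod T z = Dom T g" "g \<cdot> z = y"
        using g(5)[OF y(1) _ y(3)] y(2) x(2) by auto
      have "(f \<cdot> g) \<cdot> z = x"
        using f(2) g(2,3) z y(4) by simp
      then show ?thesis
        using z y(2) by (intro exI[of _ z]) simp
    qed
    ultimately show ?case
      using f(2,3) g(2-4) by (intro exI[of _ "f \<cdot> g"]) simp
  qed
  then show ?thesis
    using that by blast
qed

abbreviation "Z \<equiv> silting_Z T P"

lemma Z_iff: "X \<in> Z \<longleftrightarrow> X \<in> LP \<and> X \<in> RP"
  by (simp add: silting_Z_def)

lemma Z_obj: "X \<in> Z \<Longrightarrow> X \<in> Obj T"
  using Z_iff LP_obj by blast

text \<open>The dual step must not leave \<open>LP\<close>. The approximation of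
  \<open>Y[n+1]\<close> is moved back to \<open>Y\<close> by desuspending its source, so the cone of
  the result differs from \<open>Y\<close> only by an object \<open>P[-n]\<close>, which has no
  nonzero arrows to positive shifts of \<open>P\<close>.\<close>

lemma right_reflection_step:
  assumes Y: "Y \<in> LP" and v: "\<And>i A. \<lbrakk>i > Suc n; A \<in> P\<rbrakk> \<Longrightarrow> hom_vanish T A (So i Y)"
  obtains f where "f \<in> S" "f \<in> Arr T" "Dom T f = Y" "Cod T f \<in> LP"
    "\<And>i A. \<lbrakk>i > n; A \<in> P\<rbrakk> \<Longrightarrow> hom_vanish T A (So i (Cod T f))"
proof -
  let ?n = "Suc n"
  have Yo: "Y \<in> Obj T"
    using Y LP_obj by blast
  have "So ?n Y \<in> RP"
    unfolding RP_iff
  proof (intro conjI allI ballI)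
    fix i A assume A: "A \<in> P"
    show "hom_vanish T A (So (Suc i) (So ?n Y))"
      unfolding So_add by (rule v[OF _ A]) simp
  qed (use Yo in simp)
  then obtain p where p: "p \<in> Arr T" "Cod T p = So ?n Y" "Dom T p \<in> P"
    "\<And>A x. \<lbrakk>A \<in> P; x \<in> Arr T; Dom T x = A; Cod T x = So ?n Y\<rbrakk>
      \<Longrightarrow> \<exists>z. z \<in> Arr T \<and> Dom T z = A \<and> Cod T z = Dom T p \<and> p \<cdot> z = x"
    by (rule right_approx) blast
  have Po: "Dom T p \<in> Obj T"
    using p by simp
  obtain V e e' where V: "V \<in> Obj T" and e: "inverse_pair T e e'" "Dom T e = So ?n V" "Cod T e = Dom T p"
    using desuspend_n[OF Po] by metis
  note ec = inverse_pair_cancel[OF e(1)]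
  note iV = isomorphicI[OF e] isomorphic_sym[OF isomorphicI[OF e]]
  obtain q where q: "q \<in> Arr T" "Dom T q = V" "Cod T q = Y" "Sa ?n q = p \<cdot> e"
    using Sa_full[OF V Yo, of "p \<cdot> e" ?n] p(1,2) e(2,3) ec(5) by (auto simp del: funpow.simps)
  obtain y k where t: "(q, y, k) \<in> Tri T"
    using tri_cone[OF q(1)] by blast
  note a = tri_arr[OF t]
  have y: "y \<in> Arr T" "Dom T y = Y" and Y1: "Cod T y \<in> Obj T"
    using a q by simp_all
  have "So ?n V \<in> thick T P"
    by (rule N_iso[OF P_N[OF p(3)] iV(2)]) (use V in simp)
  then have "V \<in> thick T P"
    by (rule N_unshift_n[OF V])
  then have yS: "y \<in> S"
    using S_iff_cocone[OF t] q(2) by simp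
  have LPy: "Cod T y \<in> LP"
    unfolding LP_iff
  proof (intro conjI Y1 allI ballI)
    fix j A assume A: "A \<in> P"
    have Ao: "So (Suc j) A \<in> Obj T"
      using A by simp
    have "hom_vanish T (Dom T p) (So n (So (Suc j) A))"
      unfolding So_add by (rule LP_vanish[OF P_LP[OF p(3)] A]) simp
    then have "hom_vanish T (So n (ShO T V)) (So n (So (Suc j) A))"
      unfolding So_Suc by (rule hom_vanish_iso[OF _ iV(2) isomorphic_refl]) (use A in simp)
    then have "hom_vanish T (ShO T V) (So (Suc j) A)"
      using hom_vanish_shift[OF sh.map_obj[OF V] Ao] by blast
    then show "hom_vanish T (Cod T y) (So (Suc j) A)"
      by - (rule vanish_contravariant[OF t], use q(2,3) LP_vanish[OF Y A, of "Suc j"] Ao in simp_all)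
  qed
  have "hom_vanish T A (So i (Cod T y))" if i: "i > n" and A: "A \<in> P" for i A
  proof -
    obtain r where r: "i = ?n + r"
      using i by (metis Suc_leI le_iff_add)
    have Ao: "A \<in> Obj T"
      using A by simp
    \<comment> \<open>As \<open>i = Suc n + r\<close>, the shift of \<open>V\<close> by
      \<open>Suc i\<close> is a positive shift of an object of \<open>P\<close>, and presilting
      applies.\<close>
    have "isomorphic T (So (Suc r) (Dom T p)) (So (Suc i) V)"
      using So_isomorphic[OF iV(2), of "Suc r"] unfolding So_add r by (simp add: add.commute del: funpow.simps)
    then have vS: "hom_vanish T A (So (Suc i) V)"
      by (rule hom_vanish_iso[OF P_vanish[OF A p(3)] isomorphic_refl[OF Ao]])
    show ?thesis
    \<comment> \<open>The lowest degree needs the approximation property of \<open>p\<close>; above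
      it the hypothesis on \<open>Y\<close> suffices together with the previous vanishing.\<close>
    proof (cases r)
      case 0
      then have i: "i = ?n"
        using r by simp
      obtain k' where t': "(Sa i q, Sa i y, k') \<in> Tri T"
        using tri_shift_n[OF t] by blast
      note b = tri_arr[OF t']
      have b': "Sa i q \<in> Arr T" "Sa i y \<in> Arr T" "k' \<in> Arr T" "Dom T (Sa i q) = So i V"
        "Cod T (Sa i q) = So i Y" "Dom T (Sa i y) = So i Y"
          "Cod T (Sa i y) = So i (Cod T y)" "Dom T k' = So i (Cod T y)" "Cod T k' = So (Suc i) V"
        using b q y by simp_all
      show ?thesis
      proof (rule hom_vanishI[OF Ao])
        show Y1o: "So i (Cod T y) \<in> Obj T"
          using Y1 by simp
        fix x assume x: "x \<in> Arr T" "Dom T x = A" "Cod T x = So i (Cod T y)"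
        have "k' \<cdot> x = Zero T A (So (Suc i) V)"
          by (rule hom_vanishD[OF vS]) (use x b' in \<open>simp_all del: funpow.simps\<close>)
        then have "k' \<cdot> x = Zero T (Dom T x) (Cod T k')"
          using x b' by (simp del: funpow.simps)
        then obtain z where z: "z \<in> Arr T" "Dom T z = A" "Cod T z = So i Y" "Sa i y \<cdot> z = x"
          using hom_exactE[OF tri_exact2[OF t'] x(1)] x(2,3) b' by metis
        obtain c where c: "c \<in> Arr T" "Dom T c = A" "Cod T c = Dom T p" "p \<cdot> c = z"
          using p(4)[OF A z(1,2)] z(3) i by blast
        have "z = Sa i q \<cdot> (e' \<cdot> c)"
          unfolding i q(4) using c p(1,2) e(2,3) ec by (simp del: funpow.simps)
        then have "x = (Sa i y \<cdot> Sa i q) \<cdot> (e' \<cdot> c)"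
          using z(4) b' c e(2,3) ec(6-8) i by (simp del: funpow.simps)
        also have "\<dots> = Zero T A (So i (Cod T y))"
          unfolding comp_tri_zero1[OF t'] using b' c e(2,3) ec(6-8) i Y1o by (simp del: funpow.simps)
        finally show "x = Zero T A (So i (Cod T y))" .
      qed
    next
      case (Suc s)
      show ?thesis
        by (rule vanish_covariant[OF t _ _ Ao]) (use q(2,3) vS v[OF _ A, of i] r Suc in simp_all)
    qed
  qed
  then show ?thesis
    using that[OF yS y LPy] by blast
qed

lemma right_reflection:
  assumes Y: "Y \<in> LP"
  obtains f where "f \<in> S" "f \<in> Arr T" "Dom T f = Y" "Cod T f \<in> Z"
proof -
  obtain n where "\<And>i A. \<lbrakk>i > n; A \<in> P\<rbrakk> \<Longrightarrow> hom_vanish T A (So i Y)"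
    using P2_bound[OF LP_obj[OF Y]] by metis
  then have "\<exists>f. f \<in> S \<and> f \<in> Arr T \<and> Dom T f = Y \<and> Cod T f \<in> Z"
    using Y
  proof (induction n arbitrary: Y)
    case 0
    have "Y \<in> Z"
      unfolding Z_iff RP_iff using 0 LP_obj by blast
    then show ?case
      using Z_obj S_ident by (intro exI[of _ "Ident T Y"]) simp
  next
    case (Suc n)
    obtain f where f: "f \<in> S" "f \<in> Arr T" "Dom T f = Y" "Cod T f \<in> LP"
      "\<And>i A. \<lbrakk>i > n; A \<in> P\<rbrakk> \<Longrightarrow> hom_vanish T A (So i (Cod T f))"
      using right_reflection_step[OF Suc.prems(2,1)] by blast
    obtain g where g: "g \<in> S" "g \<in> Arr T" "Dom T g = Cod T f" "Cod T g \<in> Z"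
      using Suc.IH[OF f(5,4)] by blast
    have "g \<cdot> f \<in> S"
      by (rule S_comp) (use f g in simp_all)
    then show ?case
      using f(2,3) g(2-4) by (intro exI[of _ "g \<cdot> f"]) simp
  qed
  then show ?thesis
    using that by blast
qed

text \<open>First move into \<open>LP\<close> along \<open>f\<close>, then into \<open>Z\<close>
  along \<open>g\<close>; both arrows lie in \<open>S\<close>, so they become invertible.\<close>

lemma Q_dense:
  assumes X: "X \<in> Obj T"
  shows "\<exists>Y\<in>Z. isomorphic U Y X"
proof -
  obtain f where f: "f \<in> S" "f \<in> Arr T" "Cod T f = X" "Dom T f \<in> LP"
    by (rule left_coreflection[OF X]) blast
  obtain g where g: "g \<in> S" "g \<in> Arr T" "Dom T g = Dom T f" "Cod T g \<in> Z"
    by (rule right_reflection[OF f(4)])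
  have 1: "isomorphic U (Dom T f) X"
    using isomorphicI[OF Q_iso[OF f(1)]] f by simp
  have 2: "isomorphic U (Dom T f) (Cod T g)"
    using isomorphicI[OF Q_iso[OF g(1)]] g by simp
  show ?thesis
    by (rule bexI[of _ "Cod T g"], rule Q.cod.isomorphic_trans[OF isomorphic_sym[OF 2] 1], rule g(4))
qed

text \<open>An arrow killed by the projection factors through the thick subcategory. Composed with
  the map \<open>w\<close> from \<open>Y\<close> to the cone of its right approximation it vanishes
  by \<open>thick_composite_zero\<close>, so it factors through the approximation itself.\<close>

lemma Q_zero_factors:
  assumes f: "f \<in> Arr T" "Dom T f = X" "Cod T f = Y" and X: "X \<in> LP" and Y: "Y \<in> RP" and z: "Q f = Zero U X Y"
  shows "\<exists>A\<in>P. \<exists>u v. u \<in> Arr T \<and> Dom T u = X \<and> Cod T u = A \<and> v \<in> Arr T \<and> Dom T v = A \<and> Cod T v = Y \<and> f = v \<cdot> u"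
proof -
  obtain s where s: "s \<in> S" "s \<in> Arr T" "Cod T s = X" "f \<cdot> s = Zero T (Dom T s) Y"
    using z Q_zero_iff[OF f] by blast
  obtain a b where ab: "a \<in> Arr T" "b \<in> Arr T" "Cod T a = Dom T b" "Cod T a \<in> thick T P" "f = b \<cdot> a"
    by (rule S_killed[OF s(1) f(1)]) (use s f in simp_all)
  obtain p w k where t: "(p, w, k) \<in> Tri T" "Dom T p \<in> P" "Cod T p = Y" "Cod T w \<in> R0"
    by (rule right_approx_triangle[OF Y])
  note A = tri_arr[OF t(1)]
  have "Dom T a = X" "Cod T b = Y"
    using ab f by auto
  then have "(w \<cdot> b) \<cdot> a = Zero T (Dom T a) (Cod T (w \<cdot> b))"
    by (intro thick_composite_zero) (use ab X A t in simp_all)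
  then have "w \<cdot> f = Zero T (Dom T f) (Cod T w)"
    using ab A t(3) \<open>Cod T b = Y\<close> by simp
  then obtain z where "z \<in> Arr T" "Dom T z = X" "Cod T z = Dom T p" "p \<cdot> z = f"
    using hom_exactE[OF tri_exact1[OF t(1)] f(1)] f t(3) by metis
  then show ?thesis
    using t A by (intro bexI[of _ "Dom T p"] exI[of _ z] exI[of _ p]) simp_all
qed

text \<open>The map from \<open>X\<close> to the cone of the denominator lifts to the coreflection of that cone; refining
  the roof accordingly, the numerator extends along the new denominator.\<close>

lemma Q_full:
  assumes a: "a \<in> Hom U X Y" and X: "X \<in> LP" and Y: "Y \<in> RP"
  shows "\<exists>f. f \<in> Arr T \<and> Dom T f = X \<and> Cod T f = Y \<and> Q f = a"
proof -
  obtain s f where r: "roof s f" "a = cl s f" "Cod T s = X" "Cod T f = Y" "s \<in> S" "s \<in> Arr T"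
    "f \<in> Arr T" "Dom T s = Dom T f"
    using a by (rule U_homE)
  obtain g h where t: "(s, g, h) \<in> Tri T" "Cod T g \<in> thick T P"
    using r(5) by (rule S_coneE)
  note A = tri_arr[OF t(1)]
  have Co: "Cod T g \<in> Obj T"
    using A by simp
  obtain e where e: "e \<in> S" "e \<in> Arr T" "Cod T e = Cod T g" "Dom T e \<in> LP"
    "\<And>x. \<lbrakk>x \<in> Arr T; Dom T x \<in> LP; Cod T x = Cod T g\<rbrakk> \<Longrightarrow> \<exists>y. y \<in> Arr T \<and> Dom T y = Dom T x
      \<and> Cod T y = Dom T e \<and> e \<cdot> y = x"
    by (rule left_coreflection[OF Co]) blast
  have "Dom T g = X"
    using A r(3) by simp
  then obtain g' where g': "g' \<in> Arr T" "Dom T g' = X" "Cod T g' = Dom T e" "e \<cdot> g' = g"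
    using e(5)[of g] A X by auto
  \<comment> \<open>The codomain and the cone of \<open>e\<close> are in the thick subcategory,
    hence so is its domain.\<close>
  have eN: "Dom T e \<in> thick T P"
  proof -
    obtain g2 h2 where t2: "(e, g2, h2) \<in> Tri T" "Cod T g2 \<in> thick T P"
      using e(1) by (rule S_coneE)
    show ?thesis
      by (rule N_tri1[OF t2(1) _ t2(2)]) (use e t in simp)
  qed
  obtain s' h' where t': "(s', g', h') \<in> Tri T"
    by (rule cocone[OF g'(1)])
  note B = tri_arr[OF t']
  have s': "Cod T s' = X" "s' \<in> S"
    using B g' S_iff[OF t'] eN by simp_all
  have "g \<cdot> s' = e \<cdot> (g' \<cdot> s')"
    unfolding g'(4)[symmetric] using e g'(1-3) B s' by simp
  also have "\<dots> = Zero T (Dom T s') (Cod T g)"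
    unfolding comp_tri_zero1[OF t'] using e g'(1-3) B by simp
  finally have "g \<cdot> s' = Zero T (Dom T s') (Cod T g)" .
  then obtain w where w: "w \<in> Arr T" "Dom T w = Dom T s'" "Cod T w = Dom T s" "s \<cdot> w = s'"
    using hom_exactE[OF tri_exact1[OF t(1)] B(1)] s' r(3) by metis
  have wS: "w \<in> S"
    using S_octahedron[OF w(1) r(5) w(3)] w(4) s'(2) by simp
  have fw: "f \<cdot> w \<in> Arr T" "Dom T (f \<cdot> w) = Dom T s'" "Cod T (f \<cdot> w) = Y"
    using w r by simp_all
  \<comment> \<open>This arrow is the obstruction to extending \<open>f \<cdot> w\<close> along
    \<open>s'\<close>. It starts at an object lying both in \<open>LP\<close> and in the thick
    subcategory and ends in \<open>R0\<close>; the inserted identity gives it the shape of a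
    composite.\<close>
  have "ShA T (f \<cdot> w) \<cdot> h' = (ShA T (f \<cdot> w) \<cdot> h') \<cdot> Ident T (Dom T e)"
    using fw B g' by simp
  also have "\<dots> = Zero T (Dom T (Ident T (Dom T e))) (Cod T (ShA T (f \<cdot> w) \<cdot> h'))"
    by (rule thick_composite_zero) (use fw B g'(1-3) e LP_obj[OF e(4)] eN RP_shift_R0[OF Y] in simp_all)
  also have "\<dots> = Zero T (Cod T g') (ShO T (Cod T (f \<cdot> w)))"
    using fw B g'(1-3) LP_obj[OF e(4)] by simp
  finally obtain k where k: "k \<in> Arr T" "Dom T k = X" "Cod T k = Y" "k \<cdot> s' = f \<cdot> w"
    using tri_extend0[OF t' fw(1,2)] fw(3) s'(1) by metis
  have "a = cl (s \<cdot> w) (f \<cdot> w)"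
    using cl_refine[OF r(1) wS w(3)] r(2) by simp
  also have "\<dots> = cl (Ident T X \<cdot> s') (k \<cdot> s')"
    using w(4) k(4) B s' by simp
  also have "\<dots> = cl (Ident T X) k"
    by (rule cl_refine) (use k s' LP_obj[OF X] in simp_all)
  also have "\<dots> = Q k"
    using k by (simp add: Q_cl)
  finally show ?thesis
    using k by blast
qed

section \<open>Closure properties of Z and the kernel of the projection\<close>

lemma P_Z: "A \<in> P \<Longrightarrow> A \<in> Z"
  by (simp add: Z_iff P_LP P_RP)

lemma Z_zero_object:
  assumes "zero_object T M"
  shows "M \<in> Z"
proof -
  have M: "M \<in> Obj T"
    by (rule zero_object_obj[OF assms])
  have So_M: "zero_object T (So n M)" for n
    using assms by (induction n) (simp_all add: sh.map_zero_object)
  have "hom_vanish T M (So n A)" if "A \<in> P" for n A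
    using from_zero_object[OF assms] M that by (intro hom_vanishI) simp_all
  moreover have "hom_vanish T A (So n M)" if "A \<in> P" for n A
    using to_zero_object[OF So_M] M that by (intro hom_vanishI) simp_all
  ultimately show ?thesis
    unfolding Z_iff LP_iff RP_iff using M by blast
qed

lemma Z_biproduct:
  assumes b: "biproduct T A B M" and A: "A \<in> Z" and B: "B \<in> Z"
  shows "M \<in> Z"
proof -
  have M: "M \<in> Obj T"
    using b by (simp add: biproduct_def)
  have "hom_vanish T M (So (Suc n) Q')" if Q': "Q' \<in> P" for n Q'
    by (rule hom_vanish_biproduct(1)[OF b]) (use A B Q' LP_vanish[OF _ Q', of _ "Suc n"] in \<open>simp_all
      add: Z_iff\<close>)
  moreover have "hom_vanish T Q' (So (Suc n) M)" if Q': "Q' \<in> P" for n Q'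
    by (rule hom_vanish_biproduct(2)[OF So_biproduct[OF b]]) (use A B Q' RP_vanish[OF _ Q', of _ "Suc n"]
      in \<open>simp_all add: Z_iff\<close>)
  ultimately show ?thesis
    unfolding Z_iff LP_iff RP_iff using M by blast
qed

text \<open>Only arrows from the cone to \<open>P[1]\<close> need more than vanishing in the long
  exact sequence. Such an arrow comes from the shift of an arrow from the domain of \<open>f\<close>
  to \<open>P\<close>; this one extends over \<open>f\<close> by assumption, and
  \<open>ShA T f \<cdot> h = 0\<close> kills the result.\<close>

lemma Z_cone:
  assumes t: "(f, g, h) \<in> Tri T" and f: "Dom T f \<in> Z" "Cod T f \<in> Z"
    and approx: "\<And>A x. \<lbrakk>A \<in> P; x \<in> Arr T; Dom T x = Dom T f; Cod T x = A\<rbrakk> \<Longrightarrow>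
      \<exists>z. z \<in> Arr T \<and> Dom T z = Cod T f \<and> Cod T z = A \<and> z \<cdot> f = x"
  shows "Cod T g \<in> Z"
proof -
  note a = tri_arr[OF t]
  have Go: "Cod T g \<in> Obj T"
    using a by simp
  have "hom_vanish T (Cod T g) (So (Suc n) A)" if A: "A \<in> P" for n A
  proof (rule hom_vanishI[OF Go])
    have Ao: "A \<in> Obj T" "So n A \<in> Obj T" "So (Suc n) A \<in> Obj T"
      using A by simp_all
    then show "So (Suc n) A \<in> Obj T" by simp
    fix x assume x: "x \<in> Arr T" "Dom T x = Cod T g" "Cod T x = So (Suc n) A"
    have "hom_vanish T (Cod T f) (So (Suc n) A)"
      by (rule LP_vanish[OF _ A]) (use f in \<open>simp_all add: Z_iff\<close>)
    then have "x \<cdot> g = Zero T (Cod T f) (So (Suc n) A)"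
      by (rule hom_vanishD) (use a x in simp_all)
    then have "x \<cdot> g = Zero T (Dom T g) (Cod T x)"
      using x a by (simp del: funpow.simps)
    then obtain z where z: "z \<in> Arr T" "Dom T z = ShO T (Dom T f)" "Cod T z = So (Suc n) A" "z \<cdot> h = x"
      using tri_extend2[OF t x(1,2)] x(3) by metis
    obtain z' where z': "z' \<in> Arr T" "Dom T z' = Dom T f" "Cod T z' = So n A" "ShA T z' = z"
      using sh_full[OF a(7) Ao(2) z(1,2)] z(3) by auto
    show "x = Zero T (Cod T g) (So (Suc n) A)"
    proof (cases n)
      case 0
      then have "Cod T z' = A"
        using z'(3) by simp
      then obtain y where y: "y \<in> Arr T" "Dom T y = Cod T f" "Cod T y = A" "y \<cdot> f = z'"
        using approx[OF A z'(1,2)] by blast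
      have "x = (ShA T y \<cdot> ShA T f) \<cdot> h"
        using z(4) z'(4) y a sh_comp[of f y] by simp
      also have "\<dots> = ShA T y \<cdot> (ShA T f \<cdot> h)"
        using y(1-3) a by simp
      also have "\<dots> = Zero T (Cod T g) (So (Suc n) A)"
        unfolding comp_tri_zero2(2)[OF t] using y(1-3) a 0 Go by simp
      finally show ?thesis .
    next
      case (Suc m)
      have "z' = Zero T (Dom T f) (So n A)"
        by (rule hom_vanishD[OF LP_vanish[OF _ A] z'(1-3)]) (use f Suc in \<open>simp_all add: Z_iff\<close>)
      then have "z = Zero T (ShO T (Dom T f)) (So (Suc n) A)"
        using z'(4) a Ao by simp
      then show ?thesis
        using z(4) a Ao by (simp del: funpow.simps)
    qed
  qed
  moreover have "hom_vanish T A (So (Suc n) (Cod T g))" if A: "A \<in> P" for n A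
    by (rule vanish_covariant[OF t]) (use f A RP_vanish[OF _ A, of _ "Suc n"] RP_vanish[OF _ A, of _ "Suc
      (Suc n)"] in \<open>simp_all add: Z_iff\<close>)
  ultimately show ?thesis
    unfolding Z_iff LP_iff RP_iff using Go by blast
qed

text \<open>The identity of such an object factors through the thick subcategory, so some
  denominator kills it.\<close>

lemma N_zero_U:
  assumes "A \<in> thick T P"
  shows "zero_object U A"
proof -
  have A: "A \<in> Obj T"
    using N_obj[OF assms] .
  obtain u where u: "u \<in> S" "u \<in> Arr T" "Cod T u = Dom T (Ident T A)"
    "(Ident T A \<cdot> Ident T A) \<cdot> u = Zero T (Dom T u) (Cod T (Ident T A))"
    by (rule S_kill[of "Ident T A" "Ident T A"]) (use A assms in simp_all)
  have "Q (Ident T A) = Zero U A A"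
    using Q_zero_iff[of "Ident T A" A A] u A by auto
  then show ?thesis
    unfolding Q.cod.zero_object_iff using A Q.map_ident[OF A] by simp
qed

lemma Q_zero_P:
  assumes "u \<in> Arr T" "Dom T u = X" "Cod T u = Y" "X \<in> P \<or> Y \<in> P"
  shows "Q u = Zero U X Y"
  using assms Q.cod.from_zero_object[OF N_zero_U[OF P_N], of X "Q u" Y]
    Q.cod.to_zero_object[OF N_zero_U[OF P_N], of Y "Q u" X] by auto

abbreviation "I \<equiv> ideal_of T P"
abbreviation "J \<equiv> ideal_class T I"

text \<open>Here \<open>P = add_closure T P\<close> enters: the ideal is defined by factorization
  through the additive closure.\<close>

lemma I_iff: "f \<in> I \<longleftrightarrow> f \<in> Arr T \<and> (\<exists>A\<in>P. \<exists>u v. u \<in> Arr T \<and> Dom T u = Dom T f \<and> Cod T u = A \<and> v \<in> Arr T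
  \<and> Dom T v = A \<and>
    Cod T v = Cod T f \<and> f = v \<cdot> u)"
  unfolding ideal_of_def P_add[symmetric] mem_Collect_eq in_Hom Bex_def by metis

text \<open>This reduces every identity in the ideal quotient to one in the Verdier quotient.\<close>

lemma ideal_rel_iff:
  assumes f: "f \<in> Arr T" "Dom T f \<in> Z" "Cod T f \<in> Z"
  shows "(f, g) \<in> ideal_rel T I \<longleftrightarrow> g \<in> Arr T \<and> Dom T g = Dom T f \<and> Cod T g = Cod T f \<and> Q g = Q f"
proof (cases "g \<in> Arr T \<and> Dom T g = Dom T f \<and> Cod T g = Cod T f")
  case True
  let ?d = "f \<boxplus> neg T g"
  have d: "?d \<in> Arr T" "Dom T ?d = Dom T f" "Cod T ?d = Cod T f"
    using True f by simp_all
  have Qd: "Q ?d = Q f \<boxplus>\<^bsub>U\<^esub> neg U (Q g)"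
    using True f Q.map_add[of f "neg T g"] by simp
  have "?d \<in> I \<longleftrightarrow> Q ?d = Zero U (Dom T f) (Cod T f)"
  proof
    assume "?d \<in> I"
    then obtain A u v where A: "A \<in> P" and u: "u \<in> Arr T" "Dom T u = Dom T f" "Cod T u = A"
      "v \<in> Arr T" "Dom T v = A" "Cod T v = Cod T f"
        "?d = v \<cdot> u"
      unfolding I_iff d by blast
    have "Q ?d = Q v \<cdot>\<^bsub>U\<^esub> Zero U (Dom T f) A"
      unfolding u(7) using u(1-6) A Q_zero_P[OF u(1-3)] by (simp add: Q.map_comp')
    then show "Q ?d = Zero U (Dom T f) (Cod T f)"
      using u(1-6) f Z_obj by simp
  next
    assume "Q ?d = Zero U (Dom T f) (Cod T f)"
    then show "?d \<in> I"
      unfolding I_iff using Q_zero_factors[OF d] f d Z_iff by simp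
  qed
  also have "\<dots> \<longleftrightarrow> Q g = Q f"
  proof
    assume "Q ?d = Zero U (Dom T f) (Cod T f)"
    then have "Q f \<boxplus>\<^bsub>U\<^esub> neg U (Q g) = Zero U (Dom T f) (Cod T f)"
      unfolding Qd .
    then have "Q f = Q g"
      by (rule Q.cod.diff_zero_imp_eq) (use True f in simp_all)
    then show "Q g = Q f"
      by simp
  next
    assume "Q g = Q f"
    then show "Q ?d = Zero U (Dom T f) (Cod T f)"
      unfolding Qd using f by (simp add: Q.cod.add_neg)
  qed
  finally show ?thesis
    using True f by (simp add: ideal_rel_def)
qed (use f in \<open>auto simp: ideal_rel_def\<close>)

lemma in_J_iff:
  assumes f: "f \<in> Arr T" "Dom T f \<in> Z" "Cod T f \<in> Z"
  shows "g \<in> J f \<longleftrightarrow> g \<in> Arr T \<and> Dom T g = Dom T f \<and> Cod T g = Cod T f \<and> Q g = Q f"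
  using ideal_rel_iff[OF f] by (simp add: ideal_class_def)

lemma J_eqI:
  assumes f: "f \<in> Arr T" "Dom T f \<in> Z" "Cod T f \<in> Z" and g: "g \<in> Arr T" "Dom T g = Dom T f"
    "Cod T g = Cod T f" "Q g = Q f"
  shows "J f = J g"
  by (rule Set.set_eqI) (use f g in \<open>simp add: in_J_iff\<close>)

end

section \<open>Silting reduction\<close>

locale silting_data = silting T P
  for T :: "('o, 'm) triang_data" (structure) and P :: "'o set" +
  fixes \<iota> \<pi> \<delta> :: "'o \<Rightarrow> 'm"
  assumes approximation: "approximation_triangles T P \<iota> \<pi> \<delta>"
begin

abbreviation "V \<equiv> silting_reduction T P \<iota> \<pi> \<delta>"
abbreviation "F \<equiv> rho_bar T P"

definition ZA :: "'m \<Rightarrow> bool" where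
  "ZA f \<longleftrightarrow> f \<in> Arr T \<and> Dom T f \<in> Z \<and> Cod T f \<in> Z"

lemmas V_defs = silting_reduction_def silting_preadd_def ideal_quotient_def preadd_data.extend_def
  triang_data.fields_def

lemma ZA_D: "ZA f \<Longrightarrow> f \<in> Arr T" "ZA f \<Longrightarrow> Dom T f \<in> Z" "ZA f \<Longrightarrow> Cod T f \<in> Z"
  by (simp_all add: ZA_def)

lemma ZA_I: "\<lbrakk>f \<in> Arr T; Dom T f = X; Cod T f = Y; X \<in> Z; Y \<in> Z\<rbrakk> \<Longrightarrow> ZA f"
  by (simp add: ZA_def)

lemma J_self: "ZA f \<Longrightarrow> f \<in> J f"
  by (simp add: in_J_iff ZA_def)

lemma Obj_V [simp]: "Obj V = Z"
  by (simp add: V_defs)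

lemma Arr_V: "a \<in> Arr V \<longleftrightarrow> (\<exists>f. ZA f \<and> a = J f)"
  by (auto simp: V_defs quotient_def ideal_class_def ZA_def)

lemma J_arr [simp]: "ZA f \<Longrightarrow> J f \<in> Arr V"
  using Arr_V by blast

text \<open>Classes are the fibres of \<open>Q\<close> on parallel arrows of \<open>Z\<close>, so a
  function that respects \<open>Q\<close> on such arrows can be evaluated on any
  representative.\<close>

lemma the_elem_J:
  assumes "ZA f" "\<And>g. \<lbrakk>g \<in> Arr T; Dom T g = Dom T f; Cod T g = Cod T f; Q g = Q f\<rbrakk> \<Longrightarrow> k g = k f"
  shows "the_elem (k ` J f) = k f"
proof (rule the_elem_const)
  show "k f \<in> k ` J f"
    using J_self[OF assms(1)] by blast
  fix y assume "y \<in> k ` J f"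
  then obtain g where g: "g \<in> J f" "y = k g"
    by blast
  have "k g = k f"
    by (rule assms(2)) (use g(1) in_J_iff[OF assms(1)[unfolded ZA_def, THEN conjunct1]] assms(1) in
      \<open>simp_all add: ZA_def\<close>)
  then show "y = k f"
    using g(2) by simp
qed

lemma dom_J [simp]: "ZA f \<Longrightarrow> Dom V (J f) = Dom T f"
  using the_elem_J[of f "Dom T"] by (simp add: V_defs)

lemma cod_J [simp]: "ZA f \<Longrightarrow> Cod V (J f) = Cod T f"
  using the_elem_J[of f "Cod T"] by (simp add: V_defs)

lemma F_J [simp]: "ZA f \<Longrightarrow> F (J f) = Q f"
  using the_elem_J[of f Q] by (simp add: rho_bar_def)

lemma ident_V: "Ident V X = J (Ident T X)" and zero_V: "Zero V X Y = J (Zero T X Y)"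
  by (simp_all add: V_defs)

lemma J_cong: "\<lbrakk>ZA f; g \<in> Arr T; Dom T g = Dom T f; Cod T g = Cod T f; Q g = Q f\<rbrakk> \<Longrightarrow> J g = J f"
  using J_eqI[of f g] by (simp add: ZA_def)

lemma the_elem_J2:
  assumes f: "ZA f" "ZA g" and k: "\<And>f' g'. \<lbrakk>f' \<in> Arr T; Dom T f' = Dom T f; Cod T f' = Cod T f; Q f' = Q f;
      g' \<in> Arr T; Dom T g' = Dom T g; Cod T g' = Cod T g; Q g' = Q g\<rbrakk> \<Longrightarrow> k f' g' = k f g"
  shows "the_elem {k f' g' | f' g'. f' \<in> J f \<and> g' \<in> J g} = k f g"
proof (rule the_elem_const)
  show "k f g \<in> {k f' g' | f' g'. f' \<in> J f \<and> g' \<in> J g}"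
    using J_self[OF f(1)] J_self[OF f(2)] by blast
  fix y assume "y \<in> {k f' g' | f' g'. f' \<in> J f \<and> g' \<in> J g}"
  then obtain f' g' where "y = k f' g'" "f' \<in> J f" "g' \<in> J g"
    by blast
  then show "y = k f g"
    using k[of f' g'] f by (simp add: in_J_iff ZA_def)
qed

section \<open>The additive structure on the quotient of Z and its functor to the Verdier
  quotient\<close>

lemma ZA_comp: "\<lbrakk>ZA f; ZA g; Cod T f = Dom T g\<rbrakk> \<Longrightarrow> ZA (g \<cdot> f)"
  by (simp add: ZA_def)

lemma comp_J [simp]:
  assumes f: "ZA f" "ZA g" "Cod T f = Dom T g"
  shows "J g \<cdot>\<^bsub>V\<^esub> J f = J (g \<cdot> f)"
proof -
  have "the_elem {J (g' \<cdot> f') | f' g'. f' \<in> J f \<and> g' \<in> J g} = J (g \<cdot> f)"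
  proof (rule the_elem_J2[OF f(1,2)])
    fix f' g' assume h: "f' \<in> Arr T" "Dom T f' = Dom T f" "Cod T f' = Cod T f" "Q f' = Q f"
      "g' \<in> Arr T" "Dom T g' = Dom T g" "Cod T g' = Cod T g" "Q g' = Q g"
    show "J (g' \<cdot> f') = J (g \<cdot> f)"
      by (rule J_cong[OF ZA_comp[OF f]]) (use h f ZA_D in \<open>simp_all add: Q.map_comp'\<close>)
  qed
  then show ?thesis
    by (simp add: V_defs)
qed

lemma ZA_add: "\<lbrakk>ZA f; ZA g; Dom T f = Dom T g; Cod T f = Cod T g\<rbrakk> \<Longrightarrow> ZA (f \<boxplus> g)"
  by (simp add: ZA_def)

lemma add_J [simp]:
  assumes f: "ZA f" "ZA g" "Dom T f = Dom T g" "Cod T f = Cod T g"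
  shows "J f \<boxplus>\<^bsub>V\<^esub> J g = J (f \<boxplus> g)"
proof -
  have "the_elem {J (f' \<boxplus> g') | f' g'. f' \<in> J f \<and> g' \<in> J g} = J (f \<boxplus> g)"
  proof (rule the_elem_J2[OF f(1,2)])
    fix f' g' assume h: "f' \<in> Arr T" "Dom T f' = Dom T f" "Cod T f' = Cod T f" "Q f' = Q f"
      "g' \<in> Arr T" "Dom T g' = Dom T g" "Cod T g' = Cod T g" "Q g' = Q g"
    show "J (f' \<boxplus> g') = J (f \<boxplus> g)"
      by (rule J_cong[OF ZA_add[OF f]]) (use h f ZA_D in \<open>simp_all add: Q.map_add\<close>)
  qed
  then show ?thesis
    by (simp add: V_defs)
qed

lemma V_homE:
  assumes "a \<in> Hom V X Y"
  obtains f where "ZA f" "a = J f" "f \<in> Arr T" "Dom T f = X" "Cod T f = Y" "X \<in> Z" "Y \<in> Z"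
  using assms by (auto simp: Arr_V ZA_D)

lemma ZA_ident [simp]: "X \<in> Z \<Longrightarrow> ZA (Ident T X)"
  using Z_obj by (simp add: ZA_def)

lemma ZA_zero [simp]: "\<lbrakk>X \<in> Z; Y \<in> Z\<rbrakk> \<Longrightarrow> ZA (Zero T X Y)"
  using Z_obj by (simp add: ZA_def)

lemma V_category: "category V"
proof
  fix a assume "a \<in> Arr V"
  then show "Dom V a \<in> Obj V" "Cod V a \<in> Obj V"
    by (auto simp: Arr_V ZA_D)
next
  fix X assume "X \<in> Obj V"
  then show "Ident V X \<in> Hom V X X"
    using Z_obj by (simp add: ident_V)
next
  fix a b X Y W assume "a \<in> Hom V X Y" "b \<in> Hom V Y W"
  then show "b \<cdot>\<^bsub>V\<^esub> a \<in> Hom V X W"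
    by (elim V_homE) (simp add: ZA_comp)
next
  fix a X Y assume a: "a \<in> Hom V X Y"
  show "Ident V Y \<cdot>\<^bsub>V\<^esub> a = a" "a \<cdot>\<^bsub>V\<^esub> Ident V X = a"
    by (rule V_homE[OF a], simp add: ident_V Z_obj)+
next
  fix a b c W X Y X' assume "a \<in> Hom V W X" "b \<in> Hom V X Y" "c \<in> Hom V Y X'"
  then show "(c \<cdot>\<^bsub>V\<^esub> b) \<cdot>\<^bsub>V\<^esub> a = c \<cdot>\<^bsub>V\<^esub> (b \<cdot>\<^bsub>V\<^esub> a)"
    by (elim V_homE) (simp add: ZA_comp)
qed

lemma V_hom_comm_group:
  assumes ob: "X \<in> Z" "Y \<in> Z"
  shows "comm_group (hom_group V X Y)"
proof (rule comm_groupI, simp_all only: hom_group_simps)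
  show "Zero V X Y \<in> Hom V X Y"
    using ob Z_obj by (simp add: zero_V)
next
  fix a b assume ab: "a \<in> Hom V X Y" "b \<in> Hom V X Y"
  then show "a \<boxplus>\<^bsub>V\<^esub> b \<in> Hom V X Y"
    by (elim V_homE) (simp add: ZA_add)
  show "a \<boxplus>\<^bsub>V\<^esub> b = b \<boxplus>\<^bsub>V\<^esub> a"
    using ab by (elim V_homE) (simp add: add_comm)
next
  fix a b c assume "a \<in> Hom V X Y" "b \<in> Hom V X Y" "c \<in> Hom V X Y"
  then show "a \<boxplus>\<^bsub>V\<^esub> b \<boxplus>\<^bsub>V\<^esub> c = a \<boxplus>\<^bsub>V\<^esub> (b \<boxplus>\<^bsub>V\<^esub> c)"
    by (elim V_homE) (simp add: ZA_add add_assoc)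
next
  fix a assume a: "a \<in> Hom V X Y"
  then obtain f where f: "ZA f" "a = J f" "f \<in> Arr T" "Dom T f = X" "Cod T f = Y"
    by (rule V_homE)
  show "Zero V X Y \<boxplus>\<^bsub>V\<^esub> a = a"
    using f ob Z_obj by (simp add: zero_V)
  have n: "ZA (neg T f)"
    using f ob by (simp add: ZA_def)
  then have "J (neg T f) \<boxplus>\<^bsub>V\<^esub> a = Zero V X Y"
    using f by (simp add: zero_V neg_add)
  moreover have "J (neg T f) \<in> Hom V X Y"
    using f n by simp
  ultimately show "\<exists>y\<in>Hom V X Y. y \<boxplus>\<^bsub>V\<^esub> a = Zero V X Y"
    by blast
qed

lemma V_preadditive: "preadditive_category V"
proof (rule preadditive_category.intro[OF V_category preadditive_category_axioms.intro])
  fix X Y assume "X \<in> Obj V" "Y \<in> Obj V"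
  then show "comm_group (hom_group V X Y)"
    using V_hom_comm_group by simp
next
  fix a b b' X Y W assume "a \<in> Hom V X Y" "b \<in> Hom V Y W" "b' \<in> Hom V Y W"
  then show "(b \<boxplus>\<^bsub>V\<^esub> b') \<cdot>\<^bsub>V\<^esub> a = (b \<cdot>\<^bsub>V\<^esub> a) \<boxplus>\<^bsub>V\<^esub> (b' \<cdot>\<^bsub>V\<^esub> a)"
    by (elim V_homE) (simp add: ZA_add ZA_comp add_comp)
next
  fix a a' b X Y W assume "a \<in> Hom V X Y" "a' \<in> Hom V X Y" "b \<in> Hom V Y W"
  then show "b \<cdot>\<^bsub>V\<^esub> (a \<boxplus>\<^bsub>V\<^esub> a') = (b \<cdot>\<^bsub>V\<^esub> a) \<boxplus>\<^bsub>V\<^esub> (b \<cdot>\<^bsub>V\<^esub> a')"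
    by (elim V_homE) (simp add: ZA_add ZA_comp comp_add)
qed

text \<open>\<open>Z\<close> contains the zero objects and direct sums formed in \<open>T\<close>,
  so their structure maps can simply be passed to classes.\<close>

lemma V_additive: "additive_category V"
proof (rule additive_category.intro[OF V_category additive_category_axioms.intro])
  interpret V: preadditive_category V
    by (rule V_preadditive)
  obtain M where M: "zero_object T M" "M \<in> Obj T"
    by (rule zero_object_obtain)
  have "Ident T M = Zero T M M"
    using M by (simp add: zero_object_iff)
  then have "zero_object V M"
    unfolding V.zero_object_iff using Z_zero_object[OF M(1)] by (simp add: ident_V zero_V)
  then show "\<exists>M. zero_object V M"
    by blast
  fix A B assume "A \<in> Obj V" "B \<in> Obj V"
  then have ob: "A \<in> Z" "B \<in> Z"
    by simp_all
  then obtain M where b: "biproduct T A B M"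
    using biproduct_exists[of A B] Z_obj by blast
  have MZ: "M \<in> Z"
    by (rule Z_biproduct[OF b ob])
  obtain i j p q where a: "i \<in> Arr T" "Dom T i = A" "Cod T i = M" "j \<in> Arr T" "Dom T j = B" "Cod T j = M"
      "p \<in> Arr T" "Dom T p = M" "Cod T p = A" "q \<in> Arr T" "Dom T q = M" "Cod T q = B"
      and e: "p \<cdot> i = Ident T A" "q \<cdot> j = Ident T B" "p \<cdot> j = Zero T B A" "q \<cdot> i = Zero T A B"
      "(i \<cdot> p) \<boxplus> (j \<cdot> q) = Ident T M"
    using b by (rule biproductE)
  have z: "ZA i" "ZA j" "ZA p" "ZA q"
    using a ob MZ by (simp_all add: ZA_def)
  have "biproduct V A B M"
    unfolding biproduct_def using a e z ob MZ
    by (intro conjI bexI[of _ "J i"] bexI[of _ "J j"] bexI[of _ "J p"] bexI[of _ "J q"])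
      (simp_all add: ident_V zero_V ZA_comp)
  then show "\<exists>M. biproduct V A B M"
    by blast
qed (use preadditive_category.hom_comm_group[OF V_preadditive] preadditive_category.comp_add_left[OF
  V_preadditive]
    preadditive_category.comp_add_right[OF V_preadditive] in auto)

lemma F_functor: "additive_functor V U (\<lambda>X. X) F"
proof -
  interpret V: preadditive_category V
    by (rule V_preadditive)
  show ?thesis
  proof unfold_locales
    show "additive_maps V U (\<lambda>X. X) F"
      unfolding additive_maps_def
    proof (intro ballI homI, unfold hom_group_simps)
      fix X Y a b assume "a \<in> Hom V X Y" "b \<in> Hom V X Y"
      then show "F (a \<boxplus>\<^bsub>V\<^esub> b) = F a \<boxplus>\<^bsub>U\<^esub> F b"
        by (elim V_homE) (simp add: ZA_add Q.map_add)
    next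
      fix X Y a assume "a \<in> Hom V X Y"
      then show "F a \<in> Hom U X Y"
        by (elim V_homE) simp
    qed
  next
    fix a b X Y W assume "a \<in> Hom V X Y" "b \<in> Hom V Y W"
    then show "F (b \<cdot>\<^bsub>V\<^esub> a) = F b \<cdot>\<^bsub>U\<^esub> F a"
      by (elim V_homE) (simp add: ZA_comp Q.map_comp')
  next
    fix a X Y assume "a \<in> Hom V X Y"
    then show "F a \<in> Hom U X Y"
      by (elim V_homE) simp
  qed (simp_all add: Z_obj ident_V)
qed

text \<open>Injectivity restates that classes are fibres of \<open>Q\<close>; surjectivity is
  \<open>Q_full\<close>.\<close>

lemma F_full_faithful: "full_faithful V U (\<lambda>X. X) F"
  unfolding full_faithful_def bij_betw_def Obj_V
proof (intro ballI conjI)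
  fix X Y assume ob: "X \<in> Z" "Y \<in> Z"
  show "inj_on F (Hom V X Y)"
  proof (rule inj_onI)
    fix a b assume aH: "a \<in> Hom V X Y" and bH: "b \<in> Hom V X Y" and eq: "F a = F b"
    obtain f where f: "ZA f" "a = J f" "f \<in> Arr T" "Dom T f = X" "Cod T f = Y"
      using aH by (rule V_homE)
    obtain g where g: "ZA g" "b = J g" "g \<in> Arr T" "Dom T g = X" "Cod T g = Y"
      using bH by (rule V_homE)
    have "Q f = Q g"
      using eq f(1,2) g(1,2) by simp
    then show "a = b"
      unfolding f(2) g(2) by (intro J_cong) (use f g in simp_all)
  qed
  show "F ` Hom V X Y = Hom U X Y"
  proof (rule subset_antisym[OF image_subsetI subsetI])
    show "F a \<in> Hom U X Y" if "a \<in> Hom V X Y" for a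
      using that by (elim V_homE) simp
    fix a assume "a \<in> Hom U X Y"
    then obtain f where f: "f \<in> Arr T" "Dom T f = X" "Cod T f = Y" "Q f = a"
      using Q_full ob Z_iff by blast
    then have "ZA f"
      using ob by (simp add: ZA_def)
    then show "a \<in> F ` Hom V X Y"
      using f by (intro image_eqI[of _ _ "J f"]) simp_all
  qed
qed

lemma F_ess_surj: "ess_surj V U (\<lambda>X. X)"
  unfolding ess_surj_def using Q_dense by simp

section \<open>The shift of the silting reduction\<close>

lemma approx_triangle:
  assumes X: "X \<in> Z"
  shows "(\<iota> X, \<pi> X, \<delta> X) \<in> Tri T" "Dom T (\<iota> X) = X" "Cod T (\<iota> X) \<in> P"
    "\<lbrakk>A \<in> P; x \<in> Arr T; Dom T x = X; Cod T x = A\<rbrakk> \<Longrightarrow> \<exists>z. z \<in> Arr T \<and> Dom T z = Cod T (\<iota> X) \<and> Cod T z = A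
      \<and> z \<cdot> \<iota> X = x"
proof -
  have h: "Dom T (\<iota> X) = X" "left_approximation T P (\<iota> X)" "(\<iota> X, \<pi> X, \<delta> X) \<in> Tri T"
    using approximation X unfolding approximation_triangles_def by blast+
  then show "(\<iota> X, \<pi> X, \<delta> X) \<in> Tri T" "Dom T (\<iota> X) = X" "Cod T (\<iota> X) \<in> P"
    by (auto simp: left_approximation_def)
  assume A: "A \<in> P" and x: "x \<in> Arr T" "Dom T x = X" "Cod T x = A"
  then have "x \<in> Hom T (Dom T (\<iota> X)) A"
    using h by simp
  then obtain z where "z \<in> Hom T (Cod T (\<iota> X)) A" "z \<cdot> \<iota> X = x"
    using h(2) A unfolding left_approximation_def by blast
  then show "\<exists>z. z \<in> Arr T \<and> Dom T z = Cod T (\<iota> X) \<and> Cod T z = A \<and> z \<cdot> \<iota> X = x"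
    by auto
qed

lemma approx_arr:
  assumes X: "X \<in> Z"
  shows "\<iota> X \<in> Arr T" "\<pi> X \<in> Arr T" "\<delta> X \<in> Arr T" "Dom T (\<pi> X) = Cod T (\<iota> X)" "Dom T (\<delta> X) = Cod T (\<pi> X)"
    "Cod T (\<delta> X) = ShO T X" "Cod T (\<pi> X) \<in> Z"
proof -
  note t = approx_triangle[OF X]
  note a = tri_arr[OF t(1)]
  show "\<iota> X \<in> Arr T" "\<pi> X \<in> Arr T" "\<delta> X \<in> Arr T" "Dom T (\<pi> X) = Cod T (\<iota> X)" "Dom T (\<delta> X) = Cod T (\<pi> X)"
    "Cod T (\<delta> X) = ShO T X"
    using a t(2) by simp_all
  \<comment> \<open>The approximation property of \<open>\<iota> X\<close> is the extension
    hypothesis of \<open>Z_cone\<close>.\<close>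
  show "Cod T (\<pi> X) \<in> Z"
    by (rule Z_cone[OF t(1)]) (use X t P_Z in simp_all)
qed

lemma delta_S:
  assumes X: "X \<in> Z"
  shows "\<delta> X \<in> S"
  using S_iff[OF rotate[OF rotate[OF approx_triangle(1)[OF X]]]] N_shift[OF P_N[OF approx_triangle(3)[OF
    X]]] approx_arr[OF X]
  by simp

lemma angle_exists:
  assumes f: "ZA f" "Dom T f = X" "Cod T f = Y"
  shows "\<exists>p g. seq_morphism T (ShA T) (\<iota> X, \<pi> X, \<delta> X) (\<iota> Y, \<pi> Y, \<delta> Y) (f, p, g)"
proof -
  have ob: "X \<in> Z" "Y \<in> Z" and f': "f \<in> Arr T"
    using f ZA_D by auto
  note tX = approx_triangle[OF ob(1)] and tY = approx_triangle[OF ob(2)] and aX = approx_arr[OF ob(1)]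
    and aY = approx_arr[OF ob(2)]
  have "\<iota> Y \<cdot> f \<in> Arr T" "Dom T (\<iota> Y \<cdot> f) = X" "Cod T (\<iota> Y \<cdot> f) = Cod T (\<iota> Y)"
    using f f' aY tY by simp_all
  then obtain p where p: "p \<in> Arr T" "Dom T p = Cod T (\<iota> X)" "Cod T p = Cod T (\<iota> Y)" "p \<cdot> \<iota> X = \<iota> Y \<cdot> f"
    using tX(4)[OF tY(3)] by blast
  obtain g where "seq_morphism T (ShA T) (\<iota> X, \<pi> X, \<delta> X) (\<iota> Y, \<pi> Y, \<delta> Y) (f, p, g)"
    by (rule fillE[OF tX(1) tY(1), of f p]) (use f f' tX tY p in simp_all)
  then show ?thesis
    by blast
qed

text \<open>The last equation is the third square of the morphism, projected. It is the naturality
  square required of the comparison of shifts, and it determines \<open>Q g\<close> because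
  \<open>Q (\<delta> Y)\<close> is invertible.\<close>

lemma angle_square:
  assumes f: "ZA f" "Dom T f = X"
    "Cod T f = Y" and m: "seq_morphism T (ShA T) (\<iota> X, \<pi> X, \<delta> X) (\<iota> Y, \<pi> Y, \<delta> Y) (f, p, g)"
  shows "ZA g" "Dom T g = Cod T (\<pi> X)" "Cod T g = Cod T (\<pi> Y)" "Q (\<delta> Y) \<cdot>\<^bsub>U\<^esub> Q g = VS (Q f) \<cdot>\<^bsub>U\<^esub> Q (\<delta> X)"
proof -
  have ob: "X \<in> Z" "Y \<in> Z" and f': "f \<in> Arr T"
    using f ZA_D by auto
  note aX = approx_arr[OF ob(1)] and aY = approx_arr[OF ob(2)]
  show g: "Dom T g = Cod T (\<pi> X)" "Cod T g = Cod T (\<pi> Y)"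
    using m aX aY by (auto simp: seq_morphism_iff)
  have g': "g \<in> Arr T" and e: "ShA T f \<cdot> \<delta> X = \<delta> Y \<cdot> g"
    using m by (auto simp: seq_morphism_iff)
  show "ZA g"
    using g g' aX aY by (simp add: ZA_def)
  have "Q (ShA T f \<cdot> \<delta> X) = Q (\<delta> Y \<cdot> g)"
    using e by simp
  then show "Q (\<delta> Y) \<cdot>\<^bsub>U\<^esub> Q g = VS (Q f) \<cdot>\<^bsub>U\<^esub> Q (\<delta> X)"
    using f f' g g' aX aY by (simp add: Q.map_comp' VS_Q)
qed

text \<open>All admissible \<open>g\<close> satisfy the same square in the Verdier quotient, so they
  have one image under \<open>Q\<close> and hence one class. Independence of \<open>f\<close> in its
  class and of the filler follows at once.\<close>

lemma angle_shift_J: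
  assumes f: "ZA f" "Dom T f = X"
    "Cod T f = Y" and m: "seq_morphism T (ShA T) (\<iota> X, \<pi> X, \<delta> X) (\<iota> Y, \<pi> Y, \<delta> Y) (f, p, g)"
  shows "angle_shift T P \<iota> \<pi> \<delta> (J f) = J g"
  unfolding angle_shift_def
proof (rule the_elem_const)
  let ?A = "{J g | f' p g. f' \<in> J f \<and> seq_morphism T (ShA T)
       (\<iota> (Dom T f'), \<pi> (Dom T f'), \<delta> (Dom T f')) (\<iota> (Cod T f'), \<pi> (Cod T f'), \<delta> (Cod T f')) (f', p, g)}"
  show "J g \<in> ?A"
    using J_self[OF f(1)] m f(2,3) by blast
  fix y assume "y \<in> ?A"
  then obtain f' p' g' where y: "y = J g'" and f': "f' \<in> J f"
    and m': "seq_morphism T (ShA T) (\<iota> (Dom T f'), \<pi> (Dom T f'), \<delta> (Dom T f')) (\<iota> (Cod T f'), \<pi> (Cod T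
      f'), \<delta> (Cod T f')) (f', p', g')"
    by blast
  have ob: "X \<in> Z" "Y \<in> Z"
    using f ZA_D by auto
  have h: "f' \<in> Arr T" "Dom T f' = X" "Cod T f' = Y" "Q f' = Q f"
    using f' f by (auto simp: in_J_iff ZA_def)
  have z: "ZA f'"
    by (rule ZA_I[OF h(1-3) ob])
  note s = angle_square[OF f m] and s' = angle_square[OF z h(2,3) m'[unfolded h]]
  have "Q (\<delta> Y) \<cdot>\<^bsub>U\<^esub> Q g' = Q (\<delta> Y) \<cdot>\<^bsub>U\<^esub> Q g"
    using s s' h(4) by simp
  then have "Q g' = Q g"
    by (rule Q.cod.iso_cancel_left[OF Q_iso_arrow[OF delta_S[OF ob(2)]]])
      (use s s' ZA_D approx_arr[OF ob(2)] in simp_all)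
  then show "y = J g"
    unfolding y by (intro J_cong) (use s s' ZA_D in simp_all)
qed

lemma V_shift [simp]: "ShO V = (\<lambda>X. Cod T (\<pi> X))" "ShA V = angle_shift T P \<iota> \<pi> \<delta>"
  by (simp_all add: V_defs)

end

text \<open>The projected connecting morphisms serve as the comparison of the two shifts.\<close>

sublocale silting_data \<subseteq> shift_transport "silting_reduction T P \<iota> \<pi> \<delta>" "verdier_quotient T (thick T P)"
  "\<lambda>X. X" "rho_bar T P" "\<lambda>X. verdier_proj T (thick T P) (\<delta> X)"
proof (rule shift_transport.intro[OF V_additive F_functor U_triangulated shift_transport_axioms.intro])
  show "full_faithful V U (\<lambda>X. X) F" "ess_surj V U (\<lambda>X. X)"
    by (fact F_full_faithful F_ess_surj)+
next
  fix X assume "X \<in> Obj V"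
  then have X: "X \<in> Z"
    by simp
  then show "ShO V X \<in> Obj V" "Q (\<delta> X) \<in> Hom U (ShO V X) (ShO U X)" "iso_arrow U (Q (\<delta> X))"
    using approx_arr[OF X] Q_iso_arrow[OF delta_S[OF X]] by simp_all
next
  fix a X Y assume "a \<in> Hom V X Y"
  then obtain f where f: "ZA f" "a = J f" "f \<in> Arr T" "Dom T f = X" "Cod T f = Y"
    by (rule V_homE)
  obtain p g where m: "seq_morphism T (ShA T) (\<iota> X, \<pi> X, \<delta> X) (\<iota> Y, \<pi> Y, \<delta> Y) (f, p, g)"
    using angle_exists[OF f(1,4,5)] by blast
  show "ShA V a \<in> Hom V (ShO V X) (ShO V Y)"
    unfolding f(2) using angle_shift_J[OF f(1,4,5) m] angle_square(1-3)[OF f(1,4,5) m] by simp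
next
  fix a assume "a \<in> Arr V"
  then obtain f where f: "ZA f" "a = J f"
    by (auto simp: Arr_V)
  obtain p g where m: "seq_morphism T (ShA T) (\<iota> (Dom T f), \<pi> (Dom T f), \<delta> (Dom T f)) (\<iota> (Cod T f), \<pi>
    (Cod T f), \<delta> (Cod T f)) (f, p, g)"
    using angle_exists[OF f(1)] by blast
  show "Q (\<delta> (Cod V a)) \<cdot>\<^bsub>U\<^esub> F (ShA V a) = ShA U (F a) \<cdot>\<^bsub>U\<^esub> Q (\<delta> (Dom V a))"
    unfolding f(2) using f(1) angle_shift_J[OF f(1) refl refl m] angle_square[OF f(1) refl refl m] by simp
qed

section \<open>Standard triangles versus triangles of the Verdier quotient\<close>

context silting_data begin

lemma seq_isomorphic_silting_preadd: "seq_isomorphic (silting_preadd T P) = seq_isomorphic V"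
  by (intro ext) (simp add: seq_isomorphic_def is_seq_def seq_morphism_def iso_arrow_def Hom_def V_defs)

lemma Tri_V: "t \<in> Tri V \<longleftrightarrow> (\<exists>t'\<in>standard_triangles T P \<iota> \<pi> \<delta>. seq_isomorphic V (ShO V) (ShA V) t t')"
proof -
  have "Tri V = {t. \<exists>t'\<in>standard_triangles T P \<iota> \<pi> \<delta>.
          seq_isomorphic (silting_preadd T P) (\<lambda>X. Cod T (\<pi> X)) (angle_shift T P \<iota> \<pi> \<delta>) t t'}"
    by (simp add: silting_reduction_def preadd_data.extend_def triang_data.fields_def)
  then show ?thesis
    unfolding seq_isomorphic_silting_preadd by simp
qed

text \<open>The third square of the defining morphism reads
  \<open>h = \<delta> (Dom T f) \<cdot> a\<close>, so the comparison of shifts applied after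
  \<open>F (J a)\<close> recovers \<open>Q h\<close>: the image is the projection of the original
  triangle.\<close>

lemma standard_image:
  assumes t: "(f, g, h) \<in> Tri T" and Z: "Dom T f \<in> Z" "Cod T f \<in> Z" "Cod T g \<in> Z"
    and m: "seq_morphism T (ShA T) (f, g, h) (\<iota> (Dom T f), \<pi> (Dom T f), \<delta> (Dom T f)) (Ident T (Dom T f), p, a)"
  shows "is_seq V (ShO V) (J f, J g, J a)"
    "(F (J f), F (J g), Q (\<delta> (Dom V (J f))) \<cdot>\<^bsub>U\<^esub> F (J a)) = (Q f, Q g, Q h)"
proof -
  note A = tri_arr[OF t] and ax = approx_arr[OF Z(1)]
  have "a \<in> Hom T (Dom T h) (Dom T (\<delta> (Dom T f)))" and e: "ShA T (Ident T (Dom T f)) \<cdot> h = \<delta> (Dom T f) \<cdot> a"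
    using m unfolding seq_morphism_iff by blast+
  then have a: "a \<in> Arr T" "Dom T a = Cod T g" "Cod T a = Cod T (\<pi> (Dom T f))"
    using A(5) ax(5) by simp_all
  have z: "ZA f" "ZA g" "ZA a"
    using A Z a ax by (simp_all add: ZA_def)
  show "is_seq V (ShO V) (J f, J g, J a)"
    using z A a by (simp add: is_seq_iff)
  have "h = \<delta> (Dom T f) \<cdot> a"
    using e A by simp
  then have "Q h = Q (\<delta> (Dom T f)) \<cdot>\<^bsub>U\<^esub> Q a"
    using a ax by (simp add: Q.map_comp')
  then show "(F (J f), F (J g), Q (\<delta> (Dom V (J f))) \<cdot>\<^bsub>U\<^esub> F (J a)) = (Q f, Q g, Q h)"
    using z by simp
qed

lemma Tri_V_imp:
  assumes "(\<alpha>, \<beta>, \<gamma>) \<in> Tri V"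
  shows "is_seq V (ShO V) (\<alpha>, \<beta>, \<gamma>) \<and> (F \<alpha>, F \<beta>, Q (\<delta> (Dom V \<alpha>)) \<cdot>\<^bsub>U\<^esub> F \<gamma>) \<in> Tri U"
proof -
  obtain f g h p a where t: "(f, g, h) \<in> Tri T" and Z: "Dom T f \<in> Z" "Cod T f \<in> Z" "Cod T g \<in> Z"
    and m: "seq_morphism T (ShA T) (f, g, h) (\<iota> (Dom T f), \<pi> (Dom T f), \<delta> (Dom T f)) (Ident T (Dom T f), p, a)"
    and i: "seq_isomorphic V (ShO V) (ShA V) (\<alpha>, \<beta>, \<gamma>) (J f, J g, J a)"
    using assms unfolding Tri_V standard_triangles_def by blast
  have s: "is_seq V (ShO V) (\<alpha>, \<beta>, \<gamma>)"
    using i unfolding seq_isomorphic_def by blast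
  note st = standard_image[OF t Z m]
  have "seq_isomorphic U (ShO U) (ShA U) (F \<alpha>, F \<beta>, Q (\<delta> (Dom V \<alpha>)) \<cdot>\<^bsub>U\<^esub> F \<gamma>) (Q f, Q g, Q h)"
    using i unfolding seq_isomorphic_iff[OF s st(1)] st(2) .
  then show ?thesis
    using s U.tri_iso[OF Q_tri[OF t]] by blast
qed

text \<open>Adding the approximation \<open>\<iota>\<^sub>X\<close> to \<open>f\<close> does not change its class but turns the cone into an
  object of \<open>\<Z>\<close>; so every arrow of the quotient starts a standard triangle.\<close>

lemma image_imp_Tri_V:
  assumes s: "is_seq V (ShO V) (\<alpha>, \<beta>, \<gamma>)" and T: "(F \<alpha>, F \<beta>, Q (\<delta> (Dom V \<alpha>)) \<cdot>\<^bsub>U\<^esub> F \<gamma>) \<in> Tri U"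
  shows "(\<alpha>, \<beta>, \<gamma>) \<in> Tri V"
proof -
  obtain f where f: "ZA f" "\<alpha> = J f"
    using s by (auto simp: is_seq_iff Arr_V)
  define X Y where "X = Dom T f" and "Y = Cod T f"
  have f': "f \<in> Arr T" "Dom T f = X" "Cod T f = Y" and ob: "X \<in> Z" "Y \<in> Z"
    using ZA_D[OF f(1)] by (simp_all add: X_def Y_def)
  note tX = approx_triangle[OF ob(1)] and aX = approx_arr[OF ob(1)]
  define B where "B = Cod T (\<iota> X)"
  have B: "B \<in> P"
    using tX by (simp add: B_def)
  obtain M where b: "biproduct T Y B M"
    using biproduct_exists[of Y B] Z_obj[OF ob(2)] B by auto
  have MZ: "M \<in> Z"
    by (rule Z_biproduct[OF b ob(2) P_Z[OF B]])
  obtain i j p q where a: "i \<in> Arr T" "Dom T i = Y" "Cod T i = M" "j \<in> Arr T" "Dom T j = B" "Cod T j = M"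
      "p \<in> Arr T" "Dom T p = M" "Cod T p = Y" "q \<in> Arr T" "Dom T q = M" "Cod T q = B"
      and e: "p \<cdot> i = Ident T Y" "q \<cdot> j = Ident T B" "p \<cdot> j = Zero T B Y" "q \<cdot> i = Zero T Y B"
      "(i \<cdot> p) \<boxplus> (j \<cdot> q) = Ident T M"
    using b by (rule biproductE)
  have ob': "X \<in> Obj T" "Y \<in> Obj T" "M \<in> Obj T" "B \<in> Obj T"
    using ob MZ B Z_obj by simp_all
  have \<iota>: "\<iota> X \<in> Arr T" "Dom T (\<iota> X) = X" "Cod T (\<iota> X) = B"
    using tX aX by (simp_all add: B_def)
  define f1 where "f1 = (i \<cdot> f) \<boxplus> (j \<cdot> \<iota> X)"
  have f1: "f1 \<in> Arr T" "Dom T f1 = X" "Cod T f1 = M"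
    unfolding f1_def using f' a \<iota> by simp_all
  have qf1: "q \<cdot> f1 = \<iota> X"
    unfolding f1_def using f' a \<iota> ob' by (simp add: comp_add comp_reduce[OF e(2)] comp_reduce[OF e(4)])
  obtain g1 h1 where t: "(f1, g1, h1) \<in> Tri T"
    using tri_cone[OF f1(1)] by blast
  note A = tri_arr[OF t]
  \<comment> \<open>The component \<open>\<iota> X\<close> of \<open>f1\<close> lets every arrow
    from \<open>X\<close> to \<open>P\<close> extend over \<open>f1\<close>, by projecting to
    \<open>B\<close> first; this is the hypothesis of \<open>Z_cone\<close>.\<close>
  have gZ: "Cod T g1 \<in> Z"
  proof (rule Z_cone[OF t])
    fix A' x assume A': "A' \<in> P" and x: "x \<in> Arr T" "Dom T x = Dom T f1" "Cod T x = A'"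
    then have "Dom T x = X"
      using f1 by simp
    then obtain z where z: "z \<in> Arr T" "Dom T z = B" "Cod T z = A'" "z \<cdot> \<iota> X = x"
      using tX(4)[OF A' x(1) _ x(3)] B_def by blast
    have "(z \<cdot> q) \<cdot> f1 = x"
      using z a f1 qf1 by simp
    then show "\<exists>z. z \<in> Arr T \<and> Dom T z = Cod T f1 \<and> Cod T z = A' \<and> z \<cdot> f1 = x"
      using z a f1 by (intro exI[of _ "z \<cdot> q"]) simp
  qed (use f1 ob MZ in simp_all)
  obtain c where m: "seq_morphism T (ShA T) (f1, g1, h1) (\<iota> X, \<pi> X, \<delta> X) (Ident T X, q, c)"
    by (rule fillE[OF t tX(1), of "Ident T X" q]) (use f1 a \<iota> ob' qf1 in simp_all)
  have Z1: "Dom T f1 \<in> Z" "Cod T f1 \<in> Z"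
    using f1 ob MZ by simp_all
  have m': "seq_morphism T (ShA T) (f1, g1, h1) (\<iota> (Dom T f1), \<pi> (Dom T f1), \<delta> (Dom T f1)) (Ident T (Dom
    T f1), q, c)"
    using m f1 by simp
  have std: "(J f1, J g1, J c) \<in> standard_triangles T P \<iota> \<pi> \<delta>"
    unfolding standard_triangles_def using t Z1 gZ m' by blast
  note st = standard_image[OF t Z1 gZ m']
  have Qj: "Q j = Zero U B M" "Q (\<iota> X) = Zero U X B"
    using Q_zero_P[OF a(4-6)] Q_zero_P[OF \<iota>] B by simp_all
  have Qf1: "Q f1 = Q i \<cdot>\<^bsub>U\<^esub> Q f"
    unfolding f1_def using f' a \<iota> ob' Qj by (simp add: Q.map_add Q.map_comp')
  have "Q (i \<cdot> p) \<boxplus>\<^bsub>U\<^esub> Q (j \<cdot> q) = Q (Ident T M)"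
    using a e(5) Q.map_add[of "i \<cdot> p" "j \<cdot> q"] by simp
  then have ip: "Q i \<cdot>\<^bsub>U\<^esub> Q p = Ident U M"
    using a ob' Qj by (simp add: Q.map_comp')
  have pi: "Q p \<cdot>\<^bsub>U\<^esub> Q i = Ident U Y"
    using arg_cong[OF e(1), of Q] a ob' by (simp add: Q.map_comp')
  \<comment> \<open>Arrows at \<open>B\<close> become zero in the Verdier quotient, so the inclusion
    of \<open>Y\<close> into \<open>M\<close> becomes invertible there and carries
    \<open>Q f\<close> to \<open>Q f1\<close>.\<close>
  have "inverse_pair U (Q i) (Q p)"
    using a ip pi by (simp add: inverse_pair_def)
  then have Qi: "iso_arrow U (Q i)"
    by (auto simp: iso_arrow_iff)
  have F\<alpha>: "F \<alpha> = Q f"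
    using f by simp
  have T': "(Q f, F \<beta>, Q (\<delta> (Dom V \<alpha>)) \<cdot>\<^bsub>U\<^esub> F \<gamma>) \<in> Tri U"
    using T F\<alpha> by simp
  \<comment> \<open>Two triangles of the Verdier quotient with isomorphic first arrows are
    isomorphic; full faithfulness then brings this isomorphism back.\<close>
  obtain k where k: "iso_arrow U k"
    "seq_morphism U (ShA U) (Q f, F \<beta>, Q (\<delta> (Dom V \<alpha>)) \<cdot>\<^bsub>U\<^esub> F \<gamma>) (Q f1, Q g1, Q h1) (Ident U X, Q i, k)"
    by (rule U.tri_isoE[OF T' Q_tri[OF t], of "Ident U X" "Q i"]) (use f' f1 a ob' Qf1 Qi in simp_all)
  have "seq_isomorphic U (ShO U) (ShA U) (F \<alpha>, F \<beta>, Q (\<delta> (Dom V \<alpha>)) \<cdot>\<^bsub>U\<^esub> F \<gamma>) (Q f1, Q g1, Q h1)"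
    unfolding F\<alpha> by (rule seq_isomorphicI[OF U.tri_seq[OF T'] U.tri_seq[OF Q_tri[OF t]] k(2) _ Qi k(1)])
      (use ob' in simp)
  then have "seq_isomorphic V (ShO V) (ShA V) (\<alpha>, \<beta>, \<gamma>) (J f1, J g1, J c)"
    unfolding seq_isomorphic_iff[OF s st(1)] st(2) .
  then show ?thesis
    unfolding Tri_V using std by blast
qed

end

text \<open>The two inclusions together say that the triangles generated by the standard ones are
  exactly the pulled-back triangulation.\<close>

sublocale silting_data \<subseteq> transport "silting_reduction T P \<iota> \<pi> \<delta>" "verdier_quotient T (thick T P)"
  "\<lambda>X. X" "rho_bar T P" "\<lambda>X. verdier_proj T (thick T P) (\<delta> X)"
  by unfold_locales (use Tri_V_imp image_imp_Tri_V in blast)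

theorem theorem3p6:
  fixes T :: "('o, 'm) triang_data"
    and P :: "'o set"
    and \<iota> \<pi> \<delta> :: "'o \<Rightarrow> 'm"
  assumes "triangulated_category T"
    and "presilting T P"
    and "P = add_closure T P"
    and "cond_P1 T P"
    and "cond_P2 T P"
    and "approximation_triangles T P \<iota> \<pi> \<delta>"
  shows "triangulated_category (silting_reduction T P \<iota> \<pi> \<delta>) \<and>
    triangle_equivalence (silting_reduction T P \<iota> \<pi> \<delta>) (verdier_quotient T (thick T P))
      (\<lambda>X. X) (rho_bar T P)"
proof -
  interpret triangulated_category T
    by (rule assms(1))
  interpret silting_data T P \<iota> \<pi> \<delta>
    by unfold_locales (fact assms)+
  show ?thesis
    using transported_triangulated transported_equivalence by blast
qed

end
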